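(* The space $\mathcal{X}$ of mm-isomorphism classes of mm-spaces with the concentration topology is locally path connected, and the space $\Pi$ of pyramids with the weak topology is locally path connected.
   Context: An mm-space is a triple $(X,d_X,\mu_X)$ with $(X,d_X)$ complete separable metric and $\mu_X$ a Borel probability measure; mm-isomorphism means an isometry between supports pushing $\mu_X$ to $\mu_Y$; $\mathcal{X}$ is the set of mm-isomorphism classes. A parameter of $X$ is a Borel map $\varphi\colon I=[0,1)\to X$ with $\varphi_*\mathcal{L}^1=\mu_X$. Box distance: $\square(X,Y)$ is the infimum of $\varepsilon\ge0$ such that there are parameters $\varphi,\psi$ of $X,Y$ and Borel $I_0\subset I$ with $\mathcal{L}^1(I_0)\ge1-\varepsilon$ and $|d_X(\varphi(s),\varphi(t))-d_Y(\psi(s),\psi(t))|\le\varepsilon$ for $s,t\in I_0$. Observable distance: $d_{\mathrm{conc}}(X,Y)=\inf_{\varphi,\psi}d_{\mathrm{H}}(\{f\circ\varphi\},\{g\circ\psi\})$ where $f,g$ range over real 1-Lipschitz functions on $X$, $Y$, and $d_{\mathrm{H}}$ is the Hausdorff distance for the Ky Fan metric $d_{\mathrm{KF}}(u,v)=\inf\{\varepsilon\ge0:\mathcal{L}^1(|u-v|>\varepsilon)\le\varepsilon\}$; it induces the concentration topology. Lipschitz order: $Y\prec X$ if there is a 1-Lipschitz $f\colon X\to Y$ with $f_*\mu_X=\mu_Y$. A pyramid is a nonempty $\square$-closed set $\mathcal{P}\subset\mathcal{X}$ such that $X\in\mathcal{P}$, $Y\prec X$ imply $Y\in\mathcal{P}$,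 and any $Y,Y'\in\mathcal{P}$ have a common upper bound $X\in\mathcal{P}$ for $\prec$. $\Pi$ is the set of pyramids. Pyramids $\mathcal{P}_n$ converge weakly to $\mathcal{P}$ if $\square(X,\mathcal{P}_n)\to0$ for every $X\in\mathcal{P}$ and $\liminf_n\square(X,\mathcal{P}_n)>0$ for every $X\notin\mathcal{P}$. The weak topology on $\Pi$ is the topology of a metric $\rho$ on $\Pi$ compatible with weak convergence (e.g. $\rho(\mathcal{P},\mathcal{P}')=\sum_{k\ge1}2^{-k-2}k^{-1}d_{\mathrm{H}}(\mathcal{P}\cap\mathcal{X}(k,k),\mathcal{P}'\cap\mathcal{X}(k,k))$, with $d_{\mathrm{H}}$ the $\square$-Hausdorff distance and $\mathcal{X}(N,R)$ the set of spaces $(\mathbb{R}^N,\|\cdot\|_\infty,\mu)$ with $\operatorname{supp}\mu$ in the closed $R$-ball about $0$). *)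

theory Defs
  imports "HOL-Analysis.Analysis" "HOL-Probability.Probability"
begin

type_synonym 'a mm = "'a set \<times> ('a \<Rightarrow> 'a \<Rightarrow> real) \<times> 'a measure"

definition mm_borel :: "'a set \<Rightarrow> ('a \<Rightarrow> 'a \<Rightarrow> real) \<Rightarrow> 'a set set" where
  "mm_borel X d = sigma_sets X {U. openin (Metric_space.mtopology X d) U}"

definition mm_space :: "'a mm \<Rightarrow> bool" where
  "mm_space S \<longleftrightarrow> (case S of (X, d, \<mu>) \<Rightarrow>
      Metric_space X d \<and> Metric_space.mcomplete X d \<and>
      separable_space (Metric_space.mtopology X d) \<and>
      prob_space \<mu> \<and> space \<mu> = X \<and> sets \<mu> = mm_borel X d)"

definition mm_supp :: "'a mm \<Rightarrow> 'a set" where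
  "mm_supp S = (case S of (X, d, \<mu>) \<Rightarrow>
      {x \<in> X. \<forall>\<epsilon>>0. measure \<mu> (Metric_space.mball X d x \<epsilon>) > 0})"

definition mm_iso :: "'a mm \<Rightarrow> 'b mm \<Rightarrow> bool" where
  "mm_iso S T \<longleftrightarrow> (case S of (X, dX, \<mu>) \<Rightarrow> case T of (Y, dY, \<nu>) \<Rightarrow>
      (\<exists>f. bij_betw f (mm_supp S) (mm_supp T) \<and>
           (\<forall>x\<in>mm_supp S. \<forall>y\<in>mm_supp S. dY (f x) (f y) = dX x y) \<and>
           (\<forall>B\<in>sets \<nu>. f -` B \<inter> mm_supp S \<in> sets \<mu> \<and>
                         measure \<mu> (f -` B \<inter> mm_supp S) = measure \<nu> B)))"

text \<open>Every mm-space is mm-isomorphic to one whose carrier (its support, of cardinality at most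
  the continuum) is a subset of the reals, carrying an arbitrary complete separable metric.
  Hence mm-isomorphism classes are represented as sets of such representatives.\<close>
definition mm_class :: "'a mm \<Rightarrow> real mm set" where
  "mm_class S = {T. mm_space T \<and> mm_iso S T}"

definition mmX :: "real mm set set" where
  "mmX = {mm_class S | S :: real mm. mm_space S}"

definition rep :: "real mm set \<Rightarrow> real mm" where
  "rep C = (SOME S. S \<in> C)"

definition lebI :: "real measure" where
  "lebI = restrict_space lborel {0..<1}"

definition parameter :: "'a mm \<Rightarrow> (real \<Rightarrow> 'a) \<Rightarrow> bool" where
  "parameter S \<phi> \<longleftrightarrow> (case S of (X, d, \<mu>) \<Rightarrow>
      \<phi> \<in> measurable lebI \<mu> \<and> distr lebI \<mu> \<phi> = \<mu>)"

definition ky_fan :: "(real \<Rightarrow> real) \<Rightarrow> (real \<Rightarrow> real) \<Rightarrow> real" where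
  "ky_fan u v = Inf {\<epsilon>. \<epsilon> \<ge> 0 \<and>
      measure lborel {t \<in> {0..<1}. \<bar>u t - v t\<bar> > \<epsilon>} \<le> \<epsilon>}"

definition hausdorff_dist :: "('b \<Rightarrow> 'b \<Rightarrow> real) \<Rightarrow> 'b set \<Rightarrow> 'b set \<Rightarrow> real" where
  "hausdorff_dist \<delta> A B = max (SUP a\<in>A. INF b\<in>B. \<delta> a b) (SUP b\<in>B. INF a\<in>A. \<delta> a b)"

definition lip1_fun :: "'a mm \<Rightarrow> ('a \<Rightarrow> real) \<Rightarrow> bool" where
  "lip1_fun S f \<longleftrightarrow> (case S of (X, d, \<mu>) \<Rightarrow> (\<forall>x\<in>X. \<forall>y\<in>X. \<bar>f x - f y\<bar> \<le> d x y))"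

definition obs_dist :: "'a mm \<Rightarrow> 'b mm \<Rightarrow> real" where
  "obs_dist S T = Inf {hausdorff_dist ky_fan {f \<circ> \<phi> | f. lip1_fun S f} {g \<circ> \<psi> | g. lip1_fun T g}
                      | \<phi> \<psi>. parameter S \<phi> \<and> parameter T \<psi>}"

definition conc_topology :: "real mm set topology" where
  "conc_topology = topology (\<lambda>U. U \<subseteq> mmX \<and>
      (\<forall>C\<in>U. \<exists>\<epsilon>>0. \<forall>D\<in>mmX. obs_dist (rep C) (rep D) < \<epsilon> \<longrightarrow> D \<in> U))"

definition box_dist :: "'a mm \<Rightarrow> 'b mm \<Rightarrow> real" where
  "box_dist S T = (case S of (X, dX, \<mu>) \<Rightarrow> case T of (Y, dY, \<nu>) \<Rightarrow>
      Inf {\<epsilon>. \<epsilon> \<ge> 0 \<and> (\<exists>\<phi> \<psi> I0. parameter S \<phi> \<and> parameter T \<psi> \<and>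
              I0 \<in> sets borel \<and> I0 \<subseteq> {0..<1} \<and> measure lborel I0 \<ge> 1 - \<epsilon> \<and>
              (\<forall>s\<in>I0. \<forall>t\<in>I0. \<bar>dX (\<phi> s) (\<phi> t) - dY (\<psi> s) (\<psi> t)\<bar> \<le> \<epsilon>))})"

definition boxC :: "real mm set \<Rightarrow> real mm set \<Rightarrow> real" where
  "boxC C D = box_dist (rep C) (rep D)"

definition lip_dominated :: "'a mm \<Rightarrow> 'b mm \<Rightarrow> bool" where
  "lip_dominated T S \<longleftrightarrow> (case S of (X, dX, \<mu>) \<Rightarrow> case T of (Y, dY, \<nu>) \<Rightarrow>
      (\<exists>f. f ` mm_supp S \<subseteq> Y \<and>
           (\<forall>x\<in>mm_supp S. \<forall>y\<in>mm_supp S. dY (f x) (f y) \<le> dX x y) \<and>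
           (\<forall>B\<in>sets \<nu>. f -` B \<inter> mm_supp S \<in> sets \<mu> \<and>
                         measure \<mu> (f -` B \<inter> mm_supp S) = measure \<nu> B)))"

definition lip_le :: "real mm set \<Rightarrow> real mm set \<Rightarrow> bool" where
  "lip_le D C \<longleftrightarrow> lip_dominated (rep D) (rep C)"

definition pyramid :: "real mm set set \<Rightarrow> bool" where
  "pyramid P \<longleftrightarrow> P \<subseteq> mmX \<and> P \<noteq> {} \<and>
     (\<forall>C\<in>mmX. (\<forall>\<epsilon>>0. \<exists>D\<in>P. boxC C D < \<epsilon>) \<longrightarrow> C \<in> P) \<and>
     (\<forall>C\<in>P. \<forall>D\<in>mmX. lip_le D C \<longrightarrow> D \<in> P) \<and>
     (\<forall>D\<in>P. \<forall>D'\<in>P. \<exists>C\<in>P. lip_le D C \<and> lip_le D' C)"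

definition Pyr :: "real mm set set set" where
  "Pyr = {P. pyramid P}"

text \<open>\<real>^N with the l-infinity norm, encoded as sequences vanishing from index N on.\<close>
definition RN :: "nat \<Rightarrow> (nat \<Rightarrow> real) set" where
  "RN N = {x. \<forall>i\<ge>N. x i = 0}"

definition linf :: "nat \<Rightarrow> (nat \<Rightarrow> real) \<Rightarrow> (nat \<Rightarrow> real) \<Rightarrow> real" where
  "linf N x y = Max (insert 0 ((\<lambda>i. \<bar>x i - y i\<bar>) ` {..<N}))"

definition mmXNR :: "nat \<Rightarrow> real \<Rightarrow> real mm set set" where
  "mmXNR N R = {mm_class (RN N, linf N, \<mu>) | \<mu>.
      mm_space (RN N, linf N, \<mu>) \<and>
      mm_supp (RN N, linf N, \<mu>) \<subseteq> {x \<in> RN N. linf N (\<lambda>_. 0) x \<le> R}}"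

definition rho :: "real mm set set \<Rightarrow> real mm set set \<Rightarrow> real" where
  "rho P Q = (\<Sum>k. (let n = Suc k in
      (1 / (2 ^ (n + 2) * real n)) *
      hausdorff_dist boxC (P \<inter> mmXNR n (real n)) (Q \<inter> mmXNR n (real n))))"

definition weak_topology :: "real mm set set topology" where
  "weak_topology = topology (\<lambda>U. U \<subseteq> Pyr \<and>
      (\<forall>P\<in>U. \<exists>\<epsilon>>0. \<forall>Q\<in>Pyr. rho P Q < \<epsilon> \<longrightarrow> Q \<in> U))"

end

theory Submission
  imports Defs
begin

text \<open>
  A parameter turns an mm-space into a pseudo-metric on the unit interval. Two parameters of one
  space agree up to a small error after measure-preserving rearrangements, which one finds by sorting
  the labels of a fine partition; so box distance, observable distance and Lipschitz order can all be
  compared on the unit interval, where 1-Lipschitz functions extend by McShane's formula.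

  Box-close spaces with pseudo-metrics \<open>D\<close>, \<open>D'\<close> are joined by \<open>(1 - t) D + t D'\<close>. If
  \<open>D' \<le> D\<close>, then \<open>max D' (t D)\<close> joins them inside the Lipschitz interval between them.

  Concentration topology: if \<open>Y\<close> is close to \<open>X\<close>, then functions on \<open>Y\<close> that are close to the
  distances to a finite net of \<open>X\<close> show that \<open>Y\<close> dominates a space that is box-close to \<open>X\<close>. A path
  inside the Lipschitz interval followed by an interpolation path therefore joins \<open>Y\<close> to \<open>X\<close>, and
  both pieces stay near \<open>X\<close>.

  Weak topology: the classes dominated by a fixed one form a pyramid, and every pyramid is the limit
  of an increasing chain of such principal pyramids, so the Lipschitz interval paths along the chain
  concatenate to a path up to the pyramid. Two nearby pyramids contain box-close members that already
  approximate them, and the principal pyramids of these are joined by an interpolation path.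
\<close>

section \<open>Parameters of mm-spaces\<close>

text \<open>Matching two parameters of one space exactly would call for disintegration. Sorting
  labels matches them only up to an error, which is enough because all distances here are infima.
  Pseudo-metrics on the interval need only measurable sections and countably many small cells. This
  already yields a space and makes all 1-Lipschitz functions measurable.

  Spaces close in observable distance may be far apart in box distance, so straight interpolation
  from \<open>Y\<close> to \<open>X\<close> is not under control. Monotonicity helps: a larger
  pseudo-metric has more 1-Lipschitz functions, so a space between \<open>Y\<close> and a space
  dominated by \<open>Y\<close> inherits one half of the observable estimate from each end.

  The metric \<open>rho\<close> sees only finite-dimensional slices, so the members of two pyramids
  that are compared are taken finite-dimensional. That principal ideals are box-closed, hence
  pyramids, rests on compactness of families of 1-Lipschitz functions. That they approximate a given
  pyramid rests on total boundedness of the slices.\<close>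

abbreviation car :: "'a mm \<Rightarrow> 'a set" where "car S \<equiv> fst S"
abbreviation dst :: "'a mm \<Rightarrow> 'a \<Rightarrow> 'a \<Rightarrow> real" where "dst S \<equiv> fst (snd S)"
abbreviation msr :: "'a mm \<Rightarrow> 'a measure" where "msr S \<equiv> snd (snd S)"

lemma mm_space_alt: "mm_space S \<longleftrightarrow> Metric_space (car S) (dst S) \<and>
    Metric_space.mcomplete (car S) (dst S) \<and>
    separable_space (Metric_space.mtopology (car S) (dst S)) \<and>
    prob_space (msr S) \<and> space (msr S) = car S \<and> sets (msr S) = mm_borel (car S) (dst S)"
  by (auto simp: mm_space_def split: prod.splits)

lemma mm_supp_alt: "mm_supp S =
    {x \<in> car S. \<forall>\<epsilon>>0. measure (msr S) (Metric_space.mball (car S) (dst S) x \<epsilon>) > 0}"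
  by (auto simp: mm_supp_def split: prod.splits)

lemma mm_iso_alt: "mm_iso S T \<longleftrightarrow> (\<exists>f. bij_betw f (mm_supp S) (mm_supp T) \<and>
    (\<forall>x\<in>mm_supp S. \<forall>y\<in>mm_supp S. dst T (f x) (f y) = dst S x y) \<and>
    (\<forall>B\<in>sets (msr T). f -` B \<inter> mm_supp S \<in> sets (msr S) \<and>
       measure (msr S) (f -` B \<inter> mm_supp S) = measure (msr T) B))"
  by (auto simp: mm_iso_def split: prod.splits)

lemma lip_dominated_alt: "lip_dominated T S \<longleftrightarrow> (\<exists>f. f ` mm_supp S \<subseteq> car T \<and>
    (\<forall>x\<in>mm_supp S. \<forall>y\<in>mm_supp S. dst T (f x) (f y) \<le> dst S x y) \<and>
    (\<forall>B\<in>sets (msr T). f -` B \<inter> mm_supp S \<in> sets (msr S) \<and>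
       measure (msr S) (f -` B \<inter> mm_supp S) = measure (msr T) B))"
  by (auto simp: lip_dominated_def split: prod.splits)

lemma parameter_alt: "parameter S \<phi> \<longleftrightarrow> \<phi> \<in> measurable lebI (msr S) \<and> distr lebI (msr S) \<phi> = msr S"
  by (auto simp: parameter_def split: prod.splits)

lemma lip1_fun_alt: "lip1_fun S f \<longleftrightarrow> (\<forall>x\<in>car S. \<forall>y\<in>car S. \<bar>f x - f y\<bar> \<le> dst S x y)"
  by (auto simp: lip1_fun_def split: prod.splits)

section \<open>The unit interval and its subsets of full measure\<close>

lemma space_lebI [simp]: "space lebI = {0..<1}"
  by (simp add: lebI_def space_restrict_space)

lemma sets_lebI_iff: "A \<in> sets lebI \<longleftrightarrow> A \<in> sets borel \<and> A \<subseteq> {0..<1}"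
  by (auto simp: lebI_def sets_restrict_space_iff)

lemma measure_lebI: "A \<subseteq> {0..<1} \<Longrightarrow> measure lebI A = measure lborel A"
  by (simp add: lebI_def measure_restrict_space)

lemma prob_space_lebI: "prob_space lebI"
  by (rule prob_spaceI) (simp add: lebI_def emeasure_restrict_space space_restrict_space)

interpretation lebI: prob_space lebI
  by (rule prob_space_lebI)

text \<open>Exceptional null sets are carried by an explicit set because most relations below hold
  for all pairs in \<open>J \<times> J\<close>; a quantifier over almost every point in one variable
  at a time would not express this.\<close>

definition full :: "real set \<Rightarrow> bool" where
  "full J \<longleftrightarrow> J \<in> sets lebI \<and> measure lebI J = 1"

lemma full_subset: "full J \<Longrightarrow> s \<in> J \<Longrightarrow> 0 \<le> s \<and> s < 1"
  by (auto simp: full_def sets_lebI_iff)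

lemma full_sets: "full J \<Longrightarrow> J \<in> sets lebI"
  by (auto simp: full_def)

lemma full_I: "full {0..<1}"
  using lebI.prob_space by (simp add: full_def sets_lebI_iff)

lemma full_AE: "full J \<longleftrightarrow> J \<in> sets lebI \<and> (AE s in lebI. s \<in> J)"
  unfolding full_def using lebI.AE_in_set_eq_1 by blast

lemma full_Int: "full J \<Longrightarrow> full K \<Longrightarrow> full (J \<inter> K)"
  by (auto simp: full_AE)

lemma measure_full_Int: "full J \<Longrightarrow> A \<in> sets lebI \<Longrightarrow> measure lebI (A \<inter> J) = measure lebI A"
  by (rule measure_eq_AE) (auto simp: full_AE)

lemma full_meets: "full J \<Longrightarrow> A \<in> sets lebI \<Longrightarrow> measure lebI A > 0 \<Longrightarrow> \<exists>s\<in>J. s \<in> A"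
  using measure_full_Int[of J A] by (cases "A \<inter> J = {}") auto

lemma full_nonempty: "full J \<Longrightarrow> \<exists>s. s \<in> J"
  by (cases "J = {}") (auto simp: full_def)

lemma full_from_AE: "AE s in lebI. P s \<Longrightarrow> \<exists>J. full J \<and> (\<forall>s\<in>J. P s)"
proof -
  assume "AE s in lebI. P s"
  then obtain N where N: "N \<in> null_sets lebI" "{s \<in> space lebI. \<not> P s} \<subseteq> N"
    by (auto simp: eventually_ae_filter)
  have "full (space lebI - N)"
    unfolding full_AE using sets.compl_sets[OF null_setsD2[OF N(1)]] AE_not_in[OF N(1)] by auto
  moreover have "\<forall>s\<in>space lebI - N. P s" using N by auto
  ultimately show ?thesis by blast
qed

section \<open>Balls, Borel sets, supports and parameters\<close>

lemma (in Metric_space) open_countable_balls: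
  assumes "openin mtopology U" and x: "\<forall>k. x k \<in> M" "\<forall>y\<in>M. \<forall>e>0. \<exists>k. d (x k) y < e"
  shows "U = (\<Union>(k::nat,n::nat)\<in>{(k,n). mball (x k) (1 / Suc n) \<subseteq> U}. mball (x k) (1 / Suc n))"
proof (intro equalityI subsetI)
  fix y assume y: "y \<in> U"
  then obtain r where r: "r > 0" "mball y r \<subseteq> U" and yc: "y \<in> M"
    using assms(1)[unfolded openin_mtopology] by blast
  obtain n where n: "1 / Suc n < r / 2"
    using r by (metis half_gt_zero nat_approx_posE)
  obtain k where k: "d (x k) y < 1 / Suc n"
    using x(2)[rule_format, OF yc, of "1 / Suc n"] by auto
  have "mball (x k) (1 / Suc n) \<subseteq> mball y r"
    by (rule mball_subset) (use k n yc in \<open>auto simp: field_simps\<close>)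
  then have "mball (x k) (1 / Suc n) \<subseteq> U" using r by blast
  with k x yc show "y \<in> (\<Union>(k,n)\<in>{(k,n). mball (x k) (1 / Suc n) \<subseteq> U}. mball (x k) (1 / Suc n))"
    by (intro UN_I[of "(k,n)"]) auto
qed auto

lemma (in Metric_space) mcompleteI:
  assumes "\<And>\<sigma> :: nat \<Rightarrow> 'a. \<forall>n. \<sigma> n \<in> M \<Longrightarrow> \<forall>e>0. \<exists>N. \<forall>m\<ge>N. \<forall>n\<ge>N. d (\<sigma> m) (\<sigma> n) < e \<Longrightarrow>
    \<exists>x\<in>M. \<forall>e>0. \<exists>N. \<forall>n\<ge>N. d (\<sigma> n) x < e"
  shows mcomplete
  unfolding mcomplete_def
proof (intro allI impI)
  fix \<sigma> assume \<sigma>: "MCauchy \<sigma>"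
  then have r: "\<forall>n. \<sigma> n \<in> M" by (auto simp: MCauchy_def)
  have "\<forall>e>0. \<exists>N. \<forall>m\<ge>N. \<forall>n\<ge>N. d (\<sigma> m) (\<sigma> n) < e"
  proof (intro allI impI)
    fix e :: real assume "e > 0"
    then obtain N where "\<forall>n n'. N \<le> n \<longrightarrow> N \<le> n' \<longrightarrow> d (\<sigma> n) (\<sigma> n') < e"
      using \<sigma> unfolding MCauchy_def by auto
    then show "\<exists>N. \<forall>m\<ge>N. \<forall>n\<ge>N. d (\<sigma> m) (\<sigma> n) < e" by auto
  qed
  from assms[OF r this] obtain x where x: "x \<in> M" "\<forall>e>0. \<exists>N. \<forall>n\<ge>N. d (\<sigma> n) x < e" by auto
  have "limitin mtopology \<sigma> x sequentially"
    unfolding limit_metric_sequentially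
  proof (intro conjI x(1) allI impI)
    fix e :: real assume "e > 0"
    then obtain N where "\<forall>n\<ge>N. d (\<sigma> n) x < e" using x(2) by auto
    then show "\<exists>N. \<forall>n\<ge>N. \<sigma> n \<in> M \<and> d (\<sigma> n) x < e" using r by auto
  qed
  then show "\<exists>x. limitin mtopology \<sigma> x sequentially" by blast
qed

locale mm =
  fixes S :: "'a mm"
  assumes mm: "mm_space S"
begin

sublocale Metric_space "car S" "dst S"
  using mm by (simp add: mm_space_alt)

sublocale prob_space "msr S"
  using mm by (simp add: mm_space_alt)

lemma complete: "mcomplete"
  using mm by (simp add: mm_space_alt)

lemma space_msr [simp]: "space (msr S) = car S"
  using mm by (simp add: mm_space_alt)

lemma sets_msr: "sets (msr S) = sigma_sets (car S) {U. openin mtopology U}"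
  using mm by (simp add: mm_space_alt mm_borel_def)

lemma cauchy_limit:
  fixes \<sigma> :: "nat \<Rightarrow> 'a"
  assumes "\<forall>n. \<sigma> n \<in> car S" "\<forall>e>0. \<exists>N. \<forall>m\<ge>N. \<forall>n\<ge>N. dst S (\<sigma> m) (\<sigma> n) < e"
  shows "\<exists>x\<in>car S. \<forall>e>0. \<exists>N. \<forall>n\<ge>N. dst S (\<sigma> n) x < e"
proof -
  have "MCauchy \<sigma>"
    unfolding MCauchy_def
  proof (intro conjI allI impI)
    show "range \<sigma> \<subseteq> car S" using assms(1) by auto
    fix e :: real assume "e > 0"
    then obtain N where "\<forall>m\<ge>N. \<forall>n\<ge>N. dst S (\<sigma> m) (\<sigma> n) < e" using assms(2) by auto
    then show "\<exists>N. \<forall>n n'. N \<le> n \<longrightarrow> N \<le> n' \<longrightarrow> dst S (\<sigma> n) (\<sigma> n') < e" by auto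
  qed
  then obtain x where "limitin mtopology \<sigma> x sequentially"
    using complete mcomplete_def by blast
  then show ?thesis unfolding limit_metric_sequentially by blast
qed

lemma open_sets: "openin mtopology U \<Longrightarrow> U \<in> sets (msr S)"
  by (auto simp: sets_msr)

lemma ball_sets [simp, measurable]: "mball x r \<in> sets (msr S)"
  by (rule open_sets) auto

lemma car_nonempty: "car S \<noteq> {}"
  using not_empty by simp

lemma dense_seq: "\<exists>x::nat\<Rightarrow>'a. (\<forall>k. x k \<in> car S) \<and> (\<forall>y\<in>car S. \<forall>e>0. \<exists>k. dst S (x k) y < e)"
proof -
  have "separable_space mtopology"
    using mm by (simp add: mm_space_alt)
  then obtain C where C: "countable C" "C \<subseteq> car S" "mtopology closure_of C = car S"
    by (auto simp: separable_space_def)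
  have ne: "C \<noteq> {}" using C car_nonempty by auto
  have "\<exists>k. dst S (from_nat_into C k) y < e" if y: "y \<in> car S" and e: "e > 0" for y e
  proof -
    have "y \<in> mtopology closure_of C" using C y by simp
    then obtain c where c: "c \<in> C" "c \<in> mball y e"
      using e by (auto simp: metric_closure_of)
    obtain k where "from_nat_into C k = c"
      using from_nat_into_surj[OF C(1) c(1)] by blast
    with c show ?thesis by (auto simp: commute)
  qed
  moreover have "from_nat_into C k \<in> car S" for k
    using from_nat_into[OF ne] C by blast
  ultimately show ?thesis by blast
qed

text \<open>Open sets are countable unions of balls around a dense sequence, so preimages of balls
  decide Borel measurability.\<close>

lemma measurableI_ball:
  assumes f: "f \<in> space N \<rightarrow> car S"
    and b: "\<And>x r. x \<in> car S \<Longrightarrow> {s \<in> space N. dst S x (f s) < r} \<in> sets N"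
  shows "f \<in> measurable N (msr S)"
proof (rule measurable_sigma_sets[OF sets_msr _ f])
  show "{U. openin mtopology U} \<subseteq> Pow (car S)"
    using openin_subset by fastforce
  fix U assume "U \<in> {U. openin mtopology U}"
  then have U: "openin mtopology U" by simp
  obtain x :: "nat \<Rightarrow> 'a" where x: "\<forall>k. x k \<in> car S" "\<forall>y\<in>car S. \<forall>e>0. \<exists>k. dst S (x k) y < e"
    using dense_seq by blast
  let ?K = "{(k::nat,n::nat). mball (x k) (1 / Suc n) \<subseteq> U}"
  have "f -` U \<inter> space N = f -` (\<Union>(k,n)\<in>?K. mball (x k) (1 / Suc n)) \<inter> space N"
    using open_countable_balls[OF U x] by simp
  also have "\<dots> = (\<Union>(k,n)\<in>?K. {s \<in> space N. dst S (x k) (f s) < 1 / Suc n})"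
    using f x(1) by (auto simp: Pi_iff; blast)
  also have "\<dots> \<in> sets N"
    using b x by (intro sets.countable_UN') (auto intro: countable_subset[of _ UNIV])
  finally show "f -` U \<inter> space N \<in> sets N" .
qed

lemma dist_measurable: "x \<in> car S \<Longrightarrow> dst S x \<in> borel_measurable (msr S)"
proof (rule borel_measurableI_less)
  fix r assume x: "x \<in> car S"
  have "{y \<in> space (msr S). dst S x y < r} = mball x r" using x by auto
  then show "{y \<in> space (msr S). dst S x y < r} \<in> sets (msr S)" by simp
qed

lemma lip1_measurable: 
  assumes "\<And>x y. x \<in> car S \<Longrightarrow> y \<in> car S \<Longrightarrow> \<bar>f x - f y\<bar> \<le> dst S x y"
  shows "f \<in> borel_measurable (msr S)"
proof (rule borel_measurableI_less)
  fix r
  have "openin mtopology {y \<in> car S. f y < r}"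
    unfolding openin_mtopology
  proof (intro conjI allI impI)
    fix x assume x: "x \<in> {y \<in> car S. f y < r}"
    have "mball x (r - f x) \<subseteq> {y \<in> car S. f y < r}"
      using x assms by (force simp: abs_le_iff)
    then show "\<exists>e>0. mball x e \<subseteq> {y \<in> car S. f y < r}"
      using x by (intro exI[of _ "r - f x"]) auto
  qed auto
  then show "{y \<in> space (msr S). f y < r} \<in> sets (msr S)"
    using open_sets by simp
qed

text \<open>The complement of the support is the union of those null balls whose centre is in a
  dense sequence and whose radius is \<open>1 / Suc n\<close>. There are countably many of them, so
  the complement is null.\<close>

lemma supp_full: "mm_supp S \<in> sets (msr S)" "prob (mm_supp S) = 1"
proof -
  obtain x :: "nat \<Rightarrow> 'a" where x: "\<forall>k. x k \<in> car S" "\<forall>y\<in>car S. \<forall>e>0. \<exists>k. dst S (x k) y < e"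
    using dense_seq by blast
  define K where "K = {(k::nat,n::nat). prob (mball (x k) (1 / Suc n)) = 0}"
  define N where "N = (\<Union>(k,n)\<in>K. mball (x k) (1 / Suc n))"
  have N: "N \<in> null_sets (msr S)"
    unfolding N_def
  proof (rule null_sets_UN')
    show "countable K" by simp
    fix p assume "p \<in> K"
    then show "(case p of (k,n) \<Rightarrow> mball (x k) (1 / Suc n)) \<in> null_sets (msr S)"
      by (auto simp: K_def null_sets_def emeasure_eq_measure split: prod.splits)
  qed
  have "mm_supp S = car S - N"
  proof (intro equalityI subsetI)
    fix y assume y: "y \<in> mm_supp S"
    have "y \<notin> mball (x k) (1 / Suc n)" if "(k,n) \<in> K" for k n
    proof
      assume "y \<in> mball (x k) (1 / Suc n)"
      then obtain r where r: "r > 0" "mball y r \<subseteq> mball (x k) (1 / Suc n)"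
        using openin_mball[of "x k" "1 / Suc n"] unfolding openin_mtopology by blast
      then have "prob (mball y r) \<le> prob (mball (x k) (1 / Suc n))"
        by (intro finite_measure_mono) auto
      then have "prob (mball y r) = 0" using that by (simp add: K_def measure_le_0_iff)
      then show False using y r by (auto simp: mm_supp_alt)
    qed
    then show "y \<in> car S - N" using y by (auto simp: N_def mm_supp_alt)
  next
    fix y assume y: "y \<in> car S - N"
    show "y \<in> mm_supp S"
    proof (rule ccontr)
      assume "y \<notin> mm_supp S"
      then obtain e where e: "e > 0" "prob (mball y e) = 0"
        using y by (auto simp: mm_supp_alt not_less measure_le_0_iff)
      obtain n where n: "1 / Suc n < e / 2"
        using e by (metis half_gt_zero nat_approx_posE)
      obtain k where k: "dst S (x k) y < 1 / Suc n"
        using x(2)[rule_format, of y "1 / Suc n"] y by auto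
      have "mball (x k) (1 / Suc n) \<subseteq> mball y e"
        by (rule mball_subset) (use k n y in \<open>auto simp: field_simps\<close>)
      then have "prob (mball (x k) (1 / Suc n)) \<le> prob (mball y e)"
        by (intro finite_measure_mono) auto
      then have "(k,n) \<in> K" using e by (simp add: K_def measure_le_0_iff)
      then show False using k y x by (auto simp: N_def)
    qed
  qed
  then show "mm_supp S \<in> sets (msr S)"
    using N sets.compl_sets[of N "msr S"] by auto
  show "prob (mm_supp S) = 1"
    using \<open>mm_supp S = car S - N\<close> N prob_compl[of N] by (auto simp: null_sets_def measure_def)
qed

lemma supp_car: "x \<in> mm_supp S \<Longrightarrow> x \<in> car S"
  by (auto simp: mm_supp_alt)

lemma supp_ball: "x \<in> mm_supp S \<Longrightarrow> e > 0 \<Longrightarrow> prob (mball x e) > 0"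
  by (auto simp: mm_supp_alt)

lemma suppI_limit:
  assumes "y \<in> car S" "\<And>e. e > 0 \<Longrightarrow> \<exists>x\<in>mm_supp S. dst S x y < e"
  shows "y \<in> mm_supp S"
  unfolding mm_supp_alt
proof (intro CollectI conjI allI impI assms(1))
  fix e :: real assume e: "e > 0"
  obtain x where x: "x \<in> mm_supp S" "dst S x y < e / 2"
    using assms(2)[of "e/2"] e by auto
  have "mball x (e/2) \<subseteq> mball y e"
    by (rule mball_subset) (use x assms in auto)
  then have "prob (mball x (e/2)) \<le> prob (mball y e)"
    by (intro finite_measure_mono) auto
  then show "prob (mball y e) > 0"
    using supp_ball[OF x(1), of "e/2"] e by auto
qed

lemma param_car: "parameter S \<phi> \<Longrightarrow> 0 \<le> s \<Longrightarrow> s < 1 \<Longrightarrow> \<phi> s \<in> car S"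
  using measurable_space[of \<phi> lebI "msr S" s] by (auto simp: parameter_alt)

lemma param_sets: "parameter S \<phi> \<Longrightarrow> B \<in> sets (msr S) \<Longrightarrow> \<phi> -` B \<inter> {0..<1} \<in> sets lebI"
  using measurable_sets[of \<phi> lebI "msr S" B] by (auto simp: parameter_alt)

lemma param_measure: "parameter S \<phi> \<Longrightarrow> B \<in> sets (msr S) \<Longrightarrow> 
    measure lebI (\<phi> -` B \<inter> {0..<1}) = prob B"
  using measure_distr[of \<phi> lebI "msr S" B] by (auto simp: parameter_alt)

lemma paramI:
  assumes "\<phi> \<in> measurable lebI (msr S)"
    "\<And>B. B \<in> sets (msr S) \<Longrightarrow> measure lebI (\<phi> -` B \<inter> {0..<1}) = prob B"
  shows "parameter S \<phi>"
  unfolding parameter_alt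
proof (intro conjI assms(1) measure_eqI)
  fix B assume "B \<in> sets (distr lebI (msr S) \<phi>)"
  then show "emeasure (distr lebI (msr S) \<phi>) B = emeasure (msr S) B"
    using assms by (auto simp: emeasure_distr lebI.emeasure_eq_measure emeasure_eq_measure)
qed simp

lemma param_supp_full: "parameter S \<phi> \<Longrightarrow> full (\<phi> -` mm_supp S \<inter> {0..<1})"
  using supp_full param_sets param_measure by (auto simp: full_def)

text \<open>A parameter is often known only on a set of full measure. Filling the rest with one
  constant keeps all preimages measurable and changes no measure.\<close>

lemma paramI_full:
  assumes J: "full J" and c: "\<And>s. s \<in> {0..<1} - J \<Longrightarrow> \<psi> s = c" "c \<in> car S"
    and \<psi>: "\<And>s. s \<in> J \<Longrightarrow> \<psi> s \<in> car S"
    and ms: "\<And>B. B \<in> sets (msr S) \<Longrightarrow> \<psi> -` B \<inter> J \<in> sets lebI"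
      "\<And>B. B \<in> sets (msr S) \<Longrightarrow> measure lebI (\<psi> -` B \<inter> J) = prob B"
  shows "parameter S \<psi>"
proof (rule paramI)
  have JI: "J \<subseteq> {0..<1}" using full_subset[OF J] by auto
  have s2: "\<psi> -` B \<inter> {0..<1} \<in> sets lebI" if B: "B \<in> sets (msr S)" for B
  proof -
    have "s \<in> \<psi> -` B \<inter> {0..<1} \<longleftrightarrow> s \<in> (\<psi> -` B \<inter> J) \<union> (if c \<in> B then {0..<1} - J else {})" for s
      using c(1)[of s] JI by (cases "s \<in> J"; cases "s \<in> {0..<1}") auto
    then have "\<psi> -` B \<inter> {0..<1} = (\<psi> -` B \<inter> J) \<union> (if c \<in> B then {0..<1} - J else {})"
      by blast
    moreover have "\<dots> \<in> sets lebI"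
      using ms(1)[OF B] sets.compl_sets[OF full_sets[OF J]] by auto
    ultimately show ?thesis by simp
  qed
  show "measure lebI (\<psi> -` B \<inter> {0..<1}) = prob B" if B: "B \<in> sets (msr S)" for B
  proof -
    have "\<psi> -` B \<inter> {0..<1} \<inter> J = \<psi> -` B \<inter> J" using JI by auto
    then show ?thesis using measure_full_Int[OF J s2[OF B]] ms(2)[OF B] by simp
  qed
  show "\<psi> \<in> measurable lebI (msr S)"
  proof (rule measurableI)
    fix s assume "s \<in> space lebI"
    then show "\<psi> s \<in> space (msr S)"
      using \<psi> c by (cases "s \<in> J") auto
  qed (use s2 in auto)
qed

text \<open>A ball around a support point has positive measure, so its preimage meets every set of
  full measure: the image of \<open>J\<close> comes arbitrarily close to each support point.\<close>

lemma param_dense: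
  assumes "parameter S \<phi>" "full J" "x \<in> mm_supp S" "e > 0"
  shows "\<exists>s\<in>J. dst S (\<phi> s) x < e"
proof -
  have "measure lebI (\<phi> -` mball x e \<inter> {0..<1}) > 0"
    using supp_ball assms param_measure[OF assms(1), of "mball x e"] by auto
  then obtain s where "s \<in> J" "s \<in> \<phi> -` mball x e \<inter> {0..<1}"
    using full_meets[OF assms(2) param_sets[OF assms(1), of "mball x e"]] by auto
  then show ?thesis by (intro bexI[of _ s]) (auto simp: commute)
qed

end

text \<open>The measure is the push-forward of Lebesgue measure under \<kappa>. Testing
  measurability on balls around the dense sequence suffices, so the carrier may be built by hand
  from distances alone.\<close>

lemma mm_spaceI:
  assumes "Metric_space X d" "Metric_space.mcomplete X d"
    and x: "\<forall>k::nat. x k \<in> X" "\<forall>y\<in>X. \<forall>e>0. \<exists>k. d (x k) y < e"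
    and \<kappa>: "\<And>s. 0 \<le> s \<Longrightarrow> s < 1 \<Longrightarrow> \<kappa> s \<in> X"
      "\<And>k r. {s \<in> {0..<1}. d (x k) (\<kappa> s) < r} \<in> sets lebI"
  shows "\<exists>\<mu>. mm_space (X, d, \<mu>) \<and> parameter (X, d, \<mu>) \<kappa>"
proof -
  interpret Metric_space X d by fact
  let ?N = "sigma X {U. openin mtopology U}"
  have sub: "{U. openin mtopology U} \<subseteq> Pow X" using openin_subset by fastforce
  have "\<kappa> \<in> measurable lebI ?N"
  proof (rule measurable_measure_of[OF sub])
    show "\<kappa> \<in> space lebI \<rightarrow> X" using \<kappa>(1) by auto
    fix U assume "U \<in> {U. openin mtopology U}"
    then have U: "openin mtopology U" by simp
    let ?K = "{(k::nat,n::nat). mball (x k) (1 / Suc n) \<subseteq> U}"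
    have "\<kappa> -` U \<inter> space lebI = \<kappa> -` (\<Union>(k,n)\<in>?K. mball (x k) (1 / Suc n)) \<inter> space lebI"
      using open_countable_balls[OF U x] by simp
    also have "\<dots> = (\<Union>(k,n)\<in>?K. {s \<in> {0..<1}. d (x k) (\<kappa> s) < 1 / Suc n})"
      using \<kappa>(1) x(1) by (auto simp: Pi_iff; blast)
    also have "\<dots> \<in> sets lebI"
      using \<kappa>(2) by (intro sets.countable_UN') (auto intro: countable_subset[of _ UNIV])
    finally show "\<kappa> -` U \<inter> space lebI \<in> sets lebI" .
  qed
  moreover define \<mu> where "\<mu> = distr lebI ?N \<kappa>"
  moreover have "separable_space mtopology"
  proof -
    have "\<exists>z\<in>range x. z \<in> mball y r" if y: "y \<in> X" and r: "r > 0" for y r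
    proof -
      obtain k where "d (x k) y < r" using x(2)[rule_format, OF y r] by blast
      then have "x k \<in> mball y r" using x(1) y by (simp add: commute)
      then show ?thesis by blast
    qed
    then have "mtopology closure_of (range x) = X"
      unfolding metric_closure_of using x(1) by blast
    then show ?thesis unfolding separable_space_def using x(1)
      by (intro exI[of _ "range x"]) auto
  qed
  moreover have "sets \<mu> = mm_borel X d" "space \<mu> = X"
    using sub by (auto simp: \<mu>_def mm_borel_def)
  moreover have "prob_space \<mu>"
    unfolding \<mu>_def by (rule lebI.prob_space_distr) fact
  ultimately have "mm_space (X, d, \<mu>)" using assms by (simp add: mm_space_alt)
  moreover have "parameter (X, d, \<mu>) \<kappa>"
    using \<open>\<kappa> \<in> measurable lebI ?N\<close>
    by (simp add: parameter_alt \<mu>_def cong: measurable_cong_sets distr_cong)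
  ultimately show ?thesis by blast
qed

section \<open>The Lipschitz order through parameters\<close>

text \<open>The extension is the infimum over \<open>i\<close> of \<open>u i + d (p i) x\<close>. It
  is exactly 1-Lipschitz even if the data satisfy the Lipschitz condition only up to
  \<open>e\<close>; the defect reappears as a one-sided loss at the points \<open>p i\<close>. Data
  are attached to indices, so \<open>p\<close> may repeat points.\<close>

lemma mcshane:
  fixes d :: "'a \<Rightarrow> 'a \<Rightarrow> real" and u :: "'i \<Rightarrow> real"
  assumes "A \<noteq> {}" and p: "\<And>i. i \<in> A \<Longrightarrow> p i \<in> X"
    and tri: "\<And>x y z. x \<in> X \<Longrightarrow> y \<in> X \<Longrightarrow> z \<in> X \<Longrightarrow> d x z \<le> d x y + d y z"
    and sym: "\<And>x y. x \<in> X \<Longrightarrow> y \<in> X \<Longrightarrow> d x y = d y x"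
    and zero: "\<And>x. x \<in> X \<Longrightarrow> d x x = 0"
    and u: "\<And>i j. i \<in> A \<Longrightarrow> j \<in> A \<Longrightarrow> u i - u j \<le> d (p i) (p j) + e"
  obtains F where "\<And>x y. x \<in> X \<Longrightarrow> y \<in> X \<Longrightarrow> \<bar>F x - F y\<bar> \<le> d x y"
    "\<And>i. i \<in> A \<Longrightarrow> F (p i) \<le> u i" "\<And>i. i \<in> A \<Longrightarrow> u i - e \<le> F (p i)"
proof -
  define F where "F x = (INF i\<in>A. u i + d (p i) x)" for x
  have low: "u j - e - d (p j) x \<le> u i + d (p i) x" if "i \<in> A" "j \<in> A" "x \<in> X" for i j x
    using u[of j i] tri[of "p j" x "p i"] sym[of "p i" x] p that by simp
  have bdd: "bdd_below ((\<lambda>i. u i + d (p i) x) ` A)" if x: "x \<in> X" for x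
  proof -
    obtain j where "j \<in> A" using assms(1) by auto
    then show ?thesis using low x by (auto intro!: bdd_belowI[of _ "u j - e - d (p j) x"])
  qed
  have le: "F x \<le> F y + d x y" if x: "x \<in> X" and y: "y \<in> X" for x y
  proof -
    have "F x - d x y \<le> F y"
      unfolding F_def
    proof (rule cINF_greatest[OF assms(1)])
      fix i assume i: "i \<in> A"
      have "(INF i\<in>A. u i + d (p i) x) \<le> u i + d (p i) x"
        by (rule cINF_lower[OF bdd[OF x] i])
      then show "(INF i\<in>A. u i + d (p i) x) - d x y \<le> u i + d (p i) y"
        using tri[of "p i" y x] sym[of x y] p[OF i] x y by simp
    qed
    then show ?thesis by simp
  qed
  show ?thesis
  proof
    show "\<bar>F x - F y\<bar> \<le> d x y" if "x \<in> X" "y \<in> X" for x y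
      using le[of x y] le[of y x] sym[of x y] that by (simp add: abs_le_iff)
    fix i assume i: "i \<in> A"
    show "F (p i) \<le> u i"
      unfolding F_def using cINF_lower[OF bdd[OF p[OF i]] i] zero[OF p[OF i]] by simp
    show "u i - e \<le> F (p i)"
      unfolding F_def
    proof (rule cINF_greatest[OF assms(1)])
      fix j assume "j \<in> A"
      then show "u i - e \<le> u j + d (p j) (p i)"
        using low[of j i "p i"] i p zero by simp
    qed
  qed
qed

text \<open>Unlike the map in \<open>lip_dominated\<close>, this one takes values in the support of
  \<open>T\<close>, so that two such maps in opposite directions can be composed.\<close>

definition lip_map :: "'a mm \<Rightarrow> 'b mm \<Rightarrow> ('a \<Rightarrow> 'b) \<Rightarrow> bool" where
  "lip_map S T f \<longleftrightarrow> f ` mm_supp S \<subseteq> mm_supp T \<and>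
    (\<forall>x\<in>mm_supp S. \<forall>y\<in>mm_supp S. dst T (f x) (f y) \<le> dst S x y) \<and>
    (\<forall>B\<in>sets (msr T). f -` B \<inter> mm_supp S \<in> sets (msr S) \<and>
       measure (msr S) (f -` B \<inter> mm_supp S) = measure (msr T) B)"

lemma lip_mapD:
  assumes "lip_map S T f"
  shows "f ` mm_supp S \<subseteq> mm_supp T"
    "\<And>x y. x \<in> mm_supp S \<Longrightarrow> y \<in> mm_supp S \<Longrightarrow> dst T (f x) (f y) \<le> dst S x y"
    "\<And>B. B \<in> sets (msr T) \<Longrightarrow> f -` B \<inter> mm_supp S \<in> sets (msr S)"
    "\<And>B. B \<in> sets (msr T) \<Longrightarrow> measure (msr S) (f -` B \<inter> mm_supp S) = measure (msr T) B"
  using assms unfolding lip_map_def by simp_all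

text \<open>The map sends a support point \<open>x\<close> to the limit of \<psi> along parameter
  values whose \<phi>-images tend to \<open>x\<close>; completeness of \<open>T\<close> and the
  inequality on \<open>J\<close> give the limit. The estimate of distances to \<psi>-values
  determines the map and is what later shows that two such maps are mutually inverse.\<close>

lemma params_dominate:
  assumes S: "mm_space S" and T: "mm_space T" and \<phi>: "parameter S \<phi>" and \<psi>: "parameter T \<psi>"
    and J: "full J"
    and le0: "\<forall>s\<in>J. \<forall>t\<in>J. dst T (\<psi> s) (\<psi> t) \<le> dst S (\<phi> s) (\<phi> t)"
  shows "\<exists>f. lip_map S T f \<and> (\<forall>x\<in>mm_supp S. \<forall>s\<in>J. dst T (\<psi> s) (f x) \<le> dst S (\<phi> s) x)"
proof -
  interpret S: mm S by unfold_locales fact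
  interpret T: mm T by unfold_locales fact
  note le = le0[rule_format]
  define J' where "J' = J \<inter> (\<phi> -` mm_supp S \<inter> {0..<1}) \<inter> (\<psi> -` mm_supp T \<inter> {0..<1})"
  have J': "full J'"
    unfolding J'_def by (intro full_Int J S.param_supp_full[OF \<phi>] T.param_supp_full[OF \<psi>])
  have J'J: "s \<in> J" "\<phi> s \<in> mm_supp S" "\<psi> s \<in> mm_supp T" if "s \<in> J'" for s
    using that by (auto simp: J'_def)
  have \<phi>c: "\<phi> s \<in> car S" and \<psi>c: "\<psi> s \<in> car T" if "s \<in> J" for s
    using S.param_car[OF \<phi>] T.param_car[OF \<psi>] full_subset[OF J that] by auto
  have "\<exists>y\<in>car T. \<forall>s\<in>J. dst T (\<psi> s) y \<le> dst S (\<phi> s) x" if x: "x \<in> mm_supp S" for x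
  proof -
    have xc: "x \<in> car S" by (rule S.supp_car[OF x])
    \<comment> \<open>Parameter values whose \<phi>-images converge to \<open>x\<close>; their
      \<psi>-images form a Cauchy sequence by the hypothesis on \<open>J\<close>.\<close>
    have "\<forall>n. \<exists>s\<in>J. dst S (\<phi> s) x < 1 / Suc n"
      using S.param_dense[OF \<phi> J x] by simp
    then obtain \<sigma> where \<sigma>: "\<And>n. \<sigma> n \<in> J" "\<And>n. dst S (\<phi> (\<sigma> n)) x < 1 / Suc n" by metis
    have "T.MCauchy (\<lambda>n. \<psi> (\<sigma> n))"
      unfolding T.MCauchy_def
    proof (intro conjI allI impI)
      show "range (\<lambda>n. \<psi> (\<sigma> n)) \<subseteq> car T" using \<psi>c \<sigma> by auto
      fix e :: real assume "e > 0"
      then obtain N where N: "1 / Suc N < e / 2"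
        by (metis half_gt_zero nat_approx_posE)
      have "dst T (\<psi> (\<sigma> n)) (\<psi> (\<sigma> m)) < e" if "N \<le> n" "N \<le> m" for n m
      proof -
        have "dst T (\<psi> (\<sigma> n)) (\<psi> (\<sigma> m)) \<le> dst S (\<phi> (\<sigma> n)) x + dst S (\<phi> (\<sigma> m)) x"
          using le[OF \<sigma>(1) \<sigma>(1), of n m] S.triangle'[OF \<phi>c[OF \<sigma>(1)] xc \<phi>c[OF \<sigma>(1)], of n m]
          by linarith
        also have "\<dots> < 1 / Suc n + 1 / Suc m" using \<sigma>(2)[of n] \<sigma>(2)[of m] by simp
        also have "\<dots> \<le> 1 / Suc N + 1 / Suc N"
          using that by (intro add_mono divide_left_mono) auto
        also have "\<dots> < e" using N by simp
        finally show ?thesis .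
      qed
      then show "\<exists>N. \<forall>n n'. N \<le> n \<longrightarrow> N \<le> n' \<longrightarrow> dst T (\<psi> (\<sigma> n)) (\<psi> (\<sigma> n')) < e" by blast
    qed
    then obtain y where "limitin T.mtopology (\<lambda>n. \<psi> (\<sigma> n)) y sequentially"
      using T.complete T.mcomplete_def by blast
    then have y: "y \<in> car T" "\<And>e. e > 0 \<Longrightarrow> \<exists>N. \<forall>n\<ge>N. dst T (\<psi> (\<sigma> n)) y < e"
      unfolding T.limit_metric_sequentially by blast+
    have "dst T (\<psi> s) y \<le> dst S (\<phi> s) x" if s: "s \<in> J" for s
    proof (rule field_le_epsilon)
      fix e :: real assume e: "e > 0"
      obtain N where N: "\<forall>n\<ge>N. dst T (\<psi> (\<sigma> n)) y < e / 2" using y(2)[of "e/2"] e by auto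
      obtain M where M: "1 / Suc M < e / 2" using e by (metis half_gt_zero nat_approx_posE)
      define n where "n = max N M"
      have n1: "dst T (\<psi> (\<sigma> n)) y < e / 2" using N by (simp add: n_def)
      have "1 / real (Suc n) \<le> 1 / Suc M" by (intro divide_left_mono) (auto simp: n_def)
      then have n2: "dst S (\<phi> (\<sigma> n)) x < e / 2" using \<sigma>(2)[of n] M by simp
      have "dst T (\<psi> s) y \<le> dst T (\<psi> s) (\<psi> (\<sigma> n)) + dst T (\<psi> (\<sigma> n)) y"
        using T.triangle \<psi>c s \<sigma>(1) y(1) by blast
      also have "dst T (\<psi> s) (\<psi> (\<sigma> n)) \<le> dst S (\<phi> s) (\<phi> (\<sigma> n))" by (rule le[OF s \<sigma>(1)])
      also have "\<dots> \<le> dst S (\<phi> s) x + dst S (\<phi> (\<sigma> n)) x"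
        using S.triangle'[OF \<phi>c[OF s] xc \<phi>c[OF \<sigma>(1)]] by simp
      finally show "dst T (\<psi> s) y \<le> dst S (\<phi> s) x + e" using n1 n2 by simp
    qed
    with y(1) show ?thesis by blast
  qed
  then obtain f where fc: "\<And>x. x \<in> mm_supp S \<Longrightarrow> f x \<in> car T"
    and fle: "\<And>x s. x \<in> mm_supp S \<Longrightarrow> s \<in> J \<Longrightarrow> dst T (\<psi> s) (f x) \<le> dst S (\<phi> s) x" by metis
  have fs: "f x \<in> mm_supp T" if x: "x \<in> mm_supp S" for x
  proof (rule T.suppI_limit[OF fc[OF x]])
    fix e :: real assume "e > 0"
    then obtain s where "s \<in> J'" "dst S (\<phi> s) x < e" using S.param_dense[OF \<phi> J' x] by blast
    then show "\<exists>y\<in>mm_supp T. dst T y (f x) < e"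
      using fle[OF x, of s] J'J[of s] by (intro bexI[of _ "\<psi> s"]) auto
  qed
  have lip: "dst T (f x) (f y) \<le> dst S x y" if x: "x \<in> mm_supp S" and y: "y \<in> mm_supp S" for x y
  proof (rule field_le_epsilon)
    fix e :: real assume "e > 0"
    then obtain s where s: "s \<in> J" "dst S (\<phi> s) x < e / 2"
      using S.param_dense[OF \<phi> J x, of "e/2"] by auto
    have "dst T (f x) (f y) \<le> dst T (\<psi> s) (f x) + dst T (\<psi> s) (f y)"
      by (rule T.triangle'') (use fc x y \<psi>c s in auto)
    also have "\<dots> \<le> dst S (\<phi> s) x + dst S (\<phi> s) y" using fle x y s by (intro add_mono) auto
    also have "dst S (\<phi> s) y \<le> dst S (\<phi> s) x + dst S x y"
      by (rule S.triangle) (use x y s \<phi>c S.supp_car in auto)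
    finally show "dst T (f x) (f y) \<le> dst S x y + e" using s by simp
  qed
  \<comment> \<open>At \<open>x = \<phi> s\<close> the right side of \<open>fle\<close> vanishes.
    This almost sure identity is what transports the measure.\<close>
  have f\<phi>: "f (\<phi> s) = \<psi> s" if s: "s \<in> J'" for s
    using fle[OF J'J(2)[OF s] J'J(1)[OF s]] fc[OF J'J(2)[OF s]] \<psi>c[OF J'J(1)[OF s]]
      \<phi>c[OF J'J(1)[OF s]] T.nonneg[of "\<psi> s" "f (\<phi> s)"] by simp
  have fm: "f \<in> measurable (restrict_space (msr S) (mm_supp S)) (msr T)"
  proof (rule T.measurableI_ball)
    show "f \<in> space (restrict_space (msr S) (mm_supp S)) \<rightarrow> car T"
      using fc by (auto simp: space_restrict_space)
    fix y r assume y: "y \<in> car T"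
    \<comment> \<open>The preimage of a ball is open only relative to the support; \<open>U\<close>
      is an open set of the whole space with that trace on it.\<close>
    define U where "U = (\<Union>x\<in>{x\<in>mm_supp S. dst T y (f x) < r}. S.mball x (r - dst T y (f x)))"
    have "openin S.mtopology U"
      unfolding U_def by (intro openin_Union) auto
    then have "U \<in> sets (msr S)" by (rule S.open_sets)
    moreover have "{s \<in> space (restrict_space (msr S) (mm_supp S)). dst T y (f s) < r} = U \<inter> mm_supp S"
    proof (intro equalityI subsetI)
      fix x assume "x \<in> U \<inter> mm_supp S"
      then obtain z where z: "z \<in> mm_supp S" "dst S z x < r - dst T y (f z)" and x: "x \<in> mm_supp S"
        by (auto simp: U_def)
      have "dst T y (f x) \<le> dst T y (f z) + dst T (f z) (f x)"
        by (rule T.triangle) (use fc x z y in auto)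
      then have "dst T y (f x) < r" using lip[OF z(1) x] z by simp
      then show "x \<in> {s \<in> space (restrict_space (msr S) (mm_supp S)). dst T y (f s) < r}"
        using x S.supp_car by (auto simp: space_restrict_space)
    next
      fix x assume "x \<in> {s \<in> space (restrict_space (msr S) (mm_supp S)). dst T y (f s) < r}"
      then show "x \<in> U \<inter> mm_supp S"
        using S.supp_car by (auto simp: U_def space_restrict_space intro!: bexI[of _ x])
    qed
    ultimately show "{s \<in> space (restrict_space (msr S) (mm_supp S)). dst T y (f s) < r}
        \<in> sets (restrict_space (msr S) (mm_supp S))"
      by (auto simp: sets_restrict_space)
  qed
  have fB: "f -` B \<inter> mm_supp S \<in> sets (msr S)" if B: "B \<in> sets (msr T)" for B
  proof -
    have "mm_supp S \<inter> car S = mm_supp S" using S.supp_car by auto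
    then have "space (restrict_space (msr S) (mm_supp S)) = mm_supp S"
      by (simp add: space_restrict_space)
    then show ?thesis
      using measurable_sets[OF fm B] S.supp_full(1) \<open>mm_supp S \<inter> car S = mm_supp S\<close>
      by (auto simp: sets_restrict_space_iff)
  qed
  have fP: "S.prob (f -` B \<inter> mm_supp S) = T.prob B" if B: "B \<in> sets (msr T)" for B
  proof -
    have "S.prob (f -` B \<inter> mm_supp S) = measure lebI (\<phi> -` (f -` B \<inter> mm_supp S) \<inter> {0..<1})"
      using S.param_measure[OF \<phi> fB[OF B]] by simp
    also have "\<dots> = measure lebI (\<phi> -` (f -` B \<inter> mm_supp S) \<inter> {0..<1} \<inter> J')"
      using measure_full_Int[OF J' S.param_sets[OF \<phi> fB[OF B]]] by simp
    also have "\<phi> -` (f -` B \<inter> mm_supp S) \<inter> {0..<1} \<inter> J' = \<psi> -` B \<inter> {0..<1} \<inter> J'"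
      using f\<phi> J'J by auto
    also have "measure lebI \<dots> = T.prob B"
      using measure_full_Int[OF J' T.param_sets[OF \<psi> B]] T.param_measure[OF \<psi> B] by simp
    finally show ?thesis .
  qed
  show ?thesis
    using fs lip fB fP fle by (intro exI[of _ f]) (auto simp: lip_map_def)
qed

lemma params_lip_dominated:
  assumes "mm_space S" "mm_space T" "parameter S \<phi>" "parameter T \<psi>" "full J"
    "\<forall>s\<in>J. \<forall>t\<in>J. dst T (\<psi> s) (\<psi> t) \<le> dst S (\<phi> s) (\<phi> t)"
  shows "lip_dominated T S"
proof -
  interpret T: mm T by unfold_locales fact
  show ?thesis
  proof -
    obtain f where f: "lip_map S T f" using params_dominate[OF assms] by blast
    have "f ` mm_supp S \<subseteq> car T" using lip_mapD(1)[OF f] T.supp_car by blast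
    with lip_mapD(2-)[OF f] show ?thesis unfolding lip_dominated_alt by (intro exI[of _ f]) simp
  qed
qed

text \<open>Equality of the pullbacks gives 1-Lipschitz maps in both directions. Their composite
  fixes \<open>y\<close>, since for \<psi>-values close to \<open>y\<close> both estimates bound the
  distance to the image of \<open>y\<close> by the distance to \<open>y\<close>.\<close>

lemma params_mm_iso:
  assumes S: "mm_space S" and T: "mm_space T" and \<phi>: "parameter S \<phi>" and \<psi>: "parameter T \<psi>"
    and J: "full J"
    and eq: "\<forall>s\<in>J. \<forall>t\<in>J. dst T (\<psi> s) (\<psi> t) = dst S (\<phi> s) (\<phi> t)"
  shows "mm_iso S T"
proof -
  interpret S: mm S by unfold_locales fact
  interpret T: mm T by unfold_locales fact
  have \<phi>c: "\<phi> s \<in> car S" and \<psi>c: "\<psi> s \<in> car T" if "s \<in> J" for s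
    using S.param_car[OF \<phi>] T.param_car[OF \<psi>] full_subset[OF J that] by auto
  have le1: "\<forall>s\<in>J. \<forall>t\<in>J. dst T (\<psi> s) (\<psi> t) \<le> dst S (\<phi> s) (\<phi> t)"
    and le2: "\<forall>s\<in>J. \<forall>t\<in>J. dst S (\<phi> s) (\<phi> t) \<le> dst T (\<psi> s) (\<psi> t)"
    using eq by simp_all
  have "\<exists>f. lip_map S T f \<and> (\<forall>x\<in>mm_supp S. \<forall>s\<in>J. dst T (\<psi> s) (f x) \<le> dst S (\<phi> s) x)"
    by (rule params_dominate[OF S T \<phi> \<psi> J le1])
  then obtain f where f': "lip_map S T f"
    "\<forall>x\<in>mm_supp S. \<forall>s\<in>J. dst T (\<psi> s) (f x) \<le> dst S (\<phi> s) x" by auto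
  have "\<exists>g. lip_map T S g \<and> (\<forall>x\<in>mm_supp T. \<forall>s\<in>J. dst S (\<phi> s) (g x) \<le> dst T (\<psi> s) x)"
    by (rule params_dominate[OF T S \<psi> \<phi> J le2])
  then obtain g where g': "lip_map T S g"
    "\<forall>x\<in>mm_supp T. \<forall>s\<in>J. dst S (\<phi> s) (g x) \<le> dst T (\<psi> s) x" by auto
  note f = lip_mapD[OF f'(1)] and g = lip_mapD[OF g'(1)]
  have fg: "f (g y) = y" if y: "y \<in> mm_supp T" for y
  proof -
    have c: "f (g y) \<in> car T" "y \<in> car T" using f(1) g(1) y T.supp_car by blast+
    have "dst T (f (g y)) y \<le> 0"
    proof (rule field_le_epsilon)
      fix e :: real assume "e > 0"
      then obtain s where s: "s \<in> J" "dst T (\<psi> s) y < e / 2"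
        using T.param_dense[OF \<psi> J y, of "e/2"] by auto
      have "dst T (f (g y)) y \<le> dst T (\<psi> s) (f (g y)) + dst T (\<psi> s) y"
        by (rule T.triangle'') (use c \<psi>c s in auto)
      also have "dst T (\<psi> s) (f (g y)) \<le> dst T (\<psi> s) y"
      proof -
        have "g y \<in> mm_supp S" using g(1) y by auto
        then show ?thesis using f'(2)[rule_format, of "g y" s] g'(2)[rule_format, OF y s(1)] s(1) by linarith
      qed
      finally show "dst T (f (g y)) y \<le> 0 + e" using s by simp
    qed
    then show ?thesis using T.nonneg[of "f (g y)" y] T.zero[OF c] by simp
  qed
  have gf: "g (f x) = x" if x: "x \<in> mm_supp S" for x
  proof -
    have c: "g (f x) \<in> car S" "x \<in> car S" using f(1) g(1) x S.supp_car by blast+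
    have "dst S (g (f x)) x \<le> 0"
    proof (rule field_le_epsilon)
      fix e :: real assume "e > 0"
      then obtain s where s: "s \<in> J" "dst S (\<phi> s) x < e / 2"
        using S.param_dense[OF \<phi> J x, of "e/2"] by auto
      have "dst S (g (f x)) x \<le> dst S (\<phi> s) (g (f x)) + dst S (\<phi> s) x"
        by (rule S.triangle'') (use c \<phi>c s in auto)
      also have "dst S (\<phi> s) (g (f x)) \<le> dst S (\<phi> s) x"
      proof -
        have "f x \<in> mm_supp T" using f(1) x by auto
        then show ?thesis using g'(2)[rule_format, of "f x" s] f'(2)[rule_format, OF x s(1)] s(1) by linarith
      qed
      finally show "dst S (g (f x)) x \<le> 0 + e" using s by simp
    qed
    then show ?thesis using S.nonneg[of "g (f x)" x] S.zero[OF c] by simp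
  qed
  have "bij_betw f (mm_supp S) (mm_supp T)"
    by (rule bij_betw_byWitness[of _ g]) (use f(1) g(1) fg gf in blast)+
  moreover have "dst T (f x) (f y) = dst S x y" if "x \<in> mm_supp S" "y \<in> mm_supp S" for x y
  proof -
    have "f x \<in> mm_supp T" "f y \<in> mm_supp T" using f(1) that by auto
    then show ?thesis using f(2)[OF that] g(2)[of "f x" "f y"] gf[OF that(1)] gf[OF that(2)] by simp
  qed
  ultimately show ?thesis
    unfolding mm_iso_alt using f(3,4) by (intro exI[of _ f]) simp
qed

text \<open>A parameter is pushed forward along a measure-preserving map defined only on the
  support, which suffices because almost every parameter value lands there.\<close>

lemma transport_param:
  assumes S: "mm_space S" and T: "mm_space T" and \<phi>: "parameter S \<phi>" 
    and fc: "f ` mm_supp S \<subseteq> car T"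
    and fB: "\<forall>B\<in>sets (msr T). f -` B \<inter> mm_supp S \<in> sets (msr S) \<and>
       measure (msr S) (f -` B \<inter> mm_supp S) = measure (msr T) B"
  obtains \<psi> where "parameter T \<psi>" "\<forall>s\<in>\<phi> -` mm_supp S \<inter> {0..<1}. \<psi> s = f (\<phi> s)"
proof -
  interpret S: mm S by unfold_locales fact
  interpret T: mm T by unfold_locales fact
  define J where "J = \<phi> -` mm_supp S \<inter> {0..<1}"
  obtain c where c: "c \<in> car T" using T.car_nonempty by auto
  define \<psi> where "\<psi> s = (if s \<in> J then f (\<phi> s) else c)" for s
  have "parameter T \<psi>"
  proof (rule T.paramI_full[where J=J and c=c])
    show "full J" unfolding J_def by (rule S.param_supp_full[OF \<phi>])
    fix B assume B: "B \<in> sets (msr T)"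
    have "\<psi> -` B \<inter> J = \<phi> -` (f -` B \<inter> mm_supp S) \<inter> {0..<1}"
      by (auto simp: \<psi>_def J_def)
    then show "\<psi> -` B \<inter> J \<in> sets lebI" "measure lebI (\<psi> -` B \<inter> J) = T.prob B"
      using S.param_sets[OF \<phi>] S.param_measure[OF \<phi>] fB[rule_format, OF B] by metis+
  qed (use fc c in \<open>auto simp: \<psi>_def J_def\<close>)
  then show ?thesis using that[of \<psi>] by (auto simp: \<psi>_def J_def)
qed

lemma lip_dominated_params:
  assumes "lip_dominated T S" "mm_space S" "mm_space T" "parameter S \<phi>"
  obtains \<psi> J where "parameter T \<psi>" "full J"
    "\<forall>s\<in>J. \<forall>t\<in>J. dst T (\<psi> s) (\<psi> t) \<le> dst S (\<phi> s) (\<phi> t)"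
proof -
  interpret S: mm S by unfold_locales fact
  obtain f where f: "f ` mm_supp S \<subseteq> car T"
    "\<And>x y. x \<in> mm_supp S \<Longrightarrow> y \<in> mm_supp S \<Longrightarrow> dst T (f x) (f y) \<le> dst S x y"
    "\<forall>B\<in>sets (msr T). f -` B \<inter> mm_supp S \<in> sets (msr S) \<and>
       measure (msr S) (f -` B \<inter> mm_supp S) = measure (msr T) B"
    using assms(1) unfolding lip_dominated_alt by blast
  obtain \<psi> where \<psi>: "parameter T \<psi>" "\<forall>s\<in>\<phi> -` mm_supp S \<inter> {0..<1}. \<psi> s = f (\<phi> s)"
    using transport_param[OF assms(2,3,4) f(1) f(3)] by blast
  show ?thesis
    by (rule that[OF \<psi>(1) S.param_supp_full[OF assms(4)]]) (use \<psi> f(2) in auto)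
qed

lemma mm_iso_params:
  assumes "mm_iso S T" "mm_space S" "mm_space T" "parameter S \<phi>"
  obtains \<psi> J where "parameter T \<psi>" "full J"
    "\<forall>s\<in>J. \<forall>t\<in>J. dst T (\<psi> s) (\<psi> t) = dst S (\<phi> s) (\<phi> t)"
proof -
  interpret S: mm S by unfold_locales fact
  interpret T: mm T by unfold_locales fact
  obtain f where f: "bij_betw f (mm_supp S) (mm_supp T)"
    "\<And>x y. x \<in> mm_supp S \<Longrightarrow> y \<in> mm_supp S \<Longrightarrow> dst T (f x) (f y) = dst S x y"
    "\<forall>B\<in>sets (msr T). f -` B \<inter> mm_supp S \<in> sets (msr S) \<and>
       measure (msr S) (f -` B \<inter> mm_supp S) = measure (msr T) B"
    using assms(1) unfolding mm_iso_alt by blast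
  have fc: "f ` mm_supp S \<subseteq> car T"
    using f(1) T.supp_car by (auto simp: bij_betw_def)
  obtain \<psi> where \<psi>: "parameter T \<psi>" "\<forall>s\<in>\<phi> -` mm_supp S \<inter> {0..<1}. \<psi> s = f (\<phi> s)"
    using transport_param[OF assms(2,3,4) fc f(3)] by blast
  show ?thesis
    by (rule that[OF \<psi>(1) S.param_supp_full[OF assms(4)]]) (use \<psi> f(2) in auto)
qed

section \<open>Measure-preserving rearrangements and laws\<close>

text \<open>The quantile function lives on the open interval; the value 0 at the left end point does
  no harm, as a point is null. The equivalence with the distribution function is kept because
  sorting by labels reads positions off it.\<close>

lemma quantile_param:
  assumes "real_distribution M"
  obtains q where "q \<in> borel_measurable lebI" "distr lebI borel q = M"
    "\<forall>s x. 0 < s \<longrightarrow> s < 1 \<longrightarrow> (s \<le> cdf M x \<longleftrightarrow> q s \<le> x)"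
proof -
  interpret cdf_distribution M using assms by (simp add: cdf_distribution_def)
  define q where "q s = (if s \<in> {0<..<1} then I s else 0)" for s :: real
  have "q \<in> borel_measurable borel"
    unfolding q_def using measurable_CI
    by (subst measurable_restrict_space_iff[symmetric]) auto
  then have qm: "q \<in> borel_measurable lebI"
    unfolding lebI_def by (intro measurable_restrict_space1) simp
  have "distr lebI borel q = M"
  proof (rule measure_eqI)
    fix A assume "A \<in> sets (distr lebI borel q)"
    then have A: "A \<in> sets borel" by simp
    have "emeasure (distr lebI borel q) A = emeasure lborel (q -` A \<inter> {0..<1})"
      using qm A by (simp add: emeasure_distr lebI_def emeasure_restrict_space space_restrict_space)
    also have "\<dots> = emeasure lborel (I -` A \<inter> {0<..<1})"
    proof (rule emeasure_eq_AE)
      show "AE x in lborel. (x \<in> q -` A \<inter> {0..<1}) = (x \<in> I -` A \<inter> {0<..<1})"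
        using AE_lborel_singleton[of 0] by eventually_elim (auto simp: q_def)
      show "q -` A \<inter> {0..<1} \<in> sets lborel"
        using measurable_sets[OF qm A] by (simp add: sets_lebI_iff)
      show "I -` A \<inter> {0<..<1} \<in> sets lborel"
        using measurable_sets[OF measurable_CI A] by (auto simp: sets_restrict_space_iff space_restrict_space)
    qed
    also have "\<dots> = emeasure (distr (restrict_space lborel {0<..<1}) borel I) A"
      using A measurable_CI 
      by (subst emeasure_distr) (auto simp: emeasure_restrict_space space_restrict_space 
          cong: measurable_cong_sets sets_restrict_space_cong)
    finally show "emeasure (distr lebI borel q) A = emeasure M A"
      by (simp only: distr_I_eq_M)
  qed simp
  moreover have "\<forall>s x. 0 < s \<longrightarrow> s < 1 \<longrightarrow> (s \<le> C x \<longleftrightarrow> q s \<le> x)"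
  proof (intro allI impI)
    fix s x :: real assume "0 < s" "s < 1"
    then show "s \<le> C x \<longleftrightarrow> q s \<le> x" using pseudoinverse[of s x] by (simp add: q_def)
  qed
  ultimately show ?thesis using that qm by blast
qed

text \<open>Measure-preserving in the sense of push-forward, with no inverse. Composition of
  parameters asks for no more.\<close>

definition mp :: "(real \<Rightarrow> real) \<Rightarrow> bool" where
  "mp \<alpha> \<longleftrightarrow> \<alpha> \<in> measurable lebI lebI \<and> distr lebI lebI \<alpha> = lebI"

lemma mp_measurable: "mp \<alpha> \<Longrightarrow> \<alpha> \<in> measurable lebI lebI"
  by (simp add: mp_def)

lemma mp_range: "mp \<alpha> \<Longrightarrow> 0 \<le> s \<Longrightarrow> s < 1 \<Longrightarrow> 0 \<le> \<alpha> s \<and> \<alpha> s < 1"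
  using measurable_space[of \<alpha> lebI lebI s] by (auto simp: mp_def)

lemma mp_sets: "mp \<alpha> \<Longrightarrow> A \<in> sets lebI \<Longrightarrow> \<alpha> -` A \<inter> {0..<1} \<in> sets lebI"
  using measurable_sets[of \<alpha> lebI lebI A] by (simp add: mp_def)

lemma mp_measure: "mp \<alpha> \<Longrightarrow> A \<in> sets lebI \<Longrightarrow> measure lebI (\<alpha> -` A \<inter> {0..<1}) = measure lebI A"
  using measure_distr[of \<alpha> lebI lebI A] by (simp add: mp_def)

lemma mp_full: "mp \<alpha> \<Longrightarrow> full J \<Longrightarrow> full (\<alpha> -` J \<inter> {0..<1})"
  by (simp add: full_def mp_sets mp_measure)

lemma param_mp: "parameter S \<phi> \<Longrightarrow> mp \<alpha> \<Longrightarrow> parameter S (\<lambda>s. \<phi> (\<alpha> s))"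
  unfolding parameter_alt mp_def
proof (elim conjE, intro conjI)
  assume *: "\<phi> \<in> lebI \<rightarrow>\<^sub>M msr S" "distr lebI (msr S) \<phi> = msr S" "\<alpha> \<in> lebI \<rightarrow>\<^sub>M lebI"
    "distr lebI lebI \<alpha> = lebI"
  show "(\<lambda>s. \<phi> (\<alpha> s)) \<in> lebI \<rightarrow>\<^sub>M msr S"
    using measurable_compose[OF *(3,1)] by simp
  show "distr lebI (msr S) (\<lambda>s. \<phi> (\<alpha> s)) = msr S"
    using distr_distr[OF *(1,3)] * by (simp add: comp_def)
qed

lemma frac_measurable: "(frac :: real \<Rightarrow> real) \<in> measurable borel lebI"
proof -
  have "(\<lambda>x::real. x - real_of_int \<lfloor>x\<rfloor>) \<in> borel_measurable borel" by measurable
  then have "(frac :: real \<Rightarrow> real) \<in> borel_measurable borel" by (simp add: frac_def[abs_def])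
  then show ?thesis
    unfolding lebI_def by (intro measurable_restrict_space2) (auto simp: frac_lt_1)
qed

text \<open>Add the label to the parameter and pass to the quantile function of the sum.\<close>

lemma label_sort:
  fixes k :: "real \<Rightarrow> nat"
  assumes k[measurable]: "k \<in> measurable lebI (count_space UNIV)"
  obtains \<alpha> J where "mp \<alpha>" "full J"
    "\<forall>s\<in>J. \<forall>i. k (\<alpha> s) \<le> i \<longleftrightarrow> s \<le> measure lebI {t \<in> {0..<1}. k t \<le> i}"
proof -
  \<comment> \<open>The integer part stores the label and the fractional part stores the parameter.
    Hence \<open>frac\<close> maps the law of \<sigma> back to Lebesgue measure, while the order of
    the line sorts by label.\<close>
  define \<sigma> where "\<sigma> s = real (k s) + s" for s
  have id: "(\<lambda>s. s) \<in> borel_measurable lebI"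
    by (simp add: lebI_def measurable_restrict_space1)
  have \<sigma>[measurable]: "\<sigma> \<in> borel_measurable lebI"
    unfolding \<sigma>_def using measurable_compose[OF k, of real borel] id by (intro borel_measurable_add) auto
  let ?M = "distr lebI borel \<sigma>"
  have "real_distribution ?M" by (rule lebI.real_distribution_distr) simp
  then obtain q where q[measurable]: "q \<in> borel_measurable lebI" and qM: "distr lebI borel q = ?M"
    and qc: "\<forall>s x. 0 < s \<longrightarrow> s < 1 \<longrightarrow> (s \<le> cdf ?M x \<longleftrightarrow> q s \<le> x)"
    by (rule quantile_param)
  note frac_measurable[measurable]
  define \<alpha> where "\<alpha> s = frac (q s)" for s
  have fr: "frac (\<sigma> s) = s" if "s \<in> {0..<1}" for s
    using that by (simp add: \<sigma>_def frac_def floor_unique[of "int (k s)" "real (k s) + s"] floor_eq_iff)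
  have "mp \<alpha>"
    unfolding mp_def
  proof
    show am: "\<alpha> \<in> lebI \<rightarrow>\<^sub>M lebI" unfolding \<alpha>_def by measurable
    have "distr lebI lebI \<alpha> = distr (distr lebI borel q) lebI frac"
      by (subst distr_distr) (auto simp: \<alpha>_def[abs_def] comp_def)
    also have "\<dots> = distr lebI lebI (\<lambda>s. frac (\<sigma> s))"
      unfolding qM by (subst distr_distr) (auto simp: comp_def)
    also have "\<dots> = distr lebI lebI (\<lambda>s. s)"
      by (rule distr_cong) (auto simp: fr)
    finally show "distr lebI lebI \<alpha> = lebI" by (simp add: distr_id)
  qed
  \<comment> \<open>The integer part of almost every value of \<sigma> is the label of its
    fractional part. This is a property of the law, so it passes to the quantile function. Integers
    are excluded so that the comparison with \<open>real i + 1\<close> below is strict.\<close>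
  define E where "E = {y::real. 0 \<le> y \<and> 0 < frac y \<and> (\<exists>n. k (frac y) = n \<and> nat \<lfloor>y\<rfloor> = n)}"
  have E: "E \<in> sets borel"
  proof -
    have [measurable]: "(\<lambda>y. k (frac y)) \<in> borel \<rightarrow>\<^sub>M count_space UNIV"
      using measurable_compose[OF frac_measurable k] .
    have "(\<lambda>x::real. x - real_of_int \<lfloor>x\<rfloor>) \<in> borel_measurable borel" by measurable
    then have [measurable]: "(frac :: real \<Rightarrow> real) \<in> borel_measurable borel" by (simp add: frac_def[abs_def])
    have [measurable]: "(\<lambda>y::real. nat \<lfloor>y\<rfloor>) \<in> borel \<rightarrow>\<^sub>M count_space UNIV"
      using measurable_compose[OF measurable_real_floor, of nat "count_space UNIV"] by simp
    have "{y \<in> space borel. 0 \<le> y \<and> 0 < frac y \<and> (\<exists>n. k (frac y) = n \<and> nat \<lfloor>y\<rfloor> = n)} \<in> sets borel"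
      by measurable
    then show ?thesis by (simp add: E_def)
  qed
  have "AE s in lebI. \<sigma> s \<in> E"
  proof -
    have "AE s in lebI. s \<noteq> 0"
      unfolding lebI_def by (subst AE_restrict_space_iff) (use AE_lborel_singleton[of "0::real"] in auto)
    moreover have "AE s in lebI. s \<in> {0..<1}" by (rule AE_I2) simp
    ultimately show ?thesis
    proof eventually_elim
      case (elim s)
      then have "frac (\<sigma> s) = s" "\<lfloor>\<sigma> s\<rfloor> = int (k s)" "0 \<le> \<sigma> s"
        using fr by (auto simp: \<sigma>_def floor_eq_iff)
      moreover have "0 < frac (\<sigma> s)" unfolding \<open>frac (\<sigma> s) = s\<close> using elim by auto
      ultimately show ?case unfolding E_def by (simp del: frac_gt_0_iff)
    qed
  qed
  then have "AE y in ?M. y \<in> E"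
    using E by (subst AE_distr_iff) auto
  then have "AE s in lebI. q s \<in> E"
    unfolding qM[symmetric] using E by (subst (asm) AE_distr_iff) auto
  then obtain J where J: "full J" "\<forall>s\<in>J. q s \<in> E" using full_from_AE by blast
  have J0: "full (J \<inter> {0<..<1})"
  proof -
    have "AE s in lebI. s \<noteq> 0"
      unfolding lebI_def by (subst AE_restrict_space_iff) (use AE_lborel_singleton[of "0::real"] in auto)
    moreover have "AE s in lebI. s \<in> {0..<1}" by (rule AE_I2) simp
    moreover have "AE s in lebI. s \<in> J" using J by (simp add: full_AE)
    ultimately have "AE s in lebI. s \<in> J \<inter> {0<..<1}" by eventually_elim auto
    moreover have "J \<inter> {0<..<1} \<in> sets lebI"
      using full_sets[OF J(1)] by (auto simp: sets_lebI_iff)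
    ultimately show ?thesis by (simp add: full_AE)
  qed
  \<comment> \<open>The argument is \<open>i + 1\<close>: points with label at most \<open>i\<close>
    fill the range from 0 to \<open>i + 1\<close>.\<close>
  have cd: "cdf ?M (real i + 1) = measure lebI {t \<in> {0..<1}. k t \<le> i}" for i
  proof -
    have "cdf ?M (real i + 1) = measure lebI {t \<in> {0..<1}. \<sigma> t \<le> real i + 1}"
      by (simp add: cdf_def measure_distr) (auto intro!: arg_cong2[where f=measure])
    also have "\<dots> = measure lebI {t \<in> {0..<1}. k t \<le> i}"
    proof (rule measure_eq_AE)
      have "AE s in lebI. s \<noteq> 0"
        unfolding lebI_def by (subst AE_restrict_space_iff) (use AE_lborel_singleton[of "0::real"] in auto)
      then show "AE x in lebI. (x \<in> {t \<in> {0..<1}. \<sigma> t \<le> real i + 1}) = (x \<in> {t \<in> {0..<1}. k t \<le> i})"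
      proof eventually_elim
        case (elim x)
        have "\<sigma> x \<le> real i + 1 \<longleftrightarrow> k x \<le> i" if "0 \<le> x" "x < 1"
        proof
          assume "\<sigma> x \<le> real i + 1"
          then have "real (k x) < real i + 1" using elim that by (simp add: \<sigma>_def)
          then show "k x \<le> i" by linarith
        next
          assume "k x \<le> i"
          then have "real (k x) \<le> real i" by simp
          then show "\<sigma> x \<le> real i + 1" unfolding \<sigma>_def using that by linarith
        qed
        then show ?case by auto
      qed
      have "{t \<in> space lebI. \<sigma> t \<le> real i + 1} \<in> sets lebI" "{t \<in> space lebI. k t \<le> i} \<in> sets lebI"
        by measurable
      then show "{t \<in> {0..<1}. \<sigma> t \<le> real i + 1} \<in> sets lebI" "{t \<in> {0..<1}. k t \<le> i} \<in> sets lebI"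
        by simp_all
    qed
    finally show ?thesis .
  qed
  have "k (\<alpha> s) \<le> i \<longleftrightarrow> s \<le> measure lebI {t \<in> {0..<1}. k t \<le> i}" if s: "s \<in> J \<inter> {0<..<1}" for s i
  proof -
    have e: "0 \<le> q s" "frac (q s) \<noteq> 0" "k (frac (q s)) = nat \<lfloor>q s\<rfloor>"
      using J s by (auto simp: E_def)
    have "s \<le> measure lebI {t \<in> {0..<1}. k t \<le> i} \<longleftrightarrow> q s \<le> real i + 1"
      using qc[rule_format, of s "real i + 1"] s unfolding cd by simp
    also have "\<dots> \<longleftrightarrow> nat \<lfloor>q s\<rfloor> \<le> i"
    proof
      assume a: "q s \<le> real i + 1"
      moreover have "q s \<noteq> real i + 1"
      proof
        assume "q s = real i + 1"
        then have "q s = of_int (int i + 1)" by simp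
        then have "frac (q s) = 0" by (simp only: frac_of_int)
        then show False using e by simp
      qed
      ultimately have "q s < of_int (int i + 1)" by simp
      then have "\<lfloor>q s\<rfloor> < int i + 1" by (simp only: floor_less_iff)
      then show "nat \<lfloor>q s\<rfloor> \<le> i" by linarith
    next
      assume "nat \<lfloor>q s\<rfloor> \<le> i"
      then have "\<lfloor>q s\<rfloor> \<le> int i" by linarith
      then show "q s \<le> real i + 1" by linarith
    qed
    finally show ?thesis using e by (simp add: \<alpha>_def)
  qed
  then show ?thesis using that[OF \<open>mp \<alpha>\<close> J0] by blast
qed

section \<open>Coding a sequence of reals by one real\<close>

abbreviation PB :: "(nat \<Rightarrow> real) measure" where "PB \<equiv> PiM UNIV (\<lambda>_. borel)"

lemma space_PB [simp]: "space PB = UNIV"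
  by (simp add: space_PiM)

definition bit_test :: "nat \<Rightarrow> (nat \<Rightarrow> real) \<Rightarrow> bool" where
  "bit_test i v \<longleftrightarrow> v (fst (prod_decode i)) < real_of_rat (from_nat (snd (prod_decode i)))"

text \<open>The digit with index \<open>prod_encode (j,n)\<close> tells whether \<open>v j\<close>
  lies below the \<open>n\<close>-th rational. Base 4 with digits 0 and 1 only makes the digits
  recoverable by a floor, without carries.\<close>

definition code :: "(nat \<Rightarrow> real) \<Rightarrow> real" where
  "code v = (\<Sum>i. of_bool (bit_test i v) / 4 ^ Suc i)"

text \<open>The coordinate is the infimum of the rationals above it. The value \<infinity> removes
  the other rationals from the infimum, which is why extended reals appear.\<close>

definition decode :: "nat \<Rightarrow> real \<Rightarrow> real" where
  "decode j y = real_of_ereal (INF n. if \<lfloor>4 ^ Suc (prod_encode (j,n)) * y\<rfloor> mod 4 = 1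
     then ereal (real_of_rat (from_nat n)) else \<infinity>)"

text \<open>After multiplication by \<open>4 ^ Suc i\<close> the earlier digits contribute a
  multiple of 4, and the later ones, by the geometric series, at most 1/3.\<close>

lemma base4_digit:
  fixes b :: "nat \<Rightarrow> bool"
  shows "\<lfloor>4 ^ Suc i * (\<Sum>k. of_bool (b k) / 4 ^ Suc k :: real)\<rfloor> mod 4 = of_bool (b i)"
proof -
  define f :: "nat \<Rightarrow> real" where "f k = of_bool (b k) / 4 ^ Suc k" for k
  have geo: "(\<lambda>k. 1 / 4 ^ Suc (k + n) :: real) sums (1 / (3 * 4 ^ n))" for n
  proof -
    have "(\<lambda>k. (1/4 ^ Suc n) * (1/4)^k :: real) sums ((1/4 ^ Suc n) * (1 / (1 - 1/4)))"
      by (intro sums_mult geometric_sums) auto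
    then show ?thesis by (simp add: power_add power_divide field_simps)
  qed
  have f01: "0 \<le> f k" "f k \<le> 1 / 4 ^ Suc k" for k by (auto simp: f_def field_simps)
  have sf: "summable (\<lambda>k. f (k + n))" for n
    by (rule summable_comparison_test'[OF sums_summable[OF geo[of n]], of 0]) (use f01 in auto)
  have "suminf f = (\<Sum>k. f (k + Suc i)) + sum f {..<Suc i}"
    using suminf_split_initial_segment[OF sf[of 0, simplified], of "Suc i"] by simp
  moreover define T where "T = (\<Sum>k. f (k + Suc i))"
  ultimately have eq: "suminf f = T + (sum f {..<i} + f i)" by simp
  have T0: "0 \<le> T" unfolding T_def by (rule suminf_nonneg[OF sf]) (rule f01)
  have "T \<le> (\<Sum>k. 1 / 4 ^ Suc (k + Suc i))"
    unfolding T_def by (rule suminf_le[OF _ sf sums_summable[OF geo]]) (rule f01)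
  then have T1: "T \<le> 1 / (3 * 4 ^ Suc i)" using sums_unique[OF geo[of "Suc i"]] by (simp only:)
  define Z :: int where "Z = (\<Sum>k<i. of_bool (b k) * 4 ^ (i - Suc k))"
  have "4 ^ Suc i * sum f {..<i} = 4 * real_of_int Z"
  proof -
    have "4 ^ Suc i * f k = 4 * (of_bool (b k) * 4 ^ (i - Suc k))" if "k < i" for k
    proof -
      have "(4::real) ^ Suc i = 4 * (4 ^ (i - Suc k) * 4 ^ Suc k)"
      proof -
        have "Suc i = Suc (i - Suc k + Suc k)" using that by simp
        then show ?thesis by (simp only: power_add power_Suc)
      qed
      then show ?thesis by (simp add: f_def)
    qed
    then show ?thesis
      unfolding Z_def of_int_sum sum_distrib_left by (intro sum.cong refl) simp
  qed
  moreover have "4 ^ Suc i * f i = of_bool (b i)" by (simp add: f_def)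
  ultimately have "4 ^ Suc i * suminf f = 4 ^ Suc i * T + real_of_int (4 * Z + of_bool (b i))"
    unfolding eq by (simp add: distrib_left)
  moreover have "0 \<le> 4 ^ Suc i * T" "4 ^ Suc i * T < 1" 
    using T0 T1 by (auto simp: field_simps)
  ultimately have "\<lfloor>4 ^ Suc i * suminf f\<rfloor> = 4 * Z + of_bool (b i)"
    by (intro floor_unique) (auto simp del: of_int_add)
  then have "\<lfloor>4 ^ Suc i * suminf f\<rfloor> mod 4 = of_bool (b i)"
    by (cases "b i") (auto simp: mod_add_eq[symmetric])
  then show ?thesis by (simp only: f_def[abs_def])
qed

lemma decode_code: "decode j (code v) = v j"
proof -
  have b: "\<lfloor>4 ^ Suc (prod_encode (j,n)) * code v\<rfloor> mod 4 = 1 \<longleftrightarrow> v j < real_of_rat (from_nat n)" for n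
    unfolding code_def base4_digit by (auto simp: bit_test_def)
  have "(INF n. if v j < real_of_rat (from_nat n) then ereal (real_of_rat (from_nat n)) else \<infinity>) = ereal (v j)"
    (is "?I = _")
  proof (rule antisym)
    show "ereal (v j) \<le> ?I" by (rule INF_greatest) auto
    show "?I \<le> ereal (v j)"
    proof (rule ereal_le_epsilon2)
      fix e :: real assume "0 < e"
      then obtain r where r: "v j < real_of_rat r" "real_of_rat r < v j + e" 
        using of_rat_dense[of "v j" "v j + e"] by auto
      obtain n where n: "from_nat n = r" by (metis from_nat_to_nat)
      show "?I \<le> ereal (v j) + ereal e" by (rule INF_lower2[of n]) (use r n in auto)
    qed
  qed
  then show ?thesis unfolding decode_def b by simp
qed

lemma code_measurable [measurable]: "code \<in> borel_measurable PB"
  unfolding code_def bit_test_def by measurable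

lemma decode_measurable [measurable]: "decode j \<in> borel_measurable borel"
  unfolding decode_def by measurable

text \<open>The law is pushed to the line by \<open>code\<close>, represented there by its quantile
  function, and decoded again.\<close>

lemma sequence_param:
  assumes "prob_space Q" and sQ: "sets Q = sets PB"
  obtains u where "\<forall>j. u j \<in> borel_measurable lebI" "distr lebI PB (\<lambda>s j. u j s) = Q"
proof -
  interpret Q: prob_space Q by fact
  have cm: "code \<in> borel_measurable Q"
    using code_measurable sQ measurable_cong_sets by blast
  have "real_distribution (distr Q borel code)" using cm by (rule Q.real_distribution_distr)
  then obtain q where q[measurable]: "q \<in> borel_measurable lebI" and qM: "distr lebI borel q = distr Q borel code"
    by (rule quantile_param)
  have dm: "(\<lambda>y j. decode j y) \<in> measurable borel PB"
    by (intro measurable_PiM_single') auto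
  have "distr lebI PB (\<lambda>s j. decode j (q s)) = distr (distr lebI borel q) PB (\<lambda>y j. decode j y)"
    using dm by (subst distr_distr) (auto simp: comp_def)
  also have "\<dots> = distr Q PB (\<lambda>v. v)"
    unfolding qM using dm cm by (subst distr_distr) (auto simp: comp_def decode_code)
  also have "\<dots> = Q" using sQ by (simp add: distr_id2)
  finally show ?thesis using that[of "\<lambda>j s. decode j (q s)"] by auto
qed


text \<open>A countable family whose differences have the distance as their supremum, hence an
  isometric embedding into sequences with the sup norm. The bounds \<open>M j\<close> keep each
  coordinate in a compact interval, as the later compactness argument demands.\<close>

definition norming :: "'a mm \<Rightarrow> (nat \<Rightarrow> 'a \<Rightarrow> real) \<Rightarrow> (nat \<Rightarrow> real) \<Rightarrow> bool" where
  "norming S h M \<longleftrightarrow> (\<forall>j. \<forall>x\<in>car S. 0 \<le> h j x \<and> h j x \<le> M j) \<and>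
     (\<forall>j. \<forall>x\<in>car S. \<forall>y\<in>car S. \<bar>h j x - h j y\<bar> \<le> dst S x y) \<and>
     (\<forall>x\<in>car S. \<forall>y\<in>car S. \<forall>e>0. \<exists>j. dst S x y \<le> \<bar>h j x - h j y\<bar> + e)"

section \<open>Norming families, and parameters obtained from laws\<close>

context mm
begin

text \<open>The functions are distances to dense points, truncated at natural numbers. For given
  \<open>y\<close> and \<open>z\<close> one takes a dense point near \<open>y\<close> and a
  truncation level beyond its distance to \<open>z\<close>.\<close>

lemma norming_exists: "\<exists>h M. norming S h M"
proof -
  obtain x :: "nat \<Rightarrow> 'a" where x: "\<forall>k. x k \<in> car S" "\<forall>y\<in>car S. \<forall>e>0. \<exists>k. dst S (x k) y < e"
    using dense_seq by blast
  define h where "h j y = min (real (snd (prod_decode j))) (dst S (x (fst (prod_decode j))) y)" for j y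
  have "\<exists>j. dst S y z \<le> \<bar>h j y - h j z\<bar> + e" if y: "y \<in> car S" and z: "z \<in> car S" and e: "e > 0" for y z e
  proof -
    obtain k where k: "dst S (x k) y < e / 2" using x(2)[rule_format, OF y, of "e/2"] e by auto
    obtain m where m: "dst S (x k) z \<le> real m" using real_arch_simple by blast
    have h: "h (prod_encode (k,m)) z = dst S (x k) z" "h (prod_encode (k,m)) y \<le> dst S (x k) y"
      using m by (auto simp: h_def)
    have "dst S y z \<le> dst S (x k) y + dst S (x k) z"
      by (rule triangle'') (use x y z in auto)
    then have "dst S y z \<le> \<bar>h (prod_encode (k,m)) y - h (prod_encode (k,m)) z\<bar> + e"
      using k h by linarith
    then show ?thesis by blast
  qed
  moreover have "\<bar>h j y - h j z\<bar> \<le> dst S y z" if y: "y \<in> car S" and z: "z \<in> car S" for j y z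
    using mdist_reverse_triangle[of y "x (fst (prod_decode j))" z] x(1) y z
    by (simp add: h_def commute min_def abs_le_iff; smt (verit) commute)
  ultimately have "norming S h (\<lambda>j. real (snd (prod_decode j)))"
    by (auto simp: norming_def h_def)
  then show ?thesis by blast
qed

lemma norming_measurable:
  assumes "norming S h M"
  shows "h j \<in> borel_measurable (msr S)" "(\<lambda>x j. h j x) \<in> measurable (msr S) PB"
proof -
  have *: "h j \<in> borel_measurable (msr S)" for j
    by (rule lip1_measurable) (use assms in \<open>auto simp: norming_def\<close>)
  show "h j \<in> borel_measurable (msr S)" by (rule *)
  show "(\<lambda>x j. h j x) \<in> measurable (msr S) PB"
    by (rule measurable_PiM_single') (use * in auto)
qed

lemma norming_approx:
  "norming S h M \<Longrightarrow> x \<in> car S \<Longrightarrow> y \<in> car S \<Longrightarrow> e > 0 \<Longrightarrow> \<exists>j. dst S x y \<le> \<bar>h j x - h j y\<bar> + e"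
  by (simp add: norming_def)

text \<open>Distances are determined by the family, so each ball, and with it each measurable set,
  is the preimage of a measurable set of sequences.\<close>

lemma norming_sets:
  assumes h: "norming S h M" and A: "A \<in> sets (msr S)"
  obtains A' where "A' \<in> sets PB" "\<forall>x\<in>car S. x \<in> A \<longleftrightarrow> (\<lambda>j. h j x) \<in> A'"
proof -
  let ?H = "\<lambda>x j. h j x"
  let ?N = "vimage_algebra (car S) ?H PB"
  have "(\<lambda>x. x) \<in> measurable ?N (msr S)"
  proof (rule measurableI_ball)
    fix y r assume y: "y \<in> car S"
    \<comment> \<open>The strict inequality is kept by a margin \<open>1 / Suc m\<close>:
      differences that are all below \<open>r\<close> could still have supremum
      \<open>r\<close>.\<close>
    define V where "V = {v \<in> space PB. \<exists>m. \<forall>j. \<bar>h j y - v j\<bar> \<le> r - 1 / Suc m}"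
    have "V \<in> sets PB" unfolding V_def by measurable
    moreover have "{s \<in> space ?N. dst S y s < r} = ?H -` V \<inter> car S"
    proof (intro equalityI subsetI)
      fix x assume "x \<in> {s \<in> space ?N. dst S y s < r}"
      then have x: "x \<in> car S" "dst S y x < r" by auto
      then obtain m where m: "1 / Suc m < r - dst S y x"
        using nat_approx_posE[of "r - dst S y x"] by auto
      have "\<bar>h j y - h j x\<bar> \<le> r - 1 / Suc m" for j
      proof -
        have "\<bar>h j y - h j x\<bar> \<le> dst S y x" using h x y by (simp add: norming_def)
        then show ?thesis using m by linarith
      qed
      then show "x \<in> ?H -` V \<inter> car S" using x by (auto simp: V_def)
    next
      fix x assume x: "x \<in> ?H -` V \<inter> car S"
      then obtain m where m: "\<And>j. \<bar>h j y - h j x\<bar> \<le> r - 1 / Suc m" by (auto simp: V_def)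
      define a where "a = 1 / real (Suc m)"
      have a: "a > 0" by (simp add: a_def)
      obtain j where "dst S y x \<le> \<bar>h j y - h j x\<bar> + a / 2"
        using norming_approx[OF h y, of x "a / 2"] x a by auto
      then have "dst S y x \<le> r - a + a / 2" using m[of j] unfolding a_def by linarith
      also have "\<dots> < r" using a by simp
      finally show "x \<in> {s \<in> space ?N. dst S y s < r}" using x by simp
    qed
    ultimately show "{s \<in> space ?N. dst S y s < r} \<in> sets ?N"
      using in_vimage_algebra[of V PB ?H "car S"] by simp
  qed simp
  then have "(\<lambda>x. x) -` A \<inter> space ?N \<in> sets ?N" by (rule measurable_sets[OF _ A])
  then have "A \<inter> car S \<in> sets ?N" by simp
  then obtain A' where A': "A' \<in> sets PB" "A \<inter> car S = ?H -` A' \<inter> car S"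
    using sets_vimage_algebra2[of ?H "car S" PB] by auto
  show ?thesis by (rule that[OF A'(1)]) (use A'(2) in blast)
qed

text \<open>Equality of laws alone produces a parameter: almost every sequence \<open>u\<close> lies
  in the uniform closure of the embedded dense points, and completeness decodes it to a point of the
  space.\<close>

lemma param_of_law:
  assumes h: "norming S h M" and um: "\<forall>j. u j \<in> borel_measurable lebI"
    and law: "distr lebI PB (\<lambda>s j. u j s) = distr (msr S) PB (\<lambda>x j. h j x)"
  obtains \<psi> J where "parameter S \<psi>" "full J" "\<forall>s\<in>J. \<forall>j. h j (\<psi> s) = u j s"
proof -
  obtain x :: "nat \<Rightarrow> 'a" where x: "\<forall>k. x k \<in> car S" "\<forall>y\<in>car S. \<forall>e>0. \<exists>k. dst S (x k) y < e"
    using dense_seq by blast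
  let ?H = "\<lambda>x j. h j x" and ?U = "\<lambda>s j. u j s"
  have H: "?H \<in> measurable (msr S) PB" by (rule norming_measurable(2)[OF h])
  have U: "?U \<in> measurable lebI PB" by (rule measurable_PiM_single') (use um in auto)
  have transfer: "measure lebI (?U -` A \<inter> {0..<1}) = prob (?H -` A \<inter> car S)" if "A \<in> sets PB" for A
    using measure_distr[OF U that] measure_distr[OF H that] law by simp
  \<comment> \<open>Sequences uniformly approximable by the embedded points \<open>x k\<close>.
    Countable quantifiers make this measurable, and every embedded point belongs to it.\<close>
  define B where "B = {v \<in> space PB. \<forall>m. \<exists>k. \<forall>j. \<bar>v j - h j (x k)\<bar> \<le> 1 / Suc m}"
  have B: "B \<in> sets PB" unfolding B_def by measurable
  have "?H -` B \<inter> car S = car S"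
  proof -
    have "\<exists>k. \<forall>j. \<bar>h j y - h j (x k)\<bar> \<le> 1 / Suc m" if y: "y \<in> car S" for y m
    proof -
      obtain k where k: "dst S (x k) y < 1 / Suc m" using x(2)[rule_format, OF y, of "1 / Suc m"] by auto
      have "\<bar>h j y - h j (x k)\<bar> \<le> 1 / Suc m" for j
      proof -
        have "\<bar>h j (x k) - h j y\<bar> \<le> dst S (x k) y" using h x y by (simp add: norming_def)
        then show ?thesis using k by linarith
      qed
      then show ?thesis by blast
    qed
    then show ?thesis by (auto simp: B_def)
  qed
  then have "measure lebI (?U -` B \<inter> {0..<1}) = 1"
    using transfer[OF B] prob_space by simp
  define J where "J = ?U -` B \<inter> {0..<1}"
  have J: "full J"
    using measurable_sets[OF U B] \<open>measure lebI (?U -` B \<inter> {0..<1}) = 1\<close> by (simp add: full_def J_def)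
  have dec: "\<exists>y\<in>car S. \<forall>j. h j y = v j" if v: "v \<in> B" for v
  proof -
    have "\<forall>m. \<exists>k. \<forall>j. \<bar>v j - h j (x k)\<bar> \<le> 1 / Suc m" using v by (simp add: B_def)
    then obtain k where k: "\<And>m j. \<bar>v j - h j (x (k m))\<bar> \<le> 1 / Suc m" by metis
    have d: "dst S (x (k m)) (x (k n)) \<le> 1 / Suc m + 1 / Suc n" for m n
    proof (rule field_le_epsilon)
      fix e :: real assume "e > 0"
      then obtain j where "dst S (x (k m)) (x (k n)) \<le> \<bar>h j (x (k m)) - h j (x (k n))\<bar> + e"
        using norming_approx[OF h] x(1) by blast
      then show "dst S (x (k m)) (x (k n)) \<le> 1 / Suc m + 1 / Suc n + e"
        using k[of j m] k[of j n] by linarith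
    qed
    have "MCauchy (\<lambda>m. x (k m))"
      unfolding MCauchy_def
    proof (intro conjI allI impI)
      show "range (\<lambda>m. x (k m)) \<subseteq> car S" using x by auto
      fix e :: real assume "e > 0"
      then obtain N where N: "1 / Suc N < e / 2" by (metis half_gt_zero nat_approx_posE)
      have "dst S (x (k n)) (x (k n')) < e" if "N \<le> n" "N \<le> n'" for n n'
      proof -
        have "1 / real (Suc n) \<le> 1 / Suc N" "1 / real (Suc n') \<le> 1 / Suc N"
          using that by (auto intro!: divide_left_mono)
        then show ?thesis using d[of n n'] N by linarith
      qed
      then show "\<exists>N. \<forall>n n'. N \<le> n \<longrightarrow> N \<le> n' \<longrightarrow> dst S (x (k n)) (x (k n')) < e" by blast
    qed
    then obtain y where "limitin mtopology (\<lambda>m. x (k m)) y sequentially"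
      using complete mcomplete_def by blast
    then have y: "y \<in> car S" "\<And>e. e > 0 \<Longrightarrow> \<exists>N. \<forall>n\<ge>N. dst S (x (k n)) y < e"
      unfolding limit_metric_sequentially by blast+
    have "h j y = v j" for j
    proof -
      have "\<bar>h j y - v j\<bar> \<le> 0"
      proof (rule field_le_epsilon)
        fix e :: real assume e: "e > 0"
        obtain N where N: "\<forall>n\<ge>N. dst S (x (k n)) y < e / 2" using y(2)[of "e/2"] e by auto
        obtain M' where M': "1 / Suc M' < e / 2" using e by (metis half_gt_zero nat_approx_posE)
        define n where "n = max N M'"
        have "1 / real (Suc n) \<le> 1 / Suc M'" by (intro divide_left_mono) (auto simp: n_def)
        moreover have "dst S (x (k n)) y < e / 2" using N by (simp add: n_def)
        moreover have "\<bar>h j (x (k n)) - h j y\<bar> \<le> dst S (x (k n)) y"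
          using h x y by (simp add: norming_def)
        ultimately show "\<bar>h j y - v j\<bar> \<le> 0 + e" using k[of j n] M' by linarith
      qed
      then show ?thesis by simp
    qed
    with y(1) show ?thesis by blast
  qed
  then obtain r where r: "\<And>v. v \<in> B \<Longrightarrow> r v \<in> car S" "\<And>v j. v \<in> B \<Longrightarrow> h j (r v) = v j" by metis
  obtain c where c: "c \<in> car S" using car_nonempty by auto
  define \<psi> where "\<psi> s = (if s \<in> J then r (?U s) else c)" for s
  have JB: "?U s \<in> B" if "s \<in> J" for s using that by (simp add: J_def)
  have "parameter S \<psi>"
  proof (rule paramI_full[OF J, of \<psi> c])
    fix A assume A: "A \<in> sets (msr S)"
    obtain A' where A': "A' \<in> sets PB" "\<forall>x\<in>car S. x \<in> A \<longleftrightarrow> ?H x \<in> A'"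
      using norming_sets[OF h A] by blast
    have eq: "\<psi> -` A \<inter> J = ?U -` A' \<inter> {0..<1} \<inter> J"
    proof -
      have "\<psi> s \<in> A \<longleftrightarrow> ?U s \<in> A'" if s: "s \<in> J" for s
      proof -
        have "?H (r (?U s)) = ?U s" using r(2)[OF JB[OF s]] by auto
        then show ?thesis using A'(2) r(1)[OF JB[OF s]] s by (simp add: \<psi>_def)
      qed
      then show ?thesis by (auto simp: J_def)
    qed
    have s: "?U -` A' \<inter> {0..<1} \<in> sets lebI" using measurable_sets[OF U A'(1)] by simp
    then show "\<psi> -` A \<inter> J \<in> sets lebI" unfolding eq using full_sets[OF J] by blast
    have "?H -` A' \<inter> car S = A" using A'(2) sets.sets_into_space[OF A] by auto
    then show "measure lebI (\<psi> -` A \<inter> J) = prob A"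
      unfolding eq measure_full_Int[OF J s] transfer[OF A'(1)] by simp
  qed (use r(1) JB c in \<open>auto simp: \<psi>_def\<close>)
  moreover have "\<forall>s\<in>J. \<forall>j. h j (\<psi> s) = u j s"
    using r(2)[OF JB] by (auto simp: \<psi>_def)
  ultimately show ?thesis using that J by blast
qed

lemma param_exists: "\<exists>\<phi>. parameter S \<phi>"
proof -
  obtain h M where h: "norming S h M" using norming_exists by blast
  have H: "(\<lambda>x j. h j x) \<in> measurable (msr S) PB" by (rule norming_measurable(2)[OF h])
  obtain u where "\<forall>j. u j \<in> borel_measurable lebI" 
    "distr lebI PB (\<lambda>s j. u j s) = distr (msr S) PB (\<lambda>x j. h j x)"
    using sequence_param[OF prob_space_distr[OF H]] by auto
  then show ?thesis using param_of_law[OF h] by blast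
qed

lemma inj_real: "\<exists>j::'a \<Rightarrow> real. inj_on j (car S)"
proof -
  obtain h M where h: "norming S h M" using norming_exists by blast
  have "inj_on (\<lambda>x. code (\<lambda>j. h j x)) (car S)"
  proof (rule inj_onI)
    fix x y assume xy: "x \<in> car S" "y \<in> car S" "code (\<lambda>j. h j x) = code (\<lambda>j. h j y)"
    then have e: "h j x = h j y" for j using decode_code by metis
    have "dst S x y \<le> 0"
    proof (rule field_le_epsilon)
      fix e :: real assume "e > 0"
      then show "dst S x y \<le> 0 + e" using norming_approx[OF h xy(1,2), of e] e by auto
    qed
    then show "x = y" using nonneg[of x y] zero xy by force
  qed
  then show ?thesis by blast
qed

text \<open>Each point is labelled by the least index of a dense point within \<eta>/2. The
  distribution of the label depends on the measure of the space only, so sorting both parameters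
  produces the same label almost everywhere, and equal labels mean distance below \<eta>.\<close>

lemma glue:
  assumes \<psi>: "parameter S \<psi>" and \<psi>': "parameter S \<psi>'" and "\<eta> > 0"
  obtains \<alpha> \<beta> J where "mp \<alpha>" "mp \<beta>" "full J" "\<forall>s\<in>J. dst S (\<psi> (\<alpha> s)) (\<psi>' (\<beta> s)) < \<eta>"
proof -
  obtain x :: "nat \<Rightarrow> 'a" where x: "\<forall>k. x k \<in> car S" "\<forall>y\<in>car S. \<forall>e>0. \<exists>k. dst S (x k) y < e"
    using dense_seq by blast
  define c where "c y = (LEAST k. dst S (x k) y < \<eta> / 2)" for y
  have cd: "dst S (x (c y)) y < \<eta> / 2" if "y \<in> car S" for y
    unfolding c_def by (rule LeastI_ex) (use x(2)[rule_format, OF that, of "\<eta> / 2"] \<open>\<eta> > 0\<close> in auto)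
  have cm: "c \<in> measurable (msr S) (count_space UNIV)"
    unfolding c_def
  proof (rule measurable_Least)
    fix i
    have "{y \<in> space (msr S). dst S (x i) y < \<eta> / 2} = mball (x i) (\<eta> / 2)" using x by auto
    then show "(\<lambda>y. dst S (x i) y < \<eta> / 2) \<in> measurable (msr S) (count_space UNIV)"
      by (simp add: pred_def)
  qed
  have F: "measure lebI {t \<in> {0..<1}. c (\<theta> t) \<le> i} = prob (c -` {..i} \<inter> car S)"
    if "parameter S \<theta>" for \<theta> i
  proof -
    have "c -` {..i} \<inter> car S \<in> sets (msr S)" using measurable_sets[OF cm, of "{..i}"] by simp
    moreover have "{t \<in> {0..<1}. c (\<theta> t) \<le> i} = \<theta> -` (c -` {..i} \<inter> car S) \<inter> {0..<1}"
      using param_car[OF that] by auto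
    ultimately show ?thesis using param_measure[OF that] by metis
  qed
  have km: "(\<lambda>s. c (\<theta> s)) \<in> measurable lebI (count_space UNIV)" if "parameter S \<theta>" for \<theta>
    by (rule measurable_compose[OF _ cm]) (use that in \<open>simp add: parameter_alt\<close>)
  obtain \<alpha> J1 where a: "mp \<alpha>" "full J1"
    "\<forall>s\<in>J1. \<forall>i. c (\<psi> (\<alpha> s)) \<le> i \<longleftrightarrow> s \<le> measure lebI {t \<in> {0..<1}. c (\<psi> t) \<le> i}"
    by (rule label_sort[OF km[OF \<psi>]])
  obtain \<beta> J2 where b: "mp \<beta>" "full J2"
    "\<forall>s\<in>J2. \<forall>i. c (\<psi>' (\<beta> s)) \<le> i \<longleftrightarrow> s \<le> measure lebI {t \<in> {0..<1}. c (\<psi>' t) \<le> i}"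
    by (rule label_sort[OF km[OF \<psi>']])
  have "dst S (\<psi> (\<alpha> s)) (\<psi>' (\<beta> s)) < \<eta>" if s: "s \<in> J1 \<inter> J2" for s
  proof -
    have "c (\<psi> (\<alpha> s)) \<le> i \<longleftrightarrow> c (\<psi>' (\<beta> s)) \<le> i" for i
      using a(3)[rule_format, of s i] b(3)[rule_format, of s i] s unfolding F[OF \<psi>] F[OF \<psi>'] by blast
    then have eq: "c (\<psi> (\<alpha> s)) = c (\<psi>' (\<beta> s))" by (meson order_antisym order_refl)
    have s1: "0 \<le> s" "s < 1" using full_subset[OF a(2)] s by auto
    have i: "\<psi> (\<alpha> s) \<in> car S" "\<psi>' (\<beta> s) \<in> car S"
      using param_car[OF \<psi>] param_car[OF \<psi>'] mp_range[OF a(1) s1] mp_range[OF b(1) s1] by auto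
    have "dst S (\<psi> (\<alpha> s)) (\<psi>' (\<beta> s)) \<le> dst S (x (c (\<psi> (\<alpha> s)))) (\<psi> (\<alpha> s)) + dst S (x (c (\<psi> (\<alpha> s)))) (\<psi>' (\<beta> s))"
      by (rule triangle'') (use i x in auto)
    then show ?thesis using cd[OF i(1)] cd[OF i(2)] eq by simp
  qed
  then show ?thesis using that[OF a(1) b(1) full_Int[OF a(2) b(2)]] by blast
qed

end

section \<open>Pseudo-metrics on the unit interval\<close>

text \<open>Separability is stated through countably many cells of small diameter rather than a
  dense sequence: such labellings pass to smaller pseudo-metrics unchanged and to sums by pairing.
  Measurability is required of sections only.\<close>

definition pm :: "(real \<Rightarrow> real \<Rightarrow> real) \<Rightarrow> bool" where
  "pm D \<longleftrightarrow> (\<forall>s\<in>{0..<1}. \<forall>t\<in>{0..<1}. D s t = D t s) \<and> (\<forall>s\<in>{0..<1}. D s s = 0) \<and>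
    (\<forall>r\<in>{0..<1}. \<forall>s\<in>{0..<1}. \<forall>t\<in>{0..<1}. D r t \<le> D r s + D s t) \<and>
    (\<forall>s\<in>{0..<1}. D s \<in> borel_measurable lebI) \<and>
    (\<forall>e>0. \<exists>c::real \<Rightarrow> nat. \<forall>s\<in>{0..<1}. \<forall>t\<in>{0..<1}. c s = c t \<longrightarrow> D s t < e)"

lemma pmD:
  assumes "pm D"
  shows "s \<in> {0..<1} \<Longrightarrow> t \<in> {0..<1} \<Longrightarrow> D s t = D t s"
    "s \<in> {0..<1} \<Longrightarrow> D s s = 0"
    "r \<in> {0..<1} \<Longrightarrow> s \<in> {0..<1} \<Longrightarrow> t \<in> {0..<1} \<Longrightarrow> D r t \<le> D r s + D s t"
    "s \<in> {0..<1} \<Longrightarrow> D s \<in> borel_measurable lebI"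
    "e > 0 \<Longrightarrow> \<exists>c::real \<Rightarrow> nat. \<forall>s\<in>{0..<1}. \<forall>t\<in>{0..<1}. c s = c t \<longrightarrow> D s t < e"
  using assms unfolding pm_def by blast+

lemma pm_nonneg: 
  assumes "pm D" "s \<in> {0..<1}" "t \<in> {0..<1}" shows "0 \<le> D s t"
  using pmD(3)[OF assms(1), of s t s] pmD(1,2)[OF assms(1), of s] assms(2,3) 
    pmD(1)[OF assms(1,2,3)] by linarith

lemma pm_reverse:
  assumes "pm D" "r \<in> {0..<1}" "s \<in> {0..<1}" "t \<in> {0..<1}" shows "\<bar>D r s - D r t\<bar> \<le> D s t"
proof -
  have "D r s \<le> D r t + D t s" "D r t \<le> D r s + D s t" "D s t = D t s"
    using assms by (auto intro: pmD)
  then show ?thesis by linarith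
qed

text \<open>One point is picked in each nonempty cell at each scale; scale and label are coded
  together as one index, and empty cells receive the point 0.\<close>

lemma pm_dense:
  assumes D: "pm D"
  obtains a :: "nat \<Rightarrow> real" where "\<forall>i. a i \<in> {0..<1}" "\<forall>s\<in>{0..<1}. \<forall>e>0. \<exists>i. D (a i) s < e"
proof -
  have "\<forall>n. \<exists>c::real \<Rightarrow> nat. \<forall>s\<in>{0..<1}. \<forall>t\<in>{0..<1}. c s = c t \<longrightarrow> D s t < 1 / Suc n"
    using pmD(5)[OF D] by simp
  then obtain c :: "nat \<Rightarrow> real \<Rightarrow> nat" 
    where c: "\<And>n s t. s \<in> {0..<1} \<Longrightarrow> t \<in> {0..<1} \<Longrightarrow> c n s = c n t \<Longrightarrow> D s t < 1 / Suc n"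
    by metis
  define P where "P i s \<longleftrightarrow> s \<in> {0..<1} \<and> c (fst (prod_decode i)) s = snd (prod_decode i)" for i s
  define a where "a i = (if \<exists>s. P i s then SOME s. P i s else 0)" for i
  have a: "P i (a i)" if "P i s" for i s
    using that unfolding a_def by (auto intro: someI)
  have "a i \<in> {0..<1}" for i
  proof (cases "\<exists>s. P i s")
    case True then show ?thesis using a by (auto simp: P_def)
  qed (simp add: a_def)
  moreover have "\<exists>i. D (a i) s < e" if s: "s \<in> {0..<1}" and e: "e > 0" for s e
  proof -
    obtain n where n: "1 / Suc n < e" using e by (metis nat_approx_posE)
    define i where "i = prod_encode (n, c n s)"
    have "P i s" using s by (simp add: P_def i_def)
    then have "P i (a i)" by (rule a)
    then have "D (a i) s < 1 / Suc n" using c[of "a i" s n] s by (simp add: P_def i_def)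
    then have "D (a i) s < e" using n by linarith
    then show ?thesis by blast
  qed
  ultimately show ?thesis using that by blast
qed

lemma pm_pullback:
  assumes S: "mm_space S" and \<phi>: "parameter S \<phi>"
  shows "pm (\<lambda>s t. dst S (\<phi> s) (\<phi> t))"
proof -
  interpret mm S by unfold_locales fact
  have c: "\<phi> s \<in> car S" if "s \<in> {0..<1}" for s using param_car[OF \<phi>] that by auto
  obtain x :: "nat \<Rightarrow> 'a" where x: "\<forall>k. x k \<in> car S" "\<forall>y\<in>car S. \<forall>e>0. \<exists>k. dst S (x k) y < e"
    using dense_seq by blast
  have "\<exists>l::real \<Rightarrow> nat. \<forall>s\<in>{0..<1}. \<forall>t\<in>{0..<1}. l s = l t \<longrightarrow> dst S (\<phi> s) (\<phi> t) < e" if e: "e > 0" for e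
  proof -
    have "\<forall>s\<in>{0..<1}. \<exists>k. dst S (x k) (\<phi> s) < e / 2"
      using x(2)[rule_format, OF c half_gt_zero[OF e]] by blast
    then obtain l where l: "\<forall>s\<in>{0..<1}. dst S (x (l s)) (\<phi> s) < e / 2" by metis
    have "dst S (\<phi> s) (\<phi> t) < e" if s: "s \<in> {0..<1}" "t \<in> {0..<1}" "l s = l t" for s t
    proof -
      have "dst S (\<phi> s) (\<phi> t) \<le> dst S (x (l s)) (\<phi> s) + dst S (x (l s)) (\<phi> t)"
        by (rule triangle'') (use c x s in auto)
      moreover have "dst S (x (l s)) (\<phi> s) < e / 2" using l s(1) by blast
      moreover have "dst S (x (l s)) (\<phi> t) < e / 2" using l s(2,3) by force
      ultimately show ?thesis by linarith
    qed
    then show ?thesis by blast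
  qed
  moreover have "(\<lambda>t. dst S (\<phi> s) (\<phi> t)) \<in> borel_measurable lebI" if "s \<in> {0..<1}" for s
    using measurable_compose[OF _ dist_measurable[OF c[OF that]], of \<phi> lebI] \<phi> 
    by (simp add: parameter_alt)
  moreover have "\<forall>r\<in>{0..<1}. \<forall>s\<in>{0..<1}. \<forall>t\<in>{0..<1}. dst S (\<phi> r) (\<phi> t) \<le> dst S (\<phi> r) (\<phi> s) + dst S (\<phi> s) (\<phi> t)"
    using triangle c by blast
  ultimately show ?thesis unfolding pm_def using c by (simp add: commute)
qed

lemma pm_mp:
  assumes D: "pm D" and \<alpha>: "mp \<alpha>"
  shows "pm (\<lambda>s t. D (\<alpha> s) (\<alpha> t))"
proof -
  have r: "\<alpha> s \<in> {0..<1}" if "s \<in> {0..<1}" for s using mp_range[OF \<alpha>] that by auto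
  have "\<exists>c::real \<Rightarrow> nat. \<forall>s\<in>{0..<1}. \<forall>t\<in>{0..<1}. c s = c t \<longrightarrow> D (\<alpha> s) (\<alpha> t) < e" if e: "e > 0" for e
  proof -
    obtain c :: "real \<Rightarrow> nat" where "\<forall>s\<in>{0..<1}. \<forall>t\<in>{0..<1}. c s = c t \<longrightarrow> D s t < e"
      using pmD(5)[OF D e] by blast
    then show ?thesis using r by (intro exI[of _ "\<lambda>s. c (\<alpha> s)"]) blast
  qed
  moreover have "(\<lambda>t. D (\<alpha> s) (\<alpha> t)) \<in> borel_measurable lebI" if "s \<in> {0..<1}" for s
    using measurable_compose[OF mp_measurable[OF \<alpha>] pmD(4)[OF D r[OF that]]] .
  moreover have "\<forall>q\<in>{0..<1}. \<forall>s\<in>{0..<1}. \<forall>t\<in>{0..<1}. D (\<alpha> q) (\<alpha> t) \<le> D (\<alpha> q) (\<alpha> s) + D (\<alpha> s) (\<alpha> t)"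
    using pmD(3)[OF D] r by blast
  moreover have "\<forall>s\<in>{0..<1}. \<forall>t\<in>{0..<1}. D (\<alpha> s) (\<alpha> t) = D (\<alpha> t) (\<alpha> s)"
    using pmD(1)[OF D] r by blast
  moreover have "\<forall>s\<in>{0..<1}. D (\<alpha> s) (\<alpha> s) = 0" using pmD(2)[OF D] r by blast
  ultimately show ?thesis unfolding pm_def by blast
qed

lemma pm_dominated:
  assumes D: "pm D" and "\<forall>s\<in>{0..<1}. \<forall>t\<in>{0..<1}. E s t \<le> D s t"
    and "\<forall>s\<in>{0..<1}. \<forall>t\<in>{0..<1}. E s t = E t s" "\<forall>s\<in>{0..<1}. E s s = 0"
    "\<forall>r\<in>{0..<1}. \<forall>s\<in>{0..<1}. \<forall>t\<in>{0..<1}. E r t \<le> E r s + E s t"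
    "\<forall>s\<in>{0..<1}. E s \<in> borel_measurable lebI"
  shows "pm E"
proof -
  have "\<exists>c::real \<Rightarrow> nat. \<forall>s\<in>{0..<1}. \<forall>t\<in>{0..<1}. c s = c t \<longrightarrow> E s t < e" if e: "e > 0" for e
  proof -
    obtain c :: "real \<Rightarrow> nat" where "\<forall>s\<in>{0..<1}. \<forall>t\<in>{0..<1}. c s = c t \<longrightarrow> D s t < e"
      using pmD(5)[OF D e] by blast
    then show ?thesis using assms(2) by (intro exI[of _ c]) fastforce
  qed
  then show ?thesis using assms(3-) unfolding pm_def by blast
qed

lemma pm_add:
  assumes D: "pm D" and E: "pm E"
  shows "pm (\<lambda>s t. D s t + E s t)"
proof -
  have "\<exists>c::real \<Rightarrow> nat. \<forall>s\<in>{0..<1}. \<forall>t\<in>{0..<1}. c s = c t \<longrightarrow> D s t + E s t < e" if e: "e > 0" for e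
  proof -
    obtain c :: "real \<Rightarrow> nat" where c: "\<forall>s\<in>{0..<1}. \<forall>t\<in>{0..<1}. c s = c t \<longrightarrow> D s t < e / 2"
      using pmD(5)[OF D, of "e/2"] e by auto
    obtain c' :: "real \<Rightarrow> nat" where c': "\<forall>s\<in>{0..<1}. \<forall>t\<in>{0..<1}. c' s = c' t \<longrightarrow> E s t < e / 2"
      using pmD(5)[OF E, of "e/2"] e by auto
    have "D s t + E s t < e" if "s \<in> {0..<1}" "t \<in> {0..<1}" "prod_encode (c s, c' s) = prod_encode (c t, c' t)" for s t
    proof -
      have "c s = c t" "c' s = c' t" using that(3) by simp_all
      then have "D s t < e / 2" "E s t < e / 2" using c c' that(1,2) by blast+
      then show ?thesis by linarith
    qed
    then show ?thesis by (intro exI[of _ "\<lambda>s. prod_encode (c s, c' s)"]) blast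
  qed
  moreover have "\<forall>s\<in>{0..<1}. (\<lambda>t. D s t + E s t) \<in> borel_measurable lebI"
    using pmD(4)[OF D] pmD(4)[OF E] by (auto intro: borel_measurable_add)
  moreover have "D r t + E r t \<le> D r s + E r s + (D s t + E s t)" 
    if "r \<in> {0..<1}" "s \<in> {0..<1}" "t \<in> {0..<1}" for r s t
    using pmD(3)[OF D that] pmD(3)[OF E that] by linarith
  ultimately show ?thesis
    unfolding pm_def using pmD(1,2)[OF D] pmD(1,2)[OF E] by auto
qed

lemma pm_scale:
  assumes D: "pm D" and c: "0 \<le> c"
  shows "pm (\<lambda>s t. c * D s t)"
proof (cases "c = 0")
  case True then show ?thesis by (auto simp: pm_def)
next
  case False
  then have c: "0 < c" using c by simp
  have "\<exists>l::real \<Rightarrow> nat. \<forall>s\<in>{0..<1}. \<forall>t\<in>{0..<1}. l s = l t \<longrightarrow> c * D s t < e" if e: "e > 0" for e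
  proof -
    obtain l :: "real \<Rightarrow> nat" where l: "\<forall>s\<in>{0..<1}. \<forall>t\<in>{0..<1}. l s = l t \<longrightarrow> D s t < e / c"
      using pmD(5)[OF D, of "e/c"] e c by auto
    then show ?thesis using c by (intro exI[of _ l]) (auto simp: field_simps)
  qed
  moreover have "\<forall>s\<in>{0..<1}. (\<lambda>t. c * D s t) \<in> borel_measurable lebI"
    using pmD(4)[OF D] by auto
  moreover have "c * D r t \<le> c * D r s + c * D s t" 
    if "r \<in> {0..<1}" "s \<in> {0..<1}" "t \<in> {0..<1}" for r s t
    using mult_left_mono[OF pmD(3)[OF D that], of c] c by (simp add: distrib_left)
  ultimately show ?thesis
    unfolding pm_def using pmD(1,2)[OF D] by auto
qed

lemma pm_max:
  assumes D: "pm D" and E: "pm E"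
  shows "pm (\<lambda>s t. max (D s t) (E s t))"
proof (rule pm_dominated[OF pm_add[OF D E]])
  show "\<forall>s\<in>{0..<1}. \<forall>t\<in>{0..<1}. max (D s t) (E s t) \<le> D s t + E s t"
    using pm_nonneg[OF D] pm_nonneg[OF E] by auto
  show "\<forall>s\<in>{0..<1}. (\<lambda>t. max (D s t) (E s t)) \<in> borel_measurable lebI"
    using pmD(4)[OF D] pmD(4)[OF E] by (auto intro: borel_measurable_max)
  have "max (D r t) (E r t) \<le> max (D r s) (E r s) + max (D s t) (E s t)"
    if "r \<in> {0..<1}" "s \<in> {0..<1}" "t \<in> {0..<1}" for r s t
    using pmD(3)[OF D that] pmD(3)[OF E that] by linarith
  then show "\<forall>r\<in>{0..<1}. \<forall>s\<in>{0..<1}. \<forall>t\<in>{0..<1}.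
      max (D r t) (E r t) \<le> max (D r s) (E r s) + max (D s t) (E s t)" by blast
qed (use pmD(1,2)[OF D] pmD(1,2)[OF E] in auto)

section \<open>Isomorphism as an equivalence, and spaces built from pseudo-metrics\<close>

lemma mm_iso_refl: "mm_space S \<Longrightarrow> mm_iso S S"
  using params_mm_iso[of S S _ _ "{0..<1}"] mm.param_exists[of S] full_I unfolding mm_def by blast

lemma mm_iso_sym:
  assumes "mm_iso S T" "mm_space S" "mm_space T"
  shows "mm_iso T S"
proof -
  obtain \<phi> where \<phi>: "parameter S \<phi>" using mm.param_exists[of S] assms by (auto simp: mm_def)
  obtain \<psi> J where "parameter T \<psi>" "full J" "\<forall>s\<in>J. \<forall>t\<in>J. dst T (\<psi> s) (\<psi> t) = dst S (\<phi> s) (\<phi> t)"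
    by (rule mm_iso_params[OF assms \<phi>])
  then show ?thesis using params_mm_iso[OF assms(3,2) _ \<phi>] by auto
qed

lemma mm_iso_trans:
  assumes "mm_iso S T" "mm_iso T U" "mm_space S" "mm_space T" "mm_space U"
  shows "mm_iso S U"
proof -
  obtain \<phi> where \<phi>: "parameter S \<phi>" using mm.param_exists[of S] assms by (auto simp: mm_def)
  obtain \<psi> J where \<psi>: "parameter T \<psi>" "full J" "\<forall>s\<in>J. \<forall>t\<in>J. dst T (\<psi> s) (\<psi> t) = dst S (\<phi> s) (\<phi> t)"
    by (rule mm_iso_params[OF assms(1,3,4) \<phi>])
  obtain \<theta> K where \<theta>: "parameter U \<theta>" "full K" "\<forall>s\<in>K. \<forall>t\<in>K. dst U (\<theta> s) (\<theta> t) = dst T (\<psi> s) (\<psi> t)"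
    by (rule mm_iso_params[OF assms(2,4,5) \<psi>(1)])
  show ?thesis
    by (rule params_mm_iso[OF assms(3,5) \<phi> \<theta>(1) full_Int[OF \<psi>(2) \<theta>(2)]]) (use \<psi>(3) \<theta>(3) in auto)
qed

text \<open>Classes contain only spaces whose points are reals. This copy puts the class of a space
  on any other carrier, such as sequences, into \<open>mmX\<close>.\<close>

lemma real_copy:
  fixes S :: "'a mm"
  assumes S: "mm_space S"
  shows "\<exists>T::real mm. mm_space T \<and> mm_iso S T"
proof -
  interpret mm S by unfold_locales fact
  obtain j :: "'a \<Rightarrow> real" where j: "inj_on j (car S)" using inj_real by blast
  obtain \<phi> where \<phi>: "parameter S \<phi>" using param_exists by blast
  obtain x :: "nat \<Rightarrow> 'a" where x: "\<forall>k. x k \<in> car S" "\<forall>y\<in>car S. \<forall>e>0. \<exists>k. dst S (x k) y < e"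
    using dense_seq by blast
  define g where "g = inv_into (car S) j"
  have gj: "g (j y) = y" if "y \<in> car S" for y using that j by (simp add: g_def)
  define X where "X = j ` car S"
  define d where "d a b = dst S (g a) (g b)" for a b
  have gX: "g a \<in> car S" "j (g a) = a" if "a \<in> X" for a using that gj by (auto simp: X_def)
  have X: "Metric_space X d"
  proof
    show "0 \<le> d a b" "d a b = d b a" for a b by (auto simp: d_def commute)
    show "(d a b = 0) = (a = b)" if "a \<in> X" "b \<in> X" for a b
      using zero[of "g a" "g b"] gX that by (metis d_def)
    show "d a c \<le> d a b + d b c" if "a \<in> X" "b \<in> X" "c \<in> X" for a b c
      unfolding d_def using triangle gX that by blast
  qed
  have mc: "Metric_space.mcomplete X d"
  proof (rule Metric_space.mcompleteI[OF X])
    fix \<sigma> :: "nat \<Rightarrow> real"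
    assume \<sigma>: "\<forall>n. \<sigma> n \<in> X" "\<forall>e>0. \<exists>N. \<forall>m\<ge>N. \<forall>n\<ge>N. d (\<sigma> m) (\<sigma> n) < e"
    have "\<exists>y\<in>car S. \<forall>e>0. \<exists>N. \<forall>n\<ge>N. dst S (g (\<sigma> n)) y < e"
      by (rule cauchy_limit) (use \<sigma> gX in \<open>auto simp: d_def\<close>)
    then obtain y where y: "y \<in> car S" "\<forall>e>0. \<exists>N. \<forall>n\<ge>N. dst S (g (\<sigma> n)) y < e" by blast
    show "\<exists>x\<in>X. \<forall>e>0. \<exists>N. \<forall>n\<ge>N. d (\<sigma> n) x < e"
      by (rule bexI[of _ "j y"]) (use y gj in \<open>auto simp: d_def X_def\<close>)
  qed
  have "\<exists>\<mu>. mm_space (X, d, \<mu>) \<and> parameter (X, d, \<mu>) (\<lambda>s. j (\<phi> s))"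
  proof (rule mm_spaceI[OF X mc, of "\<lambda>k. j (x k)"])
    show "\<forall>k. j (x k) \<in> X" using x by (simp add: X_def)
    show "\<forall>y\<in>X. \<forall>e>0. \<exists>k. d (j (x k)) y < e"
      using x gX by (simp add: d_def gj)
    show "j (\<phi> s) \<in> X" if "0 \<le> s" "s < 1" for s using param_car[OF \<phi> that] by (simp add: X_def)
    fix k r
    have "{s \<in> {0..<1}. d (j (x k)) (j (\<phi> s)) < r} = \<phi> -` mball (x k) r \<inter> {0..<1}"
      using x(1) param_car[OF \<phi>] by (auto simp: d_def gj)
    then show "{s \<in> {0..<1}. d (j (x k)) (j (\<phi> s)) < r} \<in> sets lebI"
      using param_sets[OF \<phi>, of "mball (x k) r"] by simp
  qed
  then obtain \<mu> where \<mu>: "mm_space (X, d, \<mu>)" "parameter (X, d, \<mu>) (\<lambda>s. j (\<phi> s))" by blast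
  have "mm_iso S (X, d, \<mu>)"
    by (rule params_mm_iso[OF S \<mu>(1) \<phi> \<mu>(2) full_I]) (use param_car[OF \<phi>] in \<open>auto simp: d_def gj\<close>)
  with \<mu>(1) show ?thesis by blast
qed

text \<open>The point \<open>s\<close> becomes the sequence of its distances to a dense sequence, an
  isometry into the sup distance; the carrier is the uniform closure of the image. This forms
  quotient and completion in one step.\<close>

lemma pm_realize:
  assumes D: "pm D"
  shows "\<exists>(S::(nat \<Rightarrow> real) mm) \<kappa>. mm_space S \<and> parameter S \<kappa> \<and>
    (\<forall>s\<in>{0..<1}. \<forall>t\<in>{0..<1}. dst S (\<kappa> s) (\<kappa> t) = D s t)"
proof -
  obtain a :: "nat \<Rightarrow> real" where a: "\<And>i. a i \<in> {0..<1}" "\<And>s e. s \<in> {0..<1} \<Longrightarrow> e > 0 \<Longrightarrow> \<exists>i. D (a i) s < e"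
    using pm_dense[OF D] by metis
  define \<kappa> where "\<kappa> s = (\<lambda>j. D (a j) s)" for s
  define X where "X = {v. \<forall>e>0. \<exists>i. \<forall>j. \<bar>v j - \<kappa> (a i) j\<bar> \<le> e}"
  \<comment> \<open>\<open>Metric_space\<close> demands nonnegativity and symmetry for all
    arguments, so a default is given for unbounded differences; between points of \<open>X\<close>
    it never occurs.\<close>
  define d where "d v w = (if bdd_above (range (\<lambda>j. \<bar>v j - w j\<bar>)) then SUP j. \<bar>v j - w j\<bar> else 0)"
    for v w :: "nat \<Rightarrow> real"
  have \<kappa>1: "\<bar>\<kappa> s j - \<kappa> t j\<bar> \<le> D s t" if "s \<in> {0..<1}" "t \<in> {0..<1}" for s t j
    unfolding \<kappa>_def by (rule pm_reverse[OF D a(1) that])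
  have bdd: "bdd_above (range (\<lambda>j. \<bar>v j - w j\<bar>))" if v: "v \<in> X" and w: "w \<in> X" for v w
  proof -
    obtain i where i: "\<And>j. \<bar>v j - \<kappa> (a i) j\<bar> \<le> 1" using v zero_less_one unfolding X_def by blast
    obtain k where k: "\<And>j. \<bar>w j - \<kappa> (a k) j\<bar> \<le> 1" using w zero_less_one unfolding X_def by blast
    have "\<bar>v j - w j\<bar> \<le> 2 + D (a i) (a k)" for j
      using i[of j] k[of j] \<kappa>1[OF a(1) a(1), of i j k] by linarith
    then show ?thesis by (intro bdd_aboveI[of _ "2 + D (a i) (a k)"]) auto
  qed
  have d1: "\<bar>v j - w j\<bar> \<le> d v w" if "v \<in> X" "w \<in> X" for v w j
    using bdd[OF that] by (simp add: d_def) (rule cSUP_upper, auto)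
  have d2: "d v w \<le> c" if "\<And>j. \<bar>v j - w j\<bar> \<le> c" for v w c
  proof -
    have "0 \<le> c" using that[of 0] by linarith
    then show ?thesis unfolding d_def using that by (auto intro: cSUP_least)
  qed
  have X: "Metric_space X d"
  proof
    fix v w
    show "0 \<le> d v w"
    proof (cases "bdd_above (range (\<lambda>j. \<bar>v j - w j\<bar>))")
      case True
      then have "\<bar>v 0 - w 0\<bar> \<le> d v w" by (simp add: d_def) (rule cSUP_upper, auto)
      then show ?thesis by linarith
    qed (simp add: d_def)
    show "d v w = d w v" by (simp add: d_def abs_minus_commute)
  next
    fix v w assume vw: "v \<in> X" "w \<in> X"
    show "(d v w = 0) = (v = w)"
    proof
      assume "d v w = 0"
      then have "v j = w j" for j using d1[OF vw, of j] by simp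
      then show "v = w" by auto
    next
      assume "v = w" 
      then have "d v w \<le> 0" by (intro d2) auto
      moreover have "0 \<le> d v w" using d1[OF vw, of 0] by linarith
      ultimately show "d v w = 0" by linarith
    qed
  next
    fix u v w assume "u \<in> X" "v \<in> X" "w \<in> X"
    show "d u w \<le> d u v + d v w"
    proof (rule d2)
      fix j show "\<bar>u j - w j\<bar> \<le> d u v + d v w"
        using d1[OF \<open>u \<in> X\<close> \<open>v \<in> X\<close>, of j] d1[OF \<open>v \<in> X\<close> \<open>w \<in> X\<close>, of j] by linarith
    qed
  qed
  have \<kappa>X: "\<kappa> s \<in> X" if s: "s \<in> {0..<1}" for s
    unfolding X_def
  proof (intro CollectI allI impI)
    fix e :: real assume "e > 0"
    then obtain i where "D (a i) s < e" using a(2)[OF s] by blast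
    then have "\<bar>\<kappa> s j - \<kappa> (a i) j\<bar> \<le> e" for j
      using \<kappa>1[OF s a(1), of j i] pmD(1)[OF D s a(1), of i] by linarith
    then show "\<exists>i. \<forall>j. \<bar>\<kappa> s j - \<kappa> (a i) j\<bar> \<le> e" by blast
  qed
  have iso: "d (\<kappa> s) (\<kappa> t) = D s t" if s: "s \<in> {0..<1}" and t: "t \<in> {0..<1}" for s t
  proof (rule antisym)
    show "d (\<kappa> s) (\<kappa> t) \<le> D s t" by (rule d2) (rule \<kappa>1[OF s t])
    show "D s t \<le> d (\<kappa> s) (\<kappa> t)"
    proof (rule field_le_epsilon)
      fix e :: real assume "e > 0"
      then obtain i where i: "D (a i) s < e / 2" using a(2)[OF s, of "e/2"] by auto
      have "D s t \<le> D s (a i) + D (a i) t" by (rule pmD(3)[OF D s a(1) t])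
      moreover have "D s (a i) = D (a i) s" by (rule pmD(1)[OF D s a(1)])
      moreover have "\<bar>D (a i) s - D (a i) t\<bar> \<le> d (\<kappa> s) (\<kappa> t)"
        using d1[OF \<kappa>X[OF s] \<kappa>X[OF t], of i] by (simp add: \<kappa>_def)
      ultimately show "D s t \<le> d (\<kappa> s) (\<kappa> t) + e" using i by linarith
    qed
  qed
  have mc: "Metric_space.mcomplete X d"
  proof (rule Metric_space.mcompleteI[OF X])
    fix \<sigma> :: "nat \<Rightarrow> nat \<Rightarrow> real"
    assume \<sigma>: "\<forall>n. \<sigma> n \<in> X" "\<forall>e>0. \<exists>N. \<forall>m\<ge>N. \<forall>n\<ge>N. d (\<sigma> m) (\<sigma> n) < e"
    have "Cauchy (\<lambda>n. \<sigma> n j)" for j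
    proof (rule metric_CauchyI)
      fix e :: real assume "e > 0"
      then obtain N where N: "\<forall>m\<ge>N. \<forall>n\<ge>N. d (\<sigma> m) (\<sigma> n) < e" using \<sigma>(2) by meson
      have "dist (\<sigma> m j) (\<sigma> n j) < e" if "m \<ge> N" "n \<ge> N" for m n
      proof -
        have "d (\<sigma> m) (\<sigma> n) < e" using N that by blast
        then show ?thesis using d1[of "\<sigma> m" "\<sigma> n" j] \<sigma>(1) by (simp add: dist_real_def)
      qed
      then show "\<exists>M. \<forall>m\<ge>M. \<forall>n\<ge>M. dist (\<sigma> m j) (\<sigma> n j) < e" by blast
    qed
    then have "\<forall>j. \<exists>l. (\<lambda>n. \<sigma> n j) \<longlonglongrightarrow> l" by (simp add: Cauchy_convergent_iff convergent_def)
    then obtain v where v: "\<And>j. (\<lambda>n. \<sigma> n j) \<longlonglongrightarrow> v j" by metis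
    have near: "\<exists>N. \<forall>n\<ge>N. \<forall>j. \<bar>\<sigma> n j - v j\<bar> \<le> e" if "e > 0" for e
    proof -
      obtain N where N: "\<forall>m\<ge>N. \<forall>n\<ge>N. d (\<sigma> m) (\<sigma> n) < e" using \<sigma>(2) \<open>e > 0\<close> by meson
      have "\<bar>\<sigma> n j - v j\<bar> \<le> e" if n: "n \<ge> N" for n j
      proof (rule LIMSEQ_le_const2)
        show "(\<lambda>m. \<bar>\<sigma> n j - \<sigma> m j\<bar>) \<longlonglongrightarrow> \<bar>\<sigma> n j - v j\<bar>"
          by (intro tendsto_intros v)
        have "\<bar>\<sigma> n j - \<sigma> m j\<bar> \<le> e" if "m \<ge> N" for m
        proof -
          have "d (\<sigma> n) (\<sigma> m) < e" using N n that by blast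
          then show ?thesis using d1[of "\<sigma> n" "\<sigma> m" j] \<sigma>(1) by simp
        qed
        then show "\<exists>N. \<forall>m\<ge>N. \<bar>\<sigma> n j - \<sigma> m j\<bar> \<le> e" by blast
      qed
      then show ?thesis by blast
    qed
    have "v \<in> X"
      unfolding X_def
    proof (intro CollectI allI impI)
      fix e :: real assume e: "e > 0"
      obtain N where N: "\<forall>n\<ge>N. \<forall>j. \<bar>\<sigma> n j - v j\<bar> \<le> e / 2" using near[of "e/2"] e by auto
      obtain i where i: "\<forall>j. \<bar>\<sigma> N j - \<kappa> (a i) j\<bar> \<le> e / 2"
        using \<sigma>(1) half_gt_zero[OF e] unfolding X_def by blast
      have "\<bar>v j - \<kappa> (a i) j\<bar> \<le> e" for j
        using N[rule_format, of N j] i[rule_format, of j] by linarith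
      then show "\<exists>i. \<forall>j. \<bar>v j - \<kappa> (a i) j\<bar> \<le> e" by blast
    qed
    moreover have "\<exists>N. \<forall>n\<ge>N. d (\<sigma> n) v < e" if e: "e > 0" for e
    proof -
      obtain N where N: "\<forall>n\<ge>N. \<forall>j. \<bar>\<sigma> n j - v j\<bar> \<le> e / 2" using near[of "e/2"] e by auto
      have "d (\<sigma> n) v < e" if "n \<ge> N" for n
      proof -
        have "d (\<sigma> n) v \<le> e / 2" by (rule d2) (use N that in blast)
        then show ?thesis using e by linarith
      qed
      then show ?thesis by blast
    qed
    ultimately show "\<exists>x\<in>X. \<forall>e>0. \<exists>N. \<forall>n\<ge>N. d (\<sigma> n) x < e" by blast
  qed
  have "\<exists>\<mu>. mm_space (X, d, \<mu>) \<and> parameter (X, d, \<mu>) \<kappa>"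
  proof (rule mm_spaceI[OF X mc, of "\<lambda>i. \<kappa> (a i)"])
    show "\<forall>i. \<kappa> (a i) \<in> X" using \<kappa>X a(1) by blast
    show "\<kappa> s \<in> X" if "0 \<le> s" "s < 1" for s using \<kappa>X that by simp
    show "\<forall>v\<in>X. \<forall>e>0. \<exists>i. d (\<kappa> (a i)) v < e"
    proof (intro ballI allI impI)
      fix v e assume v: "v \<in> X" and e: "(e::real) > 0"
      obtain i where i: "\<forall>j. \<bar>v j - \<kappa> (a i) j\<bar> \<le> e / 2"
        using v half_gt_zero[OF e] unfolding X_def by blast
      have "d (\<kappa> (a i)) v \<le> e / 2" by (rule d2) (use i in \<open>simp add: abs_minus_commute\<close>)
      then show "\<exists>i. d (\<kappa> (a i)) v < e" using e by (intro exI[of _ i]) linarith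
    qed
    fix i r
    have "{s \<in> {0..<1}. d (\<kappa> (a i)) (\<kappa> s) < r} = {s \<in> space lebI. D (a i) s < r}"
      using iso[OF a(1)] by auto
    moreover have "{s \<in> space lebI. D (a i) s < r} \<in> sets lebI"
      using pmD(4)[OF D a(1)[of i]] unfolding borel_measurable_iff_less by blast
    ultimately show "{s \<in> {0..<1}. d (\<kappa> (a i)) (\<kappa> s) < r} \<in> sets lebI"
      by (simp only:)
  qed
  then obtain \<mu> where "mm_space (X, d, \<mu>)" "parameter (X, d, \<mu>) \<kappa>" by blast
  then show ?thesis using iso by (intro exI[of _ "(X, d, \<mu>)"] exI[of _ \<kappa>]) auto
qed

section \<open>Classes and the pseudo-metrics that realize them\<close>

lemma mm_class_self: "mm_space S \<Longrightarrow> S \<in> mm_class S"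
  by (simp add: mm_class_def mm_iso_refl)

lemma mm_class_eq:
  assumes "mm_iso S T" "mm_space S" "mm_space T"
  shows "mm_class S = mm_class T"
  unfolding mm_class_def
proof (intro Collect_cong conj_cong refl)
  fix U :: "real mm" assume U: "mm_space U"
  show "mm_iso S U \<longleftrightarrow> mm_iso T U"
  proof
    show "mm_iso S U \<Longrightarrow> mm_iso T U"
      by (rule mm_iso_trans[OF mm_iso_sym[OF assms] _ assms(3,2) U])
    show "mm_iso T U \<Longrightarrow> mm_iso S U"
      by (rule mm_iso_trans[OF assms(1) _ assms(2,3) U])
  qed
qed

lemma mm_class_in_mmX: 
  assumes "mm_space S" shows "mm_class S \<in> mmX"
proof -
  obtain T :: "real mm" where T: "mm_space T" "mm_iso S T" using real_copy[OF assms] by blast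
  then have "mm_class S = mm_class T" using mm_class_eq assms by blast
  then show ?thesis using T(1) unfolding mmX_def by blast
qed

lemma rep_props:
  assumes "C \<in> mmX"
  shows "mm_space (rep C)" "mm_class (rep C) = C"
proof -
  obtain S :: "real mm" where S: "C = mm_class S" "mm_space S" using assms by (auto simp: mmX_def)
  then have "S \<in> C" using mm_class_self by simp
  then have "rep C \<in> C" unfolding rep_def by (rule someI)
  then have "rep C \<in> mm_class S" by (simp only: S(1)[symmetric])
  then have r: "mm_space (rep C)" "mm_iso S (rep C)" by (simp_all add: mm_class_def)
  show "mm_space (rep C)" by (rule r(1))
  show "mm_class (rep C) = C"
    by (rule trans[OF mm_class_eq[OF r(2) S(2) r(1), symmetric] S(1)[symmetric]])
qed

text \<open>The pseudo-metric need only agree on a set of full measure with the pullback along a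
  parameter of the chosen representative, so one class has many realizations.\<close>

definition rz :: "real mm set \<Rightarrow> (real \<Rightarrow> real \<Rightarrow> real) \<Rightarrow> bool" where
  "rz C D \<longleftrightarrow> C \<in> mmX \<and> (\<exists>\<phi> J. parameter (rep C) \<phi> \<and> full J \<and>
     (\<forall>s\<in>J. \<forall>t\<in>J. D s t = dst (rep C) (\<phi> s) (\<phi> t)))"

lemma rz_mmX: "rz C D \<Longrightarrow> C \<in> mmX"
  by (simp add: rz_def)

lemma rz_of_space:
  assumes S: "mm_space S" "parameter S \<phi>" "full J" "\<forall>s\<in>J. \<forall>t\<in>J. D s t = dst S (\<phi> s) (\<phi> t)"
  shows "rz (mm_class S) D"
proof -
  let ?C = "mm_class S"
  have C: "?C \<in> mmX" by (rule mm_class_in_mmX[OF S(1)])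
  have "mm_iso S (rep ?C)"
  proof -
    have "rep ?C \<in> ?C" using rep_props[OF C] mm_class_self[of "rep ?C"] by simp
    then show ?thesis by (simp add: mm_class_def)
  qed
  then obtain \<psi> K where "parameter (rep ?C) \<psi>" "full K" 
    "\<forall>s\<in>K. \<forall>t\<in>K. dst (rep ?C) (\<psi> s) (\<psi> t) = dst S (\<phi> s) (\<phi> t)"
    using mm_iso_params[OF _ S(1) rep_props(1)[OF C] S(2)] by blast
  then show ?thesis
    unfolding rz_def using C full_Int[OF S(3), of K] S(4) 
    by (intro conjI exI[of _ \<psi>] exI[of _ "J \<inter> K"]) auto
qed

lemma rz_ex: 
  assumes "pm D" obtains C where "rz C D"
proof -
  obtain S :: "(nat \<Rightarrow> real) mm" and \<kappa> where "mm_space S" "parameter S \<kappa>"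
    "\<forall>s\<in>{0..<1}. \<forall>t\<in>{0..<1}. dst S (\<kappa> s) (\<kappa> t) = D s t"
    using pm_realize[OF assms] by blast
  then have "rz (mm_class S) D" by (intro rz_of_space[OF _ _ full_I]) auto
  then show ?thesis by (rule that)
qed

lemma rz_param:
  assumes C: "C \<in> mmX" and \<phi>: "parameter (rep C) \<phi>"
  shows "pm (\<lambda>s t. dst (rep C) (\<phi> s) (\<phi> t))" "rz C (\<lambda>s t. dst (rep C) (\<phi> s) (\<phi> t))"
proof -
  show "pm (\<lambda>s t. dst (rep C) (\<phi> s) (\<phi> t))" by (rule pm_pullback[OF rep_props(1)[OF C] \<phi>])
  show "rz C (\<lambda>s t. dst (rep C) (\<phi> s) (\<phi> t))"
    unfolding rz_def using C \<phi> full_I by (intro conjI exI[of _ \<phi>] exI[of _ "{0..<1}"]) simp_all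
qed

lemma rz_exists:
  assumes "C \<in> mmX" obtains D where "pm D" "rz C D"
proof -
  obtain \<phi> where "parameter (rep C) \<phi>"
    using mm.param_exists[of "rep C"] rep_props(1)[OF assms] unfolding mm_def by blast
  from that[OF rz_param[OF assms this]] show ?thesis .
qed

text \<open>Classes along a path are merely chosen to realize given pseudo-metrics; this identifies
  the two end points.\<close>

lemma rz_uniq:
  assumes C: "rz C D" and C': "rz C' D'" and K: "full K" "\<forall>s\<in>K. \<forall>t\<in>K. D s t = D' s t"
  shows "C = C'"
proof -
  obtain \<phi> J where \<phi>: "parameter (rep C) \<phi>" "full J" "\<forall>s\<in>J. \<forall>t\<in>J. D s t = dst (rep C) (\<phi> s) (\<phi> t)"
    using C by (auto simp: rz_def)
  obtain \<psi> J' where \<psi>: "parameter (rep C') \<psi>" "full J'" "\<forall>s\<in>J'. \<forall>t\<in>J'. D' s t = dst (rep C') (\<psi> s) (\<psi> t)"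
    using C' by (auto simp: rz_def)
  note r = rep_props[OF rz_mmX[OF C]] and r' = rep_props[OF rz_mmX[OF C']]
  have "mm_iso (rep C) (rep C')"
    by (rule params_mm_iso[OF r(1) r'(1) \<phi>(1) \<psi>(1) full_Int[OF K(1) full_Int[OF \<phi>(2) \<psi>(2)]]])
      (use K(2) \<phi>(3) \<psi>(3) in \<open>metis IntE\<close>)
  then have "mm_class (rep C) = mm_class (rep C')" by (rule mm_class_eq[OF _ r(1) r'(1)])
  then show ?thesis using r(2) r'(2) by simp
qed

lemma rz_full_cong:
  assumes "rz C D" "full K" "\<forall>s\<in>K. \<forall>t\<in>K. D' s t = D s t"
  shows "rz C D'"
proof -
  obtain \<phi> J where \<phi>: "parameter (rep C) \<phi>" "full J" "\<forall>s\<in>J. \<forall>t\<in>J. D s t = dst (rep C) (\<phi> s) (\<phi> t)"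
    using assms(1) by (auto simp: rz_def)
  then show ?thesis using assms full_Int[OF \<phi>(2) assms(2)] unfolding rz_def
    by (intro conjI exI[of _ \<phi>] exI[of _ "J \<inter> K"]) auto
qed

lemma rz_mp:
  assumes C: "rz C D" and \<alpha>: "mp \<alpha>"
  shows "rz C (\<lambda>s t. D (\<alpha> s) (\<alpha> t))"
proof -
  obtain \<phi> J where \<phi>: "parameter (rep C) \<phi>" "full J" "\<forall>s\<in>J. \<forall>t\<in>J. D s t = dst (rep C) (\<phi> s) (\<phi> t)"
    using C by (auto simp: rz_def)
  show ?thesis
    unfolding rz_def using rz_mmX[OF C] param_mp[OF \<phi>(1) \<alpha>] mp_full[OF \<alpha> \<phi>(2)] \<phi>(3)
    by (intro conjI exI[of _ "\<lambda>s. \<phi> (\<alpha> s)"] exI[of _ "\<alpha> -` J \<inter> {0..<1}"]) auto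
qed

lemma rz_le:
  assumes C: "rz C D" and C': "rz C' D'" and K: "full K" "\<forall>s\<in>K. \<forall>t\<in>K. D' s t \<le> D s t"
  shows "lip_le C' C"
proof -
  obtain \<phi> J where \<phi>: "parameter (rep C) \<phi>" "full J" "\<forall>s\<in>J. \<forall>t\<in>J. D s t = dst (rep C) (\<phi> s) (\<phi> t)"
    using C by (auto simp: rz_def)
  obtain \<psi> J' where \<psi>: "parameter (rep C') \<psi>" "full J'" "\<forall>s\<in>J'. \<forall>t\<in>J'. D' s t = dst (rep C') (\<psi> s) (\<psi> t)"
    using C' by (auto simp: rz_def)
  note r = rep_props[OF rz_mmX[OF C]] and r' = rep_props[OF rz_mmX[OF C']]
  show ?thesis
    unfolding lip_le_def
    by (rule params_lip_dominated[OF r(1) r'(1) \<phi>(1) \<psi>(1) full_Int[OF K(1) full_Int[OF \<phi>(2) \<psi>(2)]]])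
      (use K(2) \<phi>(3) \<psi>(3) in \<open>metis IntE\<close>)
qed

text \<open>A parameter of the larger space is pushed forward along the Lipschitz map, so the
  realization \<open>D\<close> of the larger class can be prescribed and only the smaller class has
  its realization chosen.\<close>

lemma lip_le_rz:
  assumes le: "lip_le C' C" and C: "rz C D" and C': "C' \<in> mmX"
  obtains D' K where "pm D'" "rz C' D'" "full K" "\<forall>s\<in>K. \<forall>t\<in>K. D' s t \<le> D s t"
proof -
  obtain \<phi> J where \<phi>: "parameter (rep C) \<phi>" "full J" "\<forall>s\<in>J. \<forall>t\<in>J. D s t = dst (rep C) (\<phi> s) (\<phi> t)"
    using C by (auto simp: rz_def)
  obtain \<psi> K where \<psi>: "parameter (rep C') \<psi>" "full K" 
    "\<forall>s\<in>K. \<forall>t\<in>K. dst (rep C') (\<psi> s) (\<psi> t) \<le> dst (rep C) (\<phi> s) (\<phi> t)"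
    using lip_dominated_params[OF le[unfolded lip_le_def] rep_props(1)[OF rz_mmX[OF C]] rep_props(1)[OF C'] \<phi>(1)]
    by blast
  show ?thesis
    by (rule that[OF rz_param[OF C' \<psi>(1)] full_Int[OF \<phi>(2) \<psi>(2)]]) (use \<phi>(3) \<psi>(3) in auto)
qed

lemma lip_le_refl: "C \<in> mmX \<Longrightarrow> lip_le C C"
proof -
  assume "C \<in> mmX"
  then obtain D where "rz C D" using rz_exists by blast
  then show ?thesis by (intro rz_le[OF _ _ full_I]) auto
qed

lemma lip_le_trans:
  assumes "lip_le C1 C2" "lip_le C2 C3" "C1 \<in> mmX" "C2 \<in> mmX" "C3 \<in> mmX"
  shows "lip_le C1 C3"
proof -
  obtain D3 where D3: "rz C3 D3" using rz_exists[OF assms(5)] by blast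
  obtain D2 K where D2: "pm D2" "rz C2 D2" "full K" "\<forall>s\<in>K. \<forall>t\<in>K. D2 s t \<le> D3 s t"
    by (rule lip_le_rz[OF assms(2) D3 assms(4)])
  obtain D1 L where D1: "pm D1" "rz C1 D1" "full L" "\<forall>s\<in>L. \<forall>t\<in>L. D1 s t \<le> D2 s t"
    by (rule lip_le_rz[OF assms(1) D2(2) assms(3)])
  show ?thesis
  proof (rule rz_le[OF D3 D1(2) full_Int[OF D2(3) D1(3)]], intro ballI)
    fix s t assume "s \<in> K \<inter> L" "t \<in> K \<inter> L"
    then have "D1 s t \<le> D2 s t" "D2 s t \<le> D3 s t" using D2(4) D1(4) by simp_all
    then show "D1 s t \<le> D3 s t" by linarith
  qed
qed

lemma rz_glue:
  assumes D: "rz C D" and D': "rz C D'" and \<eta>: "\<eta> > 0"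
  obtains \<alpha> \<beta> J where "mp \<alpha>" "mp \<beta>" "full J"
    "\<forall>s\<in>J. \<forall>t\<in>J. \<bar>D (\<alpha> s) (\<alpha> t) - D' (\<beta> s) (\<beta> t)\<bar> \<le> \<eta>"
proof -
  interpret mm "rep C" by unfold_locales (rule rep_props(1)[OF rz_mmX[OF D]])
  obtain \<phi> J1 where \<phi>: "parameter (rep C) \<phi>" "full J1" "\<forall>s\<in>J1. \<forall>t\<in>J1. D s t = dst (rep C) (\<phi> s) (\<phi> t)"
    using D by (auto simp: rz_def)
  obtain \<psi> J2 where \<psi>: "parameter (rep C) \<psi>" "full J2" "\<forall>s\<in>J2. \<forall>t\<in>J2. D' s t = dst (rep C) (\<psi> s) (\<psi> t)"
    using D' by (auto simp: rz_def)
  obtain \<alpha> \<beta> J where ab: "mp \<alpha>" "mp \<beta>" "full J" "\<forall>s\<in>J. dst (rep C) (\<phi> (\<alpha> s)) (\<psi> (\<beta> s)) < \<eta> / 2"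
    by (rule glue[OF \<phi>(1) \<psi>(1) half_gt_zero[OF \<eta>]])
  define K where "K = J \<inter> ((\<alpha> -` J1 \<inter> {0..<1}) \<inter> (\<beta> -` J2 \<inter> {0..<1}))"
  have K: "full K" unfolding K_def by (intro full_Int ab mp_full \<phi> \<psi>)
  have "\<bar>D (\<alpha> s) (\<alpha> t) - D' (\<beta> s) (\<beta> t)\<bar> \<le> \<eta>" if s: "s \<in> K" and t: "t \<in> K" for s t
  proof -
    have c: "\<phi> (\<alpha> s) \<in> car (rep C)" "\<phi> (\<alpha> t) \<in> car (rep C)" "\<psi> (\<beta> s) \<in> car (rep C)" "\<psi> (\<beta> t) \<in> car (rep C)"
      using s t param_car[OF \<phi>(1)] param_car[OF \<psi>(1)] mp_range[OF ab(1)] mp_range[OF ab(2)]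
      by (auto simp: K_def)
    have e: "D (\<alpha> s) (\<alpha> t) = dst (rep C) (\<phi> (\<alpha> s)) (\<phi> (\<alpha> t))" "D' (\<beta> s) (\<beta> t) = dst (rep C) (\<psi> (\<beta> s)) (\<psi> (\<beta> t))"
      using \<phi>(3) \<psi>(3) s t by (auto simp: K_def)
    have n: "dst (rep C) (\<phi> (\<alpha> s)) (\<psi> (\<beta> s)) < \<eta> / 2" "dst (rep C) (\<phi> (\<alpha> t)) (\<psi> (\<beta> t)) < \<eta> / 2"
      using ab(4) s t by (auto simp: K_def)
    show ?thesis unfolding e
      using n triangle[OF c(1,3,2)] triangle[OF c(3,4,2)] triangle[OF c(3,1,4)] triangle[OF c(1,2,4)]
      by (simp add: commute abs_le_iff)
  qed
  then show ?thesis using that[OF ab(1,2) K] by blast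
qed

section \<open>Box distance and observable distance\<close>

definition boxle :: "(real \<Rightarrow> real \<Rightarrow> real) \<Rightarrow> (real \<Rightarrow> real \<Rightarrow> real) \<Rightarrow> real \<Rightarrow> bool" where
  "boxle D D' e \<longleftrightarrow> (\<exists>I0\<in>sets lebI. measure lebI I0 \<ge> 1 - e \<and> (\<forall>s\<in>I0. \<forall>t\<in>I0. \<bar>D s t - D' s t\<bar> \<le> e))"

lemma boxleI: "I0 \<in> sets lebI \<Longrightarrow> measure lebI I0 \<ge> 1 - e \<Longrightarrow> \<forall>s\<in>I0. \<forall>t\<in>I0. \<bar>D s t - D' s t\<bar> \<le> e \<Longrightarrow> boxle D D' e"
  unfolding boxle_def by blast

lemma boxle_mono: "boxle D D' e \<Longrightarrow> e \<le> e' \<Longrightarrow> boxle D D' e'"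
  unfolding boxle_def by (meson diff_left_mono order_trans)

lemma boxle_sym: "boxle D D' e \<Longrightarrow> boxle D' D e"
  unfolding boxle_def by (simp add: abs_minus_commute)

lemma boxle_full:
  assumes "full J" "\<forall>s\<in>J. \<forall>t\<in>J. \<bar>D s t - D' s t\<bar> \<le> e" "0 \<le> e"
  shows "boxle D D' e"
  by (rule boxleI[OF full_sets[OF assms(1)] _ assms(2)]) (use assms in \<open>simp add: full_def\<close>)

lemma measure_Int_ge:
  assumes "A \<in> sets lebI" "B \<in> sets lebI" "measure lebI A \<ge> 1 - a" "measure lebI B \<ge> 1 - b"
  shows "measure lebI (A \<inter> B) \<ge> 1 - (a + b)"
proof -
  have "measure lebI A + measure lebI B = measure lebI (A \<union> B) + measure lebI (A \<inter> B)"
    using assms measure_Un3[of A lebI B] by (simp add: fmeasurable_def lebI.emeasure_eq_measure)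
  moreover have "measure lebI (A \<union> B) \<le> 1" by (rule lebI.prob_le_1)
  ultimately show ?thesis using assms by linarith
qed

lemma boxle_trans:
  assumes "boxle D1 D2 a" "boxle D2 D3 b"
  shows "boxle D1 D3 (a + b)"
proof -
  obtain A where A: "A \<in> sets lebI" "measure lebI A \<ge> 1 - a" "\<forall>s\<in>A. \<forall>t\<in>A. \<bar>D1 s t - D2 s t\<bar> \<le> a"
    using assms(1) unfolding boxle_def by blast
  obtain B where B: "B \<in> sets lebI" "measure lebI B \<ge> 1 - b" "\<forall>s\<in>B. \<forall>t\<in>B. \<bar>D2 s t - D3 s t\<bar> \<le> b"
    using assms(2) unfolding boxle_def by blast
  show ?thesis
  proof (rule boxleI[OF sets.Int[OF A(1) B(1)] measure_Int_ge[OF A(1) B(1) A(2) B(2)]], intro ballI)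
    fix s t assume "s \<in> A \<inter> B" "t \<in> A \<inter> B"
    then have "\<bar>D1 s t - D2 s t\<bar> \<le> a" "\<bar>D2 s t - D3 s t\<bar> \<le> b" using A(3) B(3) by simp_all
    then show "\<bar>D1 s t - D3 s t\<bar> \<le> a + b" by linarith
  qed
qed

lemma boxle_mp:
  assumes "boxle D D' e" "mp \<alpha>"
  shows "boxle (\<lambda>s t. D (\<alpha> s) (\<alpha> t)) (\<lambda>s t. D' (\<alpha> s) (\<alpha> t)) e"
proof -
  obtain A where A: "A \<in> sets lebI" "measure lebI A \<ge> 1 - e" "\<forall>s\<in>A. \<forall>t\<in>A. \<bar>D s t - D' s t\<bar> \<le> e"
    using assms(1) unfolding boxle_def by blast
  show ?thesis
    by (rule boxleI[OF mp_sets[OF assms(2) A(1)]]) (use A mp_measure[OF assms(2) A(1)] in auto)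
qed

text \<open>By McShane extension these functions and the pulled-back 1-Lipschitz functions of a
  realized space coincide on a set of full measure, so the observable distance can be computed with
  them.\<close>

definition Lf :: "(real \<Rightarrow> real \<Rightarrow> real) \<Rightarrow> (real \<Rightarrow> real) set" where
  "Lf D = {u. \<forall>s\<in>{0..<1}. \<forall>t\<in>{0..<1}. \<bar>u s - u t\<bar> \<le> D s t}"

lemma LfD: "u \<in> Lf D \<Longrightarrow> s \<in> {0..<1} \<Longrightarrow> t \<in> {0..<1} \<Longrightarrow> \<bar>u s - u t\<bar> \<le> D s t"
  unfolding Lf_def by blast

lemma Lf_mono: "u \<in> Lf D \<Longrightarrow> \<forall>s\<in>{0..<1}. \<forall>t\<in>{0..<1}. D s t \<le> D' s t \<Longrightarrow> u \<in> Lf D'"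
  unfolding Lf_def by fastforce

text \<open>A sublevel set is a countable union of balls around dense points, and balls are
  measurable because sections of \<open>D\<close> are.\<close>

lemma Lf_measurable:
  assumes D: "pm D" and u: "u \<in> Lf D"
  shows "u \<in> borel_measurable lebI"
proof (rule borel_measurableI_less)
  fix r
  obtain a :: "nat \<Rightarrow> real" where a: "\<forall>i. a i \<in> {0..<1}" "\<forall>s\<in>{0..<1}. \<forall>e>0. \<exists>i. D (a i) s < e"
    by (rule pm_dense[OF D])
  have "{s \<in> space lebI. u s < r} = (\<Union>i. {s \<in> space lebI. D (a i) s < r - u (a i)})"
  proof (intro equalityI subsetI)
    fix s assume "s \<in> {s \<in> space lebI. u s < r}"
    then have s: "s \<in> {0..<1}" "u s < r" by auto
    then obtain i where i: "D (a i) s < (r - u s) / 2" using a(2)[rule_format, OF s(1), of "(r - u s) / 2"] by auto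
    have "\<bar>u (a i) - u s\<bar> \<le> D (a i) s" by (rule LfD[OF u a(1)[rule_format] s(1)])
    then have "u (a i) - u s \<le> D (a i) s" by (rule abs_le_D1)
    then have "D (a i) s < r - u (a i)" using i by (simp add: field_simps)
    then show "s \<in> (\<Union>i. {s \<in> space lebI. D (a i) s < r - u (a i)})" using s by auto
  next
    fix s assume "s \<in> (\<Union>i. {s \<in> space lebI. D (a i) s < r - u (a i)})"
    then obtain i where i: "s \<in> {0..<1}" "D (a i) s < r - u (a i)" by auto
    have "\<bar>u (a i) - u s\<bar> \<le> D (a i) s" by (rule LfD[OF u a(1)[rule_format] i(1)])
    then show "s \<in> {s \<in> space lebI. u s < r}" using i by auto
  qed
  moreover have "{s \<in> space lebI. D (a i) s < r - u (a i)} \<in> sets lebI" for i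
    using pmD(4)[OF D a(1)[rule_format]] unfolding borel_measurable_iff_less by blast
  ultimately show "{s \<in> space lebI. u s < r} \<in> sets lebI" by auto
qed

lemma Lf_extend:
  assumes D: "pm D" and A: "A \<noteq> {}" "A \<subseteq> {0..<1}" 
    and u: "\<forall>s\<in>A. \<forall>t\<in>A. u s - u t \<le> D s t + e"
  obtains v where "v \<in> Lf D" "\<forall>s\<in>A. v s \<le> u s \<and> u s - e \<le> v s"
proof (rule mcshane[of A "\<lambda>s. s" "{0..<1}" D u e])
  fix F assume F: "\<And>x y. x \<in> {0..<1} \<Longrightarrow> y \<in> {0..<1} \<Longrightarrow> \<bar>F x - F y\<bar> \<le> D x y"
    "\<And>i. i \<in> A \<Longrightarrow> F i \<le> u i" "\<And>i. i \<in> A \<Longrightarrow> u i - e \<le> F i"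
  show thesis
  proof (rule that[of F])
    show "F \<in> Lf D" using F(1) unfolding Lf_def by blast
  qed (use F(2,3) in blast)
qed (use A u pmD(1-3)[OF D] in auto)

lemma Lf_zero: "pm D \<Longrightarrow> (\<lambda>_. 0) \<in> Lf D"
  using pm_nonneg unfolding Lf_def by simp

definition dev :: "(real \<Rightarrow> real) \<Rightarrow> (real \<Rightarrow> real) \<Rightarrow> real \<Rightarrow> real" where
  "dev u v e = measure lebI {t \<in> {0..<1}. \<bar>u t - v t\<bar> > e}"

lemma dev_sets:
  fixes u v :: "real \<Rightarrow> real"
  assumes "u \<in> borel_measurable lebI" "v \<in> borel_measurable lebI"
  shows "{t \<in> {0..<1}. \<bar>u t - v t\<bar> > e} \<in> sets lebI"
proof -
  have "(\<lambda>t. \<bar>u t - v t\<bar>) \<in> borel_measurable lebI"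
    using assms by (intro borel_measurable_abs borel_measurable_diff)
  then show ?thesis unfolding borel_measurable_iff_greater space_lebI by blast
qed

lemma dev_mono:
  assumes "u \<in> borel_measurable lebI" "v \<in> borel_measurable lebI" "e \<le> e'"
  shows "dev u v e' \<le> dev u v e"
  unfolding dev_def by (rule lebI.finite_measure_mono[OF _ dev_sets[OF assms(1,2)]]) (use assms in auto)

lemma dev_trans:
  assumes "u \<in> borel_measurable lebI" "v \<in> borel_measurable lebI" "w \<in> borel_measurable lebI"
  shows "dev u w (a + b) \<le> dev u v a + dev v w b"
proof -
  have "dev u w (a + b) \<le> measure lebI ({t \<in> {0..<1}. \<bar>u t - v t\<bar> > a} \<union> {t \<in> {0..<1}. \<bar>v t - w t\<bar> > b})"
    unfolding dev_def
    by (rule lebI.finite_measure_mono[OF _ sets.Un[OF dev_sets dev_sets]]) (use assms in auto)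
  also have "\<dots> \<le> dev u v a + dev v w b"
    unfolding dev_def by (rule measure_Un_le[OF dev_sets dev_sets]) (use assms in auto)
  finally show ?thesis .
qed

lemma dev_sym: "dev u v e = dev v u e"
  by (simp add: dev_def abs_minus_commute)

lemma dev_le_outside:
  assumes "A \<in> sets lebI" "measure lebI A \<ge> 1 - e" "\<forall>t\<in>A. \<bar>u t - v t\<bar> \<le> e'"
  shows "dev u v e' \<le> e"
proof -
  have "dev u v e' \<le> measure lebI (space lebI - A)"
    unfolding dev_def
    by (rule lebI.finite_measure_mono[OF _ sets.compl_sets[OF assms(1)]]) (use assms(3) in force)
  also have "\<dots> = 1 - measure lebI A" by (rule lebI.prob_compl[OF assms(1)])
  finally show ?thesis using assms by linarith
qed

text \<open>One half of the Hausdorff condition in the observable distance. The halves are kept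
  apart because along a path they come from different sources.\<close>

definition concle :: "(real \<Rightarrow> real \<Rightarrow> real) \<Rightarrow> (real \<Rightarrow> real \<Rightarrow> real) \<Rightarrow> real \<Rightarrow> bool" where
  "concle D D' e \<longleftrightarrow> (\<forall>u\<in>Lf D. \<exists>v\<in>Lf D'. dev u v e \<le> e)"

text \<open>On the good set a 1-Lipschitz function for \<open>D\<close> is 1-Lipschitz for
  \<open>D'\<close> up to \<open>e\<close>, and McShane extension corrects this at a loss of at most
  \<open>e\<close> there. An empty good set forces \<open>e \<ge> 1\<close>, where any function will
  do.\<close>

lemma boxle_concle:
  assumes D: "pm D" and D': "pm D'" and b: "boxle D D' e"
  shows "concle D D' e"
  unfolding concle_def
proof
  fix u assume u: "u \<in> Lf D"
  obtain A where A: "A \<in> sets lebI" "measure lebI A \<ge> 1 - e" "\<forall>s\<in>A. \<forall>t\<in>A. \<bar>D s t - D' s t\<bar> \<le> e"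
    using b unfolding boxle_def by blast
  show "\<exists>v\<in>Lf D'. dev u v e \<le> e"
  proof (cases "A = {}")
    case True
    then have "1 \<le> e" using A by simp
    moreover have "dev u (\<lambda>_. 0) e \<le> 1" unfolding dev_def by (rule lebI.prob_le_1)
    ultimately show ?thesis by (intro bexI[OF _ Lf_zero[OF D']]) linarith
  next
    case False
    have AI: "A \<subseteq> {0..<1}" using A(1) by (simp add: sets_lebI_iff)
    have "\<forall>s\<in>A. \<forall>t\<in>A. u s - u t \<le> D' s t + e"
    proof (intro ballI)
      fix s t assume "s \<in> A" "t \<in> A"
      then have "\<bar>u s - u t\<bar> \<le> D s t" "\<bar>D s t - D' s t\<bar> \<le> e" using LfD[OF u] AI A(3) by blast+
      then show "u s - u t \<le> D' s t + e" by linarith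
    qed
    then obtain v where v: "v \<in> Lf D'" "\<forall>s\<in>A. v s \<le> u s \<and> u s - e \<le> v s"
      by (rule Lf_extend[OF D' False AI])
    have "dev u v e \<le> e" by (rule dev_le_outside[OF A(1,2)]) (use v(2) in fastforce)
    with v(1) show ?thesis by blast
  qed
qed

lemma concle_trans:
  assumes "pm D1" "pm D2" "pm D3" "concle D1 D2 a" "concle D2 D3 b"
  shows "concle D1 D3 (a + b)"
  unfolding concle_def
proof
  fix u assume u: "u \<in> Lf D1"
  obtain v where v: "v \<in> Lf D2" "dev u v a \<le> a" using assms(4) u unfolding concle_def by blast
  obtain w where w: "w \<in> Lf D3" "dev v w b \<le> b" using assms(5) v(1) unfolding concle_def by blast
  have "dev u w (a + b) \<le> dev u v a + dev v w b"
    by (rule dev_trans) (use Lf_measurable assms u v w in blast)+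
  then show "\<exists>v\<in>Lf D3. dev u v (a + b) \<le> a + b" using v w by (intro bexI[OF _ w(1)]) linarith
qed

lemma concle_mono:
  assumes "pm D" "pm D'" "concle D D' e" "e \<le> e'"
  shows "concle D D' e'"
  unfolding concle_def
proof
  fix u assume u: "u \<in> Lf D"
  obtain v where v: "v \<in> Lf D'" "dev u v e \<le> e" using assms(3) u unfolding concle_def by blast
  have "dev u v e' \<le> dev u v e"
    by (rule dev_mono[OF Lf_measurable[OF assms(1) u] Lf_measurable[OF assms(2) v(1)] assms(4)])
  then show "\<exists>v\<in>Lf D'. dev u v e' \<le> e'" using v assms(4) by (intro bexI[OF _ v(1)]) linarith
qed

text \<open>A function that is 1-Lipschitz for the pullback takes equal values at points with the
  same \<alpha>-image, so it factors through the range of \<alpha>, from which McShane extension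
  continues it. That range may be any set, as the extension asks for no measurability.\<close>

lemma concle_mp:
  assumes D: "pm D" and D': "pm D'" and c: "concle D D' e" and \<alpha>: "mp \<alpha>"
  shows "concle (\<lambda>s t. D (\<alpha> s) (\<alpha> t)) (\<lambda>s t. D' (\<alpha> s) (\<alpha> t)) e"
  unfolding concle_def
proof
  fix u assume u: "u \<in> Lf (\<lambda>s t. D (\<alpha> s) (\<alpha> t))"
  have r: "\<alpha> s \<in> {0..<1}" if "s \<in> {0..<1}" for s using mp_range[OF \<alpha>] that by auto
  define A where "A = \<alpha> ` {0..<1}"
  have "\<forall>a\<in>A. \<exists>s\<in>{0..<1}. \<alpha> s = a" by (auto simp: A_def)
  then obtain g where g: "\<forall>a\<in>A. g a \<in> {0..<1} \<and> \<alpha> (g a) = a" by metis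
  have "\<forall>a\<in>A. \<forall>b\<in>A. u (g a) - u (g b) \<le> D a b + 0"
  proof (intro ballI)
    fix a b assume "a \<in> A" "b \<in> A"
    then have "\<bar>u (g a) - u (g b)\<bar> \<le> D (\<alpha> (g a)) (\<alpha> (g b))" "\<alpha> (g a) = a" "\<alpha> (g b) = b"
      using LfD[OF u] g by blast+
    then show "u (g a) - u (g b) \<le> D a b + 0" by simp
  qed
  moreover have "A \<noteq> {}" "A \<subseteq> {0..<1}" using r by (auto simp: A_def)
  ultimately obtain w where w: "w \<in> Lf D" "\<forall>a\<in>A. w a \<le> u (g a) \<and> u (g a) - 0 \<le> w a"
    using Lf_extend[OF D, of A "\<lambda>a. u (g a)" 0] by metis
  have wu: "w (\<alpha> s) = u s" if s: "s \<in> {0..<1}" for s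
  proof -
    have a: "\<alpha> s \<in> A" using s by (simp add: A_def)
    then have gs: "g (\<alpha> s) \<in> {0..<1}" "\<alpha> (g (\<alpha> s)) = \<alpha> s" using g by blast+
    have "\<bar>u (g (\<alpha> s)) - u s\<bar> \<le> D (\<alpha> (g (\<alpha> s))) (\<alpha> s)" by (rule LfD[OF u gs(1) s])
    also have "\<dots> = 0" using gs(2) pmD(2)[OF D r[OF s]] by simp
    finally show ?thesis using w(2)[rule_format, OF a] by linarith
  qed
  obtain v where v: "v \<in> Lf D'" "dev w v e \<le> e" using c w(1) unfolding concle_def by blast
  have "(\<lambda>s. v (\<alpha> s)) \<in> Lf (\<lambda>s t. D' (\<alpha> s) (\<alpha> t))"
    using LfD[OF v(1)] r unfolding Lf_def by blast
  moreover have "dev u (\<lambda>s. v (\<alpha> s)) e \<le> e"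
  proof -
    have "{t \<in> {0..<1}. \<bar>u t - v (\<alpha> t)\<bar> > e} = \<alpha> -` {t \<in> {0..<1}. \<bar>w t - v t\<bar> > e} \<inter> {0..<1}"
    proof (rule set_eqI)
      fix t
      show "t \<in> {t \<in> {0..<1}. \<bar>u t - v (\<alpha> t)\<bar> > e} \<longleftrightarrow>
          t \<in> \<alpha> -` {t \<in> {0..<1}. \<bar>w t - v t\<bar> > e} \<inter> {0..<1}"
        using wu[of t] r[of t] by (cases "t \<in> {0..<1}") auto
    qed
    then have "dev u (\<lambda>s. v (\<alpha> s)) e = dev w v e"
      unfolding dev_def
      using mp_measure[OF \<alpha> dev_sets[OF Lf_measurable[OF D w(1)] Lf_measurable[OF D' v(1)]], of e] by simp
    then show ?thesis using v(2) by simp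
  qed
  ultimately show "\<exists>v\<in>Lf (\<lambda>s t. D' (\<alpha> s) (\<alpha> t)). dev u v e \<le> e" by blast
qed

section \<open>Hausdorff and Ky Fan distances\<close>

lemma hausdorff_le:
  assumes "A \<noteq> {}" "B \<noteq> {}" and nn: "\<forall>a\<in>A. \<forall>b\<in>B. 0 \<le> \<delta> a b"
    and "\<forall>a\<in>A. \<exists>b\<in>B. \<delta> a b \<le> e" "\<forall>b\<in>B. \<exists>a\<in>A. \<delta> a b \<le> e"
  shows "hausdorff_dist \<delta> A B \<le> e"
  unfolding hausdorff_dist_def
proof (rule max.boundedI)
  show "(SUP a\<in>A. INF b\<in>B. \<delta> a b) \<le> e"
  proof (rule cSUP_least[OF assms(1)])
    fix a assume a: "a \<in> A"
    then obtain b where b: "b \<in> B" "\<delta> a b \<le> e" using assms(4) by blast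
    have "bdd_below (\<delta> a ` B)" using nn a by (intro bdd_belowI[of _ 0]) auto
    then show "(INF b\<in>B. \<delta> a b) \<le> e" using b by (rule cINF_lower2)
  qed
  show "(SUP b\<in>B. INF a\<in>A. \<delta> a b) \<le> e"
  proof (rule cSUP_least[OF assms(2)])
    fix b assume b: "b \<in> B"
    then obtain a where a: "a \<in> A" "\<delta> a b \<le> e" using assms(5) by blast
    have "bdd_below ((\<lambda>a. \<delta> a b) ` A)" using nn b by (intro bdd_belowI[of _ 0]) auto
    then show "(INF a\<in>A. \<delta> a b) \<le> e" using a by (rule cINF_lower2)
  qed
qed

lemma hausdorff_nonneg:
  assumes "A \<noteq> {}" "B \<noteq> {}" and nn: "\<forall>a\<in>A. \<forall>b\<in>B. 0 \<le> \<delta> a b \<and> \<delta> a b \<le> c"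
  shows "0 \<le> hausdorff_dist \<delta> A B"
proof -
  obtain a where a: "a \<in> A" using assms by blast
  obtain b where b: "b \<in> B" using assms by blast
  have bd: "bdd_below (\<delta> a' ` B)" if "a' \<in> A" for a' using nn that by (intro bdd_belowI[of _ 0]) auto
  have "bdd_above ((\<lambda>a. INF b\<in>B. \<delta> a b) ` A)"
  proof (rule bdd_aboveI[of _ c], clarify)
    fix a' assume "a' \<in> A"
    then have "(INF b\<in>B. \<delta> a' b) \<le> \<delta> a' b" using bd b by (intro cINF_lower) 
    then show "(INF b\<in>B. \<delta> a' b) \<le> c" using nn \<open>a' \<in> A\<close> b by force
  qed
  then have "(INF b\<in>B. \<delta> a b) \<le> (SUP a\<in>A. INF b\<in>B. \<delta> a b)" by (rule cSUP_upper[OF a])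
  moreover have "0 \<le> (INF b\<in>B. \<delta> a b)" by (rule cINF_greatest[OF assms(2)]) (use nn a in blast)
  ultimately show ?thesis unfolding hausdorff_dist_def by simp
qed

text \<open>Suprema and infima are those of the reals, which have their intended meaning only for
  nonempty bounded families; the bound \<open>c\<close> supplies this.\<close>

lemma hausdorff_less1:
  assumes "B \<noteq> {}" and nn: "\<forall>a\<in>A. \<forall>b\<in>B. 0 \<le> \<delta> a b \<and> \<delta> a b \<le> c"
    and h: "hausdorff_dist \<delta> A B < e" and a: "a \<in> A"
  shows "\<exists>b\<in>B. \<delta> a b < e"
proof -
  have bd: "bdd_below (\<delta> a' ` B)" if "a' \<in> A" for a' using nn that by (intro bdd_belowI[of _ 0]) auto
  obtain b where b: "b \<in> B" using assms by blast
  have "bdd_above ((\<lambda>a. INF b\<in>B. \<delta> a b) ` A)"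
  proof (rule bdd_aboveI[of _ c], clarify)
    fix a' assume "a' \<in> A"
    then have "(INF b\<in>B. \<delta> a' b) \<le> \<delta> a' b" using bd b by (intro cINF_lower) 
    then show "(INF b\<in>B. \<delta> a' b) \<le> c" using nn \<open>a' \<in> A\<close> b by force
  qed
  then have "(INF b\<in>B. \<delta> a b) \<le> (SUP a\<in>A. INF b\<in>B. \<delta> a b)" by (rule cSUP_upper[OF a])
  then have "(INF b\<in>B. \<delta> a b) < e" using h unfolding hausdorff_dist_def by simp
  then show ?thesis using cINF_less_iff[OF assms(1) bd[OF a]] by blast
qed

lemma hausdorff_commute: "hausdorff_dist \<delta> A B = hausdorff_dist (\<lambda>b a. \<delta> a b) B A"
  by (simp add: hausdorff_dist_def max.commute)

lemma hausdorff_less2: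
  assumes "A \<noteq> {}" and nn: "\<forall>a\<in>A. \<forall>b\<in>B. 0 \<le> \<delta> a b \<and> \<delta> a b \<le> c"
    and h: "hausdorff_dist \<delta> A B < e" and b: "b \<in> B"
  shows "\<exists>a\<in>A. \<delta> a b < e"
  using hausdorff_less1[OF assms(1) _ h[unfolded hausdorff_commute[of \<delta>]] b] nn by blast

lemma ky_fan_alt: "ky_fan u v = Inf {e. e \<ge> 0 \<and> dev u v e \<le> e}"
proof -
  have "measure lebI {t \<in> {0..<1}. \<bar>u t - v t\<bar> > e} = measure lborel {t \<in> {0..<1}. \<bar>u t - v t\<bar> > e}" for e
    by (rule measure_lebI) auto
  then show ?thesis unfolding ky_fan_def dev_def by simp
qed

lemma ky_fan_le: "0 \<le> e \<Longrightarrow> dev u v e \<le> e \<Longrightarrow> ky_fan u v \<le> e"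
  unfolding ky_fan_alt by (rule cInf_lower) (auto intro: bdd_belowI[of _ 0])

lemma ky_fan_bounds: "0 \<le> ky_fan u v" "ky_fan u v \<le> 1"
proof -
  have "dev u v 1 \<le> 1" unfolding dev_def by (rule lebI.prob_le_1)
  then show "ky_fan u v \<le> 1" by (intro ky_fan_le) simp
  show "0 \<le> ky_fan u v"
    unfolding ky_fan_alt
    by (rule cInf_greatest) (use \<open>dev u v 1 \<le> 1\<close> in \<open>auto intro!: exI[of _ 1]\<close>)
qed

lemma ky_fan_less:
  assumes "u \<in> borel_measurable lebI" "v \<in> borel_measurable lebI" "ky_fan u v < e"
  shows "dev u v e \<le> e"
proof -
  have "{e. e \<ge> 0 \<and> dev u v e \<le> e} \<noteq> {}"
  proof -
    have "dev u v 1 \<le> 1" unfolding dev_def by (rule lebI.prob_le_1)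
    then show ?thesis by (auto intro!: exI[of _ 1])
  qed
  then obtain e' where "0 \<le> e'" "dev u v e' \<le> e'" "e' < e"
    using cInf_lessD[of "{e. e \<ge> 0 \<and> dev u v e \<le> e}" e] assms(3) unfolding ky_fan_alt by blast
  then show ?thesis using dev_mono[OF assms(1,2), of e' e] by linarith
qed

section \<open>Both distances in terms of realizations\<close>

definition obsC :: "real mm set \<Rightarrow> real mm set \<Rightarrow> real" where
  "obsC C C' = obs_dist (rep C) (rep C')"

lemma boxC_alt:
  "boxC C C' = Inf {e. e \<ge> 0 \<and> (\<exists>\<phi> \<psi>. parameter (rep C) \<phi> \<and> parameter (rep C') \<psi> \<and>
     boxle (\<lambda>s t. dst (rep C) (\<phi> s) (\<phi> t)) (\<lambda>s t. dst (rep C') (\<psi> s) (\<psi> t)) e)}"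
proof -
  have "(\<exists>\<phi> \<psi> I0. parameter (rep C) \<phi> \<and> parameter (rep C') \<psi> \<and>
      I0 \<in> sets borel \<and> I0 \<subseteq> {0..<1} \<and> 1 - e \<le> measure lborel I0 \<and>
      (\<forall>s\<in>I0. \<forall>t\<in>I0. \<bar>dst (rep C) (\<phi> s) (\<phi> t) - dst (rep C') (\<psi> s) (\<psi> t)\<bar> \<le> e)) \<longleftrightarrow>
    (\<exists>\<phi> \<psi>. parameter (rep C) \<phi> \<and> parameter (rep C') \<psi> \<and>
     boxle (\<lambda>s t. dst (rep C) (\<phi> s) (\<phi> t)) (\<lambda>s t. dst (rep C') (\<psi> s) (\<psi> t)) e)" for e
    unfolding boxle_def Bex_def sets_lebI_iff using measure_lebI by metis
  then show ?thesis by (simp add: boxC_def box_dist_def split_beta)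
qed

lemma boxC_le:
  assumes "rz C D" "rz C' D'" "boxle D D' e" "0 \<le> e"
  shows "boxC C C' \<le> e"
proof -
  obtain \<phi> J where \<phi>: "parameter (rep C) \<phi>" "full J" "\<forall>s\<in>J. \<forall>t\<in>J. D s t = dst (rep C) (\<phi> s) (\<phi> t)"
    using assms(1) unfolding rz_def by blast
  obtain \<psi> J' where \<psi>: "parameter (rep C') \<psi>" "full J'" "\<forall>s\<in>J'. \<forall>t\<in>J'. D' s t = dst (rep C') (\<psi> s) (\<psi> t)"
    using assms(2) unfolding rz_def by blast
  have "boxle (\<lambda>s t. dst (rep C) (\<phi> s) (\<phi> t)) D 0"
    by (rule boxle_full[OF \<phi>(2)]) (use \<phi>(3) in auto)
  moreover have "boxle D' (\<lambda>s t. dst (rep C') (\<psi> s) (\<psi> t)) 0"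
    by (rule boxle_full[OF \<psi>(2)]) (use \<psi>(3) in auto)
  ultimately have "boxle (\<lambda>s t. dst (rep C) (\<phi> s) (\<phi> t)) (\<lambda>s t. dst (rep C') (\<psi> s) (\<psi> t)) (0 + e + 0)"
    using boxle_trans assms(3) by blast
  then show ?thesis
    unfolding boxC_alt using \<phi>(1) \<psi>(1) assms(4)
    by (intro cInf_lower bdd_belowI[of _ 0]) auto
qed

text \<open>At error 1 the empty set is admissible, so the infimum ranges over a nonempty set and
  never exceeds 1.\<close>

lemma box_set_nonempty:
  assumes "C \<in> mmX" "C' \<in> mmX"
  shows "1 \<in> {e. e \<ge> 0 \<and> (\<exists>\<phi> \<psi>. parameter (rep C) \<phi> \<and> parameter (rep C') \<psi> \<and>
     boxle (\<lambda>s t. dst (rep C) (\<phi> s) (\<phi> t)) (\<lambda>s t. dst (rep C') (\<psi> s) (\<psi> t)) (e::real))}"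
proof -
  obtain \<phi> where \<phi>: "parameter (rep C) \<phi>"
    using mm.param_exists[of "rep C"] rep_props(1)[OF assms(1)] unfolding mm_def by blast
  obtain \<psi> where \<psi>: "parameter (rep C') \<psi>"
    using mm.param_exists[of "rep C'"] rep_props(1)[OF assms(2)] unfolding mm_def by blast
  have "boxle (\<lambda>s t. dst (rep C) (\<phi> s) (\<phi> t)) (\<lambda>s t. dst (rep C') (\<psi> s) (\<psi> t)) 1"
    by (rule boxleI[of "{}"]) auto
  then show ?thesis using \<phi> \<psi> by auto
qed

text \<open>The realizations depend on the pair of classes, so in a triangle inequality the middle
  class occurs with two different ones.\<close>

lemma boxC_less:
  assumes "C \<in> mmX" "C' \<in> mmX" "boxC C C' < e"
  shows "\<exists>D D'. pm D \<and> pm D' \<and> rz C D \<and> rz C' D' \<and> boxle D D' e"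
proof -
  obtain e' \<phi> \<psi> where e: "e' < e" "parameter (rep C) \<phi>" "parameter (rep C') \<psi>"
     "boxle (\<lambda>s t. dst (rep C) (\<phi> s) (\<phi> t)) (\<lambda>s t. dst (rep C') (\<psi> s) (\<psi> t)) e'"
    using cInf_lessD[OF _ assms(3)[unfolded boxC_alt]] box_set_nonempty[OF assms(1,2)] by blast
  have "boxle (\<lambda>s t. dst (rep C) (\<phi> s) (\<phi> t)) (\<lambda>s t. dst (rep C') (\<psi> s) (\<psi> t)) e"
    by (rule boxle_mono[OF e(4)]) (use e(1) in simp)
  then show ?thesis using rz_param[OF assms(1) e(2)] rz_param[OF assms(2) e(3)] by blast
qed

lemma boxC_bounds:
  assumes "C \<in> mmX" "C' \<in> mmX"
  shows "0 \<le> boxC C C'" "boxC C C' \<le> 1"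
proof -
  show "0 \<le> boxC C C'"
    unfolding boxC_alt
  proof (rule cInf_greatest)
    show "{e. e \<ge> 0 \<and> (\<exists>\<phi> \<psi>. parameter (rep C) \<phi> \<and> parameter (rep C') \<psi> \<and>
     boxle (\<lambda>s t. dst (rep C) (\<phi> s) (\<phi> t)) (\<lambda>s t. dst (rep C') (\<psi> s) (\<psi> t)) (e::real))} \<noteq> {}"
      using box_set_nonempty[OF assms] by blast
  qed blast
  show "boxC C C' \<le> 1"
    unfolding boxC_alt by (rule cInf_lower[OF box_set_nonempty[OF assms]]) (auto intro: bdd_belowI[of _ 0])
qed

lemma lip_pull_measurable:
  assumes S: "mm_space S" and f: "lip1_fun S f" and \<phi>: "parameter S \<phi>"
  shows "f \<circ> \<phi> \<in> borel_measurable lebI"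
proof -
  interpret mm S by unfold_locales fact
  have "f \<in> borel_measurable (msr S)" by (rule lip1_measurable) (use f in \<open>auto simp: lip1_fun_alt\<close>)
  then show ?thesis using \<phi> unfolding parameter_alt by (auto intro: measurable_comp)
qed

lemma lip_pull_Lf:
  assumes S: "mm_space S" and f: "lip1_fun S f" and \<phi>: "parameter S \<phi>" and D: "pm D"
    and J: "full J" "\<forall>s\<in>J. \<forall>t\<in>J. D s t = dst S (\<phi> s) (\<phi> t)"
  obtains u where "u \<in> Lf D" "\<forall>s\<in>J. u s = f (\<phi> s)"
proof -
  interpret mm S by unfold_locales fact
  have JI: "J \<subseteq> {0..<1}" "J \<noteq> {}" using full_subset[OF J(1)] full_nonempty[OF J(1)] by auto
  have "\<forall>s\<in>J. \<forall>t\<in>J. f (\<phi> s) - f (\<phi> t) \<le> D s t + 0"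
  proof (intro ballI)
    fix s t assume st: "s \<in> J" "t \<in> J"
    then have "\<phi> s \<in> car S" "\<phi> t \<in> car S" using param_car[OF \<phi>] JI by auto
    then have "\<bar>f (\<phi> s) - f (\<phi> t)\<bar> \<le> dst S (\<phi> s) (\<phi> t)" using f by (simp add: lip1_fun_alt)
    then show "f (\<phi> s) - f (\<phi> t) \<le> D s t + 0" using J(2) st by simp
  qed
  then obtain u where "u \<in> Lf D" "\<forall>s\<in>J. u s \<le> f (\<phi> s) \<and> f (\<phi> s) - 0 \<le> u s"
    using Lf_extend[OF D JI(2,1), of "\<lambda>s. f (\<phi> s)" 0] by metis
  then show ?thesis using that by force
qed

lemma Lf_push_lip:
  assumes S: "mm_space S" and \<phi>: "parameter S \<phi>" and u: "u \<in> Lf D"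
    and J: "full J" "\<forall>s\<in>J. \<forall>t\<in>J. D s t = dst S (\<phi> s) (\<phi> t)"
  obtains f where "lip1_fun S f" "\<forall>s\<in>J. f (\<phi> s) = u s"
proof -
  interpret mm S by unfold_locales fact
  have JI: "J \<subseteq> {0..<1}" "J \<noteq> {}" using full_subset[OF J(1)] full_nonempty[OF J(1)] by auto
  show ?thesis
  proof (rule mcshane[of J \<phi> "car S" "dst S" u 0])
    fix F assume F: "\<And>x y. x \<in> car S \<Longrightarrow> y \<in> car S \<Longrightarrow> \<bar>F x - F y\<bar> \<le> dst S x y"
      "\<And>i. i \<in> J \<Longrightarrow> F (\<phi> i) \<le> u i" "\<And>i. i \<in> J \<Longrightarrow> u i - 0 \<le> F (\<phi> i)"
    show thesis
    proof (rule that[of F])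
      show "lip1_fun S F" using F(1) by (simp add: lip1_fun_alt)
      show "\<forall>s\<in>J. F (\<phi> s) = u s" using F(2,3) by force
    qed
  next
    fix i j assume ij: "i \<in> J" "j \<in> J"
    then have "\<bar>u i - u j\<bar> \<le> D i j" using LfD[OF u] JI by blast
    then show "u i - u j \<le> dst S (\<phi> i) (\<phi> j) + 0" using J(2) ij by simp
  qed (use JI param_car[OF \<phi>] triangle commute in auto)
qed

lemma dev_full_cong:
  assumes "full J" "\<forall>s\<in>J. u s = u' s \<and> v s = v' s"
    "u \<in> borel_measurable lebI" "v \<in> borel_measurable lebI"
    "u' \<in> borel_measurable lebI" "v' \<in> borel_measurable lebI"
  shows "dev u v e = dev u' v' e"
proof -
  have "{t \<in> {0..<1}. \<bar>u t - v t\<bar> > e} \<inter> J = {t \<in> {0..<1}. \<bar>u' t - v' t\<bar> > e} \<inter> J"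
    using assms(2) by auto
  then show ?thesis
    unfolding dev_def using measure_full_Int[OF assms(1) dev_sets[OF assms(3,4)], of e]
      measure_full_Int[OF assms(1) dev_sets[OF assms(5,6)], of e] by simp
qed

lemma lip1_zero: "mm_space S \<Longrightarrow> lip1_fun S (\<lambda>_. 0)"
  using Metric_space.nonneg[of "car S" "dst S"] by (simp add: lip1_fun_alt mm_space_alt)

lemma obs_haus_nonneg:
  assumes "mm_space S" "mm_space T"
  shows "0 \<le> hausdorff_dist ky_fan {f \<circ> \<phi> | f. lip1_fun S f} {g \<circ> \<psi> | g. lip1_fun T g}"
  by (rule hausdorff_nonneg[where c=1]) (use lip1_zero assms ky_fan_bounds in blast)+

lemma obsC_bdd:
  assumes "C \<in> mmX" "C' \<in> mmX"
  shows "bdd_below {hausdorff_dist ky_fan {f \<circ> \<phi> | f. lip1_fun (rep C) f} {g \<circ> \<psi> | g. lip1_fun (rep C') g}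
                      | \<phi> \<psi>. parameter (rep C) \<phi> \<and> parameter (rep C') \<psi>}"
  by (rule bdd_belowI[of _ 0]) (use obs_haus_nonneg[OF rep_props(1)[OF assms(1)] rep_props(1)[OF assms(2)]] in blast)

text \<open>A function on \<open>S\<close> is pulled back to the interval, matched there by
  \<open>concle\<close>, and pushed to \<open>T\<close>. Both orders of the arguments of
  \<open>ky_fan\<close> are recorded, one for each side of the Hausdorff distance.\<close>

lemma obs_one_side:
  assumes S: "mm_space S" and T: "mm_space T" and \<phi>: "parameter S \<phi>" and \<psi>: "parameter T \<psi>"
    and D: "pm D" and D': "pm D'" and c: "concle D D' e" "0 \<le> e"
    and J: "full J" "\<forall>s\<in>J. \<forall>t\<in>J. D s t = dst S (\<phi> s) (\<phi> t)"
    and J': "full J'" "\<forall>s\<in>J'. \<forall>t\<in>J'. D' s t = dst T (\<psi> s) (\<psi> t)"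
    and f: "lip1_fun S f"
  shows "\<exists>g. lip1_fun T g \<and> ky_fan (f \<circ> \<phi>) (g \<circ> \<psi>) \<le> e \<and> ky_fan (g \<circ> \<psi>) (f \<circ> \<phi>) \<le> e"
proof -
  obtain u where u: "u \<in> Lf D" "\<forall>s\<in>J. u s = f (\<phi> s)"
    by (rule lip_pull_Lf[OF S f \<phi> D J])
  obtain v where v: "v \<in> Lf D'" "dev u v e \<le> e" using c u unfolding concle_def by blast
  obtain g where g: "lip1_fun T g" "\<forall>s\<in>J'. g (\<psi> s) = v s"
    by (rule Lf_push_lip[OF T \<psi> v(1) J'])
  have "dev (f \<circ> \<phi>) (g \<circ> \<psi>) e = dev u v e"
    by (rule dev_full_cong[OF full_Int[OF J(1) J'(1)]])
      (use u g Lf_measurable[OF D u(1)] Lf_measurable[OF D' v(1)]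
        lip_pull_measurable[OF S f \<phi>] lip_pull_measurable[OF T g(1) \<psi>] in auto)
  then have "ky_fan (f \<circ> \<phi>) (g \<circ> \<psi>) \<le> e" "ky_fan (g \<circ> \<psi>) (f \<circ> \<phi>) \<le> e"
    using ky_fan_le[OF c(2)] v(2) dev_sym by metis+
  with g(1) show ?thesis by blast
qed

lemma obsC_le:
  assumes C: "rz C D" and C': "rz C' D'" and D: "pm D" and D': "pm D'" 
    and "concle D D' e" "concle D' D e" "0 \<le> e"
  shows "obsC C C' \<le> e"
proof -
  obtain \<phi> J where \<phi>: "parameter (rep C) \<phi>" and J: "full J" "\<forall>s\<in>J. \<forall>t\<in>J. D s t = dst (rep C) (\<phi> s) (\<phi> t)"
    using C unfolding rz_def by blast
  obtain \<psi> J' where \<psi>: "parameter (rep C') \<psi>" and J': "full J'" "\<forall>s\<in>J'. \<forall>t\<in>J'. D' s t = dst (rep C') (\<psi> s) (\<psi> t)"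
    using C' unfolding rz_def by blast
  note r = rep_props(1)[OF rz_mmX[OF C]] and r' = rep_props(1)[OF rz_mmX[OF C']]
  let ?A = "{f \<circ> \<phi> | f. lip1_fun (rep C) f}" and ?B = "{g \<circ> \<psi> | g. lip1_fun (rep C') g}"
  have "hausdorff_dist ky_fan ?A ?B \<le> e"
  proof (rule hausdorff_le)
    show "?A \<noteq> {}" "?B \<noteq> {}" using lip1_zero r r' by blast+
    show "\<forall>a\<in>?A. \<forall>b\<in>?B. 0 \<le> ky_fan a b" using ky_fan_bounds by blast
    show "\<forall>a\<in>?A. \<exists>b\<in>?B. ky_fan a b \<le> e"
      using obs_one_side[OF r r' \<phi> \<psi> D D' assms(5,7) J J'] by blast
    show "\<forall>b\<in>?B. \<exists>a\<in>?A. ky_fan a b \<le> e"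
      using obs_one_side[OF r' r \<psi> \<phi> D' D assms(6,7) J' J] by blast
  qed
  then show ?thesis
    unfolding obsC_def obs_dist_def using \<phi> \<psi>
    by (intro cInf_lower2[OF _ _ obsC_bdd[OF rz_mmX[OF C] rz_mmX[OF C']]]) blast+
qed

lemma obsC_ge0:
  assumes "C \<in> mmX" "C' \<in> mmX" shows "0 \<le> obsC C C'"
proof -
  obtain \<phi> where \<phi>: "parameter (rep C) \<phi>"
    using mm.param_exists[of "rep C"] rep_props(1)[OF assms(1)] unfolding mm_def by blast
  obtain \<psi> where \<psi>: "parameter (rep C') \<psi>"
    using mm.param_exists[of "rep C'"] rep_props(1)[OF assms(2)] unfolding mm_def by blast
  show ?thesis unfolding obsC_def obs_dist_def
    by (rule cInf_greatest) (use \<phi> \<psi> obs_haus_nonneg[OF rep_props(1)[OF assms(1)] rep_props(1)[OF assms(2)]] in blast)+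
qed

lemma obsC_less:
  assumes C: "C \<in> mmX" and C': "C' \<in> mmX" and l: "obsC C C' < e"
  shows "\<exists>D D'. pm D \<and> pm D' \<and> rz C D \<and> rz C' D' \<and> concle D D' e \<and> concle D' D e"
proof -
  note r = rep_props(1)[OF C] and r' = rep_props(1)[OF C']
  obtain \<phi>0 where \<phi>0: "parameter (rep C) \<phi>0" using mm.param_exists[of "rep C"] r unfolding mm_def by blast
  obtain \<psi>0 where \<psi>0: "parameter (rep C') \<psi>0" using mm.param_exists[of "rep C'"] r' unfolding mm_def by blast
  let ?A = "\<lambda>\<phi>. {f \<circ> \<phi> | f. lip1_fun (rep C) f}" and ?B = "\<lambda>\<psi>. {g \<circ> \<psi> | g. lip1_fun (rep C') g}"
  have "\<exists>x\<in>{hausdorff_dist ky_fan (?A \<phi>) (?B \<psi>) | \<phi> \<psi>. parameter (rep C) \<phi> \<and> parameter (rep C') \<psi>}. x < e"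
    using cInf_lessD[OF _ l[unfolded obsC_def obs_dist_def]] \<phi>0 \<psi>0 by blast
  then obtain \<phi> \<psi> where \<phi>: "parameter (rep C) \<phi>" and \<psi>: "parameter (rep C') \<psi>"
    and h: "hausdorff_dist ky_fan (?A \<phi>) (?B \<psi>) < e" by blast
  let ?D = "\<lambda>s t. dst (rep C) (\<phi> s) (\<phi> t)" and ?D' = "\<lambda>s t. dst (rep C') (\<psi> s) (\<psi> t)"
  have ne: "?A \<phi> \<noteq> {}" "?B \<psi> \<noteq> {}" using lip1_zero r r' by blast+
  have kb: "\<forall>a\<in>?A \<phi>. \<forall>b\<in>?B \<psi>. 0 \<le> ky_fan a b \<and> ky_fan a b \<le> 1" using ky_fan_bounds by blast
  note D = rz_param[OF C \<phi>] and D' = rz_param[OF C' \<psi>]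
  interpret S: mm "rep C" by unfold_locales (rule r)
  interpret T: mm "rep C'" by unfold_locales (rule r')
  have "concle ?D ?D' e"
    unfolding concle_def
  proof
    fix u assume u: "u \<in> Lf ?D"
    obtain f where f: "lip1_fun (rep C) f" "\<forall>s\<in>{0..<1}. f (\<phi> s) = u s"
      by (rule Lf_push_lip[OF r \<phi> u full_I]) auto
    obtain b where "b \<in> ?B \<psi>" "ky_fan (f \<circ> \<phi>) b < e"
      using hausdorff_less1[OF ne(2) kb h, of "f \<circ> \<phi>"] f(1) by blast
    then obtain g where g: "lip1_fun (rep C') g" "ky_fan (f \<circ> \<phi>) (g \<circ> \<psi>) < e" by blast
    obtain v where v: "v \<in> Lf ?D'" "\<forall>s\<in>{0..<1}. v s = g (\<psi> s)"
      by (rule lip_pull_Lf[OF r' g(1) \<psi> D'(1) full_I]) auto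
    have "dev (f \<circ> \<phi>) (g \<circ> \<psi>) e \<le> e"
      by (rule ky_fan_less[OF lip_pull_measurable[OF r f(1) \<phi>] lip_pull_measurable[OF r' g(1) \<psi>] g(2)])
    moreover have "dev (f \<circ> \<phi>) (g \<circ> \<psi>) e = dev u v e"
      by (rule dev_full_cong[OF full_I]) (use f v Lf_measurable[OF D(1) u] Lf_measurable[OF D'(1) v(1)]
        lip_pull_measurable[OF r f(1) \<phi>] lip_pull_measurable[OF r' g(1) \<psi>] in auto)
    ultimately show "\<exists>v\<in>Lf ?D'. dev u v e \<le> e" using v(1) by auto
  qed
  moreover have "concle ?D' ?D e"
    unfolding concle_def
  proof
    fix u assume u: "u \<in> Lf ?D'"
    obtain f where f: "lip1_fun (rep C') f" "\<forall>s\<in>{0..<1}. f (\<psi> s) = u s"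
      by (rule Lf_push_lip[OF r' \<psi> u full_I]) auto
    obtain b where "b \<in> ?A \<phi>" "ky_fan b (f \<circ> \<psi>) < e"
      using hausdorff_less2[OF ne(1) kb h, of "f \<circ> \<psi>"] f(1) by blast
    then obtain g where g: "lip1_fun (rep C) g" "ky_fan (g \<circ> \<phi>) (f \<circ> \<psi>) < e" by blast
    obtain v where v: "v \<in> Lf ?D" "\<forall>s\<in>{0..<1}. v s = g (\<phi> s)"
      by (rule lip_pull_Lf[OF r g(1) \<phi> D(1) full_I]) auto
    have "dev (g \<circ> \<phi>) (f \<circ> \<psi>) e \<le> e"
      by (rule ky_fan_less[OF lip_pull_measurable[OF r g(1) \<phi>] lip_pull_measurable[OF r' f(1) \<psi>] g(2)])
    moreover have "dev (g \<circ> \<phi>) (f \<circ> \<psi>) e = dev v u e"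
      by (rule dev_full_cong[OF full_I]) (use f v Lf_measurable[OF D'(1) u] Lf_measurable[OF D(1) v(1)]
        lip_pull_measurable[OF r' f(1) \<psi>] lip_pull_measurable[OF r g(1) \<phi>] in auto)
    ultimately show "\<exists>v\<in>Lf ?D. dev u v e \<le> e" using v(1) dev_sym by metis
  qed
  ultimately show ?thesis using D D' by blast
qed

text \<open>The common mechanism behind the triangle inequalities of both distances.\<close>

locale class_dist =
  fixes R :: "(real \<Rightarrow> real \<Rightarrow> real) \<Rightarrow> (real \<Rightarrow> real \<Rightarrow> real) \<Rightarrow> real \<Rightarrow> bool"
    and \<delta> :: "real mm set \<Rightarrow> real mm set \<Rightarrow> real"
  assumes dist_le: "rz C D \<Longrightarrow> rz C' D' \<Longrightarrow> pm D \<Longrightarrow> pm D' \<Longrightarrow> R D D' e \<Longrightarrow> 0 \<le> e \<Longrightarrow> \<delta> C C' \<le> e"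
    and dist_less: "C \<in> mmX \<Longrightarrow> C' \<in> mmX \<Longrightarrow> \<delta> C C' < e \<Longrightarrow>
      \<exists>D D'. pm D \<and> pm D' \<and> rz C D \<and> rz C' D' \<and> R D D' e"
    and dist_nonneg: "C \<in> mmX \<Longrightarrow> C' \<in> mmX \<Longrightarrow> 0 \<le> \<delta> C C'"
    and R_trans: "pm D1 \<Longrightarrow> pm D2 \<Longrightarrow> pm D3 \<Longrightarrow> R D1 D2 a \<Longrightarrow> R D2 D3 b \<Longrightarrow> R D1 D3 (a + b)"
    and R_mp: "pm D \<Longrightarrow> pm D' \<Longrightarrow> mp \<alpha> \<Longrightarrow> R D D' e \<Longrightarrow> R (\<lambda>s t. D (\<alpha> s) (\<alpha> t)) (\<lambda>s t. D' (\<alpha> s) (\<alpha> t)) e"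
    and R_box: "pm D \<Longrightarrow> pm D' \<Longrightarrow> boxle D D' e \<Longrightarrow> R D D' e"
    and R_sym: "R D D' e \<Longrightarrow> R D' D e"
begin

lemma dist_zero:
  assumes C: "C \<in> mmX" shows "\<delta> C C = 0"
proof -
  obtain D where D: "pm D" "rz C D" by (rule rz_exists[OF C])
  have "R D D 0" by (rule R_box[OF D(1) D(1) boxle_full[OF full_I]]) auto
  then show ?thesis using dist_le[OF D(2,2,1,1)] dist_nonneg[OF C C] by force
qed

lemma dist_sym_le:
  assumes C: "C \<in> mmX" "C' \<in> mmX" shows "\<delta> C' C \<le> \<delta> C C'"
proof (rule field_le_epsilon)
  fix e :: real assume "0 < e"
  then obtain D D' where "pm D" "pm D'" "rz C D" "rz C' D'" "R D D' (\<delta> C C' + e)"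
    using dist_less[OF C, of "\<delta> C C' + e"] by auto
  then show "\<delta> C' C \<le> \<delta> C C' + e"
    using dist_le R_sym dist_nonneg[OF C] \<open>0 < e\<close> by simp
qed

lemma dist_sym: "C \<in> mmX \<Longrightarrow> C' \<in> mmX \<Longrightarrow> \<delta> C' C = \<delta> C C'"
  by (intro antisym dist_sym_le)

text \<open>The two realizations of the middle class are rearranged to differ by at most a third of
  \<open>e\<close>; the relation \<open>R\<close> survives the same rearrangements on the outer
  classes.\<close>

lemma dist_triangle:
  assumes C: "C1 \<in> mmX" "C2 \<in> mmX" "C3 \<in> mmX" 
  shows "\<delta> C1 C3 \<le> \<delta> C1 C2 + \<delta> C2 C3"
proof (rule field_le_epsilon)
  fix e :: real assume e: "0 < e"
  define a where "a = \<delta> C1 C2 + e / 3"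
  define b where "b = \<delta> C2 C3 + e / 3"
  obtain D1 D2 where 1: "pm D1" "pm D2" "rz C1 D1" "rz C2 D2" "R D1 D2 a"
    using dist_less[OF C(1,2), of a] e by (auto simp: a_def)
  obtain D2' D3 where 2: "pm D2'" "pm D3" "rz C2 D2'" "rz C3 D3" "R D2' D3 b"
    using dist_less[OF C(2,3), of b] e by (auto simp: b_def)
  have e3: "e / 3 > 0" using e by simp
  obtain \<alpha> \<beta> J where g: "mp \<alpha>" "mp \<beta>" "full J"
    "\<forall>s\<in>J. \<forall>t\<in>J. \<bar>D2 (\<alpha> s) (\<alpha> t) - D2' (\<beta> s) (\<beta> t)\<bar> \<le> e / 3"
    by (rule rz_glue[OF 1(4) 2(3) e3])
  note p = pm_mp[OF 1(1) g(1)] pm_mp[OF 1(2) g(1)] pm_mp[OF 2(1) g(2)] pm_mp[OF 2(2) g(2)]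
  have "R (\<lambda>s t. D2 (\<alpha> s) (\<alpha> t)) (\<lambda>s t. D2' (\<beta> s) (\<beta> t)) (e / 3)"
    by (rule R_box[OF p(2,3) boxle_full[OF g(3,4)]]) (use e in simp)
  then have "R (\<lambda>s t. D1 (\<alpha> s) (\<alpha> t)) (\<lambda>s t. D2' (\<beta> s) (\<beta> t)) (a + e / 3)"
    by (rule R_trans[OF p(1-3) R_mp[OF 1(1,2) g(1) 1(5)]])
  then have "R (\<lambda>s t. D1 (\<alpha> s) (\<alpha> t)) (\<lambda>s t. D3 (\<beta> s) (\<beta> t)) (a + e / 3 + b)"
    by (rule R_trans[OF p(1,3,4) _ R_mp[OF 2(1,2) g(2) 2(5)]])
  then have "\<delta> C1 C3 \<le> a + e / 3 + b"
    by (rule dist_le[OF rz_mp[OF 1(3) g(1)] rz_mp[OF 2(4) g(2)] p(1,4)])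
      (use dist_nonneg[OF C(1,2)] dist_nonneg[OF C(2,3)] e in \<open>simp add: a_def b_def\<close>)
  then show "\<delta> C1 C3 \<le> \<delta> C1 C2 + \<delta> C2 C3 + e" by (simp add: a_def b_def)
qed

end

section \<open>Box and observable distance as instances\<close>

interpretation box: class_dist boxle boxC
proof
  show "\<And>C C' e. C \<in> mmX \<Longrightarrow> C' \<in> mmX \<Longrightarrow> boxC C C' < e \<Longrightarrow>
      \<exists>D D'. pm D \<and> pm D' \<and> rz C D \<and> rz C' D' \<and> boxle D D' e" by (rule boxC_less)
qed (auto intro: boxC_le boxC_bounds boxle_trans boxle_mp boxle_sym)

interpretation obs: class_dist "\<lambda>D D' e. concle D D' e \<and> concle D' D e" obsC
proof
  show "\<And>C C' e. C \<in> mmX \<Longrightarrow> C' \<in> mmX \<Longrightarrow> obsC C C' < e \<Longrightarrow>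
      \<exists>D D'. pm D \<and> pm D' \<and> rz C D \<and> rz C' D' \<and> concle D D' e \<and> concle D' D e" by (rule obsC_less)
  show "concle D1 D3 (a + b) \<and> concle D3 D1 (a + b)" 
    if "pm D1" "pm D2" "pm D3" "concle D1 D2 a \<and> concle D2 D1 a" "concle D2 D3 b \<and> concle D3 D2 b" for D1 D2 D3 a b
    using concle_trans[OF that(1-3), of a b] concle_trans[OF that(3,2,1), of b a] that(4,5) by (simp add: add.commute)
  show "concle D D' e \<and> concle D' D e" if "pm D" "pm D'" "boxle D D' e" for D D' e
    using boxle_concle[OF that] boxle_concle[OF that(2,1) boxle_sym[OF that(3)]] by simp
qed (auto intro: obsC_le obsC_ge0 concle_mp)

lemma obsC_le_boxC:
  assumes C: "C \<in> mmX" "C' \<in> mmX" shows "obsC C C' \<le> boxC C C'"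
proof (rule field_le_epsilon)
  fix e :: real assume "0 < e"
  then obtain D D' where D: "pm D" "pm D'" "rz C D" "rz C' D'" "boxle D D' (boxC C C' + e)"
    using boxC_less[OF C, of "boxC C C' + e"] by auto
  show "obsC C C' \<le> boxC C C' + e"
    by (rule obsC_le[OF D(3,4,1,2) boxle_concle[OF D(1,2,5)] boxle_concle[OF D(2,1) boxle_sym[OF D(5)]]])
      (use boxC_bounds(1)[OF C] \<open>0 < e\<close> in simp)
qed

section \<open>Topologies of pseudo-metrics and paths\<close>

definition dist_topology :: "'a set \<Rightarrow> ('a \<Rightarrow> 'a \<Rightarrow> real) \<Rightarrow> 'a topology" where
  "dist_topology M \<delta> = topology (\<lambda>U. U \<subseteq> M \<and> (\<forall>x\<in>U. \<exists>e>0. \<forall>y\<in>M. \<delta> x y < e \<longrightarrow> y \<in> U))"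

locale pseudo_dist =
  fixes M :: "'a set" and \<delta> :: "'a \<Rightarrow> 'a \<Rightarrow> real"
  assumes pzero: "x \<in> M \<Longrightarrow> \<delta> x x = 0"
    and psym: "x \<in> M \<Longrightarrow> y \<in> M \<Longrightarrow> \<delta> x y = \<delta> y x"
    and ptri: "x \<in> M \<Longrightarrow> y \<in> M \<Longrightarrow> z \<in> M \<Longrightarrow> \<delta> x z \<le> \<delta> x y + \<delta> y z"
begin

abbreviation T where "T \<equiv> dist_topology M \<delta>"

lemma openin_T: "openin T U \<longleftrightarrow> U \<subseteq> M \<and> (\<forall>x\<in>U. \<exists>e>0. \<forall>y\<in>M. \<delta> x y < e \<longrightarrow> y \<in> U)"
proof -
  have "istopology (\<lambda>U. U \<subseteq> M \<and> (\<forall>x\<in>U. \<exists>e>0. \<forall>y\<in>M. \<delta> x y < e \<longrightarrow> y \<in> U))"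
    unfolding istopology_def
  proof (intro conjI allI impI)
    fix S U assume S: "S \<subseteq> M \<and> (\<forall>x\<in>S. \<exists>e>0. \<forall>y\<in>M. \<delta> x y < e \<longrightarrow> y \<in> S)"
      and U: "U \<subseteq> M \<and> (\<forall>x\<in>U. \<exists>e>0. \<forall>y\<in>M. \<delta> x y < e \<longrightarrow> y \<in> U)"
    show "S \<inter> U \<subseteq> M" using S by blast
    show "\<forall>x\<in>S \<inter> U. \<exists>e>0. \<forall>y\<in>M. \<delta> x y < e \<longrightarrow> y \<in> S \<inter> U"
    proof
      fix x assume x: "x \<in> S \<inter> U"
      obtain e where "e > 0" "\<forall>y\<in>M. \<delta> x y < e \<longrightarrow> y \<in> S" using S x by blast
      moreover obtain e' where "e' > 0" "\<forall>y\<in>M. \<delta> x y < e' \<longrightarrow> y \<in> U" using U x by blast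
      ultimately show "\<exists>e>0. \<forall>y\<in>M. \<delta> x y < e \<longrightarrow> y \<in> S \<inter> U"
        by (intro exI[of _ "min e e'"]) simp
    qed
  next
    fix K assume K: "\<forall>U\<in>K. U \<subseteq> M \<and> (\<forall>x\<in>U. \<exists>e>0. \<forall>y\<in>M. \<delta> x y < e \<longrightarrow> y \<in> U)"
    then show "\<Union>K \<subseteq> M" by blast
    show "\<forall>x\<in>\<Union>K. \<exists>e>0. \<forall>y\<in>M. \<delta> x y < e \<longrightarrow> y \<in> \<Union>K"
    proof
      fix x assume "x \<in> \<Union>K"
      then obtain U where U: "U \<in> K" "x \<in> U" by blast
      then obtain e where "e > 0" "\<forall>y\<in>M. \<delta> x y < e \<longrightarrow> y \<in> U" using K by blast
      then show "\<exists>e>0. \<forall>y\<in>M. \<delta> x y < e \<longrightarrow> y \<in> \<Union>K" using U(1) by blast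
    qed
  qed
  then show ?thesis unfolding dist_topology_def by (simp add: topology_inverse')
qed

lemma topspace_T: "topspace T = M"
proof -
  have "openin T M" unfolding openin_T by (auto intro: exI[of _ 1])
  then have "M \<subseteq> topspace T" by (rule openin_subset)
  moreover have "topspace T \<subseteq> M" using openin_topspace[of T] unfolding openin_T by blast
  ultimately show ?thesis by blast
qed

definition bal :: "'a \<Rightarrow> real \<Rightarrow> 'a set" where "bal x e = {y \<in> M. \<delta> x y < e}"

lemma openin_bal: "x \<in> M \<Longrightarrow> openin T (bal x e)"
  unfolding openin_T
proof (intro conjI ballI)
  fix y assume x: "x \<in> M" and y: "y \<in> bal x e"
  have "z \<in> bal x e" if "z \<in> M" "\<delta> y z < e - \<delta> x y" for z
    using ptri[OF x _ that(1), of y] y that by (simp add: bal_def)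
  then show "\<exists>d>0. \<forall>z\<in>M. \<delta> y z < d \<longrightarrow> z \<in> bal x e"
    using y by (intro exI[of _ "e - \<delta> x y"]) (auto simp: bal_def)
qed (auto simp: bal_def)

definition pcont :: "(real \<Rightarrow> 'a) \<Rightarrow> bool" where
  "pcont g \<longleftrightarrow> (\<forall>t\<in>{0..1}. g t \<in> M) \<and>
    (\<forall>t\<in>{0..1}. \<forall>e>0. \<exists>r>0. \<forall>s\<in>{0..1}. \<bar>s - t\<bar> < r \<longrightarrow> \<delta> (g t) (g s) < e)"

lemma pcont_pathin: assumes g: "pcont g" shows "pathin T g"
  unfolding pathin_def continuous_map_def
proof (intro conjI allI impI)
  show "g \<in> topspace (top_of_set {0..1}) \<rightarrow> topspace T"
    using g unfolding pcont_def topspace_T by auto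
  fix U assume U: "openin T U"
  show "openin (top_of_set {0..1}) {x \<in> topspace (top_of_set {0..1}). g x \<in> U}"
    unfolding openin_euclidean_subtopology_iff
  proof (intro conjI ballI)
    fix t assume "t \<in> {x \<in> topspace (top_of_set {0..1}). g x \<in> U}"
    then have t: "t \<in> {0..1}" "g t \<in> U" by auto
    obtain e where e: "e > 0" "\<forall>y\<in>M. \<delta> (g t) y < e \<longrightarrow> y \<in> U" using U t(2) unfolding openin_T by blast
    obtain r where r: "r > 0" "\<forall>s\<in>{0..1}. \<bar>s - t\<bar> < r \<longrightarrow> \<delta> (g t) (g s) < e"
      using g t(1) e(1) unfolding pcont_def by blast
    have "g s \<in> U" if "s \<in> {0..1}" "dist s t < r" for s
      using that r(2) e(2) g unfolding pcont_def by (simp add: dist_real_def)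
    then show "\<exists>r>0. \<forall>s\<in>{0..1}. dist s t < r \<longrightarrow> s \<in> {x \<in> topspace (top_of_set {0..1}). g x \<in> U}"
      using r(1) by (intro exI[of _ r]) auto
  qed auto
qed

lemma pcont_component:
  assumes "pcont g" "\<forall>t\<in>{0..1}. g t \<in> V" "g 0 = x" "g 1 = y"
  shows "path_component_of (subtopology T V) x y"
  unfolding path_component_of_def pathin_subtopology
  using assms pcont_pathin by (intro exI[of _ g]) auto

text \<open>It suffices to join every nearby point to the centre inside a prescribed ball:
  connectedness im kleinen at every point implies local path connectedness.\<close>

lemma locally_path_connected_T:
  assumes *: "\<And>x e. x \<in> M \<Longrightarrow> e > 0 \<Longrightarrow>
    \<exists>d>0. \<forall>y\<in>M. \<delta> x y < d \<longrightarrow> path_component_of (subtopology T (bal x e)) x y"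
  shows "locally_path_connected_space T"
  unfolding locally_path_connected_space_im_kleinen
proof (intro allI impI, elim conjE)
  fix V x assume V: "openin T V" "x \<in> V"
  then have xM: "x \<in> M" unfolding openin_T by blast
  obtain e where e: "e > 0" "\<forall>y\<in>M. \<delta> x y < e \<longrightarrow> y \<in> V" using V unfolding openin_T by blast
  then have bV: "bal x e \<subseteq> V" by (auto simp: bal_def)
  obtain d where d: "d > 0" "\<forall>y\<in>M. \<delta> x y < d \<longrightarrow> path_component_of (subtopology T (bal x e)) x y"
    using *[OF xM e(1)] by blast
  have "\<exists>C. path_connectedin T C \<and> C \<subseteq> V \<and> x \<in> C \<and> y \<in> C" if y: "y \<in> bal x (min d e)" for y
  proof -
    have "path_component_of (subtopology T (bal x e)) x y" using y d(2) by (auto simp: bal_def)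
    then obtain g where g: "pathin T g" "\<forall>t\<in>{0..1}. g t \<in> bal x e" "g 0 = x" "g 1 = y"
      unfolding path_component_of_def pathin_subtopology by auto
    have "path_connectedin T (g ` {0..1})" by (rule path_connectedin_path_image[OF g(1)])
    moreover have "g 0 \<in> g ` {0..1}" "g 1 \<in> g ` {0..1}" by auto
    moreover have "g ` {0..1} \<subseteq> V" using g(2) bV by blast
    ultimately show ?thesis using g(3,4) by blast
  qed
  moreover have "x \<in> bal x (min d e)" using xM d(1) e(1) pzero by (simp add: bal_def)
  moreover have "bal x (min d e) \<subseteq> V" using bV by (auto simp: bal_def)
  ultimately show "\<exists>U. openin T U \<and> x \<in> U \<and> U \<subseteq> V \<and>
      (\<forall>y\<in>U. \<exists>C. path_connectedin T C \<and> C \<subseteq> V \<and> x \<in> C \<and> y \<in> C)"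
    using openin_bal[OF xM] by blast
qed

end

text \<open>The \<open>n\<close>-th path runs over the interval from \<open>n\<close> to
  \<open>n + 1\<close>. Continuity on an initial interval is extended piece by piece, pasting at the
  common integer.\<close>

lemma halfline_concat:
  assumes g: "\<And>n. pathin X (g n)" "\<And>n. g n 1 = g (Suc n) (0::real)"
  defines "h \<equiv> \<lambda>x::real. g (nat \<lfloor>x\<rfloor>) (x - real_of_int \<lfloor>x\<rfloor>)"
  shows "continuous_map (top_of_set {0..real n}) X h"
proof (induction n)
  case 0
  have "continuous_map (top_of_set {0}) X h"
    unfolding continuous_map_def
  proof (intro conjI allI impI)
    have "g 0 0 \<in> topspace X" using g(1)[of 0] unfolding pathin_def continuous_map_def by auto
    then show "h \<in> topspace (top_of_set {0}) \<rightarrow> topspace X" by (auto simp: h_def)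
    fix U assume "openin X U"
    have "{x \<in> topspace (top_of_set {0::real}). h x \<in> U} = {0} \<or> {x \<in> topspace (top_of_set {0::real}). h x \<in> U} = {}"
      by auto
    then show "openin (top_of_set {0}) {x \<in> topspace (top_of_set {0}). h x \<in> U}"
    proof (elim disjE)
      assume eq: "{x \<in> topspace (top_of_set {0::real}). h x \<in> U} = {0}"
      show ?thesis unfolding eq using openin_topspace[of "top_of_set {0::real}"] by simp
    next
      assume eq: "{x \<in> topspace (top_of_set {0::real}). h x \<in> U} = {}"
      show ?thesis unfolding eq by (rule openin_empty)
    qed
  qed
  then show ?case by simp
next
  case (Suc n)
  let ?Z = "top_of_set {0..real (Suc n)}"
  have sub: "subtopology ?Z {x \<in> topspace ?Z. x \<le> real n} = top_of_set {0..real n}"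
    unfolding subtopology_subtopology by (rule arg_cong[where f="subtopology euclidean"]) auto
  have sub2: "subtopology ?Z {x \<in> topspace ?Z. real n \<le> x} = top_of_set {real n..real (Suc n)}"
    unfolding subtopology_subtopology by (rule arg_cong[where f="subtopology euclidean"]) auto
  have c2: "continuous_map (top_of_set {real n..real (Suc n)}) X (\<lambda>x. g n (x - real n))"
  proof -
    have "continuous_map (top_of_set {real n..real (Suc n)}) (top_of_set {0..1}) (\<lambda>x. x - real n)"
      by (auto simp: continuous_map_in_subtopology intro!: continuous_intros)
    then have "continuous_map (top_of_set {real n..real (Suc n)}) X (g n \<circ> (\<lambda>x. x - real n))"
      by (rule continuous_map_compose[OF _ g(1)[of n, unfolded pathin_def]])
    then show ?thesis by (simp only: comp_def)
  qed
  have hn: "h (real n) = g n 0" for n by (simp add: h_def)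
  have "continuous_map ?Z X (\<lambda>x. if x \<le> real n then h x else g n (x - real n))"
  proof (rule continuous_map_cases_le)
    show "continuous_map (subtopology ?Z {x \<in> topspace ?Z. x \<le> real n}) X h" unfolding sub by (rule Suc)
    show "continuous_map (subtopology ?Z {x \<in> topspace ?Z. real n \<le> x}) X (\<lambda>x. g n (x - real n))"
      unfolding sub2 by (rule c2)
    show "h x = g n (x - real n)" if "x = real n" for x using hn[of n] that by simp
  qed (auto intro!: continuous_intros)
  then show ?case
  proof (rule continuous_map_eq)
    fix x assume "x \<in> topspace ?Z"
    then have x: "0 \<le> x" "x \<le> real n + 1" by auto
    show "(if x \<le> real n then h x else g n (x - real n)) = h x"
    proof (cases "x \<le> real n")
      case False
      show ?thesis
      proof (cases "x = real n + 1")
        case True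
        then have "x = real (Suc n)" by simp
        then show ?thesis using hn[of "Suc n"] g(2)[of n] by simp
      next
        case neq: False
        then have "\<lfloor>x\<rfloor> = int n" using False x by (simp add: floor_eq_iff)
        then show ?thesis using False by (simp add: h_def)
      qed
    qed simp
  qed
qed

text \<open>The half-line is compressed by \<open>t / (1 - t)\<close>; continuity at the added end
  point is precisely the assumption that the pieces eventually lie in each neighbourhood of
  \<open>p\<close>.\<close>

lemma infinite_concat:
  assumes g: "\<And>n. pathin X (g n)" "\<And>n. g n 1 = g (Suc n) (0::real)"
    and V: "\<And>n t. t \<in> {0..1} \<Longrightarrow> g n t \<in> V" "p \<in> V" "p \<in> topspace X"
    and conv: "\<And>U. openin X U \<Longrightarrow> p \<in> U \<Longrightarrow> \<exists>N. \<forall>n\<ge>N. \<forall>t\<in>{0..1}. g n t \<in> U"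
  shows "path_component_of (subtopology X V) (g 0 0) p"
proof -
  define h where "h x = g (nat \<lfloor>x\<rfloor>) (x - real_of_int \<lfloor>x\<rfloor>)" for x :: real
  have hc: "continuous_map (top_of_set {0..real n}) X h" for n
    using halfline_concat[of X g n, OF g] by (simp add: h_def[abs_def])
  define G where "G t = (if t < 1 then h (t / (1 - t)) else p)" for t :: real
  have fr: "x - real_of_int \<lfloor>x\<rfloor> \<in> {0..1}" for x :: real using floor_correct[of x] by (auto; linarith)
  have htop: "h x \<in> topspace X" for x
    using g(1)[of "nat \<lfloor>x\<rfloor>"] fr[of x] unfolding pathin_def continuous_map_def h_def by auto
  have "pathin X G"
    unfolding pathin_def continuous_map_def
  proof (intro conjI allI impI)
    show "G \<in> topspace (top_of_set {0..1}) \<rightarrow> topspace X" using htop V(3) by (auto simp: G_def)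
    fix U assume U: "openin X U"
    show "openin (top_of_set {0..1}) {x \<in> topspace (top_of_set {0..1}). G x \<in> U}"
      unfolding openin_euclidean_subtopology_iff
    proof (intro conjI ballI)
      fix t assume "t \<in> {x \<in> topspace (top_of_set {0..1}). G x \<in> U}"
      then have t: "0 \<le> t" "t \<le> 1" "G t \<in> U" by auto
      show "\<exists>r>0. \<forall>s\<in>{0..1}. dist s t < r \<longrightarrow> s \<in> {x \<in> topspace (top_of_set {0..1}). G x \<in> U}"
      proof (cases "t < 1")
        case True
        obtain n where n: "t / (1 - t) < real n" using reals_Archimedean2 by blast
        \<comment> \<open>The value of \<open>t\<close> at which \<open>t / (1 - t)\<close> equals
          \<open>n\<close>. Up to \<open>b\<close> only finitely many pieces are met, so the result
          on finite intervals applies.\<close>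
        define b where "b = real n / (real n + 1)"
        have b: "t < b" "b < 1" using n True t by (auto simp: b_def field_simps)
        have "continuous_map (top_of_set {0..b}) (top_of_set {0..real n}) (\<lambda>s. s / (1 - s))"
          unfolding continuous_map_in_subtopology
        proof
          show "continuous_map (top_of_set {0..b}) euclidean (\<lambda>s. s / (1 - s))"
            using b by (auto intro!: continuous_intros)
          have "0 \<le> s / (1 - s) \<and> s / (1 - s) \<le> real n" if "0 \<le> s" "s \<le> b" for s
          proof -
            have s1: "s < 1" using that b by linarith
            have "s * (real n + 1) \<le> real n" using that(2) by (simp add: b_def pos_le_divide_eq)
            then have "s \<le> real n * (1 - s)" by (simp add: algebra_simps)
            then show ?thesis using s1 that(1) by (simp add: pos_divide_le_eq)
          qed
          then show "(\<lambda>s. s / (1 - s)) \<in> topspace (top_of_set {0..b}) \<rightarrow> {0..real n}" by auto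
        qed
        then have "continuous_map (top_of_set {0..b}) X (h \<circ> (\<lambda>s. s / (1 - s)))"
          by (rule continuous_map_compose[OF _ hc])
        then have "continuous_map (top_of_set {0..b}) X (\<lambda>s. h (s / (1 - s)))"
          by (simp only: comp_def)
        then have "openin (top_of_set {0..b}) {s \<in> topspace (top_of_set {0..b}). h (s / (1 - s)) \<in> U}"
          using U unfolding continuous_map_def by blast
        moreover have "t \<in> {s \<in> topspace (top_of_set {0..b}). h (s / (1 - s)) \<in> U}"
          using t True b by (simp add: G_def)
        ultimately obtain e where e: "e > 0" 
          "\<And>s. s \<in> {0..b} \<Longrightarrow> dist s t < e \<Longrightarrow> h (s / (1 - s)) \<in> U"
          unfolding openin_euclidean_subtopology_iff by blast
        have "G s \<in> U" if s: "s \<in> {0..1}" "dist s t < min e (b - t)" for s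
        proof -
          have "s < b" using s by (auto simp: dist_real_def)
          then show ?thesis using e(2)[of s] s b by (simp add: G_def)
        qed
        then show ?thesis using e(1) b by (intro exI[of _ "min e (b - t)"]) auto
      next
        case False
        then have "t = 1" "p \<in> U" using t by (auto simp: G_def)
        obtain N where N: "\<forall>n\<ge>N. \<forall>t\<in>{0..1}. g n t \<in> U" using conv[OF U \<open>p \<in> U\<close>] by blast
        have "G s \<in> U" if s: "s \<in> {0..1}" "dist s t < 1 / (real N + 1)" for s
        proof (cases "s < 1")
          case True
          have "1 - s < 1 / (real N + 1)" using s \<open>t = 1\<close> by (auto simp: dist_real_def)
          then have "real N \<le> s / (1 - s)" using True by (simp add: field_simps)
          then have "N \<le> nat \<lfloor>s / (1 - s)\<rfloor>" by (simp add: le_nat_floor)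
          then show ?thesis using N fr True by (simp add: G_def h_def)
        qed (use \<open>p \<in> U\<close> in \<open>simp add: G_def\<close>)
        then show ?thesis by (intro exI[of _ "1 / (real N + 1)"]) auto
      qed
    qed auto
  qed
  moreover have "G t \<in> V" for t using V fr by (auto simp: G_def h_def)
  moreover have "G 0 = g 0 0" "G 1 = p" by (auto simp: G_def h_def)
  ultimately show ?thesis
    unfolding path_component_of_def pathin_subtopology by (intro exI[of _ G]) auto
qed

section \<open>Paths between mm-spaces\<close>

lemma measurable_bound:
  assumes H: "H \<in> borel_measurable lebI" and e: "e > 0"
  obtains K :: real where "K > 0" "{s \<in> {0..<1}. H s \<le> K} \<in> sets lebI" "measure lebI {s \<in> {0..<1}. H s \<le> K} \<ge> 1 - e"
proof -
  have s: "{s \<in> {0..<1}. H s \<le> K} \<in> sets lebI" for K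
    using H unfolding borel_measurable_iff_le space_lebI by blast
  have "(\<lambda>n. measure lebI {s \<in> {0..<1}. H s \<le> real n}) \<longlonglongrightarrow> measure lebI (\<Union>n. {s \<in> {0..<1}. H s \<le> real n})"
    by (rule lebI.finite_Lim_measure_incseq) (use s in \<open>auto simp: incseq_def\<close>)
  moreover have "(\<Union>n. {s \<in> {0..<1}. H s \<le> real n}) = space lebI"
    using real_arch_simple by auto
  ultimately have "(\<lambda>n. measure lebI {s \<in> {0..<1}. H s \<le> real n}) \<longlonglongrightarrow> 1"
    using lebI.prob_space by simp
  then have "\<forall>\<^sub>F n in sequentially. measure lebI {s \<in> {0..<1}. H s \<le> real n} > 1 - e"
    using e by (intro order_tendstoD(1)[of _ 1]) auto
  then obtain n where n: "measure lebI {s \<in> {0..<1}. H s \<le> real n} > 1 - e"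
    by (auto simp: eventually_sequentially)
  have "measure lebI {s \<in> {0..<1}. H s \<le> real n} \<le> measure lebI {s \<in> {0..<1}. H s \<le> real n + 1}"
    by (rule lebI.finite_measure_mono[OF _ s]) auto
  then show ?thesis using that[of "real n + 1"] s n by force
qed

text \<open>The Lipschitz constant in time, \<open>H u + H v\<close>, is unbounded, but off a set of
  measure \<open>e / 2\<close> it is at most \<open>2 * K\<close>. The box distance ignores that
  set, so the radius \<open>e / (4 * K)\<close> works for all times.\<close>

lemma box_lipschitz_family:
  assumes C: "\<forall>t\<in>{0..1}. rz (\<gamma> t) (Dt t)" and H: "H \<in> borel_measurable lebI"
    and lip: "\<forall>s\<in>{0..1}. \<forall>t\<in>{0..1}. \<forall>u\<in>{0..<1}. \<forall>v\<in>{0..<1}. \<bar>Dt s u v - Dt t u v\<bar> \<le> \<bar>s - t\<bar> * (H u + H v)"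
    and e: "e > (0::real)"
  shows "\<exists>r>0. \<forall>s\<in>{0..1}. \<forall>t\<in>{0..1}. \<bar>s - t\<bar> < r \<longrightarrow> boxC (\<gamma> t) (\<gamma> s) < e"
proof -
  obtain K where K: "K > 0" "{s \<in> {0..<1}. H s \<le> K} \<in> sets lebI" "measure lebI {s \<in> {0..<1}. H s \<le> K} \<ge> 1 - e / 2"
    by (rule measurable_bound[OF H half_gt_zero[OF e]])
  have "boxC (\<gamma> t) (\<gamma> s) < e" if st: "s \<in> {0..1}" "t \<in> {0..1}" "\<bar>s - t\<bar> < e / (4 * K)" for s t
  proof -
    have "boxle (Dt t) (Dt s) (e / 2)"
    proof (rule boxleI[OF K(2,3)], intro ballI)
      fix u v assume uv: "u \<in> {s \<in> {0..<1}. H s \<le> K}" "v \<in> {s \<in> {0..<1}. H s \<le> K}"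
      have "\<bar>Dt s u v - Dt t u v\<bar> \<le> \<bar>s - t\<bar> * (H u + H v)" using lip st uv by blast
      also have "\<dots> \<le> \<bar>s - t\<bar> * (2 * K)" by (rule mult_left_mono) (use uv in auto)
      also have "\<dots> \<le> (e / (4 * K)) * (2 * K)" by (rule mult_right_mono) (use st K in auto)
      also have "\<dots> = e / 2" using K by simp
      finally show "\<bar>Dt t u v - Dt s u v\<bar> \<le> e / 2" by linarith
    qed
    then have "boxC (\<gamma> t) (\<gamma> s) \<le> e / 2" by (intro boxC_le) (use C st e in auto)
    then show ?thesis using e by linarith
  qed
  then show ?thesis using K e by (intro exI[of _ "e / (4 * K)"]) auto
qed

lemma interval0: "(0::real) \<in> {0..<1}" by simp

lemma pm_interpolate:
  assumes "pm D" "pm D'" "t \<in> {0..1}"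
  shows "pm (\<lambda>u v. (1 - t) * D u v + t * D' u v)"
  by (rule pm_add[OF pm_scale pm_scale]) (use assms in auto)

lemma boxle_interpolate:
  assumes b: "boxle D D' e" and t: "t \<in> {0..1}"
  shows "boxle D (\<lambda>u v. (1 - t) * D u v + t * D' u v) e"
proof -
  obtain I0 where I0: "I0 \<in> sets lebI" "measure lebI I0 \<ge> 1 - e" "\<forall>u\<in>I0. \<forall>v\<in>I0. \<bar>D u v - D' u v\<bar> \<le> e"
    using b unfolding boxle_def by blast
  show ?thesis
  proof (rule boxleI[OF I0(1,2)], intro ballI)
    fix u v assume "u \<in> I0" "v \<in> I0"
    then have i: "\<bar>D u v - D' u v\<bar> \<le> e" using I0(3) by blast
    have "D u v - ((1 - t) * D u v + t * D' u v) = t * (D u v - D' u v)" by (simp add: algebra_simps)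
    then have "\<bar>D u v - ((1 - t) * D u v + t * D' u v)\<bar> = t * \<bar>D u v - D' u v\<bar>" using t by (simp add: abs_mult)
    also have "\<dots> \<le> 1 * \<bar>D u v - D' u v\<bar>" by (rule mult_right_mono) (use t in auto)
    finally show "\<bar>D u v - ((1 - t) * D u v + t * D' u v)\<bar> \<le> e" using i by simp
  qed
qed

lemma interpolation_path:
  assumes D: "pm D" "rz C D" and D': "pm D'" "rz C' D'"
  obtains \<gamma> where "\<gamma> 0 = C" "\<gamma> 1 = C'"
    "\<forall>t\<in>{0..1}. rz (\<gamma> t) (\<lambda>u v. (1 - t) * D u v + t * D' u v)"
    "\<forall>e>0. \<exists>r>0. \<forall>s\<in>{0..1}. \<forall>t\<in>{0..1}. \<bar>s - t\<bar> < r \<longrightarrow> boxC (\<gamma> t) (\<gamma> s) < e"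
proof -
  define Dt where "Dt t u v = (1 - t) * D u v + t * D' u v" for t u v
  have "\<forall>t\<in>{0..1}. \<exists>E. rz E (Dt t)"
    using rz_ex[OF pm_interpolate[OF D(1) D'(1)]] unfolding Dt_def by metis
  then obtain \<gamma> where \<gamma>: "\<forall>t\<in>{0..1}. rz (\<gamma> t) (Dt t)" by metis
  have e0: "\<gamma> 0 = C" by (rule rz_uniq[OF _ D(2) full_I]) (use \<gamma> in \<open>auto simp: Dt_def\<close>)
  have e1: "\<gamma> 1 = C'" by (rule rz_uniq[OF _ D'(2) full_I]) (use \<gamma> in \<open>auto simp: Dt_def\<close>)
  \<comment> \<open>Distances to the base point 0 bound all distances by the triangle inequality,
    which turns a bound in two variables into a sum of functions of one.\<close>
  define H where "H u = D 0 u + D' 0 u" for u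
  have H: "H \<in> borel_measurable lebI"
    unfolding H_def using pmD(4)[OF D(1) interval0] pmD(4)[OF D'(1) interval0] by (rule borel_measurable_add)
  have tri: "D u v + D' u v \<le> H u + H v" if "u \<in> {0..<1}" "v \<in> {0..<1}" for u v
    using pmD(3)[OF D(1) that(1) interval0 that(2)] pmD(3)[OF D'(1) that(1) interval0 that(2)]
      pmD(1)[OF D(1) that(1) interval0] pmD(1)[OF D'(1) that(1) interval0] by (simp add: H_def)
  have "\<bar>Dt s u v - Dt t u v\<bar> \<le> \<bar>s - t\<bar> * (H u + H v)" if "u \<in> {0..<1}" "v \<in> {0..<1}" for s t u v
  proof -
    have "Dt s u v - Dt t u v = (s - t) * (D' u v - D u v)" by (simp add: Dt_def algebra_simps)
    then have "\<bar>Dt s u v - Dt t u v\<bar> = \<bar>s - t\<bar> * \<bar>D' u v - D u v\<bar>" by (simp add: abs_mult)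
    also have "\<dots> \<le> \<bar>s - t\<bar> * (H u + H v)"
    proof (rule mult_left_mono)
      show "\<bar>D' u v - D u v\<bar> \<le> H u + H v"
        using tri[OF that] pm_nonneg[OF D(1) that] pm_nonneg[OF D'(1) that] by linarith
    qed simp
    finally show ?thesis .
  qed
  then have "\<forall>e>0. \<exists>r>0. \<forall>s\<in>{0..1}. \<forall>t\<in>{0..1}. \<bar>s - t\<bar> < r \<longrightarrow> boxC (\<gamma> t) (\<gamma> s) < e"
    using box_lipschitz_family[OF \<gamma> H] by blast
  then show ?thesis by (rule that[OF e0 e1 \<gamma>[unfolded Dt_def]])
qed

text \<open>At time 0 the maximum is \<open>D'\<close> by nonnegativity; at time 1 it equals
  \<open>D\<close> on \<open>K\<close>, where \<open>D' \<le> D\<close>, which suffices to identify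
  the class. The pseudo-metric grows with \<open>t\<close>, so domination persists along the
  path.\<close>

lemma domination_path:
  assumes D: "pm D" "rz C D" and D': "pm D'" "rz C' D'" 
    and K: "full K" "\<forall>s\<in>K. \<forall>t\<in>K. D' s t \<le> D s t"
  obtains \<gamma> where "\<gamma> 0 = C'" "\<gamma> 1 = C"
    "\<forall>t\<in>{0..1}. rz (\<gamma> t) (\<lambda>u v. max (D' u v) (t * D u v))"
    "\<forall>e>0. \<exists>r>0. \<forall>s\<in>{0..1}. \<forall>t\<in>{0..1}. \<bar>s - t\<bar> < r \<longrightarrow> boxC (\<gamma> t) (\<gamma> s) < e"
proof -
  define Dt where "Dt t u v = max (D' u v) (t * D u v)" for t u v
  have "\<forall>t\<in>{0..1}. \<exists>E. rz E (Dt t)"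
  proof
    fix t :: real assume t: "t \<in> {0..1}"
    have "pm (Dt t)"
      unfolding Dt_def by (rule pm_max[OF D'(1) pm_scale[OF D(1)]]) (use t in simp)
    then show "\<exists>E. rz E (Dt t)" using rz_ex by blast
  qed
  then obtain \<gamma> where \<gamma>: "\<forall>t\<in>{0..1}. rz (\<gamma> t) (Dt t)" by metis
  have e0: "\<gamma> 0 = C'" 
    by (rule rz_uniq[OF _ D'(2) full_I]) (use \<gamma> pm_nonneg[OF D'(1)] in \<open>auto simp: Dt_def\<close>)
  have e1: "\<gamma> 1 = C" 
    by (rule rz_uniq[OF _ D(2) K(1)]) (use \<gamma> K(2) in \<open>auto simp: Dt_def max_def\<close>)
  define H where "H u = D 0 u" for u
  have H: "H \<in> borel_measurable lebI"
    unfolding H_def using pmD(4)[OF D(1) interval0] .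
  have "\<bar>Dt s u v - Dt t u v\<bar> \<le> \<bar>s - t\<bar> * (H u + H v)" if "u \<in> {0..<1}" "v \<in> {0..<1}" for s t u v
  proof -
    have "\<bar>Dt s u v - Dt t u v\<bar> \<le> \<bar>s * D u v - t * D u v\<bar>" by (auto simp: Dt_def max_def abs_if)
    also have "\<dots> = \<bar>s - t\<bar> * D u v" using pm_nonneg[OF D(1) that] by (simp flip: left_diff_distrib add: abs_mult)
    also have "\<dots> \<le> \<bar>s - t\<bar> * (H u + H v)"
    proof (rule mult_left_mono)
      show "D u v \<le> H u + H v"
        using pmD(3)[OF D(1) that(1) interval0 that(2)] pmD(1)[OF D(1) that(1) interval0] by (simp add: H_def)
    qed simp
    finally show ?thesis .
  qed
  then have "\<forall>e>0. \<exists>r>0. \<forall>s\<in>{0..1}. \<forall>t\<in>{0..1}. \<bar>s - t\<bar> < r \<longrightarrow> boxC (\<gamma> t) (\<gamma> s) < e"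
    using box_lipschitz_family[OF \<gamma> H] by blast
  then show ?thesis by (rule that[OF e0 e1 \<gamma>[unfolded Dt_def]])
qed

section \<open>The concentration topology\<close>

text \<open>The sup-norm distance pulled back along \<open>s \<mapsto> (u i s)\<close>: it turns a
  finite family of functions into a finite-dimensional space.\<close>

definition maxdist :: "nat \<Rightarrow> (nat \<Rightarrow> real \<Rightarrow> real) \<Rightarrow> real \<Rightarrow> real \<Rightarrow> real" where
  "maxdist N u s t = linf N (\<lambda>i. u i s) (\<lambda>i. u i t)"

lemma linf_le: "0 \<le> c \<Longrightarrow> \<forall>i<N. \<bar>x i - y i\<bar> \<le> c \<Longrightarrow> linf N x y \<le> c"
  unfolding linf_def by (subst Max_le_iff) auto

lemma linf_ge: "i < N \<Longrightarrow> \<bar>x i - y i\<bar> \<le> linf N x y"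
  unfolding linf_def by (rule Max_ge) auto

lemma linf_nonneg: "0 \<le> linf N x y"
  unfolding linf_def by (rule Max_ge) auto

lemma linf_commute: "linf N x y = linf N y x"
  by (simp add: linf_def abs_minus_commute)

lemma linf_triangle: "linf N x z \<le> linf N x y + linf N y z"
proof (rule linf_le)
  show "0 \<le> linf N x y + linf N y z" using linf_nonneg[of N x y] linf_nonneg[of N y z] by linarith
  show "\<forall>i<N. \<bar>x i - z i\<bar> \<le> linf N x y + linf N y z"
  proof (intro allI impI)
    fix i assume "i < N"
    then show "\<bar>x i - z i\<bar> \<le> linf N x y + linf N y z"
      using linf_ge[of i N x y] linf_ge[of i N y z] by linarith
  qed
qed

lemma linf_self: "linf N x x = 0"
  using linf_le[of 0 N x x] linf_nonneg[of N x x] by simp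

lemma linf_measurable:
  assumes "\<forall>i<N. u i \<in> borel_measurable M"
  shows "(\<lambda>s. linf N x (\<lambda>i. u i s)) \<in> borel_measurable M"
proof (rule borel_measurableI_le)
  fix r
  show "{s \<in> space M. linf N x (\<lambda>i. u i s) \<le> r} \<in> sets M"
  proof (cases "0 \<le> r")
    case True
    have eq: "linf N x (\<lambda>i. u i s) \<le> r \<longleftrightarrow> (\<forall>i\<in>{..<N}. \<bar>x i - u i s\<bar> \<le> r)" for s
    proof
      assume l: "linf N x (\<lambda>i. u i s) \<le> r"
      show "\<forall>i\<in>{..<N}. \<bar>x i - u i s\<bar> \<le> r"
      proof
        fix i assume "i \<in> {..<N}"
        then have "\<bar>x i - u i s\<bar> \<le> linf N x (\<lambda>i. u i s)" using linf_ge[of i N x "\<lambda>i. u i s"] by simp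
        then show "\<bar>x i - u i s\<bar> \<le> r" using l by linarith
      qed
    next
      assume "\<forall>i\<in>{..<N}. \<bar>x i - u i s\<bar> \<le> r"
      then show "linf N x (\<lambda>i. u i s) \<le> r" by (intro linf_le[OF True]) simp
    qed
    show ?thesis
      unfolding eq
    proof (rule sets.sets_Collect_finite_All)
      fix i assume "i \<in> {..<N}"
      then have "(\<lambda>s. \<bar>x i - u i s\<bar>) \<in> borel_measurable M" using assms by auto
      then show "{s \<in> space M. \<bar>x i - u i s\<bar> \<le> r} \<in> sets M" unfolding borel_measurable_iff_le by blast
    qed simp
  next
    case False
    have "\<not> linf N x (\<lambda>i. u i s) \<le> r" for s
      using False linf_nonneg[of N x "\<lambda>i. u i s"] by linarith
    then show ?thesis by simp
  qed
qed

lemma maxdist_le_pm: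
  assumes D: "pm D" and v: "\<forall>i<N. v i \<in> Lf D"
  shows "\<forall>s\<in>{0..<1}. \<forall>t\<in>{0..<1}. maxdist N v s t \<le> D s t"
  unfolding maxdist_def using linf_le pm_nonneg[OF D] LfD v by (metis (no_types, lifting))

lemma pm_maxdist:
  assumes D: "pm D" and v: "\<forall>i<N. v i \<in> Lf D"
  shows "pm (maxdist N v)"
proof (rule pm_dominated[OF D maxdist_le_pm[OF D v]])
  show "\<forall>s\<in>{0..<1}. maxdist N v s \<in> borel_measurable lebI"
  proof
    fix s :: real
    have "(\<lambda>t. linf N (\<lambda>i. v i s) (\<lambda>i. v i t)) \<in> borel_measurable lebI"
      by (rule linf_measurable) (use Lf_measurable[OF D] v in blast)
    then show "maxdist N v s \<in> borel_measurable lebI" by (simp add: maxdist_def[abs_def])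
  qed
qed (auto simp: maxdist_def linf_commute linf_self linf_triangle)

text \<open>The number \<open>N\<close> depends on the class and \<open>e\<close> only, not on the
  realization. This order matters: the closeness threshold is chosen from \<open>N\<close> before a
  nearby class, and with it the realization, is known.\<close>

lemma covering_number:
  assumes C: "C \<in> mmX" and e: "e > (0::real)"
  obtains N :: nat where "0 < N" "\<forall>D. pm D \<longrightarrow> rz C D \<longrightarrow> (\<exists>s. (\<forall>i<N. s i \<in> {0..<1}) \<and>
    {t \<in> {0..<1}. \<exists>i<N. D (s i) t < e} \<in> sets lebI \<and> measure lebI {t \<in> {0..<1}. \<exists>i<N. D (s i) t < e} \<ge> 1 - e)"
proof -
  interpret mm "rep C" by unfold_locales (rule rep_props(1)[OF C])
  obtain x :: "nat \<Rightarrow> real" where x: "\<forall>k. x k \<in> car (rep C)" "\<forall>y\<in>car (rep C). \<forall>e>0. \<exists>k. dst (rep C) (x k) y < e"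
    using dense_seq by blast
  have e2: "e / 2 > 0" using e by simp
  let ?B = "\<lambda>n. \<Union>k<n. mball (x k) (e / 2)"
  have "(\<lambda>n. prob (?B n)) \<longlonglongrightarrow> prob (\<Union>n. ?B n)"
  proof (rule finite_Lim_measure_incseq)
    show "incseq ?B" unfolding incseq_def by (intro allI impI UN_mono) auto
  qed auto
  moreover have "(\<Union>n. ?B n) = space (msr (rep C))"
  proof (intro equalityI subsetI)
    fix y assume "y \<in> space (msr (rep C))"
    then have y: "y \<in> car (rep C)" by simp
    obtain k where "dst (rep C) (x k) y < e / 2" using x(2)[rule_format, OF y e2] by blast
    then have "y \<in> ?B (Suc k)" using x(1) y by auto
    then show "y \<in> (\<Union>n. ?B n)" by blast
  qed (use x in auto)
  ultimately have "(\<lambda>n. prob (?B n)) \<longlonglongrightarrow> 1" using prob_space by simp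
  then have "\<forall>\<^sub>F n in sequentially. prob (?B n) > 1 - e"
    using e by (intro order_tendstoD(1)[of _ 1]) auto
  then obtain n0 where n0: "\<forall>n\<ge>n0. prob (?B n) > 1 - e" by (auto simp: eventually_sequentially)
  define N where "N = Suc n0"
  have N: "prob (?B N) > 1 - e" using n0 by (simp add: N_def)
  have "\<exists>s. (\<forall>i<N. s i \<in> {0..<1}) \<and> {t \<in> {0..<1}. \<exists>i<N. D (s i) t < e} \<in> sets lebI \<and> 
      measure lebI {t \<in> {0..<1}. \<exists>i<N. D (s i) t < e} \<ge> 1 - e" if D: "pm D" "rz C D" for D
  proof -
    obtain \<phi> J where \<phi>: "parameter (rep C) \<phi>" "full J" "\<forall>s\<in>J. \<forall>t\<in>J. D s t = dst (rep C) (\<phi> s) (\<phi> t)"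
      using D(2) unfolding rz_def by blast
    define P where "P i t \<longleftrightarrow> t \<in> J \<and> \<phi> t \<in> mball (x i) (e / 2)" for i t
    \<comment> \<open>A parameter value landing in the \<open>i\<close>-th ball stands in for its
      centre, which itself need not be hit; this doubles the radius \<open>e / 2\<close>. The
      fallback 0 is used only when no good parameter value lands in the ball.\<close>
    define s where "s i = (if \<exists>t. P i t then SOME t. P i t else 0)" for i
    have Ps: "P i (s i)" if "P i t" for i t using that unfolding s_def by (auto intro: someI)
    have sI: "s i \<in> {0..<1}" for i
    proof (cases "\<exists>t. P i t")
      case True
      then have "s i \<in> J" using Ps by (auto simp: P_def)
      then show ?thesis using full_subset[OF \<phi>(2)] by auto
    qed (simp add: s_def)
    have meas: "{t \<in> {0..<1}. \<exists>i<N. D (s i) t < e} \<in> sets lebI"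
    proof -
      have "{t \<in> space lebI. D (s i) t < e} \<in> sets lebI" for i
        using pmD(4)[OF D(1) sI] unfolding borel_measurable_iff_less by blast
      then have "(\<Union>i<N. {t \<in> space lebI. D (s i) t < e}) \<in> sets lebI" by blast
      moreover have "(\<Union>i<N. {t \<in> space lebI. D (s i) t < e}) = {t \<in> {0..<1}. \<exists>i<N. D (s i) t < e}" by auto
      ultimately show ?thesis by simp
    qed
    have Bs: "?B N \<in> events" by auto
    have "1 - e < measure lebI (\<phi> -` ?B N \<inter> {0..<1})" using N param_measure[OF \<phi>(1) Bs] by simp
    also have "\<dots> = measure lebI (\<phi> -` ?B N \<inter> {0..<1} \<inter> J)"
      using measure_full_Int[OF \<phi>(2) param_sets[OF \<phi>(1) Bs]] by simp
    also have "\<dots> \<le> measure lebI {t \<in> {0..<1}. \<exists>i<N. D (s i) t < e}"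
    proof (rule lebI.finite_measure_mono[OF _ meas], intro subsetI)
      fix t assume t: "t \<in> \<phi> -` ?B N \<inter> {0..<1} \<inter> J"
      then obtain i where i: "i < N" "\<phi> t \<in> mball (x i) (e / 2)" by auto
      then have "P i t" using t by (simp add: P_def)
      then have "P i (s i)" by (rule Ps)
      then have si: "s i \<in> J" "\<phi> (s i) \<in> mball (x i) (e / 2)" by (auto simp: P_def)
      have "D (s i) t = dst (rep C) (\<phi> (s i)) (\<phi> t)" using \<phi>(3) si(1) t by simp
      also have "\<dots> \<le> dst (rep C) (x i) (\<phi> (s i)) + dst (rep C) (x i) (\<phi> t)"
        by (rule triangle'') (use si(2) i(2) in auto)
      also have "\<dots> < e" using si(2) i(2) by simp
      finally show "t \<in> {t \<in> {0..<1}. \<exists>i<N. D (s i) t < e}" using i(1) t by auto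
    qed
    finally show ?thesis using sI meas by (intro exI[of _ s]) auto
  qed
  then show ?thesis using that[of N] by (simp add: N_def)
qed

text \<open>If \<open>t\<close> is within \<open>e\<close> of the net point \<open>s i\<close>, then
  \<open>D t t'\<close> differs from the change of the distance to \<open>s i\<close> by at most
  \<open>2 * e\<close>. Replacing the two distances by values of \<open>v i\<close> costs
  \<open>d\<close> each.\<close>

lemma net_boxle:
  assumes D: "pm D" and s: "\<forall>i<N. s i \<in> {0..<1}" and G: "G \<in> sets lebI" "measure lebI G \<ge> 1 - a"
    and cov: "\<forall>t\<in>G. \<exists>i<N. D (s i) t < e" and v: "\<forall>t\<in>G. \<forall>i<N. \<bar>D (s i) t - v i t\<bar> \<le> d"
    and a: "a \<le> 2 * e + 2 * d" "0 \<le> d" "0 < e"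
  shows "boxle D (maxdist N v) (2 * e + 2 * d)"
proof (rule boxleI[OF G(1)])
  show "1 - (2 * e + 2 * d) \<le> measure lebI G" using G(2) a by linarith
  have GI: "G \<subseteq> {0..<1}" using G(1) by (simp add: sets_lebI_iff)
  show "\<forall>t\<in>G. \<forall>t'\<in>G. \<bar>D t t' - maxdist N v t t'\<bar> \<le> 2 * e + 2 * d"
  proof (intro ballI)
    fix t t' assume t: "t \<in> G" "t' \<in> G"
    then have tI: "t \<in> {0..<1}" "t' \<in> {0..<1}" using GI by auto
    have up: "maxdist N v t t' \<le> D t t' + 2 * d"
      unfolding maxdist_def
    proof (rule linf_le)
      show "0 \<le> D t t' + 2 * d" using pm_nonneg[OF D tI] a by linarith
      show "\<forall>i<N. \<bar>v i t - v i t'\<bar> \<le> D t t' + 2 * d"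
      proof (intro allI impI)
        fix i assume i: "i < N"
        have "\<bar>D (s i) t - v i t\<bar> \<le> d" "\<bar>D (s i) t' - v i t'\<bar> \<le> d" using v t i by blast+
        moreover have "\<bar>D (s i) t - D (s i) t'\<bar> \<le> D t t'" using pm_reverse[OF D _ tI] s i by blast
        ultimately show "\<bar>v i t - v i t'\<bar> \<le> D t t' + 2 * d" by linarith
      qed
    qed
    obtain i where i: "i < N" "D (s i) t < e" using cov t by blast
    then have si: "s i \<in> {0..<1}" using s by blast
    have "D t t' \<le> D t (s i) + D (s i) t'" by (rule pmD(3)[OF D tI(1) si tI(2)])
    moreover have "D t (s i) = D (s i) t" by (rule pmD(1)[OF D tI(1) si])
    moreover have "\<bar>D (s i) t - v i t\<bar> \<le> d" "\<bar>D (s i) t' - v i t'\<bar> \<le> d" using v t i(1) by blast+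
    moreover have "\<bar>v i t - v i t'\<bar> \<le> maxdist N v t t'" unfolding maxdist_def using linf_ge[OF i(1)] .
    ultimately have "D t t' \<le> maxdist N v t t' + 2 * e + 2 * d" using i(2) by linarith
    with up show "\<bar>D t t' - maxdist N v t t'\<bar> \<le> 2 * e + 2 * d" using a(3) by linarith
  qed
qed

lemma measure_finite_Int_ge:
  fixes N :: nat
  assumes "\<forall>i<N. A i \<in> sets lebI \<and> measure lebI (A i) \<ge> 1 - d" "B \<in> sets lebI" "measure lebI B \<ge> 1 - e"
  shows "{t \<in> B. \<forall>i<N. t \<in> A i} \<in> sets lebI \<and> measure lebI {t \<in> B. \<forall>i<N. t \<in> A i} \<ge> 1 - (e + real N * d)"
  using assms(1)
proof (induction N)
  case 0 then show ?case using assms by simp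
next
  case (Suc N)
  let ?S = "{t \<in> B. \<forall>i<N. t \<in> A i}"
  have "\<forall>i<N. A i \<in> sets lebI \<and> measure lebI (A i) \<ge> 1 - d"
    using Suc.prems less_SucI by blast
  then have IH: "?S \<in> sets lebI" "measure lebI ?S \<ge> 1 - (e + real N * d)"
    using Suc.IH by blast+
  have A: "A N \<in> sets lebI" "measure lebI (A N) \<ge> 1 - d" using Suc.prems by blast+
  have eq: "{t \<in> B. \<forall>i<Suc N. t \<in> A i} = ?S \<inter> A N" by (auto simp: less_Suc_eq)
  show ?case unfolding eq
  proof
    show "?S \<inter> A N \<in> sets lebI" by (rule sets.Int[OF IH(1) A(1)])
    have "e + real (Suc N) * d = e + real N * d + d" by (simp add: algebra_simps)
    then show "1 - (e + real (Suc N) * d) \<le> measure lebI (?S \<inter> A N)"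
      using measure_Int_ge[OF IH(1) A(1) IH(2) A(2)] by linarith
  qed
qed

section \<open>Paths in the concentration topology\<close>

interpretation obsT: pseudo_dist mmX obsC
  by unfold_locales (auto intro: obs.dist_zero obs.dist_sym obs.dist_triangle)

lemma conc_topology_alt: "conc_topology = dist_topology mmX obsC"
  by (simp add: conc_topology_def dist_topology_def obsC_def)

lemma obs_pcont:
  assumes "\<forall>t\<in>{0..1}. \<gamma> t \<in> mmX"
    "\<forall>e>0. \<exists>r>0. \<forall>s\<in>{0..1}. \<forall>t\<in>{0..1}. \<bar>s - t\<bar> < r \<longrightarrow> boxC (\<gamma> t) (\<gamma> s) < e"
  shows "obsT.pcont \<gamma>"
  unfolding obsT.pcont_def
proof (intro conjI assms(1) ballI allI impI)
  fix t e :: real assume t: "t \<in> {0..1}" and e: "e > 0"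
  obtain r where r: "r > 0" "\<forall>s\<in>{0..1}. \<forall>t\<in>{0..1}. \<bar>s - t\<bar> < r \<longrightarrow> boxC (\<gamma> t) (\<gamma> s) < e"
    using assms(2) e by blast
  have "obsC (\<gamma> t) (\<gamma> s) < e" if s: "s \<in> {0..1}" "\<bar>s - t\<bar> < r" for s
  proof -
    have "boxC (\<gamma> t) (\<gamma> s) < e" using r(2) s t by blast
    moreover have "obsC (\<gamma> t) (\<gamma> s) \<le> boxC (\<gamma> t) (\<gamma> s)" by (rule obsC_le_boxC) (use assms(1) s t in auto)
    ultimately show ?thesis by linarith
  qed
  then show "\<exists>r>0. \<forall>s\<in>{0..1}. \<bar>s - t\<bar> < r \<longrightarrow> obsC (\<gamma> t) (\<gamma> s) < e" using r(1) by blast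
qed

text \<open>The path goes from \<open>C\<close> to an auxiliary class \<open>CE\<close> by
  interpolation, under box control, and from there to \<open>C'\<close> by domination. Only the
  first leg is short in box distance; the second is controlled in observable distance by
  monotonicity of \<open>Lf\<close>.\<close>

lemma conc_local_path:
  assumes C: "C \<in> mmX" and e: "e > 0"
  shows "\<exists>d>0. \<forall>C'\<in>mmX. obsC C C' < d \<longrightarrow>
    path_component_of (subtopology obsT.T (obsT.bal C e)) C C'"
proof -
  \<comment> \<open>Both legs stay within \<open>4 * \<epsilon>\<close> of \<open>C\<close>, which
    is half of \<open>e\<close>.\<close>
  define \<epsilon> where "\<epsilon> = e / 8"
  have \<epsilon>: "\<epsilon> > 0" using e by (simp add: \<epsilon>_def)
  obtain N :: nat where N: "0 < N" "\<forall>D. pm D \<longrightarrow> rz C D \<longrightarrow> (\<exists>s. (\<forall>i<N. s i \<in> {0..<1}) \<and>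
      {t \<in> {0..<1}. \<exists>i<N. D (s i) t < \<epsilon>} \<in> sets lebI \<and> measure lebI {t \<in> {0..<1}. \<exists>i<N. D (s i) t < \<epsilon>} \<ge> 1 - \<epsilon>)"
    by (rule covering_number[OF C \<epsilon>])
  \<comment> \<open>Each of the \<open>N\<close> approximating functions may fail on a set of
    measure \<open>d\<close>; together they lose no more than \<epsilon>.\<close>
  define d where "d = \<epsilon> / real N"
  have d: "0 < d" "d \<le> \<epsilon>" "real N * d = \<epsilon>" 
  proof -
    show "0 < d" "real N * d = \<epsilon>" using N(1) \<epsilon> by (auto simp: d_def)
    have "\<epsilon> / real N \<le> \<epsilon> / 1" by (rule divide_left_mono) (use N(1) \<epsilon> in auto)
    then show "d \<le> \<epsilon>" by (simp add: d_def)
  qed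
  have "path_component_of (subtopology obsT.T (obsT.bal C e)) C C'"
    if C': "C' \<in> mmX" and l: "obsC C C' < d" for C'
  proof -
    obtain D1 D2 where D: "pm D1" "pm D2" "rz C D1" "rz C' D2" and c: "concle D1 D2 d" "concle D2 D1 d"
      using obsC_less[OF C C' l] by blast
    obtain s where s: "\<forall>i<N. s i \<in> {0..<1}" "{t \<in> {0..<1}. \<exists>i<N. D1 (s i) t < \<epsilon>} \<in> sets lebI"
      "measure lebI {t \<in> {0..<1}. \<exists>i<N. D1 (s i) t < \<epsilon>} \<ge> 1 - \<epsilon>"
      using N(2) D(1,3) by blast
    have u: "D1 (s i) \<in> Lf D1" if "i < N" for i
      unfolding Lf_def using pm_reverse[OF D(1)] s(1) that by blast
    have "\<forall>i<N. \<exists>w\<in>Lf D2. dev (D1 (s i)) w d \<le> d" using c(1) u unfolding concle_def by blast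
    then obtain v where v: "\<forall>i<N. v i \<in> Lf D2 \<and> dev (D1 (s i)) (v i) d \<le> d" by metis
    define A where "A i = {t \<in> {0..<1}. \<bar>D1 (s i) t - v i t\<bar> \<le> d}" for i
    have A: "A i \<in> sets lebI \<and> measure lebI (A i) \<ge> 1 - d" if i: "i < N" for i
    proof -
      have B: "{t \<in> {0..<1}. \<bar>D1 (s i) t - v i t\<bar> > d} \<in> sets lebI"
        by (rule dev_sets) (use u[OF i] v i Lf_measurable D in blast)+
      have eq: "A i = space lebI - {t \<in> {0..<1}. \<bar>D1 (s i) t - v i t\<bar> > d}" by (auto simp: A_def)
      show ?thesis unfolding eq using sets.compl_sets[OF B] lebI.prob_compl[OF B] v i by (simp add: dev_def)
    qed
    define G where "G = {t \<in> {t \<in> {0..<1}. \<exists>i<N. D1 (s i) t < \<epsilon>}. \<forall>i<N. t \<in> A i}"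
    have G: "G \<in> sets lebI" "measure lebI G \<ge> 1 - (\<epsilon> + real N * d)"
      unfolding G_def using measure_finite_Int_ge[of N A d, OF _ s(2,3)] A by blast+
    \<comment> \<open>The functions \<open>v i\<close> are 1-Lipschitz for \<open>D2\<close>, so
      \<open>E\<close> is dominated by \<open>D2\<close>; as they imitate distances to a net of
      \<open>D1\<close>, it is also box-close to \<open>D1\<close>.\<close>
    define E where "E = maxdist N v"
    have E: "pm E" unfolding E_def by (rule pm_maxdist[OF D(2)]) (use v in blast)
    have ED2: "\<forall>s\<in>{0..<1}. \<forall>t\<in>{0..<1}. E s t \<le> D2 s t" unfolding E_def by (rule maxdist_le_pm[OF D(2)]) (use v in blast)
    have "boxle D1 E (2 * \<epsilon> + 2 * d)"
      unfolding E_def by (rule net_boxle[OF D(1) s(1) G]) (use d \<epsilon> in \<open>auto simp: G_def A_def\<close>)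
    then have b: "boxle D1 E (4 * \<epsilon>)" by (rule boxle_mono) (use d in simp)
    obtain CE where CE: "rz CE E" by (rule rz_ex[OF E])
    obtain \<gamma> where \<gamma>: "\<gamma> 0 = C" "\<gamma> 1 = CE" "\<forall>t\<in>{0..1}. rz (\<gamma> t) (\<lambda>u v. (1 - t) * D1 u v + t * E u v)"
      "\<forall>e>0. \<exists>r>0. \<forall>s\<in>{0..1}. \<forall>t\<in>{0..1}. \<bar>s - t\<bar> < r \<longrightarrow> boxC (\<gamma> t) (\<gamma> s) < e"
      by (rule interpolation_path[OF D(1,3) E CE])
    have \<gamma>X: "\<forall>t\<in>{0..1}. \<gamma> t \<in> mmX" using \<gamma>(3) rz_mmX by blast
    have "\<gamma> t \<in> obsT.bal C e" if t: "t \<in> {0..1}" for t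
    proof -
      have "boxle D1 (\<lambda>u v. (1 - t) * D1 u v + t * E u v) (4 * \<epsilon>)"
        by (rule boxle_interpolate[OF b t])
      then have "boxC C (\<gamma> t) \<le> 4 * \<epsilon>" by (rule boxC_le[OF D(3) \<gamma>(3)[rule_format, OF t]]) (use \<epsilon> in simp)
      then have "obsC C (\<gamma> t) \<le> 4 * \<epsilon>" using obsC_le_boxC[OF C] \<gamma>X t by force
      then show ?thesis using \<gamma>X t e by (simp add: obsT.bal_def \<epsilon>_def)
    qed
    then have p1: "path_component_of (subtopology obsT.T (obsT.bal C e)) C CE"
      by (intro obsT.pcont_component[OF obs_pcont[OF \<gamma>X \<gamma>(4)]] \<gamma>(1,2)) blast
    obtain \<theta> where \<theta>: "\<theta> 0 = CE" "\<theta> 1 = C'" "\<forall>t\<in>{0..1}. rz (\<theta> t) (\<lambda>u v. max (E u v) (t * D2 u v))"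
      "\<forall>e>0. \<exists>r>0. \<forall>s\<in>{0..1}. \<forall>t\<in>{0..1}. \<bar>s - t\<bar> < r \<longrightarrow> boxC (\<theta> t) (\<theta> s) < e"
      by (rule domination_path[OF D(2,4) E CE full_I ED2])
    have \<theta>X: "\<forall>t\<in>{0..1}. \<theta> t \<in> mmX" using \<theta>(3) rz_mmX by blast
    have "\<theta> t \<in> obsT.bal C e" if t: "t \<in> {0..1}" for t
    proof -
      let ?Dt = "\<lambda>u v. max (E u v) (t * D2 u v)"
      have Dt: "pm ?Dt" by (rule pm_max[OF E pm_scale[OF D(2)]]) (use t in simp)
      have le1: "\<forall>u\<in>{0..<1}. \<forall>v\<in>{0..<1}. E u v \<le> ?Dt u v" by simp
      have le2: "\<forall>u\<in>{0..<1}. \<forall>v\<in>{0..<1}. ?Dt u v \<le> D2 u v"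
      proof (intro ballI)
        fix u v :: real assume uv: "u \<in> {0..<1}" "v \<in> {0..<1}"
        have "t * D2 u v \<le> 1 * D2 u v" by (rule mult_right_mono) (use t pm_nonneg[OF D(2) uv] in auto)
        then show "?Dt u v \<le> D2 u v" using ED2 uv by simp
      qed
      \<comment> \<open>This half comes from below: 1-Lipschitz functions for \<open>E\<close>
        remain so for the larger pseudo-metric. The converse half comes from above, since functions
        for \<open>?Dt\<close> are functions for \<open>D2\<close>.\<close>
      have "concle D1 ?Dt (4 * \<epsilon>)"
        unfolding concle_def
      proof
        fix u assume "u \<in> Lf D1"
        then obtain w where w: "w \<in> Lf E" "dev u w (4 * \<epsilon>) \<le> 4 * \<epsilon>"
          using boxle_concle[OF D(1) E b] unfolding concle_def by blast
        show "\<exists>v\<in>Lf ?Dt. dev u v (4 * \<epsilon>) \<le> 4 * \<epsilon>" 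
          using w(2) Lf_mono[OF w(1) le1] by blast
      qed
      moreover have "concle ?Dt D1 (4 * \<epsilon>)"
      proof (rule concle_mono[OF Dt D(1)])
        show "concle ?Dt D1 d"
          unfolding concle_def
        proof
          fix u assume "u \<in> Lf ?Dt"
          then have "u \<in> Lf D2" by (rule Lf_mono[OF _ le2])
          then show "\<exists>v\<in>Lf D1. dev u v d \<le> d" using c(2) unfolding concle_def by blast
        qed
      qed (use d \<epsilon> in simp)
      ultimately have "obsC C (\<theta> t) \<le> 4 * \<epsilon>"
        by (rule obsC_le[OF D(3) \<theta>(3)[rule_format, OF t] D(1) Dt]) (use \<epsilon> in simp)
      then show ?thesis using \<theta>X t e by (simp add: obsT.bal_def \<epsilon>_def)
    qed
    then have p2: "path_component_of (subtopology obsT.T (obsT.bal C e)) CE C'"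
      by (intro obsT.pcont_component[OF obs_pcont[OF \<theta>X \<theta>(4)]] \<theta>(1,2)) blast
    show ?thesis by (rule path_component_of_trans[OF p1 p2])
  qed
  then show ?thesis using d(1) by blast
qed

theorem conc_locally_path_connected: "locally_path_connected_space conc_topology"
  unfolding conc_topology_alt by (rule obsT.locally_path_connected_T[OF conc_local_path])

section \<open>Closedness of principal ideals\<close>

definition clamp :: "real \<Rightarrow> real \<Rightarrow> real \<Rightarrow> real" where
  "clamp a b x = max a (min b x)"

lemma clamp_lip: "\<bar>clamp a b x - clamp a b y\<bar> \<le> \<bar>x - y\<bar>"
  by (auto simp: clamp_def max_def min_def abs_if)

lemma clamp_id: "a \<le> x \<Longrightarrow> x \<le> b \<Longrightarrow> clamp a b x = x"
  by (simp add: clamp_def)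

lemma clamp_bounds: "a \<le> b \<Longrightarrow> a \<le> clamp a b x \<and> clamp a b x \<le> b"
  by (simp add: clamp_def)

lemma clamp_measurable [measurable]: "clamp a b \<in> borel_measurable borel"
  unfolding clamp_def by measurable

lemma Lf_clamp: "u \<in> Lf D \<Longrightarrow> (\<lambda>s. clamp a b (u s)) \<in> Lf D"
  unfolding Lf_def using clamp_lip order_trans by blast

section \<open>Limits of 1-Lipschitz functions and of their laws\<close>

lemma compact_seq_box: "seq_compact (PiE UNIV (\<lambda>i::nat. {0..M i}) :: (nat \<Rightarrow> real) set)"
proof -
  have "compactin (product_topology (\<lambda>i. euclidean) UNIV) (PiE UNIV (\<lambda>i::nat. {0..M i}) :: (nat \<Rightarrow> real) set)"
    unfolding compactin_PiE by auto
  then have "compact (PiE UNIV (\<lambda>i::nat. {0..M i}) :: (nat \<Rightarrow> real) set)"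
    unfolding euclidean_product_topology by simp
  then show ?thesis by (rule compact_imp_seq_compact)
qed

text \<open>Values of all functions at all dense points form one point of a compact product, giving
  a single subsequence for every \<open>k\<close>. The common Lipschitz bound carries convergence to
  the remaining points.\<close>

lemma arzela_ascoli:
  assumes D: "pm D" and u: "\<forall>n k. u n k \<in> Lf D" and M: "\<forall>n k. \<forall>s\<in>{0..<1}. 0 \<le> u n k s \<and> u n k s \<le> M k"
  obtains \<sigma> :: "nat \<Rightarrow> nat" and v :: "nat \<Rightarrow> real \<Rightarrow> real" where "strict_mono \<sigma>" "\<forall>k. v k \<in> Lf D" 
    "\<forall>k. \<forall>s\<in>{0..<1}. (\<lambda>n. u (\<sigma> n) k s) \<longlonglongrightarrow> v k s"
proof -
  obtain a :: "nat \<Rightarrow> real" where a: "\<forall>i. a i \<in> {0..<1}" "\<forall>s\<in>{0..<1}. \<forall>e>0. \<exists>i. D (a i) s < e"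
    by (rule pm_dense[OF D])
  define x where "x n i = u n (fst (prod_decode i)) (a (snd (prod_decode i)))" for n i
  have "\<forall>n. x n \<in> PiE UNIV (\<lambda>i. {0..M (fst (prod_decode i))})"
    using M a(1) unfolding x_def PiE_iff by simp
  then obtain l \<sigma> where \<sigma>: "strict_mono (\<sigma> :: nat \<Rightarrow> nat)" "(x \<circ> \<sigma>) \<longlonglongrightarrow> l"
    by (rule seq_compactE[OF compact_seq_box]) blast
  have coord: "(\<lambda>n. x (\<sigma> n) i) \<longlonglongrightarrow> l i" for i
  proof -
    have "continuous_on UNIV (\<lambda>y :: nat \<Rightarrow> real. y i)" by (rule continuous_on_product_coordinates)
    from continuous_on_tendsto_compose[OF this \<sigma>(2)] show ?thesis by (simp add: comp_def)
  qed
  have conv: "convergent (\<lambda>n. u (\<sigma> n) k s)" if s: "s \<in> {0..<1}" for k s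
  proof -
    have "Cauchy (\<lambda>n. u (\<sigma> n) k s)"
    proof (rule metric_CauchyI)
      fix e :: real assume e: "e > 0"
      then have e4: "e / 4 > 0" by simp
      obtain i where i: "D (a i) s < e / 4" using a(2)[rule_format, OF s e4] by blast
      have "convergent (\<lambda>n. x (\<sigma> n) (prod_encode (k, i)))" using coord unfolding convergent_def by blast
      then have "Cauchy (\<lambda>n. u (\<sigma> n) k (a i))" by (simp add: x_def convergent_Cauchy)
      then obtain N where N: "\<forall>m\<ge>N. \<forall>n\<ge>N. dist (u (\<sigma> m) k (a i)) (u (\<sigma> n) k (a i)) < e / 4"
        using metric_CauchyD[OF _ e4] by blast
      have "dist (u (\<sigma> m) k s) (u (\<sigma> n) k s) < e" if mn: "m \<ge> N" "n \<ge> N" for m n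
      proof -
        have "dist (u (\<sigma> m) k (a i)) (u (\<sigma> n) k (a i)) < e / 4" using N mn by blast
        moreover have "\<bar>u (\<sigma> m) k (a i) - u (\<sigma> m) k s\<bar> \<le> D (a i) s" "\<bar>u (\<sigma> n) k (a i) - u (\<sigma> n) k s\<bar> \<le> D (a i) s"
          using LfD[OF u[rule_format] a(1)[rule_format] s] by blast+
        ultimately show ?thesis using i unfolding dist_real_def by linarith
      qed
      then show "\<exists>N. \<forall>m\<ge>N. \<forall>n\<ge>N. dist (u (\<sigma> m) k s) (u (\<sigma> n) k s) < e" by blast
    qed
    then show ?thesis by (rule Cauchy_convergent)
  qed
  define v where "v k s = lim (\<lambda>n. u (\<sigma> n) k s)" for k s
  have v: "(\<lambda>n. u (\<sigma> n) k s) \<longlonglongrightarrow> v k s" if "s \<in> {0..<1}" for k s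
    unfolding v_def using conv[OF that] by (simp add: convergent_LIMSEQ_iff)
  have "v k \<in> Lf D" for k
    unfolding Lf_def
  proof (intro CollectI ballI)
    fix s t :: real assume st: "s \<in> {0..<1}" "t \<in> {0..<1}"
    have "(\<lambda>n. \<bar>u (\<sigma> n) k s - u (\<sigma> n) k t\<bar>) \<longlonglongrightarrow> \<bar>v k s - v k t\<bar>"
      by (intro tendsto_intros v st)
    then show "\<bar>v k s - v k t\<bar> \<le> D s t"
      by (rule LIMSEQ_le_const2) (use LfD[OF u[rule_format] st] in blast)
  qed
  then show ?thesis using that[OF \<sigma>(1)] v by blast
qed

text \<open>The generators are lower orthants in finitely many coordinates. They are closed under
  intersection, which makes them suitable for uniqueness of measures.\<close>

lemma sets_PB_generated:
  "sets PB = sigma_sets UNIV (range (\<lambda>(K::nat, r::nat \<Rightarrow> real). {x. \<forall>i<K. x i < r i}))" (is "_ = sigma_sets UNIV ?G")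
proof (intro equalityI subsetI)
  let ?N = "sigma UNIV ?G"
  have sN: "sets ?N = sigma_sets UNIV ?G" "space ?N = UNIV" by auto
  have id: "(\<lambda>x i. x i) \<in> measurable ?N PB"
  proof (rule measurable_PiM_single')
    fix i :: nat
    show "(\<lambda>x. x i) \<in> borel_measurable ?N"
    proof (rule borel_measurableI_less)
      fix y :: real
      \<comment> \<open>An orthant restricts an initial segment of coordinates; the unwanted
        restrictions on those before \<open>i\<close> disappear in the union over the bound
        \<open>m\<close>.\<close>
      have "{x \<in> space ?N. x i < y} = (\<Union>m::nat. {x. \<forall>j<Suc i. x j < (if j = i then y else real m)})"
      proof (intro equalityI subsetI)
        fix x :: "nat \<Rightarrow> real" assume x: "x \<in> {x \<in> space ?N. x i < y}"
        obtain m :: nat where m: "(\<Sum>j<Suc i. \<bar>x j\<bar>) < real m" using reals_Archimedean2 by blast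
        have "x j < real m" if "j < Suc i" for j
        proof -
          have "\<bar>x j\<bar> \<le> (\<Sum>j<Suc i. \<bar>x j\<bar>)" by (rule member_le_sum) (use that in auto)
          then show ?thesis using m by linarith
        qed
        then have "x \<in> {x. \<forall>j<Suc i. x j < (if j = i then y else real m)}" using x by auto
        then show "x \<in> (\<Union>m::nat. {x. \<forall>j<Suc i. x j < (if j = i then y else real m)})" by blast
      next
        fix x :: "nat \<Rightarrow> real" assume "x \<in> (\<Union>m::nat. {x. \<forall>j<Suc i. x j < (if j = i then y else real m)})"
        then obtain m :: nat where "\<forall>j<Suc i. x j < (if j = i then y else real m)" by blast
        then have "x i < y" by (metis lessI)
        then show "x \<in> {x \<in> space ?N. x i < y}" using sN(2) by blast
      qed
      moreover have "{x. \<forall>j<Suc i. x j < (if j = i then y else real m)} \<in> sets ?N" for m :: nat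
        unfolding sN by (rule sigma_sets.Basic) (rule image_eqI[of _ _ "(Suc i, \<lambda>j. if j = i then y else real m)"], auto)
      then have "(\<Union>m::nat. {x. \<forall>j<Suc i. x j < (if j = i then y else real m)}) \<in> sets ?N"
        by (intro sets.countable_UN) blast
      ultimately show "{x \<in> space ?N. x i < y} \<in> sets ?N" by (simp only:)
    qed
  qed auto
  fix A assume "A \<in> sets PB"
  from measurable_sets[OF id this] show "A \<in> sigma_sets UNIV ?G" using sN by simp
next
  fix A assume "A \<in> sigma_sets UNIV ?G"
  moreover have "?G \<subseteq> sets PB"
  proof clarify
    fix K :: nat and r :: "nat \<Rightarrow> real"
    have "{x \<in> space PB. \<forall>i. i < K \<longrightarrow> x i < r i} \<in> sets PB" by measurable
    then show "{x. \<forall>i<K. x i < r i} \<in> sets PB" by simp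
  qed
  ultimately show "A \<in> sets PB" using sets.sigma_sets_subset[of ?G PB] by auto
qed

text \<open>Lipschitz functions that increase with \<open>m\<close> to the indicator of the orthant
  given by \<open>K\<close> and \<open>r\<close>. Their integrals vary little under small
  perturbations, yet determine the law.\<close>

definition ramp :: "nat \<Rightarrow> nat \<Rightarrow> (nat \<Rightarrow> real) \<Rightarrow> (nat \<Rightarrow> real) \<Rightarrow> real" where
  "ramp m K r x = (\<Prod>i<K. clamp 0 1 (real m * (r i - x i)))"

lemma ramp_bounds: "0 \<le> ramp m K r x \<and> ramp m K r x \<le> 1"
  unfolding ramp_def using clamp_bounds[of 0 1] by (auto intro!: prod_nonneg prod_le_1)

lemma ramp_measurable [measurable]: "ramp m K r \<in> borel_measurable PB"
  unfolding ramp_def by measurable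

lemma ramp_lip:
  assumes "\<forall>i<K. \<bar>x i - y i\<bar> \<le> e"
  shows "\<bar>ramp m K r x - ramp m K r y\<bar> \<le> real K * (real m * e)"
proof -
  have "norm (ramp m K r x - ramp m K r y) \<le> 
      (\<Sum>i<K. norm (clamp 0 1 (real m * (r i - x i)) - clamp 0 1 (real m * (r i - y i))))"
    unfolding ramp_def using clamp_bounds[of 0 1] by (intro norm_prod_diff) auto
  also have "\<dots> \<le> (\<Sum>i<K. real m * e)"
  proof (rule sum_mono)
    fix i assume "i \<in> {..<K}"
    then have "\<bar>x i - y i\<bar> \<le> e" using assms by simp
    then have "real m * \<bar>x i - y i\<bar> \<le> real m * e" by (rule mult_left_mono) simp
    moreover have "\<bar>real m * (r i - x i) - real m * (r i - y i)\<bar> = real m * \<bar>x i - y i\<bar>"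
      by (simp flip: right_diff_distrib add: abs_mult abs_minus_commute)
    ultimately show "norm (clamp 0 1 (real m * (r i - x i)) - clamp 0 1 (real m * (r i - y i))) \<le> real m * e"
      using clamp_lip[of 0 1 "real m * (r i - x i)" "real m * (r i - y i)"] by simp
  qed
  finally show ?thesis by simp
qed

lemma ramp_limit: "(\<lambda>m. ramp m K r x) \<longlonglongrightarrow> indicat_real {x. \<forall>i<K. x i < r i} x"
proof -
  have "(\<lambda>m. clamp 0 1 (real m * (r i - x i))) \<longlonglongrightarrow> of_bool (x i < r i)" for i
  proof (cases "x i < r i")
    case True
    obtain N :: nat where N: "1 / (r i - x i) < real N" using reals_Archimedean2 by blast
    have "clamp 0 1 (real m * (r i - x i)) = 1" if "m \<ge> N" for m
    proof -
      have "1 / (r i - x i) \<le> real m" using N that by linarith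
      then have "1 \<le> real m * (r i - x i)" using True by (simp add: pos_divide_le_eq)
      then show ?thesis by (simp add: clamp_def)
    qed
    then show ?thesis using True by (intro tendsto_eventually) (auto simp: eventually_sequentially)
  next
    case False
    then have le: "real m * (r i - x i) \<le> 0" for m by (simp add: mult_nonneg_nonpos)
    have "clamp 0 1 (real m * (r i - x i)) = 0" for m using le[of m] unfolding clamp_def by linarith
    then show ?thesis using False by simp
  qed
  then have "(\<lambda>m. ramp m K r x) \<longlonglongrightarrow> (\<Prod>i<K. of_bool (x i < r i))"
    unfolding ramp_def by (intro tendsto_prod)
  moreover have "(\<Prod>i<K. of_bool (x i < r i) :: real) = indicat_real {x. \<forall>i<K. x i < r i} x"
    by (auto simp: indicator_def of_bool_def prod_zero_iff)
  ultimately show ?thesis by simp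
qed

text \<open>Dominated convergence passes from ramps to orthants, and these form an
  intersection-stable generator.\<close>

lemma law_eqI:
  assumes N: "prob_space N" "sets N = sets PB" and N': "prob_space N'" "sets N' = sets PB"
    and eq: "\<And>m K r. integral\<^sup>L N (ramp m K r) = integral\<^sup>L N' (ramp m K r)"
  shows "N = N'"
proof -
  have lim: "(\<lambda>m. integral\<^sup>L P (ramp m K r)) \<longlonglongrightarrow> measure P {x. \<forall>i<K. x i < r i}"
    if "prob_space P" "sets P = sets PB" for P K r
  proof -
    interpret prob_space P by fact
    have G: "{x. \<forall>i<K. x i < r i} \<in> sets P"
      unfolding that(2) sets_PB_generated by (rule sigma_sets.Basic) (rule image_eqI[of _ _ "(K, r)"], auto)
    have rm: "ramp m K r \<in> borel_measurable P" for m
      using ramp_measurable that(2) measurable_cong_sets by blast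
    have "(\<lambda>m. integral\<^sup>L P (ramp m K r)) \<longlonglongrightarrow> integral\<^sup>L P (indicat_real {x. \<forall>i<K. x i < r i})"
    proof (rule integral_dominated_convergence[where w="\<lambda>_. 1"])
      show "AE x in P. (\<lambda>m. ramp m K r x) \<longlonglongrightarrow> indicat_real {x. \<forall>i<K. x i < r i} x"
        by (rule AE_I2) (rule ramp_limit)
      show "AE x in P. norm (ramp m K r x) \<le> 1" for m
        by (rule AE_I2) (use ramp_bounds in simp)
    qed (use G rm in auto)
    then show ?thesis using G by simp
  qed
  show ?thesis
  proof (rule measure_eqI_generator_eq[where \<Omega>=UNIV and A="\<lambda>_. UNIV" and
        E="range (\<lambda>(K::nat, r::nat \<Rightarrow> real). {x. \<forall>i<K. x i < r i})"])
    show "Int_stable (range (\<lambda>(K::nat, r::nat \<Rightarrow> real). {x. \<forall>i<K. x i < r i}))"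
    proof (rule Int_stableI, clarify)
      fix K K' :: nat and r r' :: "nat \<Rightarrow> real"
      define b where "b i = (if i < K then if i < K' then min (r i) (r' i) else r i else r' i)" for i
      have "{x. \<forall>i<K. x i < r i} \<inter> {x. \<forall>i<K'. x i < r' i} = {x. \<forall>i<max K K'. x i < b i}"
      proof -
        have "(i < max K K' \<longrightarrow> x i < b i) \<longleftrightarrow> (i < K \<longrightarrow> x i < r i) \<and> (i < K' \<longrightarrow> x i < r' i)" for x i
          by (auto simp: b_def less_max_iff_disj)
        then show ?thesis by blast
      qed
      then show "{x. \<forall>i<K. x i < r i} \<inter> {x. \<forall>i<K'. x i < r' i} \<in> range (\<lambda>(K::nat, r::nat \<Rightarrow> real). {x. \<forall>i<K. x i < r i})"
        by (intro image_eqI[of _ _ "(max K K', b)"]) auto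
    qed
    fix X assume "X \<in> range (\<lambda>(K::nat, r::nat \<Rightarrow> real). {x. \<forall>i<K. x i < r i})"
    then obtain K r where X: "X = {x. \<forall>i<K. x i < r i}" by auto
    have "measure N X = measure N' X"
      unfolding X using lim[OF N, of K r] lim[OF N', of K r] unfolding eq by (rule LIMSEQ_unique)
    then show "emeasure N X = emeasure N' X"
      using prob_space.finite_measure[OF N(1)] prob_space.finite_measure[OF N'(1)]
      by (simp add: finite_measure.emeasure_eq_measure)
  next
    show "sets N = sigma_sets UNIV (range (\<lambda>(K::nat, r::nat \<Rightarrow> real). {x. \<forall>i<K. x i < r i}))"
      "sets N' = sigma_sets UNIV (range (\<lambda>(K::nat, r::nat \<Rightarrow> real). {x. \<forall>i<K. x i < r i}))"
      using N N' sets_PB_generated by auto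
    have "UNIV = {x::nat \<Rightarrow> real. \<forall>i<(0::nat). x i < 0}" by simp
    then show "range (\<lambda>_. UNIV) \<subseteq> range (\<lambda>(K::nat, r::nat \<Rightarrow> real). {x. \<forall>i<K. x i < r i})"
      by (auto intro!: image_eqI[of _ _ "(0::nat, \<lambda>_. 0)"])
    show "emeasure N UNIV \<noteq> \<infinity>" 
      using prob_space.finite_measure[OF N(1)] by (simp add: finite_measure.emeasure_eq_measure)
  qed auto
qed

lemma Lf_PB: "pm D \<Longrightarrow> \<forall>k. v k \<in> Lf D \<Longrightarrow> (\<lambda>s k. v k s) \<in> measurable lebI PB"
  by (rule measurable_PiM_single') (use Lf_measurable in auto)

lemma distr_full_cong:
  assumes "full J" "\<forall>s\<in>J. f s = g s" "f \<in> measurable lebI M" "g \<in> measurable lebI M"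
  shows "distr lebI M f = distr lebI M g"
proof (rule distr_cong_AE)
  have "AE s in lebI. s \<in> J" using assms(1) by (simp add: full_AE)
  then show "AE s in lebI. f s = g s" by eventually_elim (use assms(2) in blast)
qed (use assms in auto)

text \<open>The functions pass from one realization to the other through the space itself. Their
  values on the interval are rearranged, but their joint law is preserved, and only the law matters
  later.\<close>

lemma Lf_transfer_law:
  assumes C: "rz C F" "rz C F'" and F: "pm F" "pm F'" and v: "\<forall>k. v k \<in> Lf F'"
  obtains w where "\<forall>k::nat. w k \<in> Lf F" "distr lebI PB (\<lambda>s k. w k s) = distr lebI PB (\<lambda>s k. v k s)"
proof -
  note r = rep_props(1)[OF rz_mmX[OF C(1)]]
  obtain \<phi> J where \<phi>: "parameter (rep C) \<phi>" and J: "full J" "\<forall>s\<in>J. \<forall>t\<in>J. F s t = dst (rep C) (\<phi> s) (\<phi> t)"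
    using C(1) unfolding rz_def by blast
  obtain \<psi> J' where \<psi>: "parameter (rep C) \<psi>" and J': "full J'" "\<forall>s\<in>J'. \<forall>t\<in>J'. F' s t = dst (rep C) (\<psi> s) (\<psi> t)"
    using C(2) unfolding rz_def by blast
  have "\<forall>k. \<exists>g. lip1_fun (rep C) g \<and> (\<forall>s\<in>J'. g (\<psi> s) = v k s)"
    using Lf_push_lip[OF r \<psi> _ J'] v by metis
  then obtain g where g: "\<And>k. lip1_fun (rep C) (g k)" "\<And>k. \<forall>s\<in>J'. g k (\<psi> s) = v k s" by metis
  have "\<forall>k. \<exists>w. w \<in> Lf F \<and> (\<forall>s\<in>J. w s = g k (\<phi> s))"
    using lip_pull_Lf[OF r g(1) \<phi> F(1) J] by metis
  then obtain w where w: "\<And>k. w k \<in> Lf F" "\<And>k. \<forall>s\<in>J. w k s = g k (\<phi> s)" by metis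
  interpret mm "rep C" by unfold_locales (rule r)
  have gm: "(\<lambda>x k. g k x) \<in> measurable (msr (rep C)) PB"
    by (rule measurable_PiM_single') (use g(1) in \<open>auto simp: lip1_fun_alt intro!: lip1_measurable\<close>)
  have pull: "distr lebI PB (\<lambda>s k. g k (\<theta> s)) = distr (msr (rep C)) PB (\<lambda>x k. g k x)" 
    and pm: "(\<lambda>s k. g k (\<theta> s)) \<in> measurable lebI PB" if "parameter (rep C) \<theta>" for \<theta>
  proof -
    have \<theta>: "\<theta> \<in> measurable lebI (msr (rep C))" "distr lebI (msr (rep C)) \<theta> = msr (rep C)"
      using that by (auto simp: parameter_alt)
    show "(\<lambda>s k. g k (\<theta> s)) \<in> measurable lebI PB" by (rule measurable_compose[OF \<theta>(1) gm])
    have "distr lebI PB ((\<lambda>x k. g k x) \<circ> \<theta>) = distr (distr lebI (msr (rep C)) \<theta>) PB (\<lambda>x k. g k x)"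
      by (rule distr_distr[OF gm \<theta>(1), symmetric])
    then show "distr lebI PB (\<lambda>s k. g k (\<theta> s)) = distr (msr (rep C)) PB (\<lambda>x k. g k x)"
      unfolding \<theta>(2) by (simp add: comp_def)
  qed
  have "distr lebI PB (\<lambda>s k. w k s) = distr lebI PB (\<lambda>s k. g k (\<phi> s))"
    by (rule distr_full_cong[OF J(1) _ Lf_PB[OF F(1)] pm[OF \<phi>]]) (use w in auto)
  moreover have "distr lebI PB (\<lambda>s k. v k s) = distr lebI PB (\<lambda>s k. g k (\<psi> s))"
    by (rule distr_full_cong[OF J'(1) _ Lf_PB[OF F(2) v] pm[OF \<psi>]]) (use g in auto)
  ultimately have "distr lebI PB (\<lambda>s k. w k s) = distr lebI PB (\<lambda>s k. v k s)"
    using pull[OF \<phi>] pull[OF \<psi>] by simp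
  then show ?thesis using that[of w] w(1) by blast
qed

lemma norming_lip1: "norming S h M \<Longrightarrow> lip1_fun S (h k)"
  by (auto simp: norming_def lip1_fun_alt)

text \<open>The norming family moves from \<open>E\<close> to the box-close class \<open>E'\<close>
  by approximate McShane extension, between two realizations of \<open>E'\<close> with its law kept,
  and up to \<open>D\<close> because domination enlarges the set of 1-Lipschitz functions. The term
  with \<open>K\<close> and \<open>m\<close> comes from the Lipschitz constant of the ramp, the last
  \<open>e\<close> from the bad set; \<open>e < 1\<close> keeps the good set nonempty.\<close>

lemma law_approx:
  assumes C: "C \<in> mmX" and E: "E \<in> mmX" and h: "norming (rep E) h M"
    and D: "pm D" "rz C D" and E': "E' \<in> mmX" "lip_le E' C" "boxC E E' < e" and e: "e < 1"
  obtains u where "\<forall>k. u k \<in> Lf D" "\<forall>k. \<forall>s\<in>{0..<1}. 0 \<le> u k s \<and> u k s \<le> M k"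
    "\<forall>m K r. \<bar>integral\<^sup>L lebI (\<lambda>s. ramp m K r (\<lambda>k. u k s)) - integral\<^sup>L (msr (rep E)) (\<lambda>x. ramp m K r (\<lambda>k. h k x))\<bar>
       \<le> real K * (real m * e) + e"
proof -
  note rE = rep_props(1)[OF E]
  obtain B F' where BF: "pm B" "pm F'" "rz E B" "rz E' F'" "boxle B F' e"
    using boxC_less[OF E E'(1,3)] by blast
  obtain F K0 where F: "pm F" "rz E' F" "full K0" "\<forall>s\<in>K0. \<forall>t\<in>K0. F s t \<le> D s t"
    by (rule lip_le_rz[OF E'(2) D(2) E'(1)])
  obtain \<beta> J where \<beta>: "parameter (rep E) \<beta>" and J: "full J" "\<forall>s\<in>J. \<forall>t\<in>J. B s t = dst (rep E) (\<beta> s) (\<beta> t)"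
    using BF(3) unfolding rz_def by blast
  interpret mm "rep E" by unfold_locales (rule rE)
  have "\<forall>k. \<exists>b. b \<in> Lf B \<and> (\<forall>s\<in>J. b s = h k (\<beta> s))"
    using lip_pull_Lf[OF rE norming_lip1[OF h] \<beta> BF(1) J] by metis
  then obtain b where b: "\<And>k. b k \<in> Lf B" "\<And>k. \<forall>s\<in>J. b k s = h k (\<beta> s)" by metis
  obtain I0 where I0: "I0 \<in> sets lebI" "measure lebI I0 \<ge> 1 - e" "\<forall>s\<in>I0. \<forall>t\<in>I0. \<bar>B s t - F' s t\<bar> \<le> e"
    using BF(5) unfolding boxle_def by blast
  have ne: "I0 \<noteq> {}" using I0(2) e by auto
  have I0I: "I0 \<subseteq> {0..<1}" using I0(1) by (simp add: sets_lebI_iff)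
  have "\<exists>w. w \<in> Lf F' \<and> (\<forall>s\<in>I0. \<bar>w s - b k s\<bar> \<le> e)" for k
  proof -
    have "\<forall>s\<in>I0. \<forall>t\<in>I0. b k s - b k t \<le> F' s t + e"
    proof (intro ballI)
      fix s t assume "s \<in> I0" "t \<in> I0"
      then have "\<bar>b k s - b k t\<bar> \<le> B s t" "\<bar>B s t - F' s t\<bar> \<le> e" using LfD[OF b(1)] I0I I0(3) by blast+
      then show "b k s - b k t \<le> F' s t + e" by linarith
    qed
    then obtain w where w: "w \<in> Lf F'" "\<forall>s\<in>I0. w s \<le> b k s \<and> b k s - e \<le> w s"
      by (rule Lf_extend[OF BF(2) ne I0I])
    have "\<bar>w s - b k s\<bar> \<le> e" if "s \<in> I0" for s
      using w(2)[rule_format, OF that] by linarith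
    with w(1) show ?thesis by blast
  qed
  then obtain v where v: "\<And>k. v k \<in> Lf F'" "\<And>k. \<forall>s\<in>I0. \<bar>v k s - b k s\<bar> \<le> e" by metis
  obtain w where w: "\<forall>k. w k \<in> Lf F" "distr lebI PB (\<lambda>s k. w k s) = distr lebI PB (\<lambda>s k. v k s)"
    using Lf_transfer_law[OF F(2) BF(4) F(1) BF(2)] v(1) by metis
  have K0I: "K0 \<subseteq> {0..<1}" "K0 \<noteq> {}" using full_subset[OF F(3)] full_nonempty[OF F(3)] by auto
  have "\<exists>y. y \<in> Lf D \<and> (\<forall>s\<in>K0. y s = w k s)" for k
  proof -
    have "\<forall>s\<in>K0. \<forall>t\<in>K0. w k s - w k t \<le> D s t + 0"
    proof (intro ballI)
      fix s t assume "s \<in> K0" "t \<in> K0"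
      then have "\<bar>w k s - w k t\<bar> \<le> F s t" "F s t \<le> D s t" using LfD[OF w(1)[rule_format]] K0I F(4) by blast+
      then show "w k s - w k t \<le> D s t + 0" by linarith
    qed
    then obtain y where y: "y \<in> Lf D" "\<forall>s\<in>K0. y s \<le> w k s \<and> w k s - 0 \<le> y s"
      by (rule Lf_extend[OF D(1) K0I(2,1)])
    then show ?thesis by force
  qed
  then obtain y where y: "\<And>k. y k \<in> Lf D" "\<And>k. \<forall>s\<in>K0. y k s = w k s" by metis
  have M0: "0 \<le> M k" for k using car_nonempty h unfolding norming_def by (meson all_not_in_conv order_trans)
  \<comment> \<open>Extension may leave the range of the norming functions; clamping restores the
    uniform bounds and keeps the Lipschitz condition.\<close>
  define u where "u k s = clamp 0 (M k) (y k s)" for k s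
  have u1: "\<forall>k. u k \<in> Lf D" unfolding u_def using Lf_clamp[OF y(1)] by blast
  have u2: "\<forall>k. \<forall>s\<in>{0..<1}. 0 \<le> u k s \<and> u k s \<le> M k" unfolding u_def using clamp_bounds[OF M0] by blast
  have "\<bar>integral\<^sup>L lebI (\<lambda>s. ramp m K r (\<lambda>k. u k s)) - integral\<^sup>L (msr (rep E)) (\<lambda>x. ramp m K r (\<lambda>k. h k x))\<bar>
       \<le> real K * (real m * e) + e" for m K r
  proof -
    have e0: "0 \<le> e" using boxC_bounds(1)[OF E E'(1)] E'(3) by linarith
    \<comment> \<open>With the clamping absorbed into the integrand, the integral depends only on
      the law of the unclamped functions, so equality of laws applies.\<close>
    define f where "f x = ramp m K r (\<lambda>k. clamp 0 (M k) (x k))" for x :: "nat \<Rightarrow> real"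
    have cm: "(\<lambda>x k. clamp 0 (M k) (x k)) \<in> measurable PB PB"
      by (rule measurable_PiM_single') auto
    have fm: "f \<in> borel_measurable PB"
      unfolding f_def by (rule measurable_compose[OF cm ramp_measurable])
    have wm: "(\<lambda>s k. w k s) \<in> measurable lebI PB" by (rule Lf_PB[OF F(1) w(1)])
    have vm: "(\<lambda>s k. v k s) \<in> measurable lebI PB" by (rule Lf_PB[OF BF(2)]) (use v in blast)
    have ym: "(\<lambda>s k. y k s) \<in> measurable lebI PB" by (rule Lf_PB[OF D(1)]) (use y in blast)
    have hm: "(\<lambda>x k. h k x) \<in> measurable (msr (rep E)) PB" by (rule norming_measurable(2)[OF h])
    have \<beta>m: "\<beta> \<in> measurable lebI (msr (rep E))" using \<beta> by (simp add: parameter_alt)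
    have h\<beta>m: "(\<lambda>s k. h k (\<beta> s)) \<in> measurable lebI PB" by (rule measurable_compose[OF \<beta>m hm])
    have "integral\<^sup>L lebI (\<lambda>s. ramp m K r (\<lambda>k. u k s)) = integral\<^sup>L lebI (\<lambda>s. f (\<lambda>k. y k s))"
      by (simp add: f_def u_def)
    also have "\<dots> = integral\<^sup>L (distr lebI PB (\<lambda>s k. y k s)) f"
      by (rule integral_distr[OF ym fm, symmetric])
    also have "distr lebI PB (\<lambda>s k. y k s) = distr lebI PB (\<lambda>s k. w k s)"
      by (rule distr_full_cong[OF F(3) _ ym wm]) (use y in auto)
    also have "\<dots> = distr lebI PB (\<lambda>s k. v k s)" by (rule w(2))
    also have "integral\<^sup>L (distr lebI PB (\<lambda>s k. v k s)) f = integral\<^sup>L lebI (\<lambda>s. f (\<lambda>k. v k s))"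
      by (rule integral_distr[OF vm fm])
    finally have 1: "integral\<^sup>L lebI (\<lambda>s. ramp m K r (\<lambda>k. u k s)) = integral\<^sup>L lebI (\<lambda>s. f (\<lambda>k. v k s))" .
    have "integral\<^sup>L (msr (rep E)) (\<lambda>x. ramp m K r (\<lambda>k. h k x)) = 
        integral\<^sup>L (distr lebI (msr (rep E)) \<beta>) (\<lambda>x. ramp m K r (\<lambda>k. h k x))"
      using \<beta> by (simp add: parameter_alt)
    also have "\<dots> = integral\<^sup>L lebI (\<lambda>s. ramp m K r (\<lambda>k. h k (\<beta> s)))"
      by (rule integral_distr[OF \<beta>m measurable_compose[OF hm ramp_measurable]])
    finally have 2: "integral\<^sup>L (msr (rep E)) (\<lambda>x. ramp m K r (\<lambda>k. h k x)) = 
        integral\<^sup>L lebI (\<lambda>s. ramp m K r (\<lambda>k. h k (\<beta> s)))" .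
    let ?a = "\<lambda>s. f (\<lambda>k. v k s)" and ?b = "\<lambda>s. ramp m K r (\<lambda>k. h k (\<beta> s))"
    have am: "?a \<in> borel_measurable lebI" by (rule measurable_compose[OF vm fm])
    have bm: "?b \<in> borel_measurable lebI" by (rule measurable_compose[OF h\<beta>m ramp_measurable])
    have ab: "0 \<le> ?a s \<and> ?a s \<le> 1" "0 \<le> ?b s \<and> ?b s \<le> 1" for s unfolding f_def using ramp_bounds by blast+
    have ai: "integrable lebI ?a" by (rule lebI.integrable_const_bound[of _ 1]) (use ab am in auto)
    have bi: "integrable lebI ?b" by (rule lebI.integrable_const_bound[of _ 1]) (use ab bm in auto)
    define I1 where "I1 = I0 \<inter> J"
    have I1: "I1 \<in> sets lebI" "measure lebI I1 \<ge> 1 - e"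
      unfolding I1_def using I0 full_sets[OF J(1)] measure_full_Int[OF J(1) I0(1)] by auto
    define N1 where "N1 = space lebI - I1"
    have N1: "N1 \<in> sets lebI" unfolding N1_def by (rule sets.compl_sets[OF I1(1)])
    have iN1: "integrable lebI (indicat_real N1)"
      using N1 by (intro integrable_real_indicator) (auto simp: lebI.emeasure_eq_measure)
    let ?c = "real K * (real m * e)"
    have c0: "0 \<le> ?c" using e0 by simp
    have pt: "\<bar>?a s - ?b s\<bar> \<le> ?c + indicat_real N1 s" if s: "s \<in> space lebI" for s
    proof (cases "s \<in> I1")
      case True
      have "\<forall>i<K. \<bar>clamp 0 (M i) (v i s) - h i (\<beta> s)\<bar> \<le> e"
      proof (intro allI impI)
        fix i assume "i < K"
        have "\<beta> s \<in> car (rep E)" using param_car[OF \<beta>] s by simp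
        then have "0 \<le> h i (\<beta> s)" "h i (\<beta> s) \<le> M i" using h by (auto simp: norming_def)
        then have "clamp 0 (M i) (h i (\<beta> s)) = h i (\<beta> s)" by (rule clamp_id)
        then have "\<bar>clamp 0 (M i) (v i s) - h i (\<beta> s)\<bar> \<le> \<bar>v i s - h i (\<beta> s)\<bar>" by (metis clamp_lip)
        moreover have "h i (\<beta> s) = b i s" using b(2) True by (simp add: I1_def)
        moreover have "\<bar>v i s - b i s\<bar> \<le> e" using v(2) True by (simp add: I1_def)
        ultimately show "\<bar>clamp 0 (M i) (v i s) - h i (\<beta> s)\<bar> \<le> e" by simp
      qed
      then have "\<bar>?a s - ?b s\<bar> \<le> ?c" unfolding f_def by (rule ramp_lip)
      then show ?thesis using True by (simp add: indicator_def)
    next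
      case False
      then have "indicat_real N1 s = 1" using s by (simp add: N1_def)
      then show ?thesis using ab[of s] c0 by linarith
    qed
    have "\<bar>integral\<^sup>L lebI ?a - integral\<^sup>L lebI ?b\<bar> = \<bar>integral\<^sup>L lebI (\<lambda>s. ?a s - ?b s)\<bar>"
      using ai bi by simp
    also have "\<dots> \<le> integral\<^sup>L lebI (\<lambda>s. \<bar>?a s - ?b s\<bar>)" by (rule integral_abs_bound)
    also have "\<dots> \<le> integral\<^sup>L lebI (\<lambda>s. ?c + indicat_real N1 s)"
    proof (rule integral_mono)
      show "integrable lebI (\<lambda>s. \<bar>?a s - ?b s\<bar>)" using ai bi by auto
      show "integrable lebI (\<lambda>s. ?c + indicat_real N1 s)"
        by (intro Bochner_Integration.integrable_add lebI.integrable_const iN1)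
    qed (rule pt)
    also have "\<dots> = ?c + measure lebI N1"
    proof -
      have "N1 \<inter> {0..<1} = N1" using N1 by (auto simp: sets_lebI_iff)
      then have "integral\<^sup>L lebI (indicat_real N1) = measure lebI N1" by simp
      then show ?thesis 
        using Bochner_Integration.integral_add[OF lebI.integrable_const[of ?c] iN1] lebI.prob_space by simp
    qed
    also have "measure lebI N1 \<le> e" unfolding N1_def using lebI.prob_compl[OF I1(1)] I1(2) by linarith
    finally show ?thesis unfolding 1 2 by simp
  qed
  then show ?thesis using that[OF u1 u2] by blast
qed

text \<open>Principal order ideals are box-closed: normed families of 1-Lipschitz functions pulled back to
  the dominating space subconverge, and the limit still has the law of the norming family.\<close>

lemma lip_le_closed:
  assumes C: "C \<in> mmX" and E: "E \<in> mmX" and ap: "\<forall>e>0. \<exists>E'\<in>mmX. lip_le E' C \<and> boxC E E' < e"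
  shows "lip_le E C"
proof -
  obtain D where D: "pm D" "rz C D" by (rule rz_exists[OF C])
  interpret mm "rep E" by unfold_locales (rule rep_props(1)[OF E])
  obtain h M where h: "norming (rep E) h M" using norming_exists by blast
  \<comment> \<open>The denominators start at 2, as \<open>law_approx\<close> asks for errors below
    1.\<close>
  define e where "e n = inverse (real (Suc (Suc n)))" for n :: nat
  have e: "0 < e n" "e n < 1" for n by (auto simp: e_def field_simps)
  let ?I = "\<lambda>m K r. integral\<^sup>L (msr (rep E)) (\<lambda>x. ramp m K r (\<lambda>k. h k x))"
  have "\<exists>u. (\<forall>k. u k \<in> Lf D) \<and> (\<forall>k. \<forall>s\<in>{0..<1}. 0 \<le> u k s \<and> u k s \<le> M k) \<and>
      (\<forall>m K r. \<bar>integral\<^sup>L lebI (\<lambda>s. ramp m K r (\<lambda>k. u k s)) - ?I m K r\<bar> \<le> real K * (real m * e n) + e n)" for n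
  proof -
    obtain E' where E': "E' \<in> mmX" "lip_le E' C" "boxC E E' < e n" using ap e by blast
    obtain u where "\<forall>k. u k \<in> Lf D" "\<forall>k. \<forall>s\<in>{0..<1}. 0 \<le> u k s \<and> u k s \<le> M k"
      "\<forall>m K r. \<bar>integral\<^sup>L lebI (\<lambda>s. ramp m K r (\<lambda>k. u k s)) - ?I m K r\<bar> \<le> real K * (real m * e n) + e n"
      by (rule law_approx[OF C E h D E' e(2)])
    then show ?thesis by blast
  qed
  then obtain u where u: "\<And>n. \<forall>k. u n k \<in> Lf D" "\<And>n. \<forall>k. \<forall>s\<in>{0..<1}. 0 \<le> u n k s \<and> u n k s \<le> M k"
    "\<And>n. \<forall>m K r. \<bar>integral\<^sup>L lebI (\<lambda>s. ramp m K r (\<lambda>k. u n k s)) - ?I m K r\<bar> \<le> real K * (real m * e n) + e n"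
    by metis
  obtain \<sigma> v where \<sigma>: "strict_mono \<sigma>" and v: "\<forall>k. v k \<in> Lf D" 
    "\<forall>k. \<forall>s\<in>{0..<1}. (\<lambda>n. u (\<sigma> n) k s) \<longlonglongrightarrow> v k s"
    using arzela_ascoli[OF D(1), of u M] u(1,2) by blast
  have vm: "(\<lambda>s k. v k s) \<in> measurable lebI PB" by (rule Lf_PB[OF D(1) v(1)])
  have hm: "(\<lambda>x k. h k x) \<in> measurable (msr (rep E)) PB" by (rule norming_measurable(2)[OF h])
  have "distr lebI PB (\<lambda>s k. v k s) = distr (msr (rep E)) PB (\<lambda>x k. h k x)"
  proof (rule law_eqI)
    show "prob_space (distr lebI PB (\<lambda>s k. v k s))" by (rule lebI.prob_space_distr[OF vm])
    show "prob_space (distr (msr (rep E)) PB (\<lambda>x k. h k x))" by (rule prob_space_distr[OF hm])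
    fix m K r
    have "(\<lambda>n. integral\<^sup>L lebI (\<lambda>s. ramp m K r (\<lambda>k. u (\<sigma> n) k s))) \<longlonglongrightarrow> integral\<^sup>L lebI (\<lambda>s. ramp m K r (\<lambda>k. v k s))"
    proof (rule integral_dominated_convergence[where w="\<lambda>_. 1"])
      show "(\<lambda>s. ramp m K r (\<lambda>k. v k s)) \<in> borel_measurable lebI" by (rule measurable_compose[OF vm ramp_measurable])
      show "(\<lambda>s. ramp m K r (\<lambda>k. u (\<sigma> n) k s)) \<in> borel_measurable lebI" for n
        by (rule measurable_compose[OF Lf_PB[OF D(1) u(1)] ramp_measurable])
      show "AE s in lebI. (\<lambda>n. ramp m K r (\<lambda>k. u (\<sigma> n) k s)) \<longlonglongrightarrow> ramp m K r (\<lambda>k. v k s)"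
      proof (rule AE_I2)
        fix s assume "s \<in> space lebI"
        then have "(\<lambda>n. u (\<sigma> n) k s) \<longlonglongrightarrow> v k s" for k using v(2) by simp
        then show "(\<lambda>n. ramp m K r (\<lambda>k. u (\<sigma> n) k s)) \<longlonglongrightarrow> ramp m K r (\<lambda>k. v k s)"
          unfolding ramp_def clamp_def by (intro tendsto_intros)
      qed
      show "AE s in lebI. norm (ramp m K r (\<lambda>k. u (\<sigma> n) k s)) \<le> 1" for n
        by (rule AE_I2) (use ramp_bounds in simp)
    qed simp
    moreover have "(\<lambda>n. integral\<^sup>L lebI (\<lambda>s. ramp m K r (\<lambda>k. u (\<sigma> n) k s))) \<longlonglongrightarrow> ?I m K r"
    proof -
      have e0: "e \<longlonglongrightarrow> 0"
        unfolding e_def by (rule LIMSEQ_Suc[OF LIMSEQ_inverse_real_of_nat])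
      have "(\<lambda>n. real K * (real m * e n) + e n) \<longlonglongrightarrow> real K * (real m * 0) + 0"
        by (intro tendsto_intros e0)
      then have g0: "(\<lambda>n. real K * (real m * e n) + e n) \<longlonglongrightarrow> 0" by simp
      have "(\<lambda>n. integral\<^sup>L lebI (\<lambda>s. ramp m K r (\<lambda>k. u n k s)) - ?I m K r) \<longlonglongrightarrow> 0"
      proof (rule Lim_null_comparison[OF always_eventually g0], rule allI)
        fix n
        have "\<bar>integral\<^sup>L lebI (\<lambda>s. ramp m K r (\<lambda>k. u n k s)) - ?I m K r\<bar> \<le> real K * (real m * e n) + e n"
          using u(3) by blast
        then show "norm (integral\<^sup>L lebI (\<lambda>s. ramp m K r (\<lambda>k. u n k s)) - ?I m K r) \<le> real K * (real m * e n) + e n"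
          by (simp only: real_norm_def)
      qed
      then have "(\<lambda>n. integral\<^sup>L lebI (\<lambda>s. ramp m K r (\<lambda>k. u n k s))) \<longlonglongrightarrow> ?I m K r"
        by (simp add: LIM_zero_iff)
      from LIMSEQ_subseq_LIMSEQ[OF this \<sigma>] show ?thesis by (simp add: comp_def)
    qed
    ultimately have "integral\<^sup>L lebI (\<lambda>s. ramp m K r (\<lambda>k. v k s)) = ?I m K r" by (rule LIMSEQ_unique)
    then show "integral\<^sup>L (distr lebI PB (\<lambda>s k. v k s)) (ramp m K r) = integral\<^sup>L (distr (msr (rep E)) PB (\<lambda>x k. h k x)) (ramp m K r)"
      using integral_distr[OF vm ramp_measurable] integral_distr[OF hm ramp_measurable] by metis
  qed auto
  \<comment> \<open>Equality of laws turns the limit functions into a parameter of \<open>E\<close>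
    on which the norming functions take the values \<open>v\<close>. These are 1-Lipschitz for
    \<open>D\<close>, and the family recovers the distance of \<open>E\<close>, so domination
    follows.\<close>
  then obtain \<psi> J where \<psi>: "parameter (rep E) \<psi>" "full J" "\<forall>s\<in>J. \<forall>j. h j (\<psi> s) = v j s"
    using param_of_law[OF h, of v] v(1) Lf_measurable[OF D(1)] by metis
  have JI: "J \<subseteq> {0..<1}" using full_subset[OF \<psi>(2)] by auto
  show ?thesis
  proof (rule rz_le[OF D(2) rz_param(2)[OF E \<psi>(1)] \<psi>(2)], intro ballI)
    fix s t assume st: "s \<in> J" "t \<in> J"
    have c: "\<psi> s \<in> car (rep E)" "\<psi> t \<in> car (rep E)" using param_car[OF \<psi>(1)] st JI by auto
    show "dst (rep E) (\<psi> s) (\<psi> t) \<le> D s t"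
    proof (rule field_le_epsilon)
      fix d :: real assume "d > 0"
      then obtain j where j: "dst (rep E) (\<psi> s) (\<psi> t) \<le> \<bar>h j (\<psi> s) - h j (\<psi> t)\<bar> + d"
        using norming_approx[OF h c] by blast
      have "\<bar>v j s - v j t\<bar> \<le> D s t" by (rule LfD[OF v(1)[rule_format]]) (use st JI in auto)
      moreover have "h j (\<psi> s) = v j s" "h j (\<psi> t) = v j t" using \<psi>(3) st by blast+
      ultimately show "dst (rep E) (\<psi> s) (\<psi> t) \<le> D s t + d" using j by simp
    qed
  qed
qed

section \<open>Finite-dimensional mm-spaces\<close>

lemma linf_cong: "\<forall>i<N. x i = x' i \<and> y i = y' i \<Longrightarrow> linf N x y = linf N x' y'"
  unfolding linf_def by (intro arg_cong[where f="\<lambda>A. Max (insert 0 A)"] image_cong) auto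

lemma RN_metric: "Metric_space (RN N) (linf N)"
proof
  show "0 \<le> linf N x y" for x y by (rule linf_nonneg)
  show "linf N x y = linf N y x" for x y by (rule linf_commute)
  show "linf N x z \<le> linf N x y + linf N y z" for x y z by (rule linf_triangle)
  fix x y assume xy: "x \<in> RN N" "y \<in> RN N"
  show "(linf N x y = 0) = (x = y)"
  proof
    assume l: "linf N x y = 0"
    show "x = y"
    proof
      fix i show "x i = y i"
      proof (cases "i < N")
        case True then show ?thesis using linf_ge[OF True, of x y] l by simp
      qed (use xy in \<open>simp add: RN_def\<close>)
    qed
  qed (simp add: linf_self)
qed

lemma RN_complete: "Metric_space.mcomplete (RN N) (linf N)"
proof (rule Metric_space.mcompleteI[OF RN_metric])
  fix \<sigma> :: "nat \<Rightarrow> nat \<Rightarrow> real"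
  assume \<sigma>: "\<forall>n. \<sigma> n \<in> RN N" "\<forall>e>0. \<exists>K. \<forall>m\<ge>K. \<forall>n\<ge>K. linf N (\<sigma> m) (\<sigma> n) < e"
  have "\<exists>l. (\<lambda>n. \<sigma> n i) \<longlonglongrightarrow> l" if i: "i < N" for i
  proof -
    have "Cauchy (\<lambda>n. \<sigma> n i)"
    proof (rule metric_CauchyI)
      fix e :: real assume "e > 0"
      then obtain K where K: "\<forall>m\<ge>K. \<forall>n\<ge>K. linf N (\<sigma> m) (\<sigma> n) < e" using \<sigma>(2) by meson
      have "dist (\<sigma> m i) (\<sigma> n i) < e" if "m \<ge> K" "n \<ge> K" for m n
      proof -
        have "linf N (\<sigma> m) (\<sigma> n) < e" using K that by blast
        then show ?thesis using linf_ge[OF i, of "\<sigma> m" "\<sigma> n"] unfolding dist_real_def by linarith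
      qed
      then show "\<exists>K. \<forall>m\<ge>K. \<forall>n\<ge>K. dist (\<sigma> m i) (\<sigma> n i) < e" by blast
    qed
    then show ?thesis using Cauchy_convergent convergent_def by blast
  qed
  then obtain l where l: "\<And>i. i < N \<Longrightarrow> (\<lambda>n. \<sigma> n i) \<longlonglongrightarrow> l i" by metis
  define v where "v i = (if i < N then l i else 0)" for i
  have "\<exists>K. \<forall>n\<ge>K. linf N (\<sigma> n) v < e" if e: "e > 0" for e
  proof -
    obtain K where K: "\<forall>m\<ge>K. \<forall>n\<ge>K. linf N (\<sigma> m) (\<sigma> n) < e / 2" using \<sigma>(2) half_gt_zero[OF e] by meson
    have "linf N (\<sigma> n) v < e" if n: "n \<ge> K" for n
    proof -
      have "linf N (\<sigma> n) v \<le> e / 2"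
      proof (rule linf_le, use e in simp, intro allI impI)
        fix i assume i: "i < N"
        show "\<bar>\<sigma> n i - v i\<bar> \<le> e / 2"
        proof (rule LIMSEQ_le_const2)
          show "(\<lambda>m. \<bar>\<sigma> n i - \<sigma> m i\<bar>) \<longlonglongrightarrow> \<bar>\<sigma> n i - v i\<bar>"
            using l[OF i] i by (intro tendsto_intros) (simp add: v_def)
          have "\<bar>\<sigma> n i - \<sigma> m i\<bar> \<le> e / 2" if "m \<ge> K" for m
          proof -
            have "linf N (\<sigma> n) (\<sigma> m) < e / 2" using K n that by blast
            then show ?thesis using linf_ge[OF i, of "\<sigma> n" "\<sigma> m"] by linarith
          qed
          then show "\<exists>K. \<forall>m\<ge>K. \<bar>\<sigma> n i - \<sigma> m i\<bar> \<le> e / 2" by blast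
        qed
      qed
      then show ?thesis using e by linarith
    qed
    then show ?thesis by blast
  qed
  moreover have "v \<in> RN N" by (simp add: RN_def v_def)
  ultimately show "\<exists>x\<in>RN N. \<forall>e>0. \<exists>K. \<forall>n\<ge>K. linf N (\<sigma> n) x < e" by blast
qed

lemma RN_dense:
  obtains q :: "nat \<Rightarrow> nat \<Rightarrow> real" where "\<forall>k. q k \<in> RN N" "\<forall>y\<in>RN N. \<forall>e>0. \<exists>k. linf N (q k) y < e"
proof -
  define Q where "Q = (\<lambda>f i. if i < N then f i else 0) ` (PiE {..<N} (\<lambda>_. \<rat> :: real set))"
  have cQ: "countable Q" unfolding Q_def by (intro countable_image countable_PiE countable_rat) auto
  have QR: "Q \<subseteq> RN N" unfolding Q_def by (intro image_subsetI) (simp add: RN_def)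
  have dense: "\<exists>x\<in>Q. linf N x y < e" if y: "y \<in> RN N" and e: "e > 0" for y e
  proof -
    have "\<forall>i. \<exists>r\<in>\<rat>. y i < r \<and> r < y i + e / 2" using Rats_dense_in_real e by simp
    then obtain f where f: "\<And>i. f i \<in> \<rat>" "\<And>i. y i < f i \<and> f i < y i + e / 2" by metis
    define x where "x i = (if i < N then f i else 0)" for i
    have "x = (\<lambda>i. if i < N then restrict f {..<N} i else 0)" by (auto simp: x_def)
    then have "x \<in> Q" unfolding Q_def using f(1) by (intro image_eqI[of _ _ "restrict f {..<N}"]) auto
    moreover have "linf N x y \<le> e / 2"
    proof (rule linf_le, use e in simp, intro allI impI)
      fix i assume "i < N"
      then show "\<bar>x i - y i\<bar> \<le> e / 2" using f(2)[of i] unfolding x_def by simp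
    qed
    ultimately show ?thesis using e by (intro bexI[of _ x]) linarith+
  qed
  have ne: "Q \<noteq> {}" using dense[of "\<lambda>_. 0" 1] by (auto simp: RN_def)
  show ?thesis
  proof (rule that[of "from_nat_into Q"])
    show "\<forall>k. from_nat_into Q k \<in> RN N" using from_nat_into[OF ne] QR by blast
    show "\<forall>y\<in>RN N. \<forall>e>0. \<exists>k. linf N (from_nat_into Q k) y < e"
      using dense from_nat_into_surj[OF cQ] by metis
  qed
qed

text \<open>The space is \<open>\<real>^N\<close> with the law of the tuple \<open>u\<close>. Its
  support stays in the closed ball because parameter values approximate every support point.\<close>

lemma maxdist_realize:
  assumes u: "\<forall>i<N. u i \<in> borel_measurable lebI" and R: "\<forall>i<N. \<forall>s\<in>{0..<1}. \<bar>u i s\<bar> \<le> R" "0 \<le> R"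
  obtains C where "C \<in> mmXNR N R" "rz C (maxdist N u)" "pm (maxdist N u)"
proof -
  define \<kappa> where "\<kappa> s i = (if i < N then u i s else 0)" for s i
  have \<kappa>R: "\<kappa> s \<in> RN N" for s by (simp add: RN_def \<kappa>_def)
  have m: "linf N (\<kappa> s) (\<kappa> t) = maxdist N u s t" for s t
    unfolding maxdist_def by (rule linf_cong) (simp add: \<kappa>_def)
  obtain q :: "nat \<Rightarrow> nat \<Rightarrow> real" where q: "\<forall>k. q k \<in> RN N" "\<forall>y\<in>RN N. \<forall>e>0. \<exists>k. linf N (q k) y < e"
    by (rule RN_dense)
  have "\<exists>\<mu>. mm_space (RN N, linf N, \<mu>) \<and> parameter (RN N, linf N, \<mu>) \<kappa>"
  proof (rule mm_spaceI[OF RN_metric RN_complete q \<kappa>R])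
    fix k r
    have "(\<lambda>s. linf N (q k) (\<lambda>i. u i s)) \<in> borel_measurable lebI" by (rule linf_measurable[OF u])
    then have "{s \<in> space lebI. linf N (q k) (\<lambda>i. u i s) < r} \<in> sets lebI"
      unfolding borel_measurable_iff_less by blast
    moreover have "linf N (q k) (\<lambda>i. u i s) = linf N (q k) (\<kappa> s)" for s
      by (rule linf_cong) (simp add: \<kappa>_def)
    ultimately show "{s \<in> {0..<1}. linf N (q k) (\<kappa> s) < r} \<in> sets lebI" by simp
  qed
  then obtain \<mu> where \<mu>: "mm_space (RN N, linf N, \<mu>)" "parameter (RN N, linf N, \<mu>) \<kappa>" by blast
  let ?S = "(RN N, linf N, \<mu>)"
  interpret mm ?S by unfold_locales (rule \<mu>(1))
  have "mm_supp ?S \<subseteq> {x \<in> RN N. linf N (\<lambda>_. 0) x \<le> R}"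
  proof
    fix x assume x: "x \<in> mm_supp ?S"
    have "linf N (\<lambda>_. 0) x \<le> R"
    proof (rule field_le_epsilon)
      fix e :: real assume "e > 0"
      then obtain s where s: "s \<in> {0..<1}" "linf N (\<kappa> s) x < e"
        using param_dense[OF \<mu>(2) full_I x, of e] by auto
      have "linf N (\<lambda>_. 0) (\<kappa> s) \<le> R"
        by (rule linf_le[OF R(2)]) (use R(1) s(1) in \<open>simp add: \<kappa>_def\<close>)
      then show "linf N (\<lambda>_. 0) x \<le> R + e" using linf_triangle[of N "\<lambda>_. 0" x "\<kappa> s"] s(2) by linarith
    qed
    then show "x \<in> {x \<in> RN N. linf N (\<lambda>_. 0) x \<le> R}" using supp_car[OF x] by simp
  qed
  then have "mm_class ?S \<in> mmXNR N R" unfolding mmXNR_def using \<mu>(1) by blast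
  moreover have "rz (mm_class ?S) (maxdist N u)"
    by (rule rz_of_space[OF \<mu> full_I]) (simp add: m)
  moreover have "pm (maxdist N u)"
  proof -
    have "(\<lambda>s t. dst ?S (\<kappa> s) (\<kappa> t)) = maxdist N u" by (intro ext) (simp add: m)
    then show ?thesis using pm_pullback[OF \<mu>] by simp
  qed
  ultimately show ?thesis by (rule that)
qed

text \<open>The functions are the coordinates of the embedding into \<open>\<real>^N\<close>, read
  on the realization \<open>F\<close>. Off a null set they come from McShane extension, so they are
  clamped to keep the bound everywhere.\<close>

lemma mmXNR_functions:
  assumes C: "C \<in> mmXNR N R" "C \<in> mmX" and F: "pm F" "rz C F" and R: "0 \<le> R"
  obtains u where "\<forall>i<N. u i \<in> Lf F" "\<forall>i<N. \<forall>s\<in>{0..<1}. \<bar>u i s\<bar> \<le> R" "rz C (maxdist N u)"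
proof -
  obtain \<mu> where \<mu>: "C = mm_class (RN N, linf N, \<mu>)" "mm_space (RN N, linf N, \<mu>)"
    "mm_supp (RN N, linf N, \<mu>) \<subseteq> {x \<in> RN N. linf N (\<lambda>_. 0) x \<le> R}"
    using C(1) unfolding mmXNR_def by blast
  let ?S = "(RN N, linf N, \<mu>)"
  note r = rep_props[OF C(2)]
  have "rep C \<in> mm_class ?S" using mm_class_self[OF r(1)] r(2) \<mu>(1) by simp
  then have "mm_iso ?S (rep C)" by (simp add: mm_class_def)
  then have iso: "mm_iso (rep C) ?S" by (rule mm_iso_sym[OF _ \<mu>(2) r(1)])
  obtain \<phi> J where \<phi>: "parameter (rep C) \<phi>" "full J" "\<forall>s\<in>J. \<forall>t\<in>J. F s t = dst (rep C) (\<phi> s) (\<phi> t)"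
    using F(2) unfolding rz_def by blast
  obtain \<psi> J2 where \<psi>: "parameter ?S \<psi>" "full J2" "\<forall>s\<in>J2. \<forall>t\<in>J2. dst ?S (\<psi> s) (\<psi> t) = dst (rep C) (\<phi> s) (\<phi> t)"
    by (rule mm_iso_params[OF iso r(1) \<mu>(2) \<phi>(1)])
  interpret mm ?S by unfold_locales (rule \<mu>(2))
  define J3 where "J3 = J \<inter> (J2 \<inter> (\<psi> -` mm_supp ?S \<inter> {0..<1}))"
  have J3: "full J3" unfolding J3_def by (intro full_Int \<phi> \<psi> param_supp_full)
  have JI: "J3 \<subseteq> {0..<1}" "J3 \<noteq> {}" using full_subset[OF J3] full_nonempty[OF J3] by auto
  have eq: "linf N (\<psi> s) (\<psi> t) = F s t" if "s \<in> J3" "t \<in> J3" for s t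
    using \<psi>(3) \<phi>(3) that by (simp add: J3_def)
  have bd: "\<bar>\<psi> s i\<bar> \<le> R" if "s \<in> J3" "i < N" for s i
  proof -
    have "linf N (\<lambda>_. 0) (\<psi> s) \<le> R" using that(1) \<mu>(3) unfolding J3_def by blast
    then show ?thesis using linf_ge[OF that(2), of "\<lambda>_. 0" "\<psi> s"] by simp
  qed
  have "\<exists>w. i < N \<longrightarrow> w \<in> Lf F \<and> (\<forall>s\<in>{0..<1}. \<bar>w s\<bar> \<le> R) \<and> (\<forall>s\<in>J3. w s = \<psi> s i)" for i
  proof (cases "i < N")
    case True
    have "\<forall>s\<in>J3. \<forall>t\<in>J3. \<psi> s i - \<psi> t i \<le> F s t + 0"
    proof (intro ballI)
      fix s t assume "s \<in> J3" "t \<in> J3"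
      then show "\<psi> s i - \<psi> t i \<le> F s t + 0" using eq linf_ge[OF True, of "\<psi> s" "\<psi> t"] by simp
    qed
    then obtain w where w: "w \<in> Lf F" "\<forall>s\<in>J3. w s \<le> \<psi> s i \<and> \<psi> s i - 0 \<le> w s"
      by (rule Lf_extend[OF F(1) JI(2,1)])
    have "clamp (-R) R (w s) = \<psi> s i" if "s \<in> J3" for s
    proof -
      have "w s = \<psi> s i" using w(2)[rule_format, OF that] by linarith
      then show ?thesis using bd[OF that True] by (simp add: clamp_id abs_le_iff)
    qed
    moreover have "\<bar>clamp (-R) R (w s)\<bar> \<le> R" for s using clamp_bounds[of "-R" R "w s"] R by linarith
    ultimately show ?thesis using Lf_clamp[OF w(1)] by (intro exI[of _ "\<lambda>s. clamp (-R) R (w s)"]) blast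
  qed simp
  then obtain u where u: "\<And>i. i < N \<Longrightarrow> u i \<in> Lf F \<and> (\<forall>s\<in>{0..<1}. \<bar>u i s\<bar> \<le> R) \<and> (\<forall>s\<in>J3. u i s = \<psi> s i)" by metis
  have "rz C (maxdist N u)"
  proof (rule rz_full_cong[OF F(2) J3], intro ballI)
    fix s t assume st: "s \<in> J3" "t \<in> J3"
    have "maxdist N u s t = linf N (\<psi> s) (\<psi> t)" unfolding maxdist_def by (rule linf_cong) (use u st in blast)
    then show "maxdist N u s t = F s t" using eq st by simp
  qed
  then show ?thesis using that[of u] u by blast
qed

lemma maxdist_near:
  assumes "\<forall>i<N. \<bar>u i s - v i s'\<bar> \<le> e" "\<forall>i<N. \<bar>u i t - v i t'\<bar> \<le> e" "0 \<le> e"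
  shows "\<bar>maxdist N u s t - maxdist N v s' t'\<bar> \<le> 2 * e"
proof -
  have "maxdist N u s t \<le> maxdist N v s' t' + 2 * e"
    unfolding maxdist_def
  proof (rule linf_le)
    show "0 \<le> linf N (\<lambda>i. v i s') (\<lambda>i. v i t') + 2 * e" using linf_nonneg[of N "\<lambda>i. v i s'" "\<lambda>i. v i t'"] assms(3) by linarith
    show "\<forall>i<N. \<bar>u i s - u i t\<bar> \<le> linf N (\<lambda>i. v i s') (\<lambda>i. v i t') + 2 * e"
    proof (intro allI impI)
      fix i assume i: "i < N"
      have "\<bar>u i s - v i s'\<bar> \<le> e" "\<bar>u i t - v i t'\<bar> \<le> e" using assms(1,2) i by blast+
      then show "\<bar>u i s - u i t\<bar> \<le> linf N (\<lambda>i. v i s') (\<lambda>i. v i t') + 2 * e"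
        using linf_ge[OF i, of "\<lambda>i. v i s'" "\<lambda>i. v i t'"] by linarith
    qed
  qed
  moreover have "maxdist N v s' t' \<le> maxdist N u s t + 2 * e"
    unfolding maxdist_def
  proof (rule linf_le)
    show "0 \<le> linf N (\<lambda>i. u i s) (\<lambda>i. u i t) + 2 * e" using linf_nonneg[of N "\<lambda>i. u i s" "\<lambda>i. u i t"] assms(3) by linarith
    show "\<forall>i<N. \<bar>v i s' - v i t'\<bar> \<le> linf N (\<lambda>i. u i s) (\<lambda>i. u i t) + 2 * e"
    proof (intro allI impI)
      fix i assume i: "i < N"
      have "\<bar>u i s - v i s'\<bar> \<le> e" "\<bar>u i t - v i t'\<bar> \<le> e" using assms(1,2) i by blast+
      then show "\<bar>v i s' - v i t'\<bar> \<le> linf N (\<lambda>i. u i s) (\<lambda>i. u i t) + 2 * e"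
        using linf_ge[OF i, of "\<lambda>i. u i s" "\<lambda>i. u i t"] by linarith
    qed
  qed
  ultimately show ?thesis by linarith
qed

text \<open>The coordinates of \<open>E\<close> are 1-Lipschitz on \<open>C\<close>, hence up to
  \<open>e\<close> on \<open>C'\<close>, and extend there with error \<open>e\<close> on the good
  set. Two points enter a distance, which gives the factor 2, whatever the dimension.\<close>

lemma dominated_transfer:
  assumes C: "C \<in> mmX" "C' \<in> mmX" "boxC C C' < e" and E: "E \<in> mmX" "E \<in> mmXNR N R" "lip_le E C" and R: "0 \<le> R"
  shows "\<exists>E'\<in>mmX. E' \<in> mmXNR N R \<and> lip_le E' C' \<and> boxC E E' \<le> 2 * e"
proof -
  have e: "0 < e" using boxC_bounds(1)[OF C(1,2)] C(3) by linarith
  obtain D D' where D: "pm D" "pm D'" "rz C D" "rz C' D'" "boxle D D' e" using boxC_less[OF C] by blast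
  obtain F K where F: "pm F" "rz E F" "full K" "\<forall>s\<in>K. \<forall>t\<in>K. F s t \<le> D s t"
    by (rule lip_le_rz[OF E(3) D(3) E(1)])
  obtain u where u: "\<forall>i<N. u i \<in> Lf F" "\<forall>i<N. \<forall>s\<in>{0..<1}. \<bar>u i s\<bar> \<le> R" "rz E (maxdist N u)"
    by (rule mmXNR_functions[OF E(2,1) F(1,2) R])
  obtain I0 where I0: "I0 \<in> sets lebI" "measure lebI I0 \<ge> 1 - e" "\<forall>s\<in>I0. \<forall>t\<in>I0. \<bar>D s t - D' s t\<bar> \<le> e"
    using D(5) unfolding boxle_def by blast
  define A where "A = I0 \<inter> K"
  have A: "A \<in> sets lebI" "measure lebI A \<ge> 1 - e" 
    unfolding A_def using I0 full_sets[OF F(3)] measure_full_Int[OF F(3) I0(1)] by auto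
  have AI: "A \<subseteq> {0..<1}" using A(1) by (simp add: sets_lebI_iff)
  have "\<exists>w. i < N \<longrightarrow> w \<in> Lf D' \<and> (\<forall>s\<in>{0..<1}. \<bar>w s\<bar> \<le> R) \<and> (\<forall>s\<in>A. \<bar>u i s - w s\<bar> \<le> e)" for i
  proof (cases "i < N \<and> A \<noteq> {}")
    case True
    then have i: "i < N" "A \<noteq> {}" by auto
    have "\<forall>s\<in>A. \<forall>t\<in>A. u i s - u i t \<le> D' s t + e"
    proof (intro ballI)
      fix s t assume st: "s \<in> A" "t \<in> A"
      have "\<bar>u i s - u i t\<bar> \<le> F s t" by (rule LfD[OF u(1)[rule_format, OF i(1)]]) (use st AI in auto)
      moreover have "F s t \<le> D s t" using F(4) st by (simp add: A_def)
      moreover have "\<bar>D s t - D' s t\<bar> \<le> e" using I0(3) st by (simp add: A_def)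
      ultimately show "u i s - u i t \<le> D' s t + e" by linarith
    qed
    then obtain w where w: "w \<in> Lf D'" "\<forall>s\<in>A. w s \<le> u i s \<and> u i s - e \<le> w s"
      by (rule Lf_extend[OF D(2) i(2) AI])
    have "\<bar>u i s - clamp (-R) R (w s)\<bar> \<le> e" if "s \<in> A" for s
    proof -
      have "\<bar>u i s\<bar> \<le> R" using u(2) i(1) that AI by blast
      then have "clamp (-R) R (u i s) = u i s" by (intro clamp_id) auto
      then have "\<bar>u i s - clamp (-R) R (w s)\<bar> \<le> \<bar>u i s - w s\<bar>" by (metis clamp_lip)
      then show ?thesis using w(2)[rule_format, OF that] by linarith
    qed
    moreover have "\<bar>clamp (-R) R (w s)\<bar> \<le> R" for s using clamp_bounds[of "-R" R "w s"] R by linarith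
    ultimately show ?thesis using Lf_clamp[OF w(1)] by (intro exI[of _ "\<lambda>s. clamp (-R) R (w s)"]) blast
  next
    case False
    \<comment> \<open>An empty good set can occur for \<open>e \<ge> 1\<close>; the zero function
      then meets all requirements.\<close>
    then show ?thesis using Lf_zero[OF D(2)] R by (intro exI[of _ "\<lambda>_. 0"]) auto
  qed
  then obtain v where v: "\<And>i. i < N \<Longrightarrow> v i \<in> Lf D' \<and> (\<forall>s\<in>{0..<1}. \<bar>v i s\<bar> \<le> R) \<and> (\<forall>s\<in>A. \<bar>u i s - v i s\<bar> \<le> e)" by metis
  have vm: "\<forall>i<N. v i \<in> borel_measurable lebI" using v Lf_measurable[OF D(2)] by blast
  have vL: "\<forall>i<N. v i \<in> Lf D'" using v by blast
  have vR: "\<forall>i<N. \<forall>s\<in>{0..<1}. \<bar>v i s\<bar> \<le> R" using v by blast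
  obtain E' where E': "E' \<in> mmXNR N R" "rz E' (maxdist N v)" "pm (maxdist N v)"
    by (rule maxdist_realize[OF vm vR R])
  have "lip_le E' C'"
    by (rule rz_le[OF D(4) E'(2) full_I maxdist_le_pm[OF D(2) vL]])
  moreover have "boxC E E' \<le> 2 * e"
  proof (rule boxC_le[OF u(3) E'(2) boxleI[OF A(1)]])
    show "1 - 2 * e \<le> measure lebI A" using A(2) e by linarith
    show "\<forall>s\<in>A. \<forall>t\<in>A. \<bar>maxdist N u s t - maxdist N v s t\<bar> \<le> 2 * e"
    proof (intro ballI)
      fix s t assume "s \<in> A" "t \<in> A"
      then show "\<bar>maxdist N u s t - maxdist N v s t\<bar> \<le> 2 * e" 
        by (intro maxdist_near) (use v e in auto)
    qed
  qed (use e in simp)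
  ultimately show ?thesis using E'(1) rz_mmX[OF E'(2)] by blast
qed

section \<open>Total boundedness of the finite-dimensional slices\<close>

lemma floor_quotient_near:
  assumes "0 \<le> x" "0 \<le> y" "d > (0::real)" "nat \<lfloor>x / d\<rfloor> = nat \<lfloor>y / d\<rfloor>"
  shows "\<bar>x - y\<bar> \<le> d"
proof -
  have "0 \<le> \<lfloor>x / d\<rfloor>" "0 \<le> \<lfloor>y / d\<rfloor>" using assms by auto
  then have "\<lfloor>x / d\<rfloor> = \<lfloor>y / d\<rfloor>" using assms(4) by linarith
  then have "\<bar>x / d - y / d\<bar> \<le> 1" using floor_correct[of "x / d"] floor_correct[of "y / d"] by linarith
  then have "\<bar>x - y\<bar> / d \<le> 1" using assms(3) by (simp flip: diff_divide_distrib)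
  then show ?thesis using assms(3) by (simp add: pos_divide_le_eq)
qed

text \<open>After sorting, the labels at \<open>s\<close> can differ only if \<open>s\<close> lies
  between the two distribution functions at some \<open>j < m\<close>. These are \<open>m\<close>
  intervals of length at most \<eta>.\<close>

lemma label_match:
  fixes k k' :: "real \<Rightarrow> nat"
  assumes k: "k \<in> measurable lebI (count_space UNIV)" "\<forall>s\<in>{0..<1}. k s < m"
    and k': "k' \<in> measurable lebI (count_space UNIV)" "\<forall>s\<in>{0..<1}. k' s < m"
    and cl: "\<forall>j<m. \<bar>measure lebI {t \<in> {0..<1}. k t \<le> j} - measure lebI {t \<in> {0..<1}. k' t \<le> j}\<bar> \<le> \<eta>"
  obtains \<alpha> \<beta> G where "mp \<alpha>" "mp \<beta>" "G \<in> sets lebI" "measure lebI G \<ge> 1 - real m * \<eta>"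
    "\<forall>s\<in>G. k (\<alpha> s) = k' (\<beta> s)"
proof -
  let ?F = "\<lambda>j. measure lebI {t \<in> {0..<1}. k t \<le> j}" and ?F' = "\<lambda>j. measure lebI {t \<in> {0..<1}. k' t \<le> j}"
  obtain \<alpha> J1 where a: "mp \<alpha>" "full J1" "\<forall>s\<in>J1. \<forall>i. k (\<alpha> s) \<le> i \<longleftrightarrow> s \<le> ?F i"
    by (rule label_sort[OF k(1)])
  obtain \<beta> J2 where b: "mp \<beta>" "full J2" "\<forall>s\<in>J2. \<forall>i. k' (\<beta> s) \<le> i \<longleftrightarrow> s \<le> ?F' i"
    by (rule label_sort[OF k'(1)])
  define B where "B j = {min (?F j) (?F' j)<..max (?F j) (?F' j)} \<inter> {0..<1}" for j
  have B: "B j \<in> sets lebI" for j by (auto simp: B_def sets_lebI_iff)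
  have Bm: "measure lebI (B j) \<le> \<eta>" if "j < m" for j
  proof -
    have "measure lebI (B j) = measure lborel (B j)" by (rule measure_lebI) (auto simp: B_def)
    also have "\<dots> \<le> measure lborel {min (?F j) (?F' j)<..max (?F j) (?F' j)}"
      unfolding B_def by (rule measure_mono_fmeasurable) (auto simp: fmeasurable_def)
    also have "\<dots> = \<bar>?F j - ?F' j\<bar>" by (simp add: max_def min_def)
    finally show ?thesis using cl that by force
  qed
  define U where "U = (\<Union>j<m. B j)"
  have U: "U \<in> sets lebI" unfolding U_def using B by blast
  have "measure lebI U \<le> (\<Sum>j<m. measure lebI (B j))"
    unfolding U_def by (rule measure_UNION_le) (use B in auto)
  also have "\<dots> \<le> (\<Sum>j<m. \<eta>)" by (rule sum_mono) (use Bm in auto)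
  finally have Um: "measure lebI U \<le> real m * \<eta>" by simp
  define G where "G = (space lebI - U) \<inter> (J1 \<inter> J2)"
  have cU: "space lebI - U \<in> sets lebI" by (rule sets.compl_sets[OF U])
  have G: "G \<in> sets lebI" 
    unfolding G_def using cU full_sets[OF a(2)] full_sets[OF b(2)] by blast
  have "measure lebI G = 1 - measure lebI U"
    unfolding G_def using measure_full_Int[OF full_Int[OF a(2) b(2)] cU] lebI.prob_compl[OF U] by simp
  then have "measure lebI G \<ge> 1 - real m * \<eta>" using Um by linarith
  moreover have "k (\<alpha> s) = k' (\<beta> s)" if s: "s \<in> G" for s
  proof -
    have sI: "0 \<le> s" "s < 1" and sJ: "s \<in> J1" "s \<in> J2" and sU: "s \<notin> U" using s by (auto simp: G_def)
    have "k (\<alpha> s) \<le> j \<longleftrightarrow> k' (\<beta> s) \<le> j" for j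
    proof (cases "j < m")
      case True
      then have "s \<notin> B j" using sU by (auto simp: U_def)
      then have "s \<le> ?F j \<longleftrightarrow> s \<le> ?F' j" using sI unfolding B_def by (auto simp: min_def max_def split: if_splits)
      then show ?thesis using a(3) b(3) sJ by blast
    next
      case False
      have "k (\<alpha> s) < m" "k' (\<beta> s) < m" using k(2) k'(2) mp_range[OF a(1) sI] mp_range[OF b(1) sI] by auto
      then show ?thesis using False by simp
    qed
    then show ?thesis by (meson order_antisym order_refl)
  qed
  ultimately show ?thesis using that[OF a(1) b(1) G] by blast
qed

text \<open>Coordinates are rounded to a grid and the distribution of the grid cell is rounded
  again, leaving finitely many patterns. Two classes with the same pattern can be rearranged to
  agree in the cell except on a small set.\<close>

lemma mmXNR_totally_bounded:
  assumes A: "A \<subseteq> mmXNR N R" "A \<subseteq> mmX" and R: "0 \<le> R" and e: "e > (0::real)"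
  shows "\<exists>B. finite B \<and> B \<subseteq> A \<and> (\<forall>a\<in>A. \<exists>b\<in>B. boxC a b \<le> e)"
proof -
  have "\<exists>u. (\<forall>i<N. u i \<in> borel_measurable lebI) \<and> (\<forall>i<N. \<forall>s\<in>{0..<1}. \<bar>u i s\<bar> \<le> R) \<and> rz a (maxdist N u)"
    if a: "a \<in> A" for a
  proof -
    have am: "a \<in> mmXNR N R" "a \<in> mmX" using a A by auto
    obtain F where F: "pm F" "rz a F" by (rule rz_exists[OF am(2)])
    obtain u where u: "\<forall>i<N. u i \<in> Lf F" "\<forall>i<N. \<forall>s\<in>{0..<1}. \<bar>u i s\<bar> \<le> R" "rz a (maxdist N u)"
      by (rule mmXNR_functions[OF am F R])
    then show ?thesis using Lf_measurable[OF F(1)] by blast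
  qed
  then obtain u where u: "\<And>a. a \<in> A \<Longrightarrow> \<forall>i<N. u a i \<in> borel_measurable lebI"
    "\<And>a. a \<in> A \<Longrightarrow> \<forall>i<N. \<forall>s\<in>{0..<1}. \<bar>u a i s\<bar> \<le> R" "\<And>a. a \<in> A \<Longrightarrow> rz a (maxdist N (u a))" by metis
  \<comment> \<open>The mesh of the grid: coordinates off by \<open>d\<close> change a sup-norm
    distance by at most \<open>2 * d\<close>.\<close>
  define d where "d = e / 2"
  have d: "d > 0" using e by (simp add: d_def)
  define L where "L = Suc (nat \<lfloor>2 * R / d\<rfloor>)"
  define cell where "cell x = nat \<lfloor>(x + R) / d\<rfloor>" for x
  have cellL: "cell x < L" if "\<bar>x\<bar> \<le> R" for x
  proof -
    have "(x + R) / d \<le> 2 * R / d" using that d by (intro divide_right_mono) auto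
    then have "\<lfloor>(x + R) / d\<rfloor> \<le> \<lfloor>2 * R / d\<rfloor>" by (rule floor_mono)
    then show ?thesis unfolding cell_def L_def by linarith
  qed
  define X where "X = PiE {..<N} (\<lambda>_. {..<L})"
  have X: "finite X" unfolding X_def by (intro finite_PiE) auto
  \<comment> \<open>Cells are numbered so that they can be sorted as labels below
    \<open>card X\<close>.\<close>
  obtain h where h: "bij_betw h X {0..<card X}" using ex_bij_betw_finite_nat[OF X] by blast
  define c where "c a s = (\<lambda>i\<in>{..<N}. cell (u a i s))" for a s
  define k where "k a s = h (c a s)" for a s
  have cX: "c a s \<in> X" if "a \<in> A" "s \<in> {0..<1}" for a s
    unfolding c_def X_def using cellL u(2)[OF that(1)] that(2) by auto
  have kX: "\<forall>s\<in>{0..<1}. k a s < card X" if "a \<in> A" for a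
    using cX[OF that] h unfolding k_def bij_betw_def by fastforce
  have km: "k a \<in> measurable lebI (count_space UNIV)" if a: "a \<in> A" for a
  proof -
    have S: "{s \<in> space lebI. \<forall>i\<in>{..<N}. cell (u a i s) = f i} \<in> sets lebI" for f
    proof (rule sets.sets_Collect_finite_All)
      fix i assume "i \<in> {..<N}"
      then have [measurable]: "u a i \<in> borel_measurable lebI" using u(1)[OF a] by simp
      have "(\<lambda>s. \<lfloor>(u a i s + R) / d\<rfloor>) \<in> measurable lebI (count_space UNIV)" by measurable
      then have "(\<lambda>s. cell (u a i s)) \<in> measurable lebI (count_space UNIV)"
        unfolding cell_def by (rule measurable_compose[where g=nat]) simp
      from measurable_sets[OF this, of "{f i}"] show "{s \<in> space lebI. cell (u a i s) = f i} \<in> sets lebI"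
        by (simp add: vimage_def Int_def conj_commute)
    qed simp
    have "k a -` {j} \<inter> space lebI \<in> sets lebI" for j
    proof -
      have "k a -` {j} \<inter> space lebI = (\<Union>f\<in>{f\<in>X. h f = j}. {s \<in> space lebI. \<forall>i\<in>{..<N}. cell (u a i s) = f i})"
      proof (intro equalityI subsetI)
        fix s assume s: "s \<in> k a -` {j} \<inter> space lebI"
        then have "c a s \<in> {f\<in>X. h f = j}" using cX[OF a] by (simp add: k_def)
        moreover have "s \<in> {s \<in> space lebI. \<forall>i\<in>{..<N}. cell (u a i s) = c a s i}" using s by (simp add: c_def)
        ultimately show "s \<in> (\<Union>f\<in>{f\<in>X. h f = j}. {s \<in> space lebI. \<forall>i\<in>{..<N}. cell (u a i s) = f i})" by blast
      next
        fix s assume "s \<in> (\<Union>f\<in>{f\<in>X. h f = j}. {s \<in> space lebI. \<forall>i\<in>{..<N}. cell (u a i s) = f i})"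
        then obtain f where f: "f \<in> X" "h f = j" "s \<in> space lebI" "\<forall>i\<in>{..<N}. cell (u a i s) = f i" by blast
        have "c a s = f"
        proof
          fix i show "c a s i = f i"
            using f(1,4) by (cases "i < N") (auto simp: c_def X_def PiE_def extensional_def)
        qed
        then show "s \<in> k a -` {j} \<inter> space lebI" using f by (simp add: k_def)
      qed
      then show ?thesis using S X by auto
    qed
    then show ?thesis by (simp add: measurable_count_space_eq2_countable)
  qed
  let ?m = "card X"
  \<comment> \<open>Chosen so that the total mismatch over all \<open>?m\<close> labels has measure
    at most \<open>e\<close>; the summand 1 keeps the denominator positive.\<close>
  define \<eta> where "\<eta> = e / (real ?m + 1)"
  have \<eta>: "\<eta> > 0" "real ?m * \<eta> \<le> e" using e by (auto simp: \<eta>_def field_simps)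
  define F where "F a j = measure lebI {t \<in> {0..<1}. k a t \<le> j}" for a j
  define \<Phi> where "\<Phi> a = (\<lambda>j\<in>{..<?m}. nat \<lfloor>F a j / \<eta>\<rfloor>)" for a
  have F01: "0 \<le> F a j" "F a j \<le> 1" for a j by (auto simp: F_def)
  have "\<Phi> ` A \<subseteq> PiE {..<?m} (\<lambda>_. {..nat \<lfloor>1 / \<eta>\<rfloor>})"
  proof -
    have "nat \<lfloor>F a j / \<eta>\<rfloor> \<le> nat \<lfloor>1 / \<eta>\<rfloor>" for a j
      using F01 \<eta>(1) by (intro nat_mono floor_mono divide_right_mono) auto
    then show ?thesis unfolding \<Phi>_def by (intro image_subsetI) (simp add: restrict_PiE_iff)
  qed
  then have fin: "finite (\<Phi> ` A)" by (rule finite_subset) (intro finite_PiE, auto)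
  define B where "B = inv_into A \<Phi> ` (\<Phi> ` A)"
  have "\<exists>b\<in>B. boxC a b \<le> e" if a: "a \<in> A" for a
  proof (rule bexI)
    define b where "b = inv_into A \<Phi> (\<Phi> a)"
    show "inv_into A \<Phi> (\<Phi> a) \<in> B" using a by (auto simp: B_def)
    have b: "b \<in> A" "\<Phi> b = \<Phi> a"
      unfolding b_def using a by (auto intro!: inv_into_into f_inv_into_f)
    have "\<forall>j<?m. \<bar>F a j - F b j\<bar> \<le> \<eta>"
    proof (intro allI impI)
      fix j assume j: "j < ?m"
      have "\<Phi> a j = \<Phi> b j" using b(2) by simp
      then have "nat \<lfloor>F a j / \<eta>\<rfloor> = nat \<lfloor>F b j / \<eta>\<rfloor>" using j by (simp add: \<Phi>_def)
      then show "\<bar>F a j - F b j\<bar> \<le> \<eta>" by (rule floor_quotient_near[OF F01(1) F01(1) \<eta>(1)])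
    qed
    then obtain \<alpha> \<beta> G where G: "mp \<alpha>" "mp \<beta>" "G \<in> sets lebI" "measure lebI G \<ge> 1 - real ?m * \<eta>"
      "\<forall>s\<in>G. k a (\<alpha> s) = k b (\<beta> s)"
      unfolding F_def by (rule label_match[OF km[OF a] kX[OF a] km[OF b(1)] kX[OF b(1)]])
    have near: "\<bar>u a i (\<alpha> s) - u b i (\<beta> s)\<bar> \<le> d" if s: "s \<in> G" and i: "i < N" for s i
    proof -
      have sI: "0 \<le> s" "s < 1" using G(3) s by (auto simp: sets_lebI_iff)
      have r: "\<alpha> s \<in> {0..<1}" "\<beta> s \<in> {0..<1}" using mp_range[OF G(1) sI] mp_range[OF G(2) sI] by auto
      have "c a (\<alpha> s) = c b (\<beta> s)"
        using h cX[OF a r(1)] cX[OF b(1) r(2)] G(5) s unfolding k_def bij_betw_def inj_on_def by blast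
      then have "c a (\<alpha> s) i = c b (\<beta> s) i" by simp
      then have "cell (u a i (\<alpha> s)) = cell (u b i (\<beta> s))" using i by (simp add: c_def)
      moreover have "\<bar>u a i (\<alpha> s)\<bar> \<le> R" "\<bar>u b i (\<beta> s)\<bar> \<le> R" using u(2)[OF a] u(2)[OF b(1)] i r by blast+
      ultimately have "\<bar>(u a i (\<alpha> s) + R) - (u b i (\<beta> s) + R)\<bar> \<le> d"
        unfolding cell_def by (intro floor_quotient_near[OF _ _ d]) auto
      then show ?thesis by simp
    qed
    have "boxC a b \<le> e"
    proof (rule boxC_le[OF rz_mp[OF u(3)[OF a] G(1)] rz_mp[OF u(3)[OF b(1)] G(2)] boxleI[OF G(3)]])
      show "1 - e \<le> measure lebI G" using G(4) \<eta>(2) by linarith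
      show "\<forall>s\<in>G. \<forall>t\<in>G. \<bar>maxdist N (u a) (\<alpha> s) (\<alpha> t) - maxdist N (u b) (\<beta> s) (\<beta> t)\<bar> \<le> e"
      proof (intro ballI)
        fix s t assume st: "s \<in> G" "t \<in> G"
        have "\<bar>maxdist N (u a) (\<alpha> s) (\<alpha> t) - maxdist N (u b) (\<beta> s) (\<beta> t)\<bar> \<le> 2 * d"
          by (rule maxdist_near) (use near st d in auto)
        then show "\<bar>maxdist N (u a) (\<alpha> s) (\<alpha> t) - maxdist N (u b) (\<beta> s) (\<beta> t)\<bar> \<le> e" by (simp add: d_def)
      qed
    qed (use e in simp)
    then show "boxC a (inv_into A \<Phi> (\<Phi> a)) \<le> e" by (simp add: b_def)
  qed
  moreover have "finite B" unfolding B_def using fin by simp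
  moreover have "B \<subseteq> A" unfolding B_def by (intro image_subsetI inv_into_into)
  ultimately show ?thesis by blast
qed

text \<open>The dominated space is the law of the truncated distances to a finite net.\<close>

lemma finite_dim_approx:
  assumes C: "C \<in> mmX" and e: "e > 0"
  obtains n C' where "1 \<le> n" "C' \<in> mmXNR n (real n)" "C' \<in> mmX" "lip_le C' C" "boxC C C' \<le> e"
proof -
  define \<epsilon> where "\<epsilon> = e / 2"
  have \<epsilon>: "\<epsilon> > 0" using e by (simp add: \<epsilon>_def)
  obtain D where D: "pm D" "rz C D" by (rule rz_exists[OF C])
  obtain N :: nat where N: "0 < N" "\<forall>D. pm D \<longrightarrow> rz C D \<longrightarrow> (\<exists>s. (\<forall>i<N. s i \<in> {0..<1}) \<and>
      {t \<in> {0..<1}. \<exists>i<N. D (s i) t < \<epsilon>} \<in> sets lebI \<and> measure lebI {t \<in> {0..<1}. \<exists>i<N. D (s i) t < \<epsilon>} \<ge> 1 - \<epsilon>)"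
    by (rule covering_number[OF C \<epsilon>])
  obtain s0 where s0: "\<forall>i<N. s0 i \<in> {0..<1}" "{t \<in> {0..<1}. \<exists>i<N. D (s0 i) t < \<epsilon>} \<in> sets lebI"
      "measure lebI {t \<in> {0..<1}. \<exists>i<N. D (s0 i) t < \<epsilon>} \<ge> 1 - \<epsilon>" using N(2) D by blast
  \<comment> \<open>The sum bounds all distances to the net at once. Where it is at most
    \<open>K\<close>, truncating them at \<open>n \<ge> K\<close> changes nothing.\<close>
  define H where "H t = (\<Sum>i<N. D (s0 i) t)" for t
  have Hm: "H \<in> borel_measurable lebI" unfolding H_def
    by (rule borel_measurable_sum) (use pmD(4)[OF D(1)] s0(1) in auto)
  obtain K :: real where K: "K > 0" "{s \<in> {0..<1}. H s \<le> K} \<in> sets lebI" "measure lebI {s \<in> {0..<1}. H s \<le> K} \<ge> 1 - \<epsilon>"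
    by (rule measurable_bound[OF Hm \<epsilon>])
  obtain n0 :: nat where n0: "K \<le> real n0" using real_arch_simple by blast
  \<comment> \<open>A slice uses one number for both dimension and radius, so \<open>n\<close> must
    exceed both.\<close>
  define n where "n = max N n0"
  have n: "1 \<le> n" "N \<le> n" "K \<le> real n" using N(1) n0 by (auto simp: n_def)
  \<comment> \<open>The net has \<open>N\<close> points, but \<open>n\<close> coordinates are
    needed; the first point is repeated.\<close>
  define s where "s i = s0 (if i < N then i else 0)" for i
  have sI: "s i \<in> {0..<1}" for i using s0(1) N(1) by (simp add: s_def)
  define v where "v i t = clamp (- real n) (real n) (D (s i) t)" for i t
  have DL: "D (s i) \<in> Lf D" for i unfolding Lf_def using pm_reverse[OF D(1) sI] by blast
  have v: "\<forall>i<n. v i \<in> Lf D" unfolding v_def using Lf_clamp[OF DL] by blast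
  have vm: "\<forall>i<n. v i \<in> borel_measurable lebI" using v Lf_measurable[OF D(1)] by blast
  have vR: "\<forall>i<n. \<forall>t\<in>{0..<1}. \<bar>v i t\<bar> \<le> real n"
  proof (intro allI impI ballI)
    fix i t
    show "\<bar>v i t\<bar> \<le> real n" unfolding v_def using clamp_bounds[of "- real n" "real n" "D (s i) t"] by linarith
  qed
  obtain C' where C': "C' \<in> mmXNR n (real n)" "rz C' (maxdist n v)" "pm (maxdist n v)"
    by (rule maxdist_realize[OF vm vR]) simp
  define G where "G = {t \<in> {0..<1}. \<exists>i<N. D (s0 i) t < \<epsilon>} \<inter> {s \<in> {0..<1}. H s \<le> K}"
  have G: "G \<in> sets lebI" "measure lebI G \<ge> 1 - (\<epsilon> + \<epsilon>)"
    unfolding G_def using sets.Int[OF s0(2) K(2)] measure_Int_ge[OF s0(2) K(2) s0(3) K(3)] by blast+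
  have "boxle D (maxdist n v) (2 * \<epsilon> + 2 * 0)"
  proof (rule net_boxle[OF D(1) _ G])
    show "\<forall>i<n. s i \<in> {0..<1}" using sI by blast
    show "\<forall>t\<in>G. \<exists>i<n. D (s i) t < \<epsilon>"
    proof
      fix t assume "t \<in> G"
      then obtain i where i: "i < N" "D (s0 i) t < \<epsilon>" by (auto simp: G_def)
      then have "D (s i) t < \<epsilon>" by (simp add: s_def)
      then show "\<exists>i<n. D (s i) t < \<epsilon>" using i(1) n(2) by (intro exI[of _ i]) simp
    qed
    show "\<forall>t\<in>G. \<forall>i<n. \<bar>D (s i) t - v i t\<bar> \<le> 0"
    proof (intro ballI allI impI)
      fix t i assume t: "t \<in> G"
      then have tI: "t \<in> {0..<1}" and Ht: "H t \<le> K" by (auto simp: G_def)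
      define j where "j = (if i < N then i else 0)"
      have j: "j < N" using N(1) by (simp add: j_def)
      have "D (s0 j) t \<le> H t" unfolding H_def
        by (rule member_le_sum) (use j pm_nonneg[OF D(1) _ tI] s0(1) in auto)
      then have "D (s i) t \<le> real n" using Ht n(3) by (simp add: s_def j_def)
      moreover have "0 \<le> D (s i) t" by (rule pm_nonneg[OF D(1) sI tI])
      ultimately have "v i t = D (s i) t" unfolding v_def by (intro clamp_id) auto
      then show "\<bar>D (s i) t - v i t\<bar> \<le> 0" by simp
    qed
  qed (use \<epsilon> in auto)
  then have "boxle D (maxdist n v) e" by (simp add: \<epsilon>_def)
  then have "boxC C C' \<le> e" by (rule boxC_le[OF D(2) C'(2)]) (use e in simp)
  moreover have "lip_le C' C" by (rule rz_le[OF D(2) C'(2) full_I maxdist_le_pm[OF D(1) v]])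
  ultimately show ?thesis using that[OF n(1) C'(1) rz_mmX[OF C'(2)]] by blast
qed

section \<open>Pyramids and the weak topology\<close>

definition slice :: "nat \<Rightarrow> real mm set set \<Rightarrow> real mm set set" where
  "slice n P = P \<inter> mmXNR n (real n)"

definition Hd :: "nat \<Rightarrow> real mm set set \<Rightarrow> real mm set set \<Rightarrow> real" where
  "Hd n P Q = hausdorff_dist boxC (slice n P) (slice n Q)"

lemma Pyr_mmX: "P \<in> Pyr \<Longrightarrow> C \<in> P \<Longrightarrow> C \<in> mmX"
  unfolding Pyr_def pyramid_def by blast

lemma Pyr_down: "P \<in> Pyr \<Longrightarrow> C \<in> P \<Longrightarrow> D \<in> mmX \<Longrightarrow> lip_le D C \<Longrightarrow> D \<in> P"
  unfolding Pyr_def pyramid_def by blast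

lemma Pyr_directed: "P \<in> Pyr \<Longrightarrow> C \<in> P \<Longrightarrow> D \<in> P \<Longrightarrow> \<exists>E\<in>P. lip_le C E \<and> lip_le D E"
  unfolding Pyr_def pyramid_def by blast

lemma Pyr_nonempty: "P \<in> Pyr \<Longrightarrow> P \<noteq> {}"
  unfolding Pyr_def pyramid_def by blast

text \<open>The zero pseudo-metric realizes the one-point space, which every space dominates.
  Nonemptiness gives the suprema and infima in the Hausdorff distance their meaning.\<close>

lemma slice_nonempty:
  assumes P: "P \<in> Pyr" shows "slice n P \<noteq> {}"
proof -
  obtain X where X: "X \<in> P" using Pyr_nonempty[OF P] by blast
  obtain D where D: "pm D" "rz X D" by (rule rz_exists[OF Pyr_mmX[OF P X]])
  obtain C where C: "C \<in> mmXNR n (real n)" "rz C (maxdist n (\<lambda>_ _. 0))" "pm (maxdist n (\<lambda>_ _. 0))"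
    by (rule maxdist_realize[of n "\<lambda>_ _. 0" "real n"]) auto
  have "lip_le C X"
    by (rule rz_le[OF D(2) C(2) full_I]) (use pm_nonneg[OF D(1)] in \<open>auto simp: maxdist_def linf_self\<close>)
  then have "C \<in> P" by (rule Pyr_down[OF P X rz_mmX[OF C(2)]])
  then show ?thesis using C(1) unfolding slice_def by blast
qed

lemma slice_mmX: "P \<in> Pyr \<Longrightarrow> C \<in> slice n P \<Longrightarrow> C \<in> mmX"
  unfolding slice_def using Pyr_mmX by blast

lemma box_slice_bounds:
  "P \<in> Pyr \<Longrightarrow> Q \<in> Pyr \<Longrightarrow> \<forall>a\<in>slice n P. \<forall>b\<in>slice n Q. 0 \<le> boxC a b \<and> boxC a b \<le> 1"
  using boxC_bounds slice_mmX by blast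

lemma Hd_le:
  assumes "P \<in> Pyr" "Q \<in> Pyr" "\<forall>a\<in>slice n P. \<exists>b\<in>slice n Q. boxC a b \<le> e" "\<forall>b\<in>slice n Q. \<exists>a\<in>slice n P. boxC a b \<le> e"
  shows "Hd n P Q \<le> e"
  unfolding Hd_def
  by (rule hausdorff_le[OF slice_nonempty[OF assms(1)] slice_nonempty[OF assms(2)] _ assms(3,4)])
    (use box_slice_bounds[OF assms(1,2)] in blast)

lemma Hd_less:
  assumes "P \<in> Pyr" "Q \<in> Pyr" "Hd n P Q < e"
  shows "a \<in> slice n P \<Longrightarrow> \<exists>b\<in>slice n Q. boxC a b < e" "b \<in> slice n Q \<Longrightarrow> \<exists>a\<in>slice n P. boxC a b < e"
  using hausdorff_less1[OF slice_nonempty[OF assms(2)] box_slice_bounds[OF assms(1,2)] assms(3)[unfolded Hd_def]]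
    hausdorff_less2[OF slice_nonempty[OF assms(1)] box_slice_bounds[OF assms(1,2)] assms(3)[unfolded Hd_def]]
  by blast+

lemma Hd_bounds:
  assumes P: "P \<in> Pyr" "Q \<in> Pyr" shows "0 \<le> Hd n P Q" "Hd n P Q \<le> 1"
proof -
  show "0 \<le> Hd n P Q"
    unfolding Hd_def
    by (rule hausdorff_nonneg[OF slice_nonempty[OF P(1)] slice_nonempty[OF P(2)] box_slice_bounds[OF P]])
  obtain a where a: "a \<in> slice n P" using slice_nonempty[OF P(1), of n] by blast
  obtain b where b: "b \<in> slice n Q" using slice_nonempty[OF P(2), of n] by blast
  show "Hd n P Q \<le> 1" by (rule Hd_le[OF P]) (use box_slice_bounds[OF P] a b in blast)+
qed

lemma Hd_sym: 
  assumes P: "P \<in> Pyr" "Q \<in> Pyr" shows "Hd n P Q = Hd n Q P"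
proof -
  have le: "Hd n Q P \<le> Hd n P Q" if P: "P \<in> Pyr" "Q \<in> Pyr" for P Q
  proof (rule field_le_epsilon)
    fix e :: real assume "e > 0"
    then have l: "Hd n P Q < Hd n P Q + e" by simp
    show "Hd n Q P \<le> Hd n P Q + e"
    proof (rule Hd_le[OF P(2,1)])
      show "\<forall>a\<in>slice n Q. \<exists>b\<in>slice n P. boxC a b \<le> Hd n P Q + e"
      proof
        fix a assume a: "a \<in> slice n Q"
        obtain b where b: "b \<in> slice n P" "boxC b a < Hd n P Q + e" using Hd_less(2)[OF P l a] by blast
        have "boxC a b = boxC b a" by (rule box.dist_sym[OF slice_mmX[OF P(1) b(1)] slice_mmX[OF P(2) a]])
        then show "\<exists>b\<in>slice n P. boxC a b \<le> Hd n P Q + e" using b by (intro bexI[OF _ b(1)]) simp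
      qed
      show "\<forall>b\<in>slice n P. \<exists>a\<in>slice n Q. boxC a b \<le> Hd n P Q + e"
      proof
        fix b assume b: "b \<in> slice n P"
        obtain a where a: "a \<in> slice n Q" "boxC b a < Hd n P Q + e" using Hd_less(1)[OF P l b] by blast
        have "boxC a b = boxC b a" by (rule box.dist_sym[OF slice_mmX[OF P(1) b] slice_mmX[OF P(2) a(1)]])
        then show "\<exists>a\<in>slice n Q. boxC a b \<le> Hd n P Q + e" using a by (intro bexI[OF _ a(1)]) simp
      qed
    qed
  qed
  show ?thesis by (rule antisym[OF le[OF P(2,1)] le[OF P]])
qed

lemma Hd_zero: 
  assumes P: "P \<in> Pyr" shows "Hd n P P = 0"
proof -
  have "boxC a a = 0" if "a \<in> slice n P" for a using box.dist_zero[OF slice_mmX[OF P that]] .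
  then have "Hd n P P \<le> 0" by (intro Hd_le[OF P P]) force+
  then show ?thesis using Hd_bounds(1)[OF P P, of n] by simp
qed

lemma Hd_triangle:
  assumes P: "P \<in> Pyr" "Q \<in> Pyr" "R \<in> Pyr" shows "Hd n P R \<le> Hd n P Q + Hd n Q R"
proof (rule field_le_epsilon)
  fix e :: real assume e: "e > 0"
  then have l1: "Hd n P Q < Hd n P Q + e / 2" and l2: "Hd n Q R < Hd n Q R + e / 2" by auto
  have tri: "boxC a c \<le> boxC a b + boxC b c" if "a \<in> slice n P" "b \<in> slice n Q" "c \<in> slice n R" for a b c
    by (rule box.dist_triangle) (use slice_mmX P that in blast)+
  show "Hd n P R \<le> Hd n P Q + Hd n Q R + e"
  proof (rule Hd_le[OF P(1,3)])
    show "\<forall>a\<in>slice n P. \<exists>c\<in>slice n R. boxC a c \<le> Hd n P Q + Hd n Q R + e"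
    proof
      fix a assume a: "a \<in> slice n P"
      obtain b where b: "b \<in> slice n Q" "boxC a b < Hd n P Q + e / 2" using Hd_less(1)[OF P(1,2) l1 a] by blast
      obtain c where c: "c \<in> slice n R" "boxC b c < Hd n Q R + e / 2" using Hd_less(1)[OF P(2,3) l2 b(1)] by blast
      show "\<exists>c\<in>slice n R. boxC a c \<le> Hd n P Q + Hd n Q R + e"
        using tri[OF a b(1) c(1)] b(2) c(2) by (intro bexI[OF _ c(1)]) linarith
    qed
    show "\<forall>c\<in>slice n R. \<exists>a\<in>slice n P. boxC a c \<le> Hd n P Q + Hd n Q R + e"
    proof
      fix c assume c: "c \<in> slice n R"
      obtain b where b: "b \<in> slice n Q" "boxC b c < Hd n Q R + e / 2" using Hd_less(2)[OF P(2,3) l2 c] by blast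
      obtain a where a: "a \<in> slice n P" "boxC a b < Hd n P Q + e / 2" using Hd_less(2)[OF P(1,2) l1 b(1)] by blast
      show "\<exists>a\<in>slice n P. boxC a c \<le> Hd n P Q + Hd n Q R + e"
        using tri[OF a(1) b(1) c] a(2) b(2) by (intro bexI[OF _ a(1)]) linarith
    qed
  qed
qed

text \<open>The weights of \<open>rho\<close> with the index shifted: the summand \<open>k\<close>
  belongs to the slice \<open>Suc k\<close>.\<close>

definition wt :: "nat \<Rightarrow> real" where "wt k = 1 / (2 ^ (Suc k + 2) * real (Suc k))"

lemma rho_alt: "rho P Q = (\<Sum>k. wt k * Hd (Suc k) P Q)"
  by (simp add: rho_def wt_def Hd_def slice_def Let_def)

lemma wt_pos: "0 < wt k" by (simp add: wt_def)

lemma wt_le: "wt k \<le> (1/2) ^ Suc k * (1 / real (Suc k))"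
proof -
  have "wt k = (1/2) ^ Suc k * (1 / real (Suc k)) * (1 / 4)" by (simp add: wt_def power_divide field_simps)
  also have "\<dots> \<le> (1/2) ^ Suc k * (1 / real (Suc k)) * 1" by (rule mult_left_mono) auto
  finally show ?thesis by simp
qed

lemma half_sums: "(\<lambda>k. (1/2) ^ Suc k * c) sums (c::real)"
  using sums_mult2[OF power_half_series, of c] by simp

lemma rho_term_bound:
  assumes P: "P \<in> Pyr" "Q \<in> Pyr" shows "0 \<le> wt k * Hd (Suc k) P Q" "wt k * Hd (Suc k) P Q \<le> (1/2) ^ Suc k * 1"
proof -
  show "0 \<le> wt k * Hd (Suc k) P Q" using Hd_bounds(1)[OF P] wt_pos[of k] by simp
  have "wt k * Hd (Suc k) P Q \<le> wt k * 1" by (rule mult_left_mono) (use Hd_bounds(2)[OF P] wt_pos[of k] in auto)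
  also have "\<dots> \<le> (1/2) ^ Suc k * (1 / real (Suc k))" using wt_le by simp
  also have "\<dots> \<le> (1/2) ^ Suc k * 1" by (rule mult_left_mono) auto
  finally show "wt k * Hd (Suc k) P Q \<le> (1/2) ^ Suc k * 1" .
qed

lemma rho_summable:
  assumes P: "P \<in> Pyr" "Q \<in> Pyr" shows "summable (\<lambda>k. wt k * Hd (Suc k) P Q)"
proof (rule summable_comparison_test'[OF sums_summable[OF half_sums[of 1]], of 0])
  fix k show "norm (wt k * Hd (Suc k) P Q) \<le> (1/2) ^ Suc k * 1"
    using rho_term_bound[OF P, of k] by simp
qed

text \<open>The weights are compared with powers of 1/2 of total mass 1. Up to \<open>n0\<close> the
  bound on the slices is used; beyond it the factor \<open>1 / n\<close> in the weight is itself at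
  most \<open>c\<close>, as Hausdorff distances of slices never exceed 1.\<close>

lemma rho_le:
  assumes P: "P \<in> Pyr" "Q \<in> Pyr" and c: "1 / real (Suc n0) \<le> c" and l: "\<forall>n. 1 \<le> n \<longrightarrow> n \<le> n0 \<longrightarrow> Hd n P Q \<le> c"
  shows "rho P Q \<le> c"
proof -
  have c0: "0 \<le> c" using c by (meson divide_nonneg_nonneg of_nat_0_le_iff order_trans zero_le_one)
  have "wt k * Hd (Suc k) P Q \<le> (1/2) ^ Suc k * c" for k
  proof (cases "Suc k \<le> n0")
    case True
    have "wt k * Hd (Suc k) P Q \<le> wt k * c" by (rule mult_left_mono) (use l True wt_pos[of k] in auto)
    also have "\<dots> \<le> (1/2) ^ Suc k * (1 / real (Suc k)) * c" by (rule mult_right_mono[OF wt_le c0])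
    also have "\<dots> \<le> (1/2) ^ Suc k * 1 * c" by (intro mult_right_mono mult_left_mono c0) auto
    finally show ?thesis by simp
  next
    case False
    have "wt k * Hd (Suc k) P Q \<le> wt k * 1" by (rule mult_left_mono) (use Hd_bounds(2)[OF P] wt_pos[of k] in auto)
    also have "\<dots> \<le> (1/2) ^ Suc k * (1 / real (Suc k))" using wt_le by simp
    also have "\<dots> \<le> (1/2) ^ Suc k * c"
    proof (rule mult_left_mono)
      have "1 / real (Suc k) \<le> 1 / real (Suc n0)" using False by (intro divide_left_mono) auto
      then show "1 / real (Suc k) \<le> c" using c by linarith
    qed simp
    finally show ?thesis .
  qed
  then have "rho P Q \<le> (\<Sum>k. (1/2) ^ Suc k * c)"
    unfolding rho_alt by (rule suminf_le[OF _ rho_summable[OF P] sums_summable[OF half_sums]])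
  also have "\<dots> = c" using sums_unique[OF half_sums] by metis
  finally show ?thesis .
qed

text \<open>Nonnegative summands are bounded by the sum, so closeness in \<open>rho\<close> forces
  closeness in any fixed slice.\<close>

lemma rho_ge: 
  assumes P: "P \<in> Pyr" "Q \<in> Pyr" shows "wt k * Hd (Suc k) P Q \<le> rho P Q"
  unfolding rho_alt using sum_le_suminf[OF rho_summable[OF P], of "{k}"] rho_term_bound(1)[OF P] by simp

lemma rho_mono:
  assumes P: "P \<in> Pyr" "Q \<in> Pyr" and P': "P' \<in> Pyr" "Q' \<in> Pyr" and le: "\<And>n. Hd n P Q \<le> Hd n P' Q'"
  shows "rho P Q \<le> rho P' Q'"
  unfolding rho_alt
proof (rule suminf_le[OF _ rho_summable[OF P] rho_summable[OF P']])
  fix k show "wt k * Hd (Suc k) P Q \<le> wt k * Hd (Suc k) P' Q'"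
    by (rule mult_left_mono[OF le]) (use wt_pos[of k] in simp)
qed

interpretation rhoT: pseudo_dist Pyr rho
proof
  show "rho P P = 0" if P: "P \<in> Pyr" for P unfolding rho_alt using Hd_zero[OF P] by simp
  show "rho P Q = rho Q P" if P: "P \<in> Pyr" "Q \<in> Pyr" for P Q unfolding rho_alt using Hd_sym[OF P] by simp
  show "rho P R \<le> rho P Q + rho Q R" if P: "P \<in> Pyr" "Q \<in> Pyr" "R \<in> Pyr" for P Q R
  proof -
    have "rho P R \<le> (\<Sum>k. wt k * Hd (Suc k) P Q + wt k * Hd (Suc k) Q R)"
      unfolding rho_alt
    proof (rule suminf_le[OF _ rho_summable[OF P(1,3)] summable_add[OF rho_summable[OF P(1,2)] rho_summable[OF P(2,3)]]])
      fix k
      have "wt k * Hd (Suc k) P R \<le> wt k * (Hd (Suc k) P Q + Hd (Suc k) Q R)"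
        by (rule mult_left_mono[OF Hd_triangle[OF P]]) (use wt_pos[of k] in simp)
      then show "wt k * Hd (Suc k) P R \<le> wt k * Hd (Suc k) P Q + wt k * Hd (Suc k) Q R" by (simp add: distrib_left)
    qed
    also have "\<dots> = rho P Q + rho Q R"
      unfolding rho_alt by (rule suminf_add[OF rho_summable[OF P(1,2)] rho_summable[OF P(2,3)], symmetric])
    finally show ?thesis .
  qed
qed

lemma weak_topology_alt: "weak_topology = dist_topology Pyr rho"
  by (simp add: weak_topology_def dist_topology_def)

text \<open>For nested sets one side of the Hausdorff distance vanishes, and the other improves when
  the inner set grows. Hence an increasing path inside a pyramid never moves away from it.\<close>

lemma rho_sandwich:
  assumes P: "P \<in> Pyr" "Q \<in> Pyr" "R \<in> Pyr" and "P \<subseteq> Q" "Q \<subseteq> R"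
  shows "rho R Q \<le> rho R P"
proof (rule rho_mono[OF P(3,2) P(3,1)])
  fix n
  have s: "slice n P \<subseteq> slice n Q" "slice n Q \<subseteq> slice n R" using assms(4,5) by (auto simp: slice_def)
  show "Hd n R Q \<le> Hd n R P"
  proof (rule field_le_epsilon)
    fix e :: real assume e: "e > 0"
    then have l: "Hd n R P < Hd n R P + e" by simp
    show "Hd n R Q \<le> Hd n R P + e"
    proof (rule Hd_le[OF P(3,2)])
      show "\<forall>a\<in>slice n R. \<exists>b\<in>slice n Q. boxC a b \<le> Hd n R P + e"
      proof
        fix a assume "a \<in> slice n R"
        then obtain b where "b \<in> slice n P" "boxC a b < Hd n R P + e" using Hd_less(1)[OF P(3,1) l] by blast
        then show "\<exists>b\<in>slice n Q. boxC a b \<le> Hd n R P + e" using s(1) by (intro bexI[of _ b]) auto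
      qed
      show "\<forall>b\<in>slice n Q. \<exists>a\<in>slice n R. boxC a b \<le> Hd n R P + e"
      proof
        fix b assume b: "b \<in> slice n Q"
        have "boxC b b = 0" by (rule box.dist_zero[OF slice_mmX[OF P(2) b]])
        then show "\<exists>a\<in>slice n R. boxC a b \<le> Hd n R P + e"
          using s(2) b Hd_bounds(1)[OF P(3,1), of n] e by (intro bexI[of _ b]) auto
      qed
    qed
  qed
qed

section \<open>Principal pyramids\<close>

definition lip_ideal :: "real mm set \<Rightarrow> real mm set set" where
  "lip_ideal C = {E \<in> mmX. lip_le E C}"

text \<open>The generator is a common upper bound for everything, and closedness is the closedness
  of domination under box limits.\<close>

lemma lip_ideal_Pyr:
  assumes C: "C \<in> mmX" shows "lip_ideal C \<in> Pyr"
  unfolding Pyr_def pyramid_def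
proof (intro CollectI conjI ballI impI)
  show "lip_ideal C \<subseteq> mmX" by (auto simp: lip_ideal_def)
  have CC: "C \<in> lip_ideal C" using C lip_le_refl by (simp add: lip_ideal_def)
  then show "lip_ideal C \<noteq> {}" by blast
  show "E \<in> lip_ideal C" if E: "E \<in> mmX" "\<forall>e>0. \<exists>D\<in>lip_ideal C. boxC E D < e" for E
  proof -
    have "\<forall>e>0. \<exists>E'\<in>mmX. lip_le E' C \<and> boxC E E' < e" using E(2) unfolding lip_ideal_def by blast
    then show ?thesis using lip_le_closed[OF C E(1)] E(1) by (simp add: lip_ideal_def)
  qed
  show "D \<in> lip_ideal C" if "E \<in> lip_ideal C" "D \<in> mmX" "lip_le D E" for E D
    using that lip_le_trans[OF that(3) _ that(2) _ C] by (simp add: lip_ideal_def)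
  show "\<exists>E\<in>lip_ideal C. lip_le D E \<and> lip_le D' E" if "D \<in> lip_ideal C" "D' \<in> lip_ideal C" for D D'
    using that CC by (intro bexI[OF _ CC]) (simp add: lip_ideal_def)
qed

lemma lip_ideal_mono:
  assumes "lip_le C C'" "C \<in> mmX" "C' \<in> mmX" shows "lip_ideal C \<subseteq> lip_ideal C'"
  unfolding lip_ideal_def using lip_le_trans[OF _ assms(1)] assms(2,3) by blast

lemma lip_ideal_subset: "P \<in> Pyr \<Longrightarrow> C \<in> P \<Longrightarrow> lip_ideal C \<subseteq> P"
  unfolding lip_ideal_def using Pyr_down by blast

text \<open>Transfer of dominated spaces has the factor 2 in every slice, uniformly in the
  dimension. Box-continuous paths of classes thereby become continuous paths of pyramids.\<close>

lemma lip_ideal_rho: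
  assumes C: "C \<in> mmX" "C' \<in> mmX" shows "rho (lip_ideal C) (lip_ideal C') \<le> 2 * boxC C C'"
proof (rule field_le_epsilon)
  fix e :: real assume e: "e > 0"
  define d where "d = boxC C C' + e / 2"
  have d: "boxC C C' < d" "boxC C' C < d" using e box.dist_sym[OF C] by (auto simp: d_def)
  have d0: "0 < 2 * d" using boxC_bounds(1)[OF C] e by (simp add: d_def)
  obtain n0 where n0: "1 / real (Suc n0) < 2 * d" using nat_approx_posE[OF d0] by blast
  note P = lip_ideal_Pyr[OF C(1)] lip_ideal_Pyr[OF C(2)]
  have tr: "\<exists>b\<in>slice n (lip_ideal C'). boxC a b \<le> 2 * d"
    if c: "C \<in> mmX" "C' \<in> mmX" "boxC C C' < d" "a \<in> slice n (lip_ideal C)" for C C' a n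
  proof -
    have a: "a \<in> mmX" "lip_le a C" "a \<in> mmXNR n (real n)" using c(4) unfolding slice_def lip_ideal_def by blast+
    obtain E' where "E' \<in> mmX" "E' \<in> mmXNR n (real n)" "lip_le E' C'" "boxC a E' \<le> 2 * d"
      using dominated_transfer[OF c(1-3) a(1,3,2) of_nat_0_le_iff] by blast
    then show ?thesis unfolding slice_def lip_ideal_def by (intro bexI[of _ E']) simp_all
  qed
  have "Hd n (lip_ideal C) (lip_ideal C') \<le> 2 * d" for n
  proof (rule Hd_le[OF P])
    show "\<forall>a\<in>slice n (lip_ideal C). \<exists>b\<in>slice n (lip_ideal C'). boxC a b \<le> 2 * d" using tr[OF C d(1)] by blast
    show "\<forall>b\<in>slice n (lip_ideal C'). \<exists>a\<in>slice n (lip_ideal C). boxC a b \<le> 2 * d"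
    proof
      fix b assume b: "b \<in> slice n (lip_ideal C')"
      obtain a where a: "a \<in> slice n (lip_ideal C)" "boxC b a \<le> 2 * d" using tr[OF C(2,1) d(2) b] by blast
      have "boxC a b = boxC b a" by (rule box.dist_sym[OF slice_mmX[OF P(2) b] slice_mmX[OF P(1) a(1)]])
      then show "\<exists>a\<in>slice n (lip_ideal C). boxC a b \<le> 2 * d" using a by (intro bexI[OF _ a(1)]) simp
    qed
  qed
  then have "rho (lip_ideal C) (lip_ideal C') \<le> 2 * d" using n0 by (intro rho_le[OF P, of n0]) auto
  then show "rho (lip_ideal C) (lip_ideal C') \<le> 2 * boxC C C' + e" by (simp add: d_def)
qed

lemma finite_upper_bound:
  assumes P: "P \<in> Pyr" and B: "finite B" "B \<subseteq> P"
  shows "\<exists>X\<in>P. \<forall>b\<in>B. lip_le b X"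
  using B
proof (induction B rule: finite_induct)
  case empty
  then show ?case using Pyr_nonempty[OF P] by blast
next
  case (insert b B)
  then obtain X where X: "X \<in> P" "\<forall>b\<in>B. lip_le b X" by auto
  have b: "b \<in> P" using insert.prems by simp
  obtain Y where Y: "Y \<in> P" "lip_le b Y" "lip_le X Y" using Pyr_directed[OF P b X(1)] by blast
  have "lip_le b' Y" if "b' \<in> B" for b'
    by (rule lip_le_trans[OF _ Y(3)]) (use X that Pyr_mmX[OF P] Y(1) insert.prems in auto)
  then show ?case using Y by (intro bexI[OF _ Y(1)]) simp
qed

text \<open>Only the slices up to some \<open>n0\<close> matter. Each has a finite net inside the
  pyramid, and one upper bound of all these nets generates the approximating ideal.\<close>

lemma lip_ideal_approx:
  assumes P: "P \<in> Pyr" and e: "e > 0"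
  shows "\<exists>X\<in>P. rho P (lip_ideal X) < e"
proof -
  define c where "c = e / 2"
  have c: "c > 0" using e by (simp add: c_def)
  obtain n0 where n0: "1 / real (Suc n0) < c" using nat_approx_posE[OF c] by blast
  have "\<exists>B. finite B \<and> B \<subseteq> slice n P \<and> (\<forall>a\<in>slice n P. \<exists>b\<in>B. boxC a b \<le> c)" for n
    by (rule mmXNR_totally_bounded[of _ n "real n", OF _ _ _ c]) (use slice_mmX[OF P] in \<open>auto simp: slice_def\<close>)
  then obtain B where B: "\<And>n. finite (B n)" "\<And>n. B n \<subseteq> slice n P" "\<And>n. \<forall>a\<in>slice n P. \<exists>b\<in>B n. boxC a b \<le> c" by metis
  have "finite (\<Union>n\<le>n0. B n)" using B(1) by blast
  moreover have "(\<Union>n\<le>n0. B n) \<subseteq> P" using B(2) by (auto simp: slice_def)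
  ultimately obtain X where X: "X \<in> P" "\<forall>b\<in>(\<Union>n\<le>n0. B n). lip_le b X" using finite_upper_bound[OF P] by blast
  have PX: "lip_ideal X \<in> Pyr" by (rule lip_ideal_Pyr[OF Pyr_mmX[OF P X(1)]])
  have "Hd n P (lip_ideal X) \<le> c" if n: "n \<le> n0" for n
  proof (rule Hd_le[OF P PX])
    show "\<forall>a\<in>slice n P. \<exists>b\<in>slice n (lip_ideal X). boxC a b \<le> c"
    proof
      fix a assume "a \<in> slice n P"
      then obtain b where b: "b \<in> B n" "boxC a b \<le> c" using B(3) by blast
      have bs: "b \<in> slice n P" using B(2) b(1) by blast
      have "lip_le b X" using X(2) b(1) n by blast
      then have "b \<in> slice n (lip_ideal X)" using bs slice_mmX[OF P bs] by (simp add: slice_def lip_ideal_def)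
      then show "\<exists>b\<in>slice n (lip_ideal X). boxC a b \<le> c" using b(2) by blast
    qed
    show "\<forall>b\<in>slice n (lip_ideal X). \<exists>a\<in>slice n P. boxC a b \<le> c"
    proof
      fix b assume b: "b \<in> slice n (lip_ideal X)"
      then have "b \<in> slice n P" using lip_ideal_subset[OF P X(1)] by (auto simp: slice_def)
      moreover have "boxC b b = 0" by (rule box.dist_zero[OF slice_mmX[OF PX b]])
      ultimately show "\<exists>a\<in>slice n P. boxC a b \<le> c" using c by (intro bexI[of _ b]) auto
    qed
  qed
  then have "rho P (lip_ideal X) \<le> c" using n0 by (intro rho_le[OF P PX, of n0]) auto
  then show ?thesis using X(1) e by (intro bexI[OF _ X(1)]) (simp add: c_def)
qed

lemma lip_ideal_pcont:
  assumes "\<forall>t\<in>{0..1}. \<gamma> t \<in> mmX"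
    "\<forall>e>0. \<exists>r>0. \<forall>s\<in>{0..1}. \<forall>t\<in>{0..1}. \<bar>s - t\<bar> < r \<longrightarrow> boxC (\<gamma> t) (\<gamma> s) < e"
  shows "rhoT.pcont (\<lambda>t. lip_ideal (\<gamma> t))"
  unfolding rhoT.pcont_def
proof (intro conjI ballI allI impI)
  show "lip_ideal (\<gamma> t) \<in> Pyr" if "t \<in> {0..1}" for t by (rule lip_ideal_Pyr) (use assms(1) that in blast)
  fix t e :: real assume t: "t \<in> {0..1}" and e: "e > 0"
  obtain r where r: "r > 0" "\<forall>s\<in>{0..1}. \<forall>t\<in>{0..1}. \<bar>s - t\<bar> < r \<longrightarrow> boxC (\<gamma> t) (\<gamma> s) < e / 2"
    using assms(2) half_gt_zero[OF e] by blast
  have "rho (lip_ideal (\<gamma> t)) (lip_ideal (\<gamma> s)) < e" if s: "s \<in> {0..1}" "\<bar>s - t\<bar> < r" for s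
  proof -
    have "boxC (\<gamma> t) (\<gamma> s) < e / 2" using r(2) s t by blast
    moreover have "rho (lip_ideal (\<gamma> t)) (lip_ideal (\<gamma> s)) \<le> 2 * boxC (\<gamma> t) (\<gamma> s)"
      by (rule lip_ideal_rho) (use assms(1) s t in auto)
    ultimately show ?thesis by linarith
  qed
  then show "\<exists>r>0. \<forall>s\<in>{0..1}. \<bar>s - t\<bar> < r \<longrightarrow> rho (lip_ideal (\<gamma> t)) (lip_ideal (\<gamma> s)) < e" using r(1) by blast
qed

lemma lip_ideal_step_path:
  assumes X: "X \<in> mmX" "X' \<in> mmX" "lip_le X X'"
  obtains g where "rhoT.pcont g" "g 0 = lip_ideal X" "g 1 = lip_ideal X'"
    "\<forall>t\<in>{0..1}. lip_ideal X \<subseteq> g t \<and> g t \<subseteq> lip_ideal X'"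
proof -
  obtain D where D: "pm D" "rz X' D" by (rule rz_exists[OF X(2)])
  obtain D' K where D': "pm D'" "rz X D'" "full K" "\<forall>s\<in>K. \<forall>t\<in>K. D' s t \<le> D s t"
    by (rule lip_le_rz[OF X(3) D(2) X(1)])
  obtain \<gamma> where \<gamma>: "\<gamma> 0 = X" "\<gamma> 1 = X'" "\<forall>t\<in>{0..1}. rz (\<gamma> t) (\<lambda>u v. max (D' u v) (t * D u v))"
    "\<forall>e>0. \<exists>r>0. \<forall>s\<in>{0..1}. \<forall>t\<in>{0..1}. \<bar>s - t\<bar> < r \<longrightarrow> boxC (\<gamma> t) (\<gamma> s) < e"
    by (rule domination_path[OF D D'])
  have \<gamma>X: "\<forall>t\<in>{0..1}. \<gamma> t \<in> mmX" using \<gamma>(3) rz_mmX by blast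
  have "lip_ideal X \<subseteq> lip_ideal (\<gamma> t) \<and> lip_ideal (\<gamma> t) \<subseteq> lip_ideal X'" if t: "t \<in> {0..1}" for t
  proof
    have r: "rz (\<gamma> t) (\<lambda>u v. max (D' u v) (t * D u v))" and m: "\<gamma> t \<in> mmX" using \<gamma>(3) \<gamma>X t by blast+
    have "lip_le X (\<gamma> t)" by (rule rz_le[OF r D'(2) full_I]) simp
    then show "lip_ideal X \<subseteq> lip_ideal (\<gamma> t)" by (rule lip_ideal_mono[OF _ X(1) m])
    have "lip_le (\<gamma> t) X'"
    proof (rule rz_le[OF D(2) r D'(3)], intro ballI)
      fix u v assume uv: "u \<in> K" "v \<in> K"
      then have uvI: "u \<in> {0..<1}" "v \<in> {0..<1}" using full_subset[OF D'(3)] by auto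
      have "t * D u v \<le> 1 * D u v" by (rule mult_right_mono) (use t pm_nonneg[OF D(1) uvI] in auto)
      then show "max (D' u v) (t * D u v) \<le> D u v" using D'(4) uv by simp
    qed
    then show "lip_ideal (\<gamma> t) \<subseteq> lip_ideal X'" by (rule lip_ideal_mono[OF _ m X(2)])
  qed
  then show ?thesis
    using that[OF lip_ideal_pcont[OF \<gamma>X \<gamma>(4)]] \<gamma>(1,2) by simp
qed

text \<open>Everything on the path lies between the ideal of \<open>X\<close> and \<open>P\<close>,
  so its distance to \<open>P\<close> is never larger than at the start. The region depends on the
  initial error alone, which lets the lemma serve near another pyramid as well.\<close>

lemma lip_ideal_to_pyramid:
  assumes P: "P \<in> Pyr" and X: "X \<in> P"
  shows "path_component_of (subtopology rhoT.T {Q \<in> Pyr. rho P Q \<le> rho P (lip_ideal X)}) (lip_ideal X) P"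
proof -
  \<comment> \<open>The chain starts at the prescribed \<open>X\<close>, where no closeness is
    asked; the rate \<open>1 / n\<close> begins at \<open>n = 1\<close>.\<close>
  define S where "S n x \<longleftrightarrow> x \<in> P \<and> (n = 0 \<longrightarrow> x = X) \<and> (0 < n \<longrightarrow> rho P (lip_ideal x) < 1 / real n)" for n :: nat and x
  have "\<exists>x. \<forall>n. S n (x n) \<and> lip_le (x n) (x (Suc n))"
  proof (rule dependent_nat_choice[of S "\<lambda>_. lip_le"])
    show "\<exists>x. S 0 x" using X by (simp add: S_def)
  next
    fix x n assume "S n x"
    then have x: "x \<in> P" by (simp add: S_def)
    obtain Z where Z: "Z \<in> P" "rho P (lip_ideal Z) < 1 / real (Suc n)"
      using lip_ideal_approx[OF P, of "1 / real (Suc n)"] by auto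
    \<comment> \<open>A good approximant \<open>Z\<close> need not dominate \<open>x\<close>; a
      common upper bound does, and by nesting it approximates \<open>P\<close> at least as well as
      \<open>Z\<close>.\<close>
    obtain Y where Y: "Y \<in> P" "lip_le x Y" "lip_le Z Y" using Pyr_directed[OF P x Z(1)] by blast
    have m: "Y \<in> mmX" "Z \<in> mmX" using Pyr_mmX[OF P] Y(1) Z(1) by blast+
    have "rho P (lip_ideal Y) \<le> rho P (lip_ideal Z)"
      by (rule rho_sandwich[OF lip_ideal_Pyr[OF m(2)] lip_ideal_Pyr[OF m(1)] P lip_ideal_mono[OF Y(3) m(2,1)]
            lip_ideal_subset[OF P Y(1)]])
    then have "rho P (lip_ideal Y) < 1 / real (Suc n)" using Z(2) by linarith
    then have "S (Suc n) Y" using Y(1) by (simp add: S_def)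
    then show "\<exists>y. S (Suc n) y \<and> lip_le x y" using Y(2) by blast
  qed
  then obtain x where x': "\<And>n. S n (x n)" and x4: "\<And>n. lip_le (x n) (x (Suc n))" by blast
  have x: "x n \<in> P" "x 0 = X" "0 < n \<Longrightarrow> rho P (lip_ideal (x n)) < 1 / real n" for n
    using x'[of n] x'[of 0] by (simp_all add: S_def)
  have xm: "x n \<in> mmX" for n by (rule Pyr_mmX[OF P x(1)])
  have "\<forall>n. \<exists>g. rhoT.pcont g \<and> g 0 = lip_ideal (x n) \<and> g 1 = lip_ideal (x (Suc n)) \<and>
      (\<forall>t\<in>{0..1}. lip_ideal (x n) \<subseteq> g t \<and> g t \<subseteq> lip_ideal (x (Suc n)))"
    using lip_ideal_step_path[OF xm xm x4] by metis
  then obtain g where g: "\<And>n. rhoT.pcont (g n)" "\<And>n. g n 0 = lip_ideal (x n)" "\<And>n. g n 1 = lip_ideal (x (Suc n))"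
    "\<And>n. \<forall>t\<in>{0..1}. lip_ideal (x n) \<subseteq> g n t \<and> g n t \<subseteq> lip_ideal (x (Suc n))" by metis
  have gP: "g n t \<in> Pyr" if "t \<in> {0..1}" for n t using g(1) that unfolding rhoT.pcont_def by blast
  have near: "rho P (g n t) \<le> rho P (lip_ideal (x n))" if t: "t \<in> {0..1}" for n t
  proof (rule rho_sandwich[OF lip_ideal_Pyr[OF xm] gP[OF t] P])
    show "lip_ideal (x n) \<subseteq> g n t" using g(4) t by blast
    show "g n t \<subseteq> P" using g(4) t lip_ideal_subset[OF P x(1)] by blast
  qed
  have dec: "rho P (lip_ideal (x n)) \<le> rho P (lip_ideal X)" for n
  proof (induction n)
    case 0 then show ?case using x(2) by simp
  next
    case (Suc n)
    have "rho P (lip_ideal (x (Suc n))) \<le> rho P (lip_ideal (x n))"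
      by (rule rho_sandwich[OF lip_ideal_Pyr[OF xm] lip_ideal_Pyr[OF xm] P lip_ideal_mono[OF x4 xm xm] lip_ideal_subset[OF P x(1)]])
    then show ?case using Suc by linarith
  qed
  have P0: "rho P P = 0" by (rule rhoT.pzero[OF P])
  have "rho P (lip_ideal X) \<ge> 0"
    using rho_ge[OF P lip_ideal_Pyr[OF Pyr_mmX[OF P X]], of 0] rho_term_bound(1)[OF P lip_ideal_Pyr[OF Pyr_mmX[OF P X]], of 0] by linarith
  then have PV: "P \<in> {Q \<in> Pyr. rho P Q \<le> rho P (lip_ideal X)}" using P P0 by simp
  have "path_component_of (subtopology rhoT.T {Q \<in> Pyr. rho P Q \<le> rho P (lip_ideal X)}) (g 0 0) P"
  proof (rule infinite_concat)
    show "pathin rhoT.T (g n)" for n by (rule rhoT.pcont_pathin[OF g(1)])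
    show "g n 1 = g (Suc n) 0" for n using g(2,3) by simp
    show "g n t \<in> {Q \<in> Pyr. rho P Q \<le> rho P (lip_ideal X)}" if "t \<in> {0..1}" for n t
      using gP[OF that] near[OF that, of n] dec[of n] by simp
    show "P \<in> topspace rhoT.T" unfolding rhoT.topspace_T by (rule P)
    fix U assume U: "openin rhoT.T U" "P \<in> U"
    obtain e where e: "e > 0" "\<forall>Q\<in>Pyr. rho P Q < e \<longrightarrow> Q \<in> U" using U unfolding rhoT.openin_T by blast
    obtain N where N: "1 / real (Suc N) < e" using nat_approx_posE[OF e(1)] by blast
    have "g n t \<in> U" if n: "n \<ge> Suc N" and t: "t \<in> {0..1}" for n t
    proof -
      have "rho P (lip_ideal (x n)) < 1 / real n" using x(3) n by simp
      also have "\<dots> \<le> 1 / real (Suc N)" using n by (intro divide_left_mono) auto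
      finally have "rho P (g n t) < e" using near[OF t, of n] N by linarith
      then show ?thesis using e(2) gP[OF t] by blast
    qed
    then show "\<exists>N. \<forall>n\<ge>N. \<forall>t\<in>{0..1}. g n t \<in> U" by blast
  qed (rule PV)
  then show ?thesis using g(2) x(2) by simp
qed

lemma component_mono:
  assumes "path_component_of (subtopology X V) a b" "V \<subseteq> W"
  shows "path_component_of (subtopology X W) a b"
  using assms unfolding path_component_of_def pathin_subtopology by blast

text \<open>The path from \<open>P\<close> to \<open>Q\<close> descends to a principal pyramid below
  \<open>P\<close>, crosses to one below \<open>Q\<close>, and rises to \<open>Q\<close>. The class
  \<open>X\<close> is fixed from \<open>P\<close> alone; \<open>Q\<close> supplies only a box-close
  partner.\<close>

lemma weak_local_path:
  assumes P: "P \<in> Pyr" and e: "e > 0"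
  shows "\<exists>d>0. \<forall>Q\<in>Pyr. rho P Q < d \<longrightarrow> path_component_of (subtopology rhoT.T (rhoT.bal P e)) P Q"
proof -
  \<comment> \<open>The budget in units of \<open>a\<close>: 4 for the ideal of \<open>X\<close>
    from \<open>P\<close>, 6 along the crossing, 8 for the ideal of \<open>Y\<close> from
    \<open>Q\<close>, and 10 from \<open>P\<close> on the last leg.\<close>
  define a where "a = e / 16"
  have a: "a > 0" using e by (simp add: a_def)
  obtain X0 where X0: "X0 \<in> P" "rho P (lip_ideal X0) < 2 * a" using lip_ideal_approx[OF P, of "2 * a"] a by auto
  have X0m: "X0 \<in> mmX" by (rule Pyr_mmX[OF P X0(1)])
  \<comment> \<open>A finite-dimensional replacement is needed so that \<open>X\<close> lies in a
    slice, where closeness of \<open>P\<close> and \<open>Q\<close> in \<open>rho\<close> can be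
    tested.\<close>
  obtain n X where X: "1 \<le> n" "X \<in> mmXNR n (real n)" "X \<in> mmX" "lip_le X X0" "boxC X0 X \<le> a"
    by (rule finite_dim_approx[OF X0m a])
  have XP: "X \<in> P" by (rule Pyr_down[OF P X0(1) X(3,4)])
  have PX: "lip_ideal X \<in> Pyr" by (rule lip_ideal_Pyr[OF X(3)])
  have "rho (lip_ideal X0) (lip_ideal X) \<le> 2 * a" using lip_ideal_rho[OF X0m X(3)] X(5) by linarith
  then have rX: "rho P (lip_ideal X) < 4 * a"
    using rhoT.ptri[OF P lip_ideal_Pyr[OF X0m] PX] X0(2) by linarith
  obtain k where k: "n = Suc k" using X(1) by (cases n) auto
  \<comment> \<open>The second bound makes the \<open>n\<close>-th slices of \<open>P\<close> and
    \<open>Q\<close> closer than \<open>a\<close> after division by the weight; the first enters the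
    distance estimates.\<close>
  define d where "d = min (2 * a) (wt k * a)"
  have d: "0 < d" "d \<le> 2 * a" "d \<le> wt k * a" using a wt_pos[of k] by (auto simp: d_def)
  have "path_component_of (subtopology rhoT.T (rhoT.bal P e)) P Q" if Q: "Q \<in> Pyr" and l: "rho P Q < d" for Q
  proof -
    have "wt k * Hd n P Q < wt k * a" using rho_ge[OF P Q, of k] l d(3) k by simp
    then have "Hd n P Q < a" using wt_pos[of k] by simp
    moreover have "X \<in> slice n P" using XP X(2) by (simp add: slice_def)
    ultimately obtain Y where Y: "Y \<in> slice n Q" "boxC X Y < a" using Hd_less(1)[OF P Q] by blast
    have YQ: "Y \<in> Q" and Ym: "Y \<in> mmX" using Y(1) Pyr_mmX[OF Q] by (auto simp: slice_def)
    have PY: "lip_ideal Y \<in> Pyr" by (rule lip_ideal_Pyr[OF Ym])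
    obtain D D' where D: "pm D" "pm D'" "rz X D" "rz Y D'" "boxle D D' a" using boxC_less[OF X(3) Ym Y(2)] by blast
    obtain \<gamma> where \<gamma>: "\<gamma> 0 = X" "\<gamma> 1 = Y" "\<forall>t\<in>{0..1}. rz (\<gamma> t) (\<lambda>u v. (1 - t) * D u v + t * D' u v)"
      "\<forall>e>0. \<exists>r>0. \<forall>s\<in>{0..1}. \<forall>t\<in>{0..1}. \<bar>s - t\<bar> < r \<longrightarrow> boxC (\<gamma> t) (\<gamma> s) < e"
      by (rule interpolation_path[OF D(1,3) D(2,4)])
    have \<gamma>X: "\<forall>t\<in>{0..1}. \<gamma> t \<in> mmX" using \<gamma>(3) rz_mmX by blast
    have near: "rho P (lip_ideal (\<gamma> t)) < 6 * a" if t: "t \<in> {0..1}" for t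
    proof -
      have m: "\<gamma> t \<in> mmX" using \<gamma>X t by blast
      have "boxC X (\<gamma> t) \<le> a"
        by (rule boxC_le[OF D(3) \<gamma>(3)[rule_format, OF t] boxle_interpolate[OF D(5) t]]) (use a in simp)
      then have "rho (lip_ideal X) (lip_ideal (\<gamma> t)) \<le> 2 * a" using lip_ideal_rho[OF X(3) m] by linarith
      then show ?thesis using rhoT.ptri[OF P PX lip_ideal_Pyr[OF m]] rX by linarith
    qed
    have p1: "path_component_of (subtopology rhoT.T (rhoT.bal P e)) (lip_ideal X) P"
    proof (rule component_mono[OF lip_ideal_to_pyramid[OF P XP]])
      show "{Q \<in> Pyr. rho P Q \<le> rho P (lip_ideal X)} \<subseteq> rhoT.bal P e"
        using rX a unfolding rhoT.bal_def by (auto simp: a_def)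
    qed
    have "\<forall>t\<in>{0..1}. lip_ideal (\<gamma> t) \<in> rhoT.bal P e"
      using near \<gamma>X lip_ideal_Pyr a unfolding rhoT.bal_def by (force simp: a_def)
    then have p2: "path_component_of (subtopology rhoT.T (rhoT.bal P e)) (lip_ideal X) (lip_ideal Y)"
      by (rule rhoT.pcont_component[OF lip_ideal_pcont[OF \<gamma>X \<gamma>(4)]]) (simp_all add: \<gamma>(1,2))
    have rY: "rho P (lip_ideal Y) < 6 * a" using near[of 1] \<gamma>(2) by simp
    have rQ: "rho Q (lip_ideal Y) < 8 * a"
      using rhoT.ptri[OF Q P PY] rhoT.psym[OF P Q] rY l d(2) by linarith
    have p3: "path_component_of (subtopology rhoT.T (rhoT.bal P e)) (lip_ideal Y) Q"
    proof (rule component_mono[OF lip_ideal_to_pyramid[OF Q YQ]])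
      show "{R \<in> Pyr. rho Q R \<le> rho Q (lip_ideal Y)} \<subseteq> rhoT.bal P e"
      proof
        fix R assume R: "R \<in> {R \<in> Pyr. rho Q R \<le> rho Q (lip_ideal Y)}"
        then have "rho P R \<le> rho P Q + rho Q R" using rhoT.ptri[OF P Q] by blast
        also have "\<dots> < 2 * a + 8 * a" using R rQ l d(2) by auto
        finally have "rho P R < e" using a by (simp add: a_def)
        then show "R \<in> rhoT.bal P e" using R by (simp add: rhoT.bal_def)
      qed
    qed
    show ?thesis
      by (rule path_component_of_trans[OF path_component_of_sym[OF p1] path_component_of_trans[OF p2 p3]])
  qed
  then show ?thesis using d(1) by blast
qed

theorem theorem1p6:
  shows "locally_path_connected_space conc_topology \<and>
         locally_path_connected_space weak_topology"
proof
  show "locally_path_connected_space conc_topology"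
    by (rule conc_locally_path_connected)
  show "locally_path_connected_space weak_topology"
    unfolding weak_topology_alt by (rule rhoT.locally_path_connected_T[OF weak_local_path])
qed

end
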